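(* Let $m\ge1$, $n=n_1+n_2$, let $A_1,\dots,A_m\in\mathbb R^{n\times n}$ be symmetric and $B=\begin{pmatrix}0&0\\0&D\end{pmatrix}$ with $D\in\mathbb R^{n_2\times n_2}$ negative definite ($x\cdot Dx<0$ for $x\neq0$, $D$ not necessarily symmetric). Assume that for every $\xi\in\mathbb R^m\setminus\{0\}$ no eigenvector of $\sum_\alpha\xi_\alpha A_\alpha$ lies in the null space of $B$. Let $\Gamma(t)$ be the solution operator of the Cauchy problem $$w_t+\sum_{\alpha=1}^mA_\alpha w_{x_\alpha}=Bw,\qquad w(0,\cdot)=w^0,$$ and let $L_0=[I_{n_1}\ 0]$, $L_-=[0\ I_{n_2}]$ be the projections on the first $n_1$ and last $n_2$ components (corresponding to the null space and the negative definite part of $B$). Then there are linear operators $K(t)$, $\mathcal K(t)$, $t\ge0$, such that for every $w^0\in L^1\cap L^2(\mathbb R^m,\mathbb R^n)$ the solution decomposes as $$w(t)=\Gamma(t)w^0=K(t)w^0+\mathcal K(t)w^0,$$ and the following estimates hold for every multi-index $\beta$, every $p\in[2,+\infty]$ and every $t\ge0$, with constants $C(|\beta|)$, $C$, $c>0$ independent of $w^0$ and $t$: ($K(t)$ estimates) $$\|L_0D^\beta K(t)w^0\|_{L^p}\le C(|\beta|)\min\{1,t^{-\frac m2(1-\frac1p)-\frac{|\beta|}2}\}\|L_0w^0\|_{L^1}+C(|\beta|)\min\{1,t^{-\frac m2(1-\frac1p)-\frac12-\frac{|\beta|}2}\}\|L_-w^0\|_{L^1},$$ $$\|L_-D^\beta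 K(t)w^0\|_{L^p}\le C(|\beta|)\min\{1,t^{-\frac m2(1-\frac1p)-\frac12-\frac{|\beta|}2}\}\|L_0w^0\|_{L^1}+C(|\beta|)\min\{1,t^{-\frac m2(1-\frac1p)-1-\frac{|\beta|}2}\}\|L_-w^0\|_{L^1};$$ ($\mathcal K(t)$ estimates) whenever $D^\beta w^0\in L^2$, $$\|D^\beta\mathcal K(t)w^0\|_{L^2}\le Ce^{-ct}\|D^\beta w^0\|_{L^2}.$$
   Context: $D^\beta$ denotes the space derivative of multi-index $\beta$. By convention $\min\{1,t^{-\gamma}\}=1$ at $t=0$. *)

theory Defs
  imports "HOL-Analysis.Analysis" "HOL-Probability.Essential_Supremum"
begin

section \<open>Lebesgue spaces\<close>

text \<open>Elements of \<open>L\<^sup>p\<close> are represented by Borel functions; equality in \<open>L\<^sup>p\<close> is equality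
  almost everywhere. The exponent ranges over \<open>ennreal\<close> so that \<open>p = \<infinity>\<close> is included.\<close>

definition Lp :: "ennreal \<Rightarrow> ('a::euclidean_space \<Rightarrow> 'b::euclidean_space) set" where
  "Lp p = {f \<in> borel_measurable lborel.
     if p = \<infinity> then esssup lborel (\<lambda>x. ennreal (norm (f x))) < \<infinity>
     else integrable lborel (\<lambda>x. norm (f x) powr enn2real p)}"

definition Lp_norm :: "ennreal \<Rightarrow> ('a::euclidean_space \<Rightarrow> 'b::euclidean_space) \<Rightarrow> real" where
  "Lp_norm p f =
     (if p = \<infinity> then enn2real (esssup lborel (\<lambda>x. ennreal (norm (f x))))
      else (LINT x|lborel. norm (f x) powr enn2real p) powr (1 / enn2real p))"

definition locally_integrable :: "('a::euclidean_space \<Rightarrow> 'b::euclidean_space) \<Rightarrow> bool" where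
  "locally_integrable f \<longleftrightarrow> f \<in> borel_measurable lborel \<and>
     (\<forall>S. compact S \<longrightarrow> set_integrable lborel S f)"

definition linear_operator ::
  "(('a::euclidean_space \<Rightarrow> 'b::euclidean_space) \<Rightarrow> ('a \<Rightarrow> 'b)) \<Rightarrow> bool" where
  \<comment> \<open>a well-defined linear map from \<open>L\<^sup>1 \<inter> L\<^sup>2\<close> to \<open>L\<^sup>2\<close>, modulo equality almost everywhere\<close>
  "linear_operator T \<longleftrightarrow>
     (\<forall>f \<in> Lp 1 \<inter> Lp 2. T f \<in> Lp 2) \<and>
     (\<forall>f \<in> Lp 1 \<inter> Lp 2. \<forall>g \<in> Lp 1 \<inter> Lp 2.
        (AE x in lborel. f x = g x) \<longrightarrow> (AE x in lborel. T f x = T g x)) \<and>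
     (\<forall>f \<in> Lp 1 \<inter> Lp 2. \<forall>g \<in> Lp 1 \<inter> Lp 2. \<forall>a b.
        AE x in lborel. T (\<lambda>y. a *\<^sub>R f y + b *\<^sub>R g y) x = a *\<^sub>R T f x + b *\<^sub>R T g x)"


section \<open>Test functions and weak derivatives\<close>

definition dir_deriv ::
  "'a::real_normed_vector \<Rightarrow> ('a \<Rightarrow> 'b::real_normed_vector) \<Rightarrow> 'a \<Rightarrow> 'b" where
  "dir_deriv v f = (\<lambda>x. frechet_derivative f (at x) v)"

definition smooth :: "('a::real_normed_vector \<Rightarrow> 'b::real_normed_vector) \<Rightarrow> bool" where
  "smooth f \<longleftrightarrow> (\<forall>vs x. foldr dir_deriv vs f differentiable (at x))"

definition test_function :: "('a::euclidean_space \<Rightarrow> real) \<Rightarrow> bool" where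
  "test_function \<phi> \<longleftrightarrow> smooth \<phi> \<and> compact (closure {x. \<phi> x \<noteq> 0})"

definition mi_order :: "nat ^ 'm \<Rightarrow> nat" where
  "mi_order \<beta> = (\<Sum>i\<in>UNIV. \<beta> $ i)"

definition partial_deriv ::
  "nat ^ 'm::finite \<Rightarrow> (real ^ 'm \<Rightarrow> 'b::real_normed_vector) \<Rightarrow> real ^ 'm \<Rightarrow> 'b" where
  \<comment> \<open>the order in which the \<open>\<beta> $ i\<close> derivatives in each direction \<open>i\<close> are taken is left
     unspecified; it is irrelevant for smooth functions by Schwarz's theorem\<close>
  "partial_deriv \<beta> f =
     foldr dir_deriv (map (\<lambda>i. axis i 1) (SOME is. \<forall>i. count_list is i = \<beta> $ i)) f"

definition has_weak_deriv ::
  "nat ^ 'm::finite \<Rightarrow> (real ^ 'm \<Rightarrow> 'b::euclidean_space) \<Rightarrow> (real ^ 'm \<Rightarrow> 'b) \<Rightarrow> bool" where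
  "has_weak_deriv \<beta> f g \<longleftrightarrow> locally_integrable f \<and> locally_integrable g \<and>
     (\<forall>\<phi>. test_function \<phi> \<longrightarrow>
        (LINT x|lborel. partial_deriv \<beta> \<phi> x *\<^sub>R f x) =
        (- 1) ^ mi_order \<beta> *\<^sub>R (LINT x|lborel. \<phi> x *\<^sub>R g x))"


section \<open>The Cauchy problem\<close>

definition symbol :: "('m::finite \<Rightarrow> real ^ 'n ^ 'n) \<Rightarrow> real ^ 'm \<Rightarrow> real ^ 'n ^ 'n" where
  "symbol A \<xi> = (\<Sum>\<alpha>\<in>UNIV. \<xi> $ \<alpha> *\<^sub>R A \<alpha>)"

text \<open>Weak solutions of \<open>w\<^sub>t + \<Sum>\<^sub>\<alpha> A\<^sub>\<alpha> w\<^sub>x\<^sub>\<alpha> = B w\<close> in the class \<open>C([0,\<infinity>); L\<^sup>2)\<close>: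
  the equation is tested in space, i.e. it holds in the sense of distributions in \<open>x\<close> at every
  time (one-sided in \<open>t\<close> at \<open>t = 0\<close>).
  As the test functions are scalar, the matrices stay on \<open>w\<close>.\<close>

definition weak_solution ::
  "('m::finite \<Rightarrow> real ^ 'n::finite ^ 'n) \<Rightarrow> real ^ 'n ^ 'n \<Rightarrow>
   (real ^ 'm \<Rightarrow> real ^ 'n) \<Rightarrow> (real \<Rightarrow> real ^ 'm \<Rightarrow> real ^ 'n) \<Rightarrow> bool" where
  "weak_solution A B w0 w \<longleftrightarrow>
     (\<forall>t\<ge>0. w t \<in> Lp 2) \<and>
     (\<forall>t\<ge>0. ((\<lambda>s. Lp_norm 2 (\<lambda>x. w s x - w t x)) \<longlongrightarrow> 0) (at t within {0..})) \<and>
     (AE x in lborel. w 0 x = w0 x) \<and>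
     (\<forall>\<phi>. test_function \<phi> \<longrightarrow> (\<forall>t\<ge>0.
        ((\<lambda>s. LINT x|lborel. \<phi> x *\<^sub>R w s x) has_vector_derivative
         (LINT x|lborel. (\<Sum>\<alpha>\<in>UNIV. dir_deriv (axis \<alpha> 1) \<phi> x *\<^sub>R (A \<alpha> *v w t x))
                           + \<phi> x *\<^sub>R (B *v w t x)))
        (at t within {0..})))"

definition solution_operator ::
  "('m::finite \<Rightarrow> real ^ 'n::finite ^ 'n) \<Rightarrow> real ^ 'n ^ 'n \<Rightarrow>
   (real \<Rightarrow> (real ^ 'm \<Rightarrow> real ^ 'n) \<Rightarrow> real ^ 'm \<Rightarrow> real ^ 'n) \<Rightarrow> bool" where
  "solution_operator A B \<Gamma> \<longleftrightarrow> (\<forall>w0 \<in> Lp 2. weak_solution A B w0 (\<lambda>t. \<Gamma> t w0))"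


section \<open>Block structure and decay rates\<close>

text \<open>\<open>\<real>\<^sup>n\<close> with \<open>n = n\<^sub>1 + n\<^sub>2\<close> is indexed by the sum type \<open>'n1 + 'n2\<close>.\<close>

definition block_B :: "real ^ 'n2 ^ 'n2 \<Rightarrow> real ^ ('n1::finite + 'n2::finite) ^ ('n1 + 'n2)" where
  "block_B D = (\<chi> i j. case (i, j) of (Inr k, Inr l) \<Rightarrow> D $ k $ l | _ \<Rightarrow> 0)"

definition L0 :: "real ^ ('n1::finite + 'n2::finite) \<Rightarrow> real ^ 'n1" where
  "L0 v = (\<chi> i. v $ Inl i)"

definition Lminus :: "real ^ ('n1::finite + 'n2::finite) \<Rightarrow> real ^ 'n2" where
  "Lminus v = (\<chi> j. v $ Inr j)"

definition decay :: "real \<Rightarrow> real \<Rightarrow> real" where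
  \<comment> \<open>\<open>min {1, t\<^sup>-\<^sup>\<gamma>}\<close>; the case \<open>t = 0\<close> is separate because \<open>0 powr a = 0\<close> in HOL\<close>
  "decay \<gamma> t = (if t = 0 then 1 else min 1 (t powr (- \<gamma>)))"

definition base_rate :: "'m::finite itself \<Rightarrow> ennreal \<Rightarrow> real" where
  \<comment> \<open>\<open>m/2 (1 - 1/p)\<close> for space dimension \<open>m\<close>, with \<open>1/\<infinity> = 0\<close>\<close>
  "base_rate _ p = real CARD('m) / 2 * (1 - enn2real (inverse p))"

end

theory Submission
  imports Defs "HOL-Probability.Characteristic_Functions" "HOL-Library.Multiset"
begin

text \<open>
  On the Fourier side the equation becomes \<open>v' = (B + i A(\<xi>)) v\<close> with \<open>A(\<xi>) = \<Sum>\<^sub>\<alpha> \<xi>\<^sub>\<alpha> A\<^sub>\<alpha>\<close>, a system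
  whose solution operator \<open>S(t, \<xi>)\<close> is a contraction. The eigenvector condition gives, for \<open>|\<omega>| = 1\<close>, a
  symmetric positive definite \<open>Q\<close> with \<open>Q + [[Q, A(\<omega>)], A(\<omega>)]\<close> equal to the projection on the dissipative
  components; the skew matrix \<open>[Q, A(\<omega>)]\<close> corrects the energy to a Lyapunov function, and
  \<open>|S(t, \<xi>)|\<^sup>2 \<le> 3 exp (- \<nu> min 1 |\<xi>|\<^sup>2 t)\<close>. For \<open>|\<xi>| \<le> 1\<close>, coupling the two blocks of the system through
  \<open>i A(\<xi>) = O(|\<xi>|)\<close> shows that each passage through a dissipative component gains a factor \<open>|\<xi>|\<close>.

  \<open>K\<close> is the part of the solution with frequencies \<open>|\<xi>| \<le> 1\<close> and \<open>\<K> = \<Gamma> - K\<close>. The estimates of \<open>K\<close> in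
  \<open>L\<^sup>\<infinity>\<close> and \<open>L\<^sup>2\<close> come from \<open>|ft w0| \<le> 2 |w0|\<^sub>1\<close> and Gaussian moments, those in between by interpolation.
  \<open>\<K>\<close> only sees \<open>|\<xi>| > 1\<close>, where \<open>S\<close> decays exponentially. The Fourier transform of a function that is
  merely in \<open>L\<^sup>2\<close> is never formed: \<open>\<Gamma>\<close> and \<open>\<K>\<close> are paired with \<open>f \<in> L\<^sup>1 \<inter> L\<^sup>2\<close>, and the evolution is
  moved to \<open>ft f\<close>, where the adjoint flow acts.
\<close>

section \<open>The space \<open>L\<^sup>2\<close>\<close>

text \<open>The operator \<Gamma> is known only through the weak formulation: uniqueness and
  linearity are not part of its specification, and its time derivative is given only against
  compactly supported tests. Inverse transforms of band-limited amplitudes are not compactly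
  supported, so the weak identities are first extended by cutoffs; the resulting formula for
  \<open>\<Gamma> t w0\<close> against f then gives uniqueness, linearity and commutation with
  derivatives together. In the estimate of \<K> the derivative of w0 lies in L^2 but need not be
  integrable, which forces the same detour. The sharp cutoff at |\<xi>| = 1 does no harm since p >=
  2: only L^1 and L^2 norms of amplitudes enter, never a convolution kernel. The gain |\<xi>|^2 from
  dissipative data to dissipative components does not follow from the energy: one factor comes from
  the damping by D, the other from the same bound for the adjoint system, and the fast transient
  must be kept apart. Uniformity in the direction of \<xi> is obtained by compactness, so the
  dependence of Q on the direction is never studied.\<close>

lemma Lp2_iff: "f \<in> Lp 2 \<longleftrightarrow> f \<in> borel_measurable borel \<and> integrable lborel (\<lambda>x. (norm (f x))\<^sup>2)"
  by (auto simp: Lp_def)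

lemma Lp_norm2: "Lp_norm 2 f = sqrt (LINT x|lborel. (norm (f x))\<^sup>2)"
  by (simp add: Lp_norm_def powr_half_sqrt integral_nonneg_AE)

lemma Lp1_iff: "f \<in> Lp 1 \<longleftrightarrow> integrable lborel f"
  by (auto simp: Lp_def integrable_norm_iff borel_measurable_integrable)

lemma Lp_norm1: "Lp_norm 1 f = (LINT x|lborel. norm (f x))"
  by (simp add: Lp_norm_def integral_nonneg_AE)

lemma Lp2_measurable: "f \<in> Lp 2 \<Longrightarrow> f \<in> borel_measurable borel"
  by (simp add: Lp2_iff)

lemma Lp_norm2_nonneg: "Lp_norm 2 f \<ge> 0"
  by (simp add: Lp_norm2 integral_nonneg_AE)

lemma Lp_norm2_sq: "(Lp_norm 2 f)\<^sup>2 = (LINT x|lborel. (norm (f x))\<^sup>2)"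
  by (simp add: Lp_norm2 integral_nonneg_AE)

lemma Lp2_inner:
  assumes "f \<in> Lp 2" "g \<in> Lp 2"
  shows "integrable lborel (\<lambda>x. f x \<bullet> g x)"
proof (rule Bochner_Integration.integrable_bound)
  show "integrable lborel (\<lambda>x. (norm (f x))\<^sup>2 + (norm (g x))\<^sup>2)"
    using assms by (auto simp: Lp2_iff)
  show "(\<lambda>x. f x \<bullet> g x) \<in> borel_measurable lborel"
    using assms by (auto simp: Lp2_iff)
  have "norm (a \<bullet> b) \<le> norm ((norm a)\<^sup>2 + (norm b)\<^sup>2)" for a b :: 'b
  proof -
    have "\<bar>a \<bullet> b\<bar> \<le> norm a * norm b" by (rule Cauchy_Schwarz_ineq2)
    moreover have "2 * (norm a * norm b) \<le> (norm a)\<^sup>2 + (norm b)\<^sup>2"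
      using sum_squares_bound[of "norm a" "norm b"] by (simp add: mult.assoc)
    moreover have "0 \<le> norm a * norm b" by simp
    ultimately show ?thesis by simp
  qed
  then show "AE x in lborel. norm (f x \<bullet> g x) \<le> norm ((norm (f x))\<^sup>2 + (norm (g x))\<^sup>2)" by simp
qed

lemma Lp2_scaleR: "f \<in> Lp 2 \<Longrightarrow> (\<lambda>x. a *\<^sub>R f x) \<in> Lp 2"
  unfolding Lp2_iff by (auto simp: power_mult_distrib)

lemma Lp2_add:
  assumes "f \<in> Lp 2" "g \<in> Lp 2"
  shows "(\<lambda>x. f x + g x) \<in> Lp 2"
proof -
  have "(norm (f x + g x))\<^sup>2 = (norm (f x))\<^sup>2 + 2 * (f x \<bullet> g x) + (norm (g x))\<^sup>2" for x
    by (simp add: power2_norm_eq_inner inner_simps inner_commute)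
  then show ?thesis
    using assms Lp2_inner[OF assms] unfolding Lp2_iff by (auto simp del: norm_add_rule_thm)
qed

lemma Lp2_diff: "f \<in> Lp 2 \<Longrightarrow> g \<in> Lp 2 \<Longrightarrow> (\<lambda>x. f x - g x) \<in> Lp 2"
  using Lp2_add[of f "\<lambda>x. (-1) *\<^sub>R g x"] Lp2_scaleR[of g "-1"] by simp

lemma Lp2_bound:
  assumes "g \<in> Lp 2" "f \<in> borel_measurable borel" "\<And>x. norm (f x) \<le> M * norm (g x)"
  shows "f \<in> Lp 2"
proof -
  have "integrable lborel (\<lambda>x. (norm (f x))\<^sup>2)"
  proof (rule Bochner_Integration.integrable_bound)
    show "integrable lborel (\<lambda>x. M\<^sup>2 * (norm (g x))\<^sup>2)" using assms by (auto simp: Lp2_iff)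
    have "(norm (f x))\<^sup>2 \<le> M\<^sup>2 * (norm (g x))\<^sup>2" for x
      using power_mono[OF assms(3)[of x], of 2] by (simp add: power_mult_distrib)
    then show "AE x in lborel. norm ((norm (f x))\<^sup>2) \<le> norm (M\<^sup>2 * (norm (g x))\<^sup>2)" by simp
  qed (use assms in auto)
  then show ?thesis using assms by (simp add: Lp2_iff)
qed

lemma Lp_norm2_mono:
  assumes "g \<in> Lp 2" "f \<in> borel_measurable borel" "\<And>x. norm (f x) \<le> M * norm (g x)" "0 \<le> M"
  shows "Lp_norm 2 f \<le> M * Lp_norm 2 g"
proof -
  have f: "f \<in> Lp 2" by (rule Lp2_bound[OF assms(1-3)])
  have "(LINT x|lborel. (norm (f x))\<^sup>2) \<le> (LINT x|lborel. M\<^sup>2 * (norm (g x))\<^sup>2)"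
  proof (rule integral_mono)
    show "(norm (f x))\<^sup>2 \<le> M\<^sup>2 * (norm (g x))\<^sup>2" for x
      using power_mono[OF assms(3)[of x], of 2] by (simp add: power_mult_distrib)
  qed (use assms f in \<open>auto simp: Lp2_iff\<close>)
  then have "(Lp_norm 2 f)\<^sup>2 \<le> (M * Lp_norm 2 g)\<^sup>2" by (simp add: Lp_norm2_sq power_mult_distrib)
  then show ?thesis by (rule power2_le_imp_le) (simp add: Lp_norm2_nonneg assms(4))
qed

lemma Lp_norm2_scaleR: "Lp_norm 2 (\<lambda>x. a *\<^sub>R f x) = \<bar>a\<bar> * Lp_norm 2 f"
  by (simp add: Lp_norm2 power_mult_distrib real_sqrt_mult)

lemma Lp_norm2_diff_sq:
  assumes "f \<in> Lp 2" "g \<in> Lp 2"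
  shows "(Lp_norm 2 (\<lambda>x. f x - g x))\<^sup>2 =
    (Lp_norm 2 f)\<^sup>2 - 2 * (LINT x|lborel. f x \<bullet> g x) + (Lp_norm 2 g)\<^sup>2"
proof -
  have "(norm (f x - g x))\<^sup>2 = (norm (f x))\<^sup>2 - 2 * (f x \<bullet> g x) + (norm (g x))\<^sup>2" for x
    by (simp add: power2_norm_eq_inner inner_simps inner_commute)
  then show ?thesis
    using assms Lp2_inner[OF assms] by (simp add: Lp_norm2_sq Lp2_iff)
qed

lemma Lp2_Cauchy_Schwarz:
  assumes "f \<in> Lp 2" "g \<in> Lp 2"
  shows "\<bar>LINT x|lborel. f x \<bullet> g x\<bar> \<le> Lp_norm 2 f * Lp_norm 2 g"
proof -
  define I where "I = (LINT x|lborel. f x \<bullet> g x)"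
  \<comment> \<open>Nonnegativity of |f - s g|^2 as a quadratic in s. The minimiser is I / |g|^2; if
    |g| = 0 the quadratic is affine, and a large s rules out I \<noteq> 0.\<close>
  have q: "0 \<le> (Lp_norm 2 f)\<^sup>2 - 2 * s * I + s\<^sup>2 * (Lp_norm 2 g)\<^sup>2" for s
  proof -
    have "0 \<le> (Lp_norm 2 (\<lambda>x. f x - s *\<^sub>R g x))\<^sup>2" by simp
    also have "\<dots> = (Lp_norm 2 f)\<^sup>2 - 2 * s * I + s\<^sup>2 * (Lp_norm 2 g)\<^sup>2"
      unfolding Lp_norm2_diff_sq[OF assms(1) Lp2_scaleR[OF assms(2), of s]]
      by (simp add: I_def Lp_norm2_scaleR power_mult_distrib)
    finally show ?thesis .
  qed
  have "I\<^sup>2 \<le> (Lp_norm 2 f)\<^sup>2 * (Lp_norm 2 g)\<^sup>2"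
  proof (cases "Lp_norm 2 g = 0")
    case True
    then have q': "2 * s * I \<le> (Lp_norm 2 f)\<^sup>2" for s using q[of s] by simp
    have "I = 0"
    proof (rule ccontr)
      assume "I \<noteq> 0"
      then show False using q'[of "((Lp_norm 2 f)\<^sup>2 + 1) / (2 * I)"] by simp
    qed
    then show ?thesis by simp
  next
    case False
    then have pos: "0 < (Lp_norm 2 g)\<^sup>2" by simp
    define G where "G = (Lp_norm 2 g)\<^sup>2"
    have "(I / G)\<^sup>2 * G = I * I / G" using pos by (simp add: G_def power2_eq_square)
    with q[of "I / G"] have "I * I / G \<le> (Lp_norm 2 f)\<^sup>2" by (simp add: G_def)
    then show ?thesis using pos by (simp add: G_def[symmetric] pos_divide_le_eq power2_eq_square[of I])
  qed
  then have "\<bar>I\<bar>\<^sup>2 \<le> (Lp_norm 2 f * Lp_norm 2 g)\<^sup>2" by (simp add: power_mult_distrib)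
  then show ?thesis unfolding I_def
    by (rule power2_le_imp_le) (simp add: Lp_norm2_nonneg)
qed

lemma Lp_norm2_triangle:
  assumes "f \<in> Lp 2" "g \<in> Lp 2"
  shows "Lp_norm 2 (\<lambda>x. f x + g x) \<le> Lp_norm 2 f + Lp_norm 2 g"
proof -
  have "(Lp_norm 2 (\<lambda>x. f x + g x))\<^sup>2 =
    (Lp_norm 2 f)\<^sup>2 + 2 * (LINT x|lborel. f x \<bullet> g x) + (Lp_norm 2 g)\<^sup>2"
    using Lp_norm2_diff_sq[OF assms(1) Lp2_scaleR[OF assms(2), of "-1"]] Lp_norm2_scaleR[of "-1" g]
    by simp
  also have "\<dots> \<le> (Lp_norm 2 f + Lp_norm 2 g)\<^sup>2"
    using Lp2_Cauchy_Schwarz[OF assms] by (simp add: power2_sum)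
  finally show ?thesis by (rule power2_le_imp_le) (simp add: Lp_norm2_nonneg)
qed

lemma Lp2_inner_tendsto:
  assumes "\<And>n. f n \<in> Lp 2" "h \<in> Lp 2" "g \<in> Lp 2"
    and "((\<lambda>n. Lp_norm 2 (\<lambda>x. f n x - h x)) \<longlongrightarrow> 0) F"
  shows "((\<lambda>n. LINT x|lborel. f n x \<bullet> g x) \<longlongrightarrow> (LINT x|lborel. h x \<bullet> g x)) F"
proof (rule Lim_null[THEN iffD2], rule Lim_null_comparison)
  show "((\<lambda>n. Lp_norm 2 (\<lambda>x. f n x - h x) * Lp_norm 2 g) \<longlongrightarrow> 0) F"
    using tendsto_mult_left_zero[OF assms(4)] .
  show "\<forall>\<^sub>F n in F. norm ((LINT x|lborel. f n x \<bullet> g x) - (LINT x|lborel. h x \<bullet> g x))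
      \<le> Lp_norm 2 (\<lambda>x. f n x - h x) * Lp_norm 2 g"
  proof (intro always_eventually allI)
    fix n
    have "(LINT x|lborel. f n x \<bullet> g x) - (LINT x|lborel. h x \<bullet> g x) = (LINT x|lborel. (f n x - h x) \<bullet> g x)"
      using Lp2_inner[OF assms(1,3)] Lp2_inner[OF assms(2,3)] by (simp add: inner_diff_left)
    then show "norm ((LINT x|lborel. f n x \<bullet> g x) - (LINT x|lborel. h x \<bullet> g x))
      \<le> Lp_norm 2 (\<lambda>x. f n x - h x) * Lp_norm 2 g"
      using Lp2_Cauchy_Schwarz[OF Lp2_diff[OF assms(1)[of n] assms(2)] assms(3)] by simp
  qed
qed

section \<open>Truncation to balls and duality in L^2\<close>

definition cutoff :: "real \<Rightarrow> ('a::euclidean_space \<Rightarrow> 'b::euclidean_space) \<Rightarrow> 'a \<Rightarrow> 'b" where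
  "cutoff R f = (\<lambda>x. indicator (cball 0 R) x *\<^sub>R f x)"

lemma cutoff_measurable [measurable]:
  "f \<in> borel_measurable borel \<Longrightarrow> cutoff R f \<in> borel_measurable borel"
  unfolding cutoff_def by (intro borel_measurable_scaleR borel_measurable_indicator) auto

lemma norm_cutoff_le: "norm (cutoff R f x) \<le> norm (f x)"
  by (auto simp: cutoff_def indicator_def)

lemma cutoff_Lp2: "f \<in> Lp 2 \<Longrightarrow> cutoff R f \<in> Lp 2"
  by (rule Lp2_bound[of f _ 1]) (simp_all add: norm_cutoff_le cutoff_measurable Lp2_measurable)

lemma integrable_cball_const [simp]:
  fixes c :: "'b::euclidean_space"
  shows "integrable lborel (\<lambda>x::'a::euclidean_space. indicator (cball 0 R) x *\<^sub>R c)"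
proof -
  have "emeasure lborel (cball (0::'a) R) < \<infinity>" by (rule emeasure_lborel_cball_finite)
  then show ?thesis by (auto intro!: integrable_real_indicator)
qed

lemma cutoff_Lp1:
  assumes "f \<in> Lp 2"
  shows "cutoff R f \<in> Lp 1"
  unfolding Lp1_iff
proof (rule Bochner_Integration.integrable_bound)
  show "integrable lborel (\<lambda>x. indicator (cball 0 R) x *\<^sub>R (1::real) + (norm (f x))\<^sup>2)"
    using assms by (intro Bochner_Integration.integrable_add integrable_cball_const) (auto simp: Lp2_iff)
  show "cutoff R f \<in> borel_measurable lborel" using assms by (auto simp: Lp2_iff)
  have "s \<le> 1 + s\<^sup>2" for s :: real
    using sum_squares_bound[of s 1] zero_le_power2[of s] by (smt (verit) mult.right_neutral power_one)
  then show "AE x in lborel. norm (cutoff R f x) \<le> norm (indicator (cball 0 R) x *\<^sub>R (1::real) + (norm (f x))\<^sup>2)"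
    by (auto simp: cutoff_def indicator_def)
qed

lemma cutoff_norm_tendsto:
  assumes "f \<in> Lp 2"
  shows "(\<lambda>n. Lp_norm 2 (cutoff (real n) f)) \<longlonglongrightarrow> Lp_norm 2 f"
  unfolding Lp_norm2
proof (intro tendsto_real_sqrt integral_dominated_convergence[where w="\<lambda>x. (norm (f x))\<^sup>2"])
  show "AE x in lborel. (\<lambda>n. (norm (cutoff (real n) f x))\<^sup>2) \<longlonglongrightarrow> (norm (f x))\<^sup>2"
  proof (rule AE_I2, rule tendsto_eventually)
    fix x :: 'a
    obtain N :: nat where "norm x \<le> real N" using real_arch_simple by blast
    then show "\<forall>\<^sub>F n in sequentially. (norm (cutoff (real n) f x))\<^sup>2 = (norm (f x))\<^sup>2"
      by (intro eventually_sequentiallyI[of N]) (auto simp: cutoff_def indicator_def)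
  qed
qed (use assms norm_cutoff_le in \<open>auto simp: Lp2_iff intro!: power_mono\<close>)

text \<open>The truncations of \<open>u\<close> itself serve as tests: dividing by their norm bounds
  each of them by M, and then the radius tends to infinity. Tests are restricted to L^1 \<inter> L^2
  because that is where Plancherel is available.\<close>

lemma Lp2_norm_le_by_duality:
  assumes u: "u \<in> Lp 2" and "0 \<le> M"
    and le: "\<And>f. f \<in> Lp 1 \<Longrightarrow> f \<in> Lp 2 \<Longrightarrow> \<bar>LINT x|lborel. f x \<bullet> u x\<bar> \<le> M * Lp_norm 2 f"
  shows "Lp_norm 2 u \<le> M"
proof (rule LIMSEQ_le_const2[OF cutoff_norm_tendsto[OF u]], intro exI allI impI)
  fix n :: nat
  let ?f = "cutoff (real n) u"
  have "(Lp_norm 2 ?f)\<^sup>2 = (LINT x|lborel. ?f x \<bullet> u x)"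
    unfolding Lp_norm2_sq power2_norm_eq_inner
    by (intro Bochner_Integration.integral_cong) (auto simp: cutoff_def indicator_def)
  also have "\<dots> \<le> M * Lp_norm 2 ?f"
    using le[OF cutoff_Lp1[OF u] cutoff_Lp2[OF u], of "real n"] by linarith
  finally show "Lp_norm 2 ?f \<le> M"
    using Lp_norm2_nonneg[of ?f] \<open>0 \<le> M\<close>
    by (cases "Lp_norm 2 ?f = 0") (auto simp: power2_eq_square)
qed

lemma Lp_norm2_eq_0_iff:
  assumes "u \<in> Lp 2"
  shows "Lp_norm 2 u = 0 \<longleftrightarrow> (AE x in lborel. u x = 0)"
  using assms integral_nonneg_eq_0_iff_AE[of lborel "\<lambda>x. (norm (u x))\<^sup>2"]
  by (simp add: Lp_norm2 Lp2_iff)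

lemma Lp2_eq_0_by_duality:
  assumes u: "u \<in> Lp 2"
    and "\<And>f. f \<in> Lp 1 \<Longrightarrow> f \<in> Lp 2 \<Longrightarrow> (LINT x|lborel. f x \<bullet> u x) = 0"
  shows "AE x in lborel. u x = 0"
  using Lp2_norm_le_by_duality[OF u, of 0] assms Lp_norm2_nonneg[of u] Lp_norm2_eq_0_iff[OF u] by simp

section \<open>Translations, dilations and continuity of translation in L^1\<close>

lemma lborel_integral_translation:
  fixes f :: "'a::euclidean_space \<Rightarrow> 'b::{banach, second_countable_topology}"
  assumes "f \<in> borel_measurable borel"
  shows "(LINT x|lborel. f (c + x)) = (LINT x|lborel. f x)"
proof -
  have "(LINT x|lborel. f x) = (LINT x|distr lborel borel ((+) c). f x)"
    by (simp add: lborel_distr_plus)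
  also have "\<dots> = (LINT x|lborel. f (c + x))"
    using assms by (subst integral_distr) auto
  finally show ?thesis ..
qed

lemma lborel_integrable_translation:
  fixes f :: "'a::euclidean_space \<Rightarrow> 'b::{banach, second_countable_topology}"
  assumes "integrable lborel f"
  shows "integrable lborel (\<lambda>x. f (c + x))"
proof -
  have "integrable (distr lborel borel ((+) c)) f"
    using assms by (simp add: lborel_distr_plus)
  then show ?thesis by (rule integrable_distr[rotated]) simp
qed

lemma lborel_integral_scaling:
  fixes f :: "'a::euclidean_space \<Rightarrow> 'b::{banach, second_countable_topology}"
  assumes "f \<in> borel_measurable borel" "c \<noteq> 0"
  shows "(LINT x|lborel. f x) = \<bar>c\<bar> ^ DIM('a) *\<^sub>R (LINT x|lborel. f (t + c *\<^sub>R x))"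
proof -
  have "(LINT x|lborel. f x) = (LINT x|density (distr lborel borel (\<lambda>x. t + c *\<^sub>R x)) (\<lambda>_. ennreal (\<bar>c\<bar> ^ DIM('a))). f x)"
    using lborel_affine[OF assms(2), of t] by simp
  also have "\<dots> = (LINT x|lborel. \<bar>c\<bar> ^ DIM('a) *\<^sub>R f (t + c *\<^sub>R x))"
    using assms by (subst integral_density; (subst integral_distr)?) auto
  finally show ?thesis by simp
qed

lemma lborel_integrable_scaling:
  fixes f :: "'a::euclidean_space \<Rightarrow> 'b::{banach, second_countable_topology}"
  assumes "integrable lborel f" "c \<noteq> 0"
  shows "integrable lborel (\<lambda>x. f (t + c *\<^sub>R x))"
proof -
  have "integrable (density (distr lborel borel (\<lambda>x. t + c *\<^sub>R x)) (\<lambda>_. ennreal (\<bar>c\<bar> ^ DIM('a)))) f"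
    using assms lborel_affine[OF assms(2), of t] by simp
  then have "integrable (distr lborel borel (\<lambda>x. t + c *\<^sub>R x)) (\<lambda>x. \<bar>c\<bar> ^ DIM('a) *\<^sub>R f x)"
    using assms by (subst (asm) integrable_density) auto
  then have "integrable lborel (\<lambda>x. \<bar>c\<bar> ^ DIM('a) *\<^sub>R f (t + c *\<^sub>R x))"
    by (rule integrable_distr[rotated]) simp
  then have "integrable lborel (\<lambda>x. inverse (\<bar>c\<bar> ^ DIM('a)) *\<^sub>R \<bar>c\<bar> ^ DIM('a) *\<^sub>R f (t + c *\<^sub>R x))"
    by (rule integrable_scaleR_right)
  then show ?thesis using assms by simp
qed

text \<open>A density argument: indicators of sets of finite measure, then sums, then pointwise
  limits of functions dominated by twice the limit.\<close>

lemma integral_translation_tendsto_zero: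
  fixes f :: "'a::euclidean_space \<Rightarrow> 'b::{banach, second_countable_topology}"
  assumes "integrable lborel f" "z \<longlonglongrightarrow> 0"
  shows "(\<lambda>n. LINT x|lborel. norm (f (z n + x) - f x)) \<longlonglongrightarrow> 0"
  using assms(1)
proof (induct rule: integrable_induct)
  case (base A c)
  define i where "i = (indicator A :: 'a \<Rightarrow> real)"
  have [measurable]: "A \<in> sets borel" using base by simp
  have iA: "integrable lborel i" unfolding i_def using base by (auto intro!: integrable_real_indicator)
  define \<mu> where "\<mu> = (LINT x|lborel. i x)"
  have mi[measurable]: "i \<in> borel_measurable borel" by (simp add: i_def)
  have int1: "integrable lborel (\<lambda>x. i x * i (- w + x))" for w
    by (rule Bochner_Integration.integrable_bound[OF iA]) (auto simp: i_def indicator_def)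
  have int2: "integrable lborel (\<lambda>x. i (w + x))" for w
    by (rule lborel_integrable_translation[OF iA])
  \<comment> \<open>The distance between the indicators of two translates is governed by their
    overlap, so only the overlap integral has to converge.\<close>
  have eq: "(LINT x|lborel. norm (indicator A (w + x) *\<^sub>R c - indicator A x *\<^sub>R c))
      = norm c * (2 * \<mu> - 2 * (LINT x|lborel. i x * i (- w + x)))" for w
  proof -
    have "norm (indicator A (w + x) *\<^sub>R c - indicator A x *\<^sub>R c)
        = norm c * (i (w + x) + i x - 2 * (i (w + x) * i x))" for x
      by (auto simp: i_def indicator_def)
    moreover have "integrable lborel (\<lambda>x. i (w + x) * i x)"
      by (rule Bochner_Integration.integrable_bound[OF iA]) (auto simp: i_def indicator_def)
    moreover have "(LINT x|lborel. i (w + x)) = \<mu>"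
      unfolding \<mu>_def by (rule lborel_integral_translation) simp
    moreover have "(LINT x|lborel. i (w + x) * i x) = (LINT x|lborel. i x * i (- w + x))"
      using lborel_integral_translation[of "\<lambda>x. i x * i (- w + x)" w] by simp
    ultimately show ?thesis
      using iA int2[of w] by (simp add: \<mu>_def)
  qed
  have "(\<lambda>n. LINT x|lborel. i x * i (- z n + x)) \<longlonglongrightarrow> \<mu>"
  proof (rule LIMSEQ_I)
    fix e :: real assume "0 < e"
    then have "e/2 > 0" by simp
    \<comment> \<open>Membership in an open set survives small shifts, so the overlap of
      \<open>A\<close> with translates of \<open>U\<close> converges by dominated convergence.
      Replacing \<open>A\<close> by \<open>U\<close> costs the measure of U - A, which is below
      e/2.\<close>
    obtain U where U: "open U" "A \<subseteq> U" "emeasure lborel (U - A) < e/2"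
      using outer_regular_lborel[of A "e/2"] \<open>e/2 > 0\<close> by auto
    have [measurable]: "U \<in> sets borel" using U by auto
    define k where "k = (indicator (U - A) :: 'a \<Rightarrow> real)"
    have ki: "integrable lborel k"
      unfolding k_def using U(3) by (intro integrable_real_indicator) (auto intro: less_trans)
    have km[measurable]: "k \<in> borel_measurable borel" by (simp add: k_def)
    have ke: "(LINT x|lborel. k x) < e/2"
    proof -
      have "emeasure lborel (U - A) = ennreal (measure lborel (U - A))"
        using U(3) by (intro emeasure_eq_ennreal_measure) auto
      then show ?thesis using U(3) \<open>0 < e\<close> by (simp add: k_def ennreal_less_iff)
    qed
    define j where "j = (indicator U :: 'a \<Rightarrow> real)"
    have jm[measurable]: "j \<in> borel_measurable borel" by (simp add: j_def)
    have ui: "integrable lborel (\<lambda>x. i x * j (- w + x))" for w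
    proof (rule Bochner_Integration.integrable_bound[OF iA])
      have "(\<lambda>x. - w + x) \<in> borel \<rightarrow>\<^sub>M borel" by simp
      from measurable_compose[OF this jm]
      show "(\<lambda>x. i x * j (- w + x)) \<in> borel_measurable lborel"
        using mi by (simp add: borel_measurable_times)
      have "norm (i x * j (- w + x)) \<le> norm (i x)" for x
        by (simp add: i_def j_def indicator_def)
      then show "AE x in lborel. norm (i x * j (- w + x)) \<le> norm (i x)" by simp
    qed
    have "(\<lambda>n. LINT x|lborel. i x * j (- z n + x)) \<longlonglongrightarrow> (LINT x|lborel. i x)"
    proof (rule integral_dominated_convergence[where w=i])
      show "AE x in lborel. (\<lambda>n. i x * j (- z n + x)) \<longlonglongrightarrow> i x"
      proof (rule AE_I2, rule tendsto_eventually)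
        fix x
        show "\<forall>\<^sub>F n in sequentially. i x * j (- z n + x) = i x"
        proof (cases "x \<in> A")
          case True
          have "(\<lambda>n. - z n + x) \<longlonglongrightarrow> x" using tendsto_add[OF tendsto_minus[OF assms(2)] tendsto_const[of x]] by simp
          moreover have "x \<in> U" using True U by auto
          ultimately have "\<forall>\<^sub>F n in sequentially. - z n + x \<in> U" using U(1) topological_tendstoD by blast
          then show ?thesis by (rule eventually_mono) (simp add: j_def)
        qed (simp add: i_def)
      qed
      show "(\<lambda>x. i x * j (- z n + x)) \<in> borel_measurable lborel" for n
        using borel_measurable_integrable[OF ui] .
      have "norm (i x * j (- z n + x)) \<le> i x" for n x
        by (simp add: i_def j_def indicator_def)
      then show "AE x in lborel. norm (i x * j (- z n + x)) \<le> i x" for n by simp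
    qed (use iA mi in simp_all)
    then obtain N where N: "\<And>n. n \<ge> N \<Longrightarrow> \<bar>(LINT x|lborel. i x * j (- z n + x)) - \<mu>\<bar> < e/2"
      using LIMSEQ_D[OF _ \<open>e/2>0\<close>] unfolding \<mu>_def by force
    have "\<bar>(LINT x|lborel. i x * i (- z n + x)) - \<mu>\<bar> < e" if "n \<ge> N" for n
    proof -
      have "(LINT x|lborel. i x * i (- z n + x)) \<le> \<mu>"
        unfolding \<mu>_def by (intro integral_mono int1 iA) (auto simp: i_def j_def indicator_def)
      moreover have "(LINT x|lborel. i x * j (- z n + x)) - (LINT x|lborel. k (- z n + x))
          \<le> (LINT x|lborel. i x * i (- z n + x))"
      proof -
        have "(LINT x|lborel. i x * j (- z n + x)) - (LINT x|lborel. k (- z n + x))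
          = (LINT x|lborel. i x * j (- z n + x) - k (- z n + x))"
          by (rule Bochner_Integration.integral_diff[symmetric])
            (rule ui, rule lborel_integrable_translation[OF ki])
        also have "\<dots> \<le> (LINT x|lborel. i x * i (- z n + x))"
        proof (rule integral_mono)
          show "integrable lborel (\<lambda>x. i x * j (- z n + x) - k (- z n + x))"
            by (rule Bochner_Integration.integrable_diff[OF ui lborel_integrable_translation[OF ki]])
          show "i x * j (- z n + x) - k (- z n + x) \<le> i x * i (- z n + x)" for x
            using U(2) by (auto simp: i_def j_def k_def indicator_def)
        qed (rule int1)
        finally show ?thesis .
      qed
      moreover have "(LINT x|lborel. k (- z n + x)) = (LINT x|lborel. k x)"
        by (rule lborel_integral_translation) simp
      ultimately show ?thesis using N[OF that] ke unfolding abs_less_iff by linarith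
    qed
    then show "\<exists>N. \<forall>n\<ge>N. norm ((LINT x|lborel. i x * i (- z n + x)) - \<mu>) < e" by auto
  qed
  then have "(\<lambda>n. norm c * (2 * \<mu> - 2 * (LINT x|lborel. i x * i (- z n + x)))) \<longlonglongrightarrow> norm c * (2 * \<mu> - 2 * \<mu>)"
    by (intro tendsto_intros)
  then show ?case unfolding eq by simp
next
  case (add f g)
  have "(\<lambda>n. (LINT x|lborel. norm (f (z n + x) - f x)) + (LINT x|lborel. norm (g (z n + x) - g x))) \<longlonglongrightarrow> 0"
    using tendsto_add[OF add(2,4)] by simp
  then show ?case
  proof (rule Lim_null_comparison[rotated], intro always_eventually allI)
    fix n
    note [simp] = lborel_integrable_translation[OF add(1)] lborel_integrable_translation[OF add(3)] add(1,3)
    have "(LINT x|lborel. norm (f (z n + x) + g (z n + x) - (f x + g x)))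
      \<le> (LINT x|lborel. norm (f (z n + x) - f x) + norm (g (z n + x) - g x))"
      by (rule integral_mono) (auto intro: norm_diff_triangle_ineq)
    then show "norm (LINT x|lborel. norm (f (z n + x) + g (z n + x) - (f x + g x)))
      \<le> (LINT x|lborel. norm (f (z n + x) - f x)) + (LINT x|lborel. norm (g (z n + x) - g x))"
      by (simp add: integral_nonneg_AE)
  qed
next
  case (lim f s)
  have si: "(\<lambda>i. LINT x|lborel. norm (s i x - f x)) \<longlonglongrightarrow> (LINT x::'a|lborel. 0)"
  proof -
   have m: "s i \<in> borel_measurable borel" "f \<in> borel_measurable borel" for i
     using borel_measurable_integrable[OF lim(1)] borel_measurable_integrable[OF lim(5)] by auto
   show ?thesis
   proof (rule integral_dominated_convergence[where w="\<lambda>x. 3 * norm (f x)"])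
    show "AE x in lborel. (\<lambda>i. norm (s i x - f x)) \<longlonglongrightarrow> 0"
      using lim(3) by (auto intro!: tendsto_norm_zero LIM_zero)
    show "AE x in lborel. norm (norm (s i x - f x)) \<le> 3 * norm (f x)" for i
    proof (rule AE_I2)
      fix x show "norm (norm (s i x - f x)) \<le> 3 * norm (f x)"
        using lim(4)[of x i] norm_triangle_ineq4[of "s i x" "f x"] by simp
    qed
   qed (use lim m in \<open>auto intro!: borel_measurable_norm borel_measurable_diff\<close>)
  qed
  show ?case
  proof (rule LIMSEQ_I)
    fix e :: real assume "0 < e"
    then have "e/3 > 0" by simp
    obtain i where "norm ((LINT x|lborel. norm (s i x - f x)) - (LINT x::'a|lborel. 0)) < e/3"
      using LIMSEQ_D[OF si \<open>e/3 > 0\<close>] by blast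
    then have i: "(LINT x|lborel. norm (s i x - f x)) < e/3" by simp
    obtain N where N: "\<And>n. n \<ge> N \<Longrightarrow> norm ((LINT x|lborel. norm (s i (z n + x) - s i x)) - 0) < e/3"
      using LIMSEQ_D[OF lim(2) \<open>e/3 > 0\<close>] by blast
    have "norm ((LINT x|lborel. norm (f (z n + x) - f x)) - 0) < e" if "n \<ge> N" for n
    proof -
      note [simp] = lborel_integrable_translation[OF lim(1)] lborel_integrable_translation[OF lim(5)] lim(1,5)
      \<comment> \<open>Three errors; the first and the last agree by translation invariance, so
        approximation by \<open>s i\<close> is needed only once.\<close>
      have "(LINT x|lborel. norm (f (z n + x) - f x))
        \<le> (LINT x|lborel. norm (s i (z n + x) - f (z n + x)) + norm (s i (z n + x) - s i x) + norm (s i x - f x))"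
      proof (rule integral_mono)
        fix x
        show "norm (f (z n + x) - f x) \<le> norm (s i (z n + x) - f (z n + x)) + norm (s i (z n + x) - s i x) + norm (s i x - f x)"
          by norm
      qed auto
      also have "\<dots> = (LINT x|lborel. norm (s i (z n + x) - f (z n + x))) + (LINT x|lborel. norm (s i (z n + x) - s i x)) + (LINT x|lborel. norm (s i x - f x))"
        by simp
      also have "(LINT x|lborel. norm (s i (z n + x) - f (z n + x))) = (LINT x|lborel. norm (s i x - f x))"
        using borel_measurable_integrable[OF lim(1)[of i]] borel_measurable_integrable[OF lim(5)]
        by (intro lborel_integral_translation borel_measurable_norm borel_measurable_diff) auto
      finally show ?thesis using i N[OF that] by (simp add: integral_nonneg_AE)
    qed
    then show "\<exists>N. \<forall>n\<ge>N. norm ((LINT x|lborel. norm (f (z n + x) - f x)) - 0) < e" by blast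
  qed
qed

section \<open>The Fourier transform on \<open>L\<^sup>1 \<inter> L\<^sup>2\<close>\<close>

text \<open>Meant for inverse transforms, which at first are only known to be bounded: square
  integrability is produced by monotone convergence of the truncated integrals.\<close>

lemma Lp2_if_cutoff_bounded:
  assumes [measurable]: "u \<in> borel_measurable borel"
    and L: "\<And>n. cutoff (real n) u \<in> Lp 2" "\<And>n. Lp_norm 2 (cutoff (real n) u) \<le> M"
  shows "u \<in> Lp 2 \<and> Lp_norm 2 u \<le> M"
proof -
  let ?g = "\<lambda>n x. (norm (cutoff (real n) u x))\<^sup>2"
  have int: "integrable lborel (?g n)" for n using L(1)[of n] by (simp add: Lp2_iff)
  have M: "0 \<le> M" using L(2)[of 0] Lp_norm2_nonneg[of "cutoff (real 0) u"] by linarith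
  have bnd: "(LINT x|lborel. ?g n x) \<le> M\<^sup>2" for n
    using power_mono[OF L(2)[of n] Lp_norm2_nonneg, of 2] by (simp add: Lp_norm2_sq)
  have mono: "?g i x \<le> ?g j x" if "i \<le> j" for i j x
    using that by (auto simp: cutoff_def indicator_def)
  have "incseq (\<lambda>n. LINT x|lborel. ?g n x)"
    by (intro incseq_SucI integral_mono int mono) auto
  then obtain L where L': "(\<lambda>n. LINT x|lborel. ?g n x) \<longlonglongrightarrow> L"
    using incseq_convergent[of "\<lambda>n. LINT x|lborel. ?g n x" "M\<^sup>2"] bnd by blast
  have "integrable lborel (\<lambda>x. (norm (u x))\<^sup>2)"
  proof (rule integrable_monotone_convergence[OF int _ _ L'])
    show "AE x in lborel. mono (\<lambda>n. ?g n x)" using mono by (auto simp: mono_def)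
    show "AE x in lborel. (\<lambda>n. ?g n x) \<longlonglongrightarrow> (norm (u x))\<^sup>2"
    proof (rule AE_I2, rule tendsto_eventually)
      fix x :: 'a
      obtain N :: nat where "norm x \<le> real N" using real_arch_simple by blast
      then show "\<forall>\<^sub>F n in sequentially. ?g n x = (norm (u x))\<^sup>2"
        by (intro eventually_sequentiallyI[of N]) (auto simp: cutoff_def indicator_def)
    qed
  qed simp
  then have u: "u \<in> Lp 2" by (simp add: Lp2_iff)
  have "Lp_norm 2 u \<le> M"
    by (rule LIMSEQ_le_const2[OF cutoff_norm_tendsto[OF u]]) (use L(2) in blast)
  with u show ?thesis by blast
qed

text \<open>With a product as majorant, Tonelli reduces to the two integrals in one variable, and
  each application only has to supply measurability of \<open>h\<close>.\<close>

lemma integrable_pair_bound: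
  fixes f :: "'a::euclidean_space \<Rightarrow> 'c::euclidean_space" and g :: "'b::euclidean_space \<Rightarrow> 'd::euclidean_space"
    and h :: "'a \<times> 'b \<Rightarrow> 'e::{banach, second_countable_topology}"
  assumes f: "integrable lborel f" and g: "integrable lborel g"
    and h: "h \<in> borel_measurable (lborel \<Otimes>\<^sub>M lborel)"
    and le: "\<And>x y. norm (h (x, y)) \<le> C * (norm (f x) * norm (g y))"
  shows "integrable (lborel \<Otimes>\<^sub>M lborel) h"
proof (rule lborel_pair.Fubini_integrable[OF h])
  have gx: "integrable lborel (\<lambda>y. h (x, y))" for x
  proof (rule Bochner_Integration.integrable_bound)
    show "integrable lborel (\<lambda>y. C * (norm (f x) * norm (g y)))" using g by simp
    show "(\<lambda>y. h (x, y)) \<in> borel_measurable lborel" using h by (rule measurable_Pair2) simp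
    show "AE y in lborel. norm (h (x, y)) \<le> norm (C * (norm (f x) * norm (g y)))"
      using order_trans[OF le abs_ge_self] by simp
  qed
  then show "AE x in lborel. integrable lborel (\<lambda>y. h (x, y))" by simp
  show "integrable lborel (\<lambda>x. LINT y|lborel. norm (h (x, y)))"
  proof (rule Bochner_Integration.integrable_bound)
    show "integrable lborel (\<lambda>x. norm (f x) * (C * (LINT y|lborel. norm (g y))))" using f by simp
    note [measurable] = h
    have "(\<lambda>(x, y). norm (h (x, y))) \<in> borel_measurable (lborel \<Otimes>\<^sub>M lborel)"
      by measurable
    from lborel.borel_measurable_lebesgue_integral[OF this]
    show "(\<lambda>x. LINT y|lborel. norm (h (x, y))) \<in> borel_measurable lborel" by simp
    have "(LINT y|lborel. norm (h (x, y))) \<le> (LINT y|lborel. C * (norm (f x) * norm (g y)))" for x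
      using gx g le by (intro integral_mono) auto
    then have le2: "(LINT y|lborel. norm (h (x, y))) \<le> norm (f x) * (C * (LINT y|lborel. norm (g y)))" for x
      by (simp add: mult_ac)
    then show "AE x in lborel. norm (LINT y|lborel. norm (h (x, y))) \<le> norm (norm (f x) * (C * (LINT y|lborel. norm (g y))))"
      using order_trans[OF le2 abs_ge_self] by (simp add: integral_nonneg_AE)
  qed
qed

text \<open>Lebesgue measure on \<open>'a\<close> is the image of the product of one-dimensional
  ones over \<open>Basis\<close>, and on a product measure the factors separate.\<close>

lemma lborel_integral_prod_Basis:
  fixes f :: "'a::euclidean_space \<Rightarrow> real \<Rightarrow> 'c::{real_normed_field,banach,second_countable_topology}"
  assumes int: "\<And>b. b \<in> Basis \<Longrightarrow> integrable lborel (f b)"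
  shows "integrable lborel (\<lambda>x::'a. \<Prod>b\<in>Basis. f b (x \<bullet> b))"
    and "(LINT x|(lborel::'a measure). (\<Prod>b\<in>Basis. f b (x \<bullet> b))) = (\<Prod>b\<in>Basis. LINT s|lborel. f b s)"
proof -
  interpret product_sigma_finite "\<lambda>_::'a. lborel :: real measure" ..
  let ?P = "Pi\<^sub>M Basis (\<lambda>_::'a. lborel :: real measure)"
  have T: "(\<lambda>s. \<Sum>b\<in>Basis. s b *\<^sub>R b) \<in> ?P \<rightarrow>\<^sub>M (borel :: 'a measure)" by measurable
  have f[measurable]: "f b \<in> borel_measurable borel" if "b \<in> Basis" for b
    using borel_measurable_integrable[OF int[OF that]] by simp
  have m: "(\<lambda>x::'a. \<Prod>b\<in>Basis. f b (x \<bullet> b)) \<in> borel_measurable borel" by measurable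
  have eq: "(\<Prod>b\<in>Basis. f b ((\<Sum>b\<in>Basis. s b *\<^sub>R b) \<bullet> b)) = (\<Prod>b\<in>Basis. f b (s b))" for s
    by (rule prod.cong) auto
  have "integrable ?P (\<lambda>s. \<Prod>b\<in>Basis. f b (s b))"
    by (rule product_integrable_prod) (auto simp: int)
  then show "integrable lborel (\<lambda>x::'a. \<Prod>b\<in>Basis. f b (x \<bullet> b))"
    by (subst lborel_eq) (simp add: integrable_distr_eq[OF T m] eq)
  have "(\<integral>s. (\<Prod>b\<in>Basis. f b (s b)) \<partial>?P) = (\<Prod>b\<in>Basis. LINT s|lborel. f b s)"
    by (rule product_integral_prod) (auto simp: int)
  then show "(LINT x|(lborel::'a measure). (\<Prod>b\<in>Basis. f b (x \<bullet> b))) = (\<Prod>b\<in>Basis. LINT s|lborel. f b s)"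
    by (subst lborel_eq) (simp add: integral_distr[OF T m] eq)
qed

section \<open>Gaussian integrals\<close>

definition gaussian :: "'a::euclidean_space \<Rightarrow> real" where
  "gaussian x = exp (- (norm x)\<^sup>2 / 2)"

lemma gaussian_measurable [measurable]: "gaussian \<in> borel_measurable borel"
  unfolding gaussian_def[abs_def] by measurable

lemma gaussian_nonneg: "0 \<le> gaussian x" and gaussian_le_1: "gaussian x \<le> 1"
  by (auto simp: gaussian_def)

text \<open>Up to the factor sqrt (2 pi) this is the characteristic function of the standard normal
  distribution.\<close>

lemma gaussian_1d:
  "integrable lborel (\<lambda>s. iexp (t * s) * complex_of_real (exp (- s\<^sup>2 / 2)))"
  "(LINT s|lborel. iexp (t * s) * complex_of_real (exp (- s\<^sup>2 / 2)))
    = complex_of_real (sqrt (2 * pi) * exp (- t\<^sup>2 / 2))"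
proof -
  interpret real_distribution std_normal_distribution by (rule real_dist_normal_dist)
  let ?d = std_normal_density
  have d: "sqrt (2 * pi) * ?d s = exp (- s\<^sup>2 / 2)" for s :: real
    by (simp add: std_normal_density_def)
  have "integrable std_normal_distribution (\<lambda>s. iexp (t * s))"
    by (rule integrable_const_bound[where B=1]) auto
  then have i: "integrable lborel (\<lambda>s. ?d s *\<^sub>R iexp (t * s))"
    by (subst (asm) integrable_density) auto
  have eq: "iexp (t * s) * complex_of_real (exp (- s\<^sup>2 / 2)) = sqrt (2 * pi) *\<^sub>R (?d s *\<^sub>R iexp (t * s))" for s
    unfolding d[symmetric] by (simp add: scaleR_conv_of_real)
  show "integrable lborel (\<lambda>s. iexp (t * s) * complex_of_real (exp (- s\<^sup>2 / 2)))"
    unfolding eq using i by (rule integrable_scaleR_right)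
  have "char std_normal_distribution t = (LINT s|lborel. ?d s *\<^sub>R iexp (t * s))"
    unfolding char_def by (subst integral_density) auto
  then have "(LINT s|lborel. ?d s *\<^sub>R iexp (t * s)) = complex_of_real (exp (- t\<^sup>2 / 2))"
    by (simp add: char_std_normal_distribution)
  then show "(LINT s|lborel. iexp (t * s) * complex_of_real (exp (- s\<^sup>2 / 2)))
    = complex_of_real (sqrt (2 * pi) * exp (- t\<^sup>2 / 2))"
    unfolding eq integral_scaleR_right by (simp add: scaleR_conv_of_real)
qed

text \<open>The complex exponential factors over the coordinates into one-dimensional integrals; the
  cosine is recovered as its real part.\<close>

lemma gaussian_cos:
  fixes z :: "'a::euclidean_space"
  shows "integrable lborel (\<lambda>x. cos (z \<bullet> x) * gaussian x)"
    and "(LINT x|lborel. cos (z \<bullet> x) * gaussian x) = sqrt (2 * pi) ^ DIM('a) * gaussian z"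
proof -
  define e where "e = (\<lambda>b s. iexp ((z \<bullet> b) * s) * complex_of_real (exp (- s\<^sup>2 / 2)))"
  have n2: "(\<Sum>b\<in>Basis. (x \<bullet> b)\<^sup>2) = (norm x)\<^sup>2" for x :: 'a
    by (subst power2_norm_eq_inner, subst euclidean_inner) (simp add: power2_eq_square)
  have p: "(\<Prod>b\<in>Basis. e b (x \<bullet> b)) = iexp (z \<bullet> x) * complex_of_real (gaussian x)" for x
  proof -
    have "(\<Prod>b\<in>Basis. e b (x \<bullet> b)) = (\<Prod>b\<in>Basis. iexp ((z \<bullet> b) * (x \<bullet> b))) *
       complex_of_real (\<Prod>b\<in>Basis. exp (- (x \<bullet> b)\<^sup>2 / 2))"
      by (simp add: e_def prod.distrib)
    also have "(\<Prod>b\<in>Basis. iexp ((z \<bullet> b) * (x \<bullet> b))) = iexp (z \<bullet> x)"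
      by (subst euclidean_inner[of z x]) (simp add: exp_sum[symmetric] sum_distrib_left)
    also have "(\<Prod>b\<in>Basis. exp (- (x \<bullet> b)\<^sup>2 / 2)) = gaussian x"
      unfolding gaussian_def n2[symmetric]
      by (simp add: exp_sum[symmetric] sum_negf sum_divide_distrib)
    finally show ?thesis .
  qed
  have ei: "integrable lborel (e b)" for b unfolding e_def by (rule gaussian_1d)
  from lborel_integral_prod_Basis[of e, OF ei]
  have I: "integrable lborel (\<lambda>x. iexp (z \<bullet> x) * complex_of_real (gaussian x))"
    and E: "(LINT x|lborel. iexp (z \<bullet> x) * complex_of_real (gaussian x)) = (\<Prod>b\<in>Basis. LINT s|lborel. e b s)"
    unfolding p by auto
  have Re: "Re (iexp (z \<bullet> x) * complex_of_real (gaussian x)) = cos (z \<bullet> x) * gaussian x" for x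
    by (simp add: Re_exp)
  show "integrable lborel (\<lambda>x. cos (z \<bullet> x) * gaussian x)"
    using integrable_Re[OF I] unfolding Re .
  have "(\<Prod>b\<in>Basis. LINT s|lborel. e b s) = complex_of_real (\<Prod>b\<in>Basis. sqrt (2 * pi) * exp (- (z \<bullet> b)\<^sup>2 / 2))"
    unfolding e_def gaussian_1d by simp
  also have "(\<Prod>b\<in>Basis. sqrt (2 * pi) * exp (- (z \<bullet> b)\<^sup>2 / 2)) = sqrt (2 * pi) ^ DIM('a) * gaussian z"
    unfolding gaussian_def n2[symmetric]
    by (simp add: prod.distrib exp_sum[symmetric] sum_negf sum_divide_distrib)
  finally show "(LINT x|lborel. cos (z \<bullet> x) * gaussian x) = sqrt (2 * pi) ^ DIM('a) * gaussian z"
    using E integral_Re[OF I] unfolding Re by simp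
qed

lemma gaussian_integrable: "integrable lborel gaussian"
  and gaussian_integral: "(LINT x|lborel. gaussian (x::'a::euclidean_space)) = sqrt (2 * pi) ^ DIM('a)"
proof -
  have "gaussian (0::'b::euclidean_space) = 1" by (simp add: gaussian_def)
  then show "integrable lborel (gaussian :: 'b::euclidean_space \<Rightarrow> real)"
    using gaussian_cos(1)[of "0::'b"] by simp
next
  have "gaussian (0::'a) = 1" by (simp add: gaussian_def)
  then show "(LINT x|lborel. gaussian (x::'a::euclidean_space)) = sqrt (2 * pi) ^ DIM('a)"
    using gaussian_cos(2)[of "0::'a"] by simp
qed

lemma gaussian_cos_scaled:
  fixes z :: "'a::euclidean_space"
  assumes "n > 0"
  shows "integrable lborel (\<lambda>x::'a. gaussian (inverse n *\<^sub>R x))"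
    and "(LINT x|lborel. gaussian (inverse n *\<^sub>R x) * cos (z \<bullet> x))
      = sqrt (2 * pi) ^ DIM('a) * n ^ DIM('a) * gaussian (n *\<^sub>R z)"
proof -
  show "integrable lborel (\<lambda>x::'a. gaussian (inverse n *\<^sub>R x))"
    using lborel_integrable_scaling[OF gaussian_integrable, of "inverse n" 0] assms by simp
  have "(LINT x|lborel. gaussian (inverse n *\<^sub>R x) * cos (z \<bullet> x))
    = \<bar>n\<bar> ^ DIM('a) *\<^sub>R (LINT x|lborel. gaussian (inverse n *\<^sub>R (0 + n *\<^sub>R x)) * cos (z \<bullet> (0 + n *\<^sub>R x)))"
    using assms by (intro lborel_integral_scaling) auto
  also have "(LINT x|lborel. gaussian (inverse n *\<^sub>R (0 + n *\<^sub>R x)) * cos (z \<bullet> (0 + n *\<^sub>R x)))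
     = (LINT x|lborel. cos ((n *\<^sub>R z) \<bullet> x) * gaussian x)"
    using assms by (simp add: mult.commute)
  finally show "(LINT x|lborel. gaussian (inverse n *\<^sub>R x) * cos (z \<bullet> x))
      = sqrt (2 * pi) ^ DIM('a) * n ^ DIM('a) * gaussian (n *\<^sub>R z)"
    unfolding gaussian_cos using assms by simp
qed

text \<open>Carries continuity of translation from L^1 to L^2 by means of the map a -> |a| a. This
  map is strongly monotone: its difference paired with a - b is at least (|a| + |b|) |a - b|^2 / 2,
  hence at least |a - b|^3 / 2, while Cauchy-Schwarz bounds the same pairing from above; one factor
  |a - b| cancels.\<close>

lemma norm_diff_sq_le: "(norm (a - b))\<^sup>2 \<le> 2 * norm (norm a *\<^sub>R a - norm b *\<^sub>R b)"
  for a b :: "'a::real_inner"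
proof (cases "a = b")
  case False
  define s t k where "s = norm a" "t = norm b" "k = a \<bullet> b"
  have st: "0 \<le> s" "0 \<le> t" by (auto simp: s_t_k_def)
  have d: "(norm (a - b))\<^sup>2 = s\<^sup>2 - 2 * k + t\<^sup>2"
    by (simp add: s_t_k_def power2_norm_eq_inner inner_simps inner_commute)
  have "norm (a - b) \<le> s + t" unfolding s_t_k_def by (rule norm_triangle_ineq4)
  then have "norm (a - b) * (norm (a - b))\<^sup>2 / 2 \<le> (s + t) * (norm (a - b))\<^sup>2 / 2"
    by (simp add: mult_right_mono)
  also have "\<dots> = (s + t) * (s\<^sup>2 - 2 * k + t\<^sup>2) / 2" by (simp add: d)
  also have "\<dots> \<le> s * s\<^sup>2 - (s + t) * k + t * t\<^sup>2"
  proof -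
    have "0 \<le> (s + t) * (s - t)\<^sup>2 / 2" using st by simp
    also have "\<dots> = s * s\<^sup>2 - (s + t) * k + t * t\<^sup>2 - (s + t) * (s\<^sup>2 - 2 * k + t\<^sup>2) / 2"
      by (simp add: power2_eq_square field_simps)
    finally show ?thesis by simp
  qed
  also have "\<dots> = (a - b) \<bullet> (s *\<^sub>R a - t *\<^sub>R b)"
    by (simp add: s_t_k_def power2_norm_eq_inner inner_simps inner_commute algebra_simps)
  also have "\<dots> \<le> norm (a - b) * norm (s *\<^sub>R a - t *\<^sub>R b)" by (rule norm_cauchy_schwarz)
  finally have "norm (a - b) * ((norm (a - b))\<^sup>2 / 2) \<le> norm (a - b) * norm (s *\<^sub>R a - t *\<^sub>R b)" by simp
  then show ?thesis using False by (simp add: s_t_k_def)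
qed simp

section \<open>Continuity of translation in L^2\<close>

lemma Lp2_translation:
  assumes "f \<in> Lp 2"
  shows "(\<lambda>x. f (z + x)) \<in> Lp 2" "Lp_norm 2 (\<lambda>x. f (z + x)) = Lp_norm 2 f"
proof -
  have m: "f \<in> borel_measurable borel" using assms by (simp add: Lp2_iff)
  have "(\<lambda>x. z + x) \<in> borel \<rightarrow>\<^sub>M borel" by simp
  from measurable_compose[OF this m] show "(\<lambda>x. f (z + x)) \<in> Lp 2"
    using lborel_integrable_translation[of "\<lambda>x. (norm (f x))\<^sup>2" z] assms by (simp add: Lp2_iff)
  show "Lp_norm 2 (\<lambda>x. f (z + x)) = Lp_norm 2 f"
    unfolding Lp_norm2 using lborel_integral_translation[of "\<lambda>x. (norm (f x))\<^sup>2" z] m by simp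
qed

lemma Lp2_translation_tendsto:
  fixes f :: "'a::euclidean_space \<Rightarrow> 'b::euclidean_space"
  assumes "f \<in> Lp 2" "z \<longlonglongrightarrow> 0"
  shows "(\<lambda>n. Lp_norm 2 (\<lambda>x. f (z n + x) - f x)) \<longlonglongrightarrow> 0"
proof -
  \<comment> \<open>Since |F| = |f|^2, \<open>F\<close> is integrable, and by
    \<open>norm_diff_sq_le\<close> its L^1 modulus of continuity controls the squared L^2 modulus of
    \<open>f\<close>.\<close>
  define F where "F x = norm (f x) *\<^sub>R f x" for x
  have m: "f \<in> borel_measurable borel" using assms by (simp add: Lp2_iff)
  have Fm: "F \<in> borel_measurable borel" unfolding F_def[abs_def] using m by simp
  have F: "integrable lborel F"
    by (rule Bochner_Integration.integrable_bound[of _ "\<lambda>x. (norm (f x))\<^sup>2"])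
      (use assms Fm in \<open>auto simp: Lp2_iff F_def power2_eq_square\<close>)
  have "(\<lambda>n. 2 * (LINT x|lborel. norm (F (z n + x) - F x))) \<longlonglongrightarrow> 2 * 0"
    by (intro tendsto_mult tendsto_const integral_translation_tendsto_zero F assms)
  then have lim: "(\<lambda>n. sqrt (2 * (LINT x|lborel. norm (F (z n + x) - F x)))) \<longlonglongrightarrow> 0"
    using tendsto_real_sqrt by fastforce
  show ?thesis
  proof (rule Lim_null_comparison[OF always_eventually lim], rule allI)
    fix n
    have d: "(\<lambda>x. f (z n + x) - f x) \<in> Lp 2"
      by (rule Lp2_diff[OF Lp2_translation(1) assms(1)]) (rule assms)
    have i: "integrable lborel (\<lambda>x. norm (F (z n + x) - F x))"
      using lborel_integrable_translation[OF F, of "z n"] F by simp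
    have "(LINT x|lborel. (norm (f (z n + x) - f x))\<^sup>2) \<le> (LINT x|lborel. 2 * norm (F (z n + x) - F x))"
      using d i by (intro integral_mono) (auto simp: Lp2_iff F_def norm_diff_sq_le)
    then show "norm (Lp_norm 2 (\<lambda>x. f (z n + x) - f x)) \<le> sqrt (2 * (LINT x|lborel. norm (F (z n + x) - F x)))"
      using Lp_norm2_nonneg[of "\<lambda>x. f (z n + x) - f x"] by (simp add: Lp_norm2)
  qed
qed

text \<open>Complex amplitudes are encoded as pairs (real part, imaginary part), so that
  \<open>ft f \<xi> = \<integral> e\<^sup>i\<^sup>x\<^sup>\<xi> f(x) dx\<close> and \<open>ift \<psi> x = Re \<integral> e\<^sup>-\<^sup>i\<^sup>x\<^sup>\<xi> \<psi>(\<xi>) d\<xi>\<close>.\<close>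

definition ft :: "('a::euclidean_space \<Rightarrow> 'b::euclidean_space) \<Rightarrow> 'a \<Rightarrow> 'b \<times> 'b" where
  "ft f \<xi> = (LINT x|lborel. cos (x \<bullet> \<xi>) *\<^sub>R f x, LINT x|lborel. sin (x \<bullet> \<xi>) *\<^sub>R f x)"

definition ift :: "('a::euclidean_space \<Rightarrow> 'b::euclidean_space \<times> 'b) \<Rightarrow> 'a \<Rightarrow> 'b" where
  "ift \<psi> x = (LINT \<xi>|lborel. cos (x \<bullet> \<xi>) *\<^sub>R fst (\<psi> \<xi>) + sin (x \<bullet> \<xi>) *\<^sub>R snd (\<psi> \<xi>))"

section \<open>Elementary properties of \<open>ft\<close> and \<open>ift\<close>\<close>

lemma integrable_trig:
  fixes f :: "'a::euclidean_space \<Rightarrow> 'b::euclidean_space"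
  assumes "integrable lborel f"
  shows "integrable lborel (\<lambda>x. cos (x \<bullet> \<xi>) *\<^sub>R f x)" "integrable lborel (\<lambda>x. sin (x \<bullet> \<xi>) *\<^sub>R f x)"
proof -
  have m: "f \<in> borel_measurable borel" using assms by auto
  show "integrable lborel (\<lambda>x. cos (x \<bullet> \<xi>) *\<^sub>R f x)"
    by (rule Bochner_Integration.integrable_bound[OF assms])
      (use m in \<open>auto simp: mult_left_le_one_le\<close>)
  show "integrable lborel (\<lambda>x. sin (x \<bullet> \<xi>) *\<^sub>R f x)"
    by (rule Bochner_Integration.integrable_bound[OF assms])
      (use m in \<open>auto simp: mult_left_le_one_le\<close>)
qed

lemma ft_measurable [measurable]:
  assumes [measurable]: "f \<in> borel_measurable borel"
  shows "ft f \<in> borel_measurable borel"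
proof -
  have "(\<lambda>\<xi>. LINT x|lborel. cos (x \<bullet> \<xi>) *\<^sub>R f x) \<in> borel_measurable borel"
    by (rule lborel.borel_measurable_lebesgue_integral) measurable
  moreover have "(\<lambda>\<xi>. LINT x|lborel. sin (x \<bullet> \<xi>) *\<^sub>R f x) \<in> borel_measurable borel"
    by (rule lborel.borel_measurable_lebesgue_integral) measurable
  ultimately show ?thesis unfolding ft_def by (rule borel_measurable_Pair)
qed

lemma ift_kernel_measurable:
  fixes \<psi> :: "'a::euclidean_space \<Rightarrow> 'b::euclidean_space \<times> 'b"
  assumes "\<psi> \<in> borel_measurable borel"
  shows "(\<lambda>(x::'a, \<xi>). cos (x \<bullet> \<xi>) *\<^sub>R fst (\<psi> \<xi>) + sin (x \<bullet> \<xi>) *\<^sub>R snd (\<psi> \<xi>)) \<in> borel_measurable (borel \<Otimes>\<^sub>M borel)"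
proof -
  define p q where "p \<xi> = fst (\<psi> \<xi>)" and "q \<xi> = snd (\<psi> \<xi>)" for \<xi>
  have \<psi>': "\<psi> \<in> borel \<rightarrow>\<^sub>M borel \<Otimes>\<^sub>M borel" using assms by (simp add: borel_prod)
  have [measurable]: "p \<in> borel_measurable borel" "q \<in> borel_measurable borel"
    unfolding p_def[abs_def] q_def[abs_def]
    using measurable_compose[OF \<psi>' measurable_fst] measurable_compose[OF \<psi>' measurable_snd] by auto
  show ?thesis unfolding p_def[symmetric] q_def[symmetric] by measurable
qed

lemma ift_measurable [measurable]:
  fixes \<psi> :: "'a::euclidean_space \<Rightarrow> 'b::euclidean_space \<times> 'b"
  assumes "\<psi> \<in> borel_measurable borel"
  shows "ift \<psi> \<in> borel_measurable borel"
proof -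
  have k: "(\<lambda>(x::'a, \<xi>). cos (x \<bullet> \<xi>) *\<^sub>R fst (\<psi> \<xi>) + sin (x \<bullet> \<xi>) *\<^sub>R snd (\<psi> \<xi>)) \<in> borel_measurable (borel \<Otimes>\<^sub>M lborel)"
    using ift_kernel_measurable[OF assms] by (simp cong: measurable_cong_sets sets_pair_measure_cong)
  have "(\<lambda>x. LINT \<xi>|lborel. cos (x \<bullet> \<xi>) *\<^sub>R fst (\<psi> \<xi>) + sin (x \<bullet> \<xi>) *\<^sub>R snd (\<psi> \<xi>)) \<in> borel_measurable borel"
    by (rule lborel.borel_measurable_lebesgue_integral[OF k])
  then show ?thesis by (simp add: ift_def[abs_def])
qed

lemma integrable_fst_snd:
  assumes "integrable lborel \<psi>"
  shows "integrable lborel (\<lambda>\<xi>. fst (\<psi> \<xi>))" "integrable lborel (\<lambda>\<xi>. snd (\<psi> \<xi>))"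
  using integrable_bounded_linear[OF bounded_linear_fst assms]
    integrable_bounded_linear[OF bounded_linear_snd assms] by auto

text \<open>The vector on the left is one component of the pair rotated by the angle s; the other
  component, sin s a - cos s b, completes the norm.\<close>

lemma norm_ift_integrand_le: "norm (cos s *\<^sub>R a + sin s *\<^sub>R b) \<le> norm (a, b)"
  for a b :: "'b::real_inner"
proof -
  have "(norm (C *\<^sub>R a + S *\<^sub>R b))\<^sup>2 + (norm (S *\<^sub>R a - C *\<^sub>R b))\<^sup>2
      = (S\<^sup>2 + C\<^sup>2) * ((norm a)\<^sup>2 + (norm b)\<^sup>2)" for C S :: real
    unfolding power2_norm_eq_inner by (simp add: inner_simps inner_commute power2_eq_square algebra_simps)
  from this[of "cos s" "sin s"]
  have "(norm (cos s *\<^sub>R a + sin s *\<^sub>R b))\<^sup>2 + (norm (sin s *\<^sub>R a - cos s *\<^sub>R b))\<^sup>2 = (norm (a, b))\<^sup>2"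
    by (simp add: norm_Pair)
  then have "(norm (cos s *\<^sub>R a + sin s *\<^sub>R b))\<^sup>2 \<le> (norm (a, b))\<^sup>2"
    using zero_le_power2[of "norm (sin s *\<^sub>R a - cos s *\<^sub>R b)"] by linarith
  then show ?thesis by (rule power2_le_imp_le) simp
qed

lemma ift_integrable:
  fixes \<psi> :: "'a::euclidean_space \<Rightarrow> 'b::euclidean_space \<times> 'b"
  assumes "integrable lborel \<psi>"
  shows "integrable lborel (\<lambda>\<xi>. cos (x \<bullet> \<xi>) *\<^sub>R fst (\<psi> \<xi>) + sin (x \<bullet> \<xi>) *\<^sub>R snd (\<psi> \<xi>))"
  using integrable_trig[OF integrable_fst_snd(1)[OF assms], of x] integrable_trig[OF integrable_fst_snd(2)[OF assms], of x]
  by (auto simp: inner_commute)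

lemma norm_ift_le:
  assumes "integrable lborel \<psi>"
  shows "norm (ift \<psi> x) \<le> (LINT \<xi>|lborel. norm (\<psi> \<xi>))"
  unfolding ift_def
proof (rule order_trans[OF integral_norm_bound], rule integral_mono)
  show "norm (cos (x \<bullet> \<xi>) *\<^sub>R fst (\<psi> \<xi>) + sin (x \<bullet> \<xi>) *\<^sub>R snd (\<psi> \<xi>)) \<le> norm (\<psi> \<xi>)" for \<xi>
    using norm_ift_integrand_le[of "x \<bullet> \<xi>" "fst (\<psi> \<xi>)" "snd (\<psi> \<xi>)"] by simp
qed (use assms ift_integrable[OF assms] in auto)

lemma ift_add:
  assumes "integrable lborel \<psi>" "integrable lborel \<eta>"
  shows "ift (\<lambda>\<xi>. \<psi> \<xi> + \<eta> \<xi>) x = ift \<psi> x + ift \<eta> x"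
  unfolding ift_def
  using ift_integrable[OF assms(1), of x] ift_integrable[OF assms(2), of x]
  by (subst Bochner_Integration.integral_add[symmetric]) (auto simp: scaleR_add_right algebra_simps)

lemma ift_scaleR: "ift (\<lambda>\<xi>. a *\<^sub>R \<psi> \<xi>) x = a *\<^sub>R ift \<psi> x"
  unfolding ift_def
  by (subst integral_scaleR_right[symmetric]) (simp add: algebra_simps)

lemma ft_add:
  assumes "integrable lborel f" "integrable lborel g"
  shows "ft (\<lambda>x. f x + g x) \<xi> = ft f \<xi> + ft g \<xi>"
  unfolding ft_def using integrable_trig[OF assms(1), of \<xi>] integrable_trig[OF assms(2), of \<xi>]
  by (simp add: scaleR_add_right)

lemma ft_scaleR: "ft (\<lambda>x. a *\<^sub>R f x) \<xi> = a *\<^sub>R ft f \<xi>"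
  unfolding ft_def scaleR_left_commute[of _ a] integral_scaleR_right by simp

text \<open>Fubini for the cosine and sine kernels. The opposite signs in the exponents of
  \<open>ft\<close> and \<open>ift\<close>, together with the real part, make the two maps adjoint
  for the real inner products; this is the bridge between x and \<xi>.\<close>

lemma ft_ift_adjoint:
  fixes f :: "'a::euclidean_space \<Rightarrow> 'b::euclidean_space"
  assumes f: "integrable lborel f" and p: "integrable lborel \<psi>"
  shows "(LINT x|lborel. f x \<bullet> ift \<psi> x) = (LINT \<xi>|lborel. ft f \<xi> \<bullet> \<psi> \<xi>)"
proof -
  have [measurable]: "f \<in> borel_measurable borel" "\<psi> \<in> borel_measurable borel"
    using f p by auto
  let ?h = "\<lambda>x \<xi>. f x \<bullet> (cos (x \<bullet> \<xi>) *\<^sub>R fst (\<psi> \<xi>) + sin (x \<bullet> \<xi>) *\<^sub>R snd (\<psi> \<xi>))"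
  have I: "integrable (lborel \<Otimes>\<^sub>M lborel) (case_prod ?h)"
  proof (rule integrable_pair_bound[OF f p, where C=1])
    have "(\<lambda>(x, \<xi>). f x \<bullet> (case (x, \<xi>) of (x, \<xi>) \<Rightarrow> cos (x \<bullet> \<xi>) *\<^sub>R fst (\<psi> \<xi>) + sin (x \<bullet> \<xi>) *\<^sub>R snd (\<psi> \<xi>))) \<in> borel_measurable (borel \<Otimes>\<^sub>M borel)"
      using ift_kernel_measurable[of \<psi>] by measurable
    then show "case_prod ?h \<in> borel_measurable (lborel \<Otimes>\<^sub>M lborel)"
      by (simp cong: measurable_cong_sets sets_pair_measure_cong)
    show "norm (case (x, \<xi>) of (x, \<xi>) \<Rightarrow> ?h x \<xi>) \<le> 1 * (norm (f x) * norm (\<psi> \<xi>))" for x \<xi>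
      using norm_ift_integrand_le[of "x \<bullet> \<xi>" "fst (\<psi> \<xi>)" "snd (\<psi> \<xi>)"]
        order_trans[OF Cauchy_Schwarz_ineq2[of "f x" "cos (x \<bullet> \<xi>) *\<^sub>R fst (\<psi> \<xi>) + sin (x \<bullet> \<xi>) *\<^sub>R snd (\<psi> \<xi>)"]
          mult_left_mono[OF _ norm_ge_zero]]
      by simp
  qed
  have "(LINT x|lborel. f x \<bullet> ift \<psi> x) = (LINT x|lborel. LINT \<xi>|lborel. ?h x \<xi>)"
    unfolding ift_def by (intro Bochner_Integration.integral_cong refl integral_inner_right[symmetric] impI ift_integrable p)
  also have "\<dots> = (LINT \<xi>|lborel. LINT x|lborel. ?h x \<xi>)"
    by (rule lborel_pair.Fubini_integral[OF I, symmetric])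
  also have "\<dots> = (LINT \<xi>|lborel. ft f \<xi> \<bullet> \<psi> \<xi>)"
  proof (rule Bochner_Integration.integral_cong[OF refl])
    fix \<xi>
    note i = integrable_trig[OF f, of \<xi>]
    have "ft f \<xi> \<bullet> \<psi> \<xi> = (LINT x|lborel. cos (x \<bullet> \<xi>) *\<^sub>R f x) \<bullet> fst (\<psi> \<xi>) + (LINT x|lborel. sin (x \<bullet> \<xi>) *\<^sub>R f x) \<bullet> snd (\<psi> \<xi>)"
      by (simp add: ft_def inner_prod_def)
    also have "\<dots> = (LINT x|lborel. (cos (x \<bullet> \<xi>) *\<^sub>R f x) \<bullet> fst (\<psi> \<xi>)) + (LINT x|lborel. (sin (x \<bullet> \<xi>) *\<^sub>R f x) \<bullet> snd (\<psi> \<xi>))"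
      using i by (simp only: integral_inner_left)
    also have "\<dots> = (LINT x|lborel. (cos (x \<bullet> \<xi>) *\<^sub>R f x) \<bullet> fst (\<psi> \<xi>) + (sin (x \<bullet> \<xi>) *\<^sub>R f x) \<bullet> snd (\<psi> \<xi>))"
      using i by (intro Bochner_Integration.integral_add[symmetric] integrable_inner_left) auto
    also have "\<dots> = (LINT x|lborel. ?h x \<xi>)" by (simp add: inner_add_right)
    finally show "(LINT x|lborel. ?h x \<xi>) = ft f \<xi> \<bullet> \<psi> \<xi>" ..
  qed
  finally show ?thesis .
qed


section \<open>The Plancherel identity and inversion in L^2\<close>

lemma norm_ft_sq:
  fixes f :: "'a::euclidean_space \<Rightarrow> 'b::euclidean_space"
  assumes f: "integrable lborel f"
  shows "(norm (ft f \<xi>))\<^sup>2 = (LINT x|lborel. LINT y|lborel. cos ((x - y) \<bullet> \<xi>) * (f x \<bullet> f y))"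
proof -
  note i = integrable_trig[OF f, of \<xi>]
  define P Q where "P = (LINT x|lborel. cos (x \<bullet> \<xi>) *\<^sub>R f x)" and "Q = (LINT x|lborel. sin (x \<bullet> \<xi>) *\<^sub>R f x)"
  have "(norm (ft f \<xi>))\<^sup>2 = P \<bullet> P + Q \<bullet> Q"
    by (simp add: power2_norm_eq_inner ft_def P_def Q_def inner_prod_def)
  also have "\<dots> = (LINT x|lborel. (cos (x \<bullet> \<xi>) *\<^sub>R f x) \<bullet> P) + (LINT x|lborel. (sin (x \<bullet> \<xi>) *\<^sub>R f x) \<bullet> Q)"
    using i by (simp only: integral_inner_left P_def[symmetric] Q_def[symmetric])
  also have "\<dots> = (LINT x|lborel. (cos (x \<bullet> \<xi>) *\<^sub>R f x) \<bullet> P + (sin (x \<bullet> \<xi>) *\<^sub>R f x) \<bullet> Q)"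
    using i by (intro Bochner_Integration.integral_add[symmetric] integrable_inner_left) auto
  also have "\<dots> = (LINT x|lborel. LINT y|lborel. cos ((x - y) \<bullet> \<xi>) * (f x \<bullet> f y))"
  proof (rule Bochner_Integration.integral_cong[OF refl])
    fix x
    have "(cos (x \<bullet> \<xi>) *\<^sub>R f x) \<bullet> P + (sin (x \<bullet> \<xi>) *\<^sub>R f x) \<bullet> Q
       = (LINT y|lborel. (cos (x \<bullet> \<xi>) *\<^sub>R f x) \<bullet> (cos (y \<bullet> \<xi>) *\<^sub>R f y)) + (LINT y|lborel. (sin (x \<bullet> \<xi>) *\<^sub>R f x) \<bullet> (sin (y \<bullet> \<xi>) *\<^sub>R f y))"
      using i by (simp only: integral_inner_right P_def Q_def)
    also have "\<dots> = (LINT y|lborel. (cos (x \<bullet> \<xi>) *\<^sub>R f x) \<bullet> (cos (y \<bullet> \<xi>) *\<^sub>R f y) + (sin (x \<bullet> \<xi>) *\<^sub>R f x) \<bullet> (sin (y \<bullet> \<xi>) *\<^sub>R f y))"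
      using i by (intro Bochner_Integration.integral_add[symmetric] integrable_inner_right) auto
    also have "\<dots> = (LINT y|lborel. cos ((x - y) \<bullet> \<xi>) * (f x \<bullet> f y))"
      by (intro Bochner_Integration.integral_cong refl) (simp add: inner_diff_left cos_diff algebra_simps)
    finally show "(cos (x \<bullet> \<xi>) *\<^sub>R f x) \<bullet> P + (sin (x \<bullet> \<xi>) *\<^sub>R f x) \<bullet> Q
      = (LINT y|lborel. cos ((x - y) \<bullet> \<xi>) * (f x \<bullet> f y))" .
  qed
  finally show ?thesis .
qed

text \<open>A Gaussian weight of width n makes the frequency integral absolutely convergent.
  Integrating in \<xi> first leaves a Gaussian of width 1/n in x - y, so the result is an average of
  correlations of f with its translates by z/n.\<close>

lemma gaussian_norm_ft_sq:
  fixes f :: "'a::euclidean_space \<Rightarrow> 'b::euclidean_space"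
  assumes f: "f \<in> Lp 1" "f \<in> Lp 2" and "n > 0"
  shows "integrable lborel (\<lambda>\<xi>. gaussian (inverse n *\<^sub>R \<xi>) * (norm (ft f \<xi>))\<^sup>2)"
    and "(LINT \<xi>|lborel. gaussian (inverse n *\<^sub>R \<xi>) * (norm (ft f \<xi>))\<^sup>2) =
      sqrt (2 * pi) ^ DIM('a) * (LINT z|lborel. gaussian z * (LINT y|lborel. f (inverse n *\<^sub>R z + y) \<bullet> f y))"
proof -
  have fi: "integrable lborel f" using f(1) by (simp add: Lp1_iff)
  then have [measurable]: "f \<in> borel_measurable borel" by auto
  let ?\<kappa> = "sqrt (2 * pi) ^ DIM('a)"
  define u where "u p = f (fst p) \<bullet> f (snd p)" for p
  have "(\<lambda>p. f (fst p) \<bullet> f (snd p)) \<in> borel_measurable (borel \<Otimes>\<^sub>M borel)"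
    by measurable
  then have um'[measurable]: "u \<in> borel_measurable (borel \<Otimes>\<^sub>M borel)" by (simp add: u_def[abs_def])
  then have um[measurable]: "u \<in> borel_measurable borel"
    by (simp add: u_def[abs_def] borel_prod)
  have "integrable (lborel \<Otimes>\<^sub>M lborel) u"
  proof (rule integrable_pair_bound[OF fi fi, where C=1])
    show "u \<in> borel_measurable (lborel \<Otimes>\<^sub>M lborel)" using um by (simp add: lborel_prod)
  qed (simp add: u_def Cauchy_Schwarz_ineq2)
  then have ui: "integrable (lborel :: ('a \<times> 'a) measure) u" by (simp add: lborel_prod)
  have pairI: "integrable (lborel :: ('a \<times> 'a) measure) h"
    if "h \<in> borel_measurable (borel \<Otimes>\<^sub>M borel)" "\<And>p. norm (h p) \<le> C * norm (u p)" for h :: "'a \<times> 'a \<Rightarrow> real" and C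
  proof (rule Bochner_Integration.integrable_bound)
    show "integrable lborel (\<lambda>p. C * norm (u p))" using ui by simp
    show "AE p in lborel. norm (h p) \<le> norm (C * norm (u p))"
      using order_trans[OF that(2) abs_ge_self] by simp
  qed (use that(1) in \<open>simp add: borel_prod\<close>)
  have iter: "(LINT x|lborel. LINT y|lborel. h (x, y)) = integral\<^sup>L lborel h"
    "(LINT y|lborel. LINT x|lborel. h (x, y)) = integral\<^sup>L lborel h"
    if "integrable (lborel :: ('a \<times> 'a) measure) h" for h :: "'a \<times> 'a \<Rightarrow> real"
  proof -
    have "integrable (lborel \<Otimes>\<^sub>M lborel) (case_prod (curry h))" using that by (simp add: lborel_prod)
    from lborel_pair.integral_fst[OF this] lborel_pair.integral_snd[OF this]
    show "(LINT x|lborel. LINT y|lborel. h (x, y)) = integral\<^sup>L lborel h"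
      "(LINT y|lborel. LINT x|lborel. h (x, y)) = integral\<^sup>L lborel h" by (simp_all add: lborel_prod)
  qed
  have F: "(norm (ft f \<xi>))\<^sup>2 = (LINT p|lborel. cos ((fst p - snd p) \<bullet> \<xi>) * u p)" for \<xi>
  proof -
    have "integrable lborel (\<lambda>p. cos ((fst p - snd p) \<bullet> \<xi>) * u p)"
      by (rule pairI[where C=1]) (auto simp: abs_mult mult_left_le_one_le)
    from iter(1)[OF this] show ?thesis by (simp add: norm_ft_sq[OF fi] u_def)
  qed
  let ?g = "\<lambda>\<xi>::'a. gaussian (inverse n *\<^sub>R \<xi>)"
  have gi: "integrable lborel ?g" by (rule gaussian_cos_scaled(1)[OF \<open>n > 0\<close>])
  have [measurable]: "?g \<in> borel_measurable borel" using borel_measurable_integrable[OF gi] by simp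
  let ?H = "\<lambda>\<xi> p. ?g \<xi> * (cos ((fst p - snd p) \<bullet> \<xi>) * u p)"
  have I: "integrable (lborel \<Otimes>\<^sub>M lborel) (case_prod ?H)"
  proof (rule integrable_pair_bound[OF gi ui, where C=1])
    have "case_prod ?H \<in> borel_measurable (borel \<Otimes>\<^sub>M (borel \<Otimes>\<^sub>M borel))" by measurable
    then have "case_prod ?H \<in> borel_measurable borel" by (simp add: borel_prod)
    then show "case_prod ?H \<in> borel_measurable (lborel \<Otimes>\<^sub>M lborel)" by (simp add: lborel_prod)
    show "norm (case (\<xi>, p) of (\<xi>, p) \<Rightarrow> ?H \<xi> p) \<le> 1 * (norm (?g \<xi>) * norm (u p))" for \<xi> p
      by (auto simp: abs_mult intro!: mult_left_mono mult_left_le_one_le)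
  qed
  have gF: "?g \<xi> * (norm (ft f \<xi>))\<^sup>2 = (LINT p|lborel. ?H \<xi> p)" for \<xi> unfolding F by simp
  show "integrable lborel (\<lambda>\<xi>. ?g \<xi> * (norm (ft f \<xi>))\<^sup>2)"
    unfolding gF using lborel_pair.integrable_fst[OF I] by simp
  have "(LINT \<xi>|lborel. ?g \<xi> * (norm (ft f \<xi>))\<^sup>2) = (LINT p|lborel. LINT \<xi>|lborel. ?H \<xi> p)"
    unfolding gF by (rule lborel_pair.Fubini_integral[OF I, symmetric])
  also have "\<dots> = (LINT p|lborel. u p * (?\<kappa> * n ^ DIM('a) * gaussian (n *\<^sub>R (fst p - snd p))))"
  proof (rule Bochner_Integration.integral_cong[OF refl])
    fix p :: "'a \<times> 'a"
    have "(LINT \<xi>|lborel. ?H \<xi> p) = (LINT \<xi>|lborel. u p * (?g \<xi> * cos ((fst p - snd p) \<bullet> \<xi>)))"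
      by (intro Bochner_Integration.integral_cong refl) (simp add: mult_ac)
    then show "(LINT \<xi>|lborel. ?H \<xi> p) = u p * (?\<kappa> * n ^ DIM('a) * gaussian (n *\<^sub>R (fst p - snd p)))"
      using gaussian_cos_scaled(2)[OF \<open>n > 0\<close>, of "fst p - snd p"] by simp
  qed
  also have "\<dots> = (LINT y|lborel. LINT x|lborel. u (x, y) * (?\<kappa> * n ^ DIM('a) * gaussian (n *\<^sub>R (x - y))))"
  proof -
    have "integrable lborel (\<lambda>p. u p * (?\<kappa> * n ^ DIM('a) * gaussian (n *\<^sub>R (fst p - snd p))))"
    proof (rule pairI[where C="?\<kappa> * n ^ DIM('a)"])
      show "norm (u p * (?\<kappa> * n ^ DIM('a) * gaussian (n *\<^sub>R (fst p - snd p)))) \<le> ?\<kappa> * n ^ DIM('a) * norm (u p)" for p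
        using \<open>n > 0\<close> gaussian_le_1[of "n *\<^sub>R (fst p - snd p)"] gaussian_nonneg[of "n *\<^sub>R (fst p - snd p)"]
        by (simp add: abs_mult mult_ac mult_left_le mult_left_mono)
    qed measurable
    from iter(2)[OF this] show ?thesis by simp
  qed
  \<comment> \<open>The substitution x = y + z/n replaces the narrow Gaussian by a fixed one, and
    its Jacobian cancels the power of n.\<close>
  also have "\<dots> = (LINT y|lborel. LINT z|lborel. ?\<kappa> * (gaussian z * (f (inverse n *\<^sub>R z + y) \<bullet> f y)))"
  proof (rule Bochner_Integration.integral_cong[OF refl])
    fix y
    let ?h = "\<lambda>x. u (x, y) * (?\<kappa> * n ^ DIM('a) * gaussian (n *\<^sub>R (x - y)))"
    have "integral\<^sup>L lborel ?h = \<bar>inverse n\<bar> ^ DIM('a) *\<^sub>R (LINT z|lborel. ?h (y + inverse n *\<^sub>R z))"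
    proof (rule lborel_integral_scaling)
      have "(\<lambda>x. (f x \<bullet> f y) * (?\<kappa> * n ^ DIM('a) * gaussian (n *\<^sub>R (x - y)))) \<in> borel_measurable borel"
        by measurable
      then show "?h \<in> borel_measurable borel" by (simp add: u_def)
    qed (use \<open>n > 0\<close> in simp)
    also have "\<dots> = (LINT z|lborel. \<bar>inverse n\<bar> ^ DIM('a) *\<^sub>R ?h (y + inverse n *\<^sub>R z))" by simp
    also have "\<dots> = (LINT z|lborel. ?\<kappa> * (gaussian z * (f (inverse n *\<^sub>R z + y) \<bullet> f y)))"
      using \<open>n > 0\<close> by (intro Bochner_Integration.integral_cong refl)
        (simp add: u_def power_inverse add.commute field_simps)
    finally show "integral\<^sup>L lborel ?h = (LINT z|lborel. ?\<kappa> * (gaussian z * (f (inverse n *\<^sub>R z + y) \<bullet> f y)))" .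
  qed
  also have "\<dots> = (LINT z|lborel. LINT y|lborel. ?\<kappa> * (gaussian z * (f (inverse n *\<^sub>R z + y) \<bullet> f y)))"
  proof (rule lborel_pair.Fubini_integral)
    let ?k = "\<lambda>z y. ?\<kappa> * (gaussian z * (f (inverse n *\<^sub>R z + y) \<bullet> f y))"
    have fz: "(\<lambda>x. f (z + x)) \<in> Lp 2" for z by (rule Lp2_translation(1)[OF f(2)])
    have prod: "integrable lborel (\<lambda>y. norm (f (z + y)) * norm (f y))" for z
      using Lp2_inner[of "\<lambda>y. norm (f (z + y))" "\<lambda>y. norm (f y)"] fz[of z] f(2) by (simp add: Lp2_iff)
    \<comment> \<open>Cauchy-Schwarz and translation invariance bound the correlation uniformly in
      z, so integrability in z rests on the Gaussian alone.\<close>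
    have prodle: "(LINT y|lborel. norm (f (z + y)) * norm (f y)) \<le> (Lp_norm 2 f)\<^sup>2" for z
    proof -
      have "(LINT y|lborel. norm (f (z + y)) * norm (f y)) \<le> Lp_norm 2 (\<lambda>y. norm (f (z + y))) * Lp_norm 2 (\<lambda>y. norm (f y))"
        using Lp2_Cauchy_Schwarz[of "\<lambda>y. norm (f (z + y))" "\<lambda>y. norm (f y)"] fz[of z] f(2)
        by (simp add: Lp2_iff)
      also have "Lp_norm 2 (\<lambda>y. norm (f (z + y))) = Lp_norm 2 f"
        using Lp2_translation(2)[OF f(2), of z] by (simp add: Lp_norm2)
      also have "Lp_norm 2 (\<lambda>y. norm (f y)) = Lp_norm 2 f" by (simp add: Lp_norm2)
      finally show ?thesis by (simp add: power2_eq_square)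
    qed
    have km: "case_prod ?k \<in> borel_measurable (lborel \<Otimes>\<^sub>M lborel)" by measurable
    have ki: "integrable lborel (\<lambda>y. ?k z y)" for z
      using Lp2_inner[OF fz[of "inverse n *\<^sub>R z"] f(2)] by simp
    have kle: "(LINT y|lborel. norm (?k z y)) \<le> ?\<kappa> * (Lp_norm 2 f)\<^sup>2 * gaussian z" for z
    proof -
      have "(LINT y|lborel. norm (?k z y)) \<le> (LINT y|lborel. ?\<kappa> * gaussian z * (norm (f (inverse n *\<^sub>R z + y)) * norm (f y)))"
        using ki[of z] prod[of "inverse n *\<^sub>R z"] gaussian_nonneg[of z]
        by (intro integral_mono integrable_norm)
          (auto simp: abs_mult mult.assoc intro!: mult_left_mono Cauchy_Schwarz_ineq2)
      also have "\<dots> \<le> ?\<kappa> * gaussian z * (Lp_norm 2 f)\<^sup>2"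
        using prodle[of "inverse n *\<^sub>R z"] gaussian_nonneg[of z] by (simp add: mult_left_mono)
      finally show ?thesis by (simp add: mult_ac)
    qed
    have "integrable (lborel \<Otimes>\<^sub>M lborel) (case_prod ?k)"
    proof (rule lborel_pair.Fubini_integrable[OF km])
      show "AE z in lborel. integrable lborel (\<lambda>y. (case (z, y) of (z, y) \<Rightarrow> ?k z y))" using ki by simp
      show "integrable lborel (\<lambda>z. LINT y|lborel. norm (case (z, y) of (z, y) \<Rightarrow> ?k z y))"
      proof (rule Bochner_Integration.integrable_bound)
        show "integrable lborel (\<lambda>z::'a. ?\<kappa> * (Lp_norm 2 f)\<^sup>2 * gaussian z)" by (simp add: gaussian_integrable)
        have "(\<lambda>(z, y). norm (?k z y)) \<in> borel_measurable (lborel \<Otimes>\<^sub>M lborel)" by measurable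
        from lborel.borel_measurable_lebesgue_integral[OF this]
        show "(\<lambda>z. LINT y|lborel. norm (case (z, y) of (z, y) \<Rightarrow> ?k z y)) \<in> borel_measurable lborel" by simp
        show "AE z in lborel. norm (LINT y|lborel. norm (case (z, y) of (z, y) \<Rightarrow> ?k z y))
          \<le> norm (?\<kappa> * (Lp_norm 2 f)\<^sup>2 * gaussian z)"
        proof (rule AE_I2)
          fix z
          show "norm (LINT y|lborel. norm (case (z, y) of (z, y) \<Rightarrow> ?k z y)) \<le> norm (?\<kappa> * (Lp_norm 2 f)\<^sup>2 * gaussian z)"
            using order_trans[OF kle[of z] abs_ge_self] by (simp only: prod.case real_norm_def abs_of_nonneg[OF integral_nonneg_AE[OF AE_I2[OF abs_ge_zero]]])
        qed
      qed
    qed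
    then show "integrable (lborel \<Otimes>\<^sub>M lborel) (\<lambda>(z, y). ?k z y)" .
  qed
  also have "\<dots> = ?\<kappa> * (LINT z|lborel. gaussian z * (LINT y|lborel. f (inverse n *\<^sub>R z + y) \<bullet> f y))"
    by simp
  finally show "(LINT \<xi>|lborel. ?g \<xi> * (norm (ft f \<xi>))\<^sup>2) =
      ?\<kappa> * (LINT z|lborel. gaussian z * (LINT y|lborel. f (inverse n *\<^sub>R z + y) \<bullet> f y))" .
qed

text \<open>As n grows the weight increases to 1 and the left side of
  \<open>gaussian_norm_ft_sq\<close> converges monotonically; on the right the correlations tend to
  |f|^2 by continuity of translation. The factor sqrt (2 pi) per dimension occurs twice, in the
  transform of the Gaussian and in its integral.\<close>

theorem plancherel:
  fixes f :: "'a::euclidean_space \<Rightarrow> 'b::euclidean_space"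
  assumes f: "f \<in> Lp 1" "f \<in> Lp 2"
  shows "ft f \<in> Lp 2" and "(Lp_norm 2 (ft f))\<^sup>2 = (2 * pi) ^ DIM('a) * (Lp_norm 2 f)\<^sup>2"
proof -
  let ?\<kappa> = "sqrt (2 * pi) ^ DIM('a)"
  have m[measurable]: "f \<in> borel_measurable borel" using f(2) by (simp add: Lp2_iff)
  let ?g = "\<lambda>n (\<xi>::'a). gaussian (inverse (real (Suc n)) *\<^sub>R \<xi>) * (norm (ft f \<xi>))\<^sup>2"
  let ?W = "\<lambda>n z. LINT y|lborel. f (inverse (real (Suc n)) *\<^sub>R z + y) \<bullet> f y"
  have invlim: "(\<lambda>n. inverse (real (Suc n)) *\<^sub>R z) \<longlonglongrightarrow> 0" for z :: 'a
    using tendsto_scaleR[OF LIMSEQ_inverse_real_of_nat tendsto_const[of z]] by simp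
  have fz: "(\<lambda>x. f (z + x)) \<in> Lp 2" for z by (rule Lp2_translation(1)[OF f(2)])
  have Wlim: "(\<lambda>n. ?W n z) \<longlonglongrightarrow> (Lp_norm 2 f)\<^sup>2" for z
    using Lp2_inner_tendsto[OF fz f(2) f(2) Lp2_translation_tendsto[OF f(2) invlim[of z]]]
    by (simp add: Lp_norm2_sq power2_norm_eq_inner)
  have Wle: "\<bar>?W n z\<bar> \<le> (Lp_norm 2 f)\<^sup>2" for n z
    using Lp2_Cauchy_Schwarz[OF fz[of "inverse (real (Suc n)) *\<^sub>R z"] f(2)]
    by (simp add: Lp2_translation(2)[OF f(2)] power2_eq_square)
  have "(\<lambda>n. LINT z|lborel. gaussian z * ?W n z) \<longlonglongrightarrow> (LINT z|(lborel::'a measure). gaussian z * (Lp_norm 2 f)\<^sup>2)"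
  proof (rule integral_dominated_convergence[where w="\<lambda>z. gaussian z * (Lp_norm 2 f)\<^sup>2"])
    show "integrable lborel (\<lambda>z::'a. gaussian z * (Lp_norm 2 f)\<^sup>2)" by (simp add: gaussian_integrable)
    show "AE z in lborel. (\<lambda>n. gaussian z * ?W n z) \<longlonglongrightarrow> gaussian z * (Lp_norm 2 f)\<^sup>2"
      by (intro AE_I2 tendsto_mult tendsto_const Wlim)
    show "AE z in lborel. norm (gaussian z * ?W n z) \<le> gaussian z * (Lp_norm 2 f)\<^sup>2" for n
    proof (rule AE_I2)
      fix z show "norm (gaussian z * ?W n z) \<le> gaussian z * (Lp_norm 2 f)\<^sup>2"
        unfolding real_norm_def abs_mult abs_of_nonneg[OF gaussian_nonneg]
        by (rule mult_left_mono[OF Wle gaussian_nonneg])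
    qed
    have "(\<lambda>z. ?W n z) \<in> borel_measurable borel" for n
      by (rule lborel.borel_measurable_lebesgue_integral) measurable
    then show "(\<lambda>z. gaussian z * ?W n z) \<in> borel_measurable lborel" for n by simp
  qed simp
  then have "(\<lambda>n. ?\<kappa> * (LINT z|lborel. gaussian z * ?W n z)) \<longlonglongrightarrow> ?\<kappa> * (?\<kappa> * (Lp_norm 2 f)\<^sup>2)"
    by (intro tendsto_mult tendsto_const) (simp add: gaussian_integral)
  also have "?\<kappa> * (?\<kappa> * (Lp_norm 2 f)\<^sup>2) = (2 * pi) ^ DIM('a) * (Lp_norm 2 f)\<^sup>2"
  proof -
    have "?\<kappa> * ?\<kappa> = (sqrt (2 * pi) * sqrt (2 * pi)) ^ DIM('a)" by (rule power_mult_distrib[symmetric])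
    also have "sqrt (2 * pi) * sqrt (2 * pi) = 2 * pi" by (rule real_sqrt_mult_self[THEN trans]) simp
    finally show ?thesis by (simp add: mult.assoc[symmetric])
  qed
  finally have lim: "(\<lambda>n. integral\<^sup>L lborel (?g n)) \<longlonglongrightarrow> (2 * pi) ^ DIM('a) * (Lp_norm 2 f)\<^sup>2"
    by (simp add: gaussian_norm_ft_sq(2)[OF f])
  have "integrable lborel (\<lambda>\<xi>. (norm (ft f \<xi>))\<^sup>2) \<and>
    (LINT \<xi>|lborel. (norm (ft f \<xi>))\<^sup>2) = (2 * pi) ^ DIM('a) * (Lp_norm 2 f)\<^sup>2"
  proof (rule conjI)
    have int: "integrable lborel (?g n)" for n by (rule gaussian_norm_ft_sq(1)[OF f]) simp
    have "gaussian (inverse (real (Suc i)) *\<^sub>R \<xi>) \<le> gaussian (inverse (real (Suc j)) *\<^sub>R \<xi>)" if "i \<le> j" for i j and \<xi> :: 'a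
    proof -
      have "(norm (inverse (real (Suc j)) *\<^sub>R \<xi>))\<^sup>2 \<le> (norm (inverse (real (Suc i)) *\<^sub>R \<xi>))\<^sup>2"
      proof (rule power_mono)
        have "inverse (real (Suc j)) \<le> inverse (real (Suc i))"
          using that by (intro le_imp_inverse_le) auto
        then show "norm (inverse (real (Suc j)) *\<^sub>R \<xi>) \<le> norm (inverse (real (Suc i)) *\<^sub>R \<xi>)"
          by (simp only: norm_scaleR) (intro mult_right_mono, auto)
      qed simp
      then show ?thesis by (simp add: gaussian_def)
    qed
    then have "?g i \<xi> \<le> ?g j \<xi>" if "i \<le> j" for i j \<xi>
      using that by (intro mult_right_mono) auto
    then have mono: "AE \<xi> in lborel. mono (\<lambda>n. ?g n \<xi>)" by (intro AE_I2 monoI)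
    have "(\<lambda>n. gaussian (inverse (real (Suc n)) *\<^sub>R \<xi>)) \<longlonglongrightarrow> exp (- (norm (0::'a))\<^sup>2 / 2)" for \<xi> :: 'a
      unfolding gaussian_def by (intro tendsto_exp tendsto_divide tendsto_minus tendsto_power tendsto_norm invlim tendsto_const) simp
    then have "(\<lambda>n. gaussian (inverse (real (Suc n)) *\<^sub>R \<xi>)) \<longlonglongrightarrow> 1" for \<xi> :: 'a
      by simp
    from tendsto_mult[OF this tendsto_const]
    have "(\<lambda>n. ?g n \<xi>) \<longlonglongrightarrow> 1 * (norm (ft f \<xi>))\<^sup>2" for \<xi> .
    then have gl: "AE \<xi> in lborel. (\<lambda>n. ?g n \<xi>) \<longlonglongrightarrow> (norm (ft f \<xi>))\<^sup>2" by simp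
    have fm: "(\<lambda>\<xi>. (norm (ft f \<xi>))\<^sup>2) \<in> borel_measurable lborel"
      using ft_measurable[OF m] by simp
    show "integrable lborel (\<lambda>\<xi>. (norm (ft f \<xi>))\<^sup>2)"
      by (rule integrable_monotone_convergence[OF int mono gl lim fm])
    show "(LINT \<xi>|lborel. (norm (ft f \<xi>))\<^sup>2) = (2 * pi) ^ DIM('a) * (Lp_norm 2 f)\<^sup>2"
      by (rule integral_monotone_convergence[OF int mono gl lim fm])
  qed
  then show "ft f \<in> Lp 2" "(Lp_norm 2 (ft f))\<^sup>2 = (2 * pi) ^ DIM('a) * (Lp_norm 2 f)\<^sup>2"
    using ft_measurable[OF m] by (simp_all add: Lp2_iff Lp_norm2_sq)
qed

lemma plancherel_norm:
  fixes f :: "'a::euclidean_space \<Rightarrow> 'b::euclidean_space"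
  assumes "f \<in> Lp 1" "f \<in> Lp 2"
  shows "Lp_norm 2 (ft f) = sqrt ((2 * pi) ^ DIM('a)) * Lp_norm 2 f"
  using plancherel(2)[OF assms] Lp_norm2_nonneg[of f] Lp_norm2_nonneg[of "ft f"]
  by (metis abs_of_nonneg real_sqrt_abs real_sqrt_mult)

text \<open>Dual to Plancherel: pairing \<open>ift \<psi>\<close> with a truncated test equals
  pairing \<psi> with the transform of that test. Only an inequality can hold, because the real part
  in \<open>ift\<close> discards part of \<psi>.\<close>

lemma ift_L2:
  fixes \<psi> :: "'a::euclidean_space \<Rightarrow> 'b::euclidean_space \<times> 'b"
  assumes p: "\<psi> \<in> Lp 1" "\<psi> \<in> Lp 2"
  shows "ift \<psi> \<in> Lp 2" and "Lp_norm 2 (ift \<psi>) \<le> sqrt ((2 * pi) ^ DIM('a)) * Lp_norm 2 \<psi>"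
proof -
  have pi: "integrable lborel \<psi>" using p by (simp add: Lp1_iff)
  have [measurable]: "\<psi> \<in> borel_measurable borel" using p by (simp add: Lp2_iff)
  let ?M = "sqrt ((2 * pi) ^ DIM('a)) * Lp_norm 2 \<psi>"
  have M: "0 \<le> ?M" by (simp add: Lp_norm2_nonneg)
  \<comment> \<open>The sup bound of \<open>ift \<psi>\<close> by the L^1 norm of \<psi> makes each
    truncation square integrable.\<close>
  have c: "cutoff (real n) (ift \<psi>) \<in> Lp 2" for n
  proof -
    let ?B = "LINT \<xi>|lborel. norm (\<psi> \<xi>)"
    have "(\<lambda>x::'a. indicator (cball 0 (real n)) x *\<^sub>R ?B) \<in> Lp 2"
    proof -
      have "(norm (indicator (cball 0 (real n)) x *\<^sub>R ?B))\<^sup>2 = indicator (cball 0 (real n)) x *\<^sub>R ?B\<^sup>2" for x :: 'a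
        by (simp add: indicator_def)
      then show ?thesis using integrable_cball_const[where c="?B\<^sup>2" and R="real n"] borel_measurable_integrable[OF integrable_cball_const[where c="?B" and R="real n"]] by (simp add: Lp2_iff)
    qed
    then show ?thesis
      by (rule Lp2_bound[where M=1]) (use norm_ift_le[OF pi] in \<open>auto simp: cutoff_def indicator_def intro: order_trans[OF _ abs_ge_self]\<close>)
  qed
  have "Lp_norm 2 (cutoff (real n) (ift \<psi>)) \<le> ?M" for n
  proof (rule Lp2_norm_le_by_duality[OF c M])
    fix f :: "'a \<Rightarrow> 'b" assume f: "f \<in> Lp 1" "f \<in> Lp 2"
    let ?f = "cutoff (real n) f"
    have f': "?f \<in> Lp 1" "?f \<in> Lp 2" using cutoff_Lp1[OF f(2)] cutoff_Lp2[OF f(2)] by auto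
    have "(LINT x|lborel. f x \<bullet> cutoff (real n) (ift \<psi>) x) = (LINT x|lborel. ?f x \<bullet> ift \<psi> x)"
      by (simp add: cutoff_def)
    also have "\<dots> = (LINT \<xi>|lborel. ft ?f \<xi> \<bullet> \<psi> \<xi>)"
      using f' pi by (intro ft_ift_adjoint) (auto simp: Lp1_iff)
    also have "\<bar>\<dots>\<bar> \<le> Lp_norm 2 (ft ?f) * Lp_norm 2 \<psi>"
      by (rule Lp2_Cauchy_Schwarz[OF plancherel(1)[OF f'] p(2)])
    also have "\<dots> = ?M * Lp_norm 2 ?f" by (simp add: plancherel_norm[OF f'])
    also have "\<dots> \<le> ?M * Lp_norm 2 f"
      using M Lp_norm2_mono[OF f(2), of ?f 1] f'(2) norm_cutoff_le[of "real n" f]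
      by (intro mult_left_mono) (auto simp: Lp2_iff)
    finally show "\<bar>LINT x|lborel. f x \<bullet> cutoff (real n) (ift \<psi>) x\<bar> \<le> ?M * Lp_norm 2 f" .
  qed
  from Lp2_if_cutoff_bounded[OF _ c this] show "ift \<psi> \<in> Lp 2" "Lp_norm 2 (ift \<psi>) \<le> ?M" by auto
qed

text \<open>Expand the square. With N the norm of the truncated transform and c = (2 pi) ^ DIM('a),
  the cross term is exactly c N^2 and \<open>ift_L2\<close> bounds the first square by c N^2. What
  remains is c times the loss of squared norm by truncation, which tends to 0.\<close>

theorem fourier_inversion_L2:
  fixes f :: "'a::euclidean_space \<Rightarrow> 'b::euclidean_space"
  assumes f: "f \<in> Lp 1" "f \<in> Lp 2"
  shows "(\<lambda>n. Lp_norm 2 (\<lambda>x. ift (cutoff (real n) (ft f)) x - (2 * pi) ^ DIM('a) *\<^sub>R f x)) \<longlonglongrightarrow> 0"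
proof -
  let ?c = "(2 * pi) ^ DIM('a)"
  have c: "?c > 0" by simp
  note F = plancherel(1)[OF f]
  let ?N = "\<lambda>n. Lp_norm 2 (cutoff (real n) (ft f))"
  have lim: "(\<lambda>n. sqrt (?c * ((Lp_norm 2 (ft f))\<^sup>2 - (?N n)\<^sup>2))) \<longlonglongrightarrow> sqrt (?c * ((Lp_norm 2 (ft f))\<^sup>2 - (Lp_norm 2 (ft f))\<^sup>2))"
    by (intro tendsto_intros cutoff_norm_tendsto F)
  then have lim: "(\<lambda>n. sqrt (?c * ((Lp_norm 2 (ft f))\<^sup>2 - (?N n)\<^sup>2))) \<longlonglongrightarrow> 0" by simp
  show ?thesis
  proof (rule Lim_null_comparison[OF always_eventually lim], rule allI)
    fix n
    let ?p = "cutoff (real n) (ft f)"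
    have p: "?p \<in> Lp 1" "?p \<in> Lp 2" using cutoff_Lp1[OF F] cutoff_Lp2[OF F] by auto
    note I = ift_L2[OF p]
    have "(Lp_norm 2 (ift ?p))\<^sup>2 \<le> (sqrt ?c * ?N n)\<^sup>2"
      by (rule power_mono[OF I(2) Lp_norm2_nonneg])
    then have 1: "(Lp_norm 2 (ift ?p))\<^sup>2 \<le> ?c * (?N n)\<^sup>2" by (simp add: power_mult_distrib)
    have "(LINT x|lborel. ift ?p x \<bullet> (?c *\<^sub>R f x)) = ?c * (LINT x|lborel. f x \<bullet> ift ?p x)"
      by (simp add: inner_commute)
    also have "(LINT x|lborel. f x \<bullet> ift ?p x) = (LINT \<xi>|lborel. ft f \<xi> \<bullet> ?p \<xi>)"
      using f p by (intro ft_ift_adjoint) (auto simp: Lp1_iff)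
    also have "\<dots> = (?N n)\<^sup>2"
      unfolding Lp_norm2_sq power2_norm_eq_inner
      by (intro Bochner_Integration.integral_cong refl) (auto simp: cutoff_def indicator_def)
    finally have 2: "(LINT x|lborel. ift ?p x \<bullet> (?c *\<^sub>R f x)) = ?c * (?N n)\<^sup>2" .
    have "(Lp_norm 2 (\<lambda>x. ift ?p x - ?c *\<^sub>R f x))\<^sup>2 = (Lp_norm 2 (ift ?p))\<^sup>2 - 2 * (?c * (?N n)\<^sup>2) + (?c * Lp_norm 2 f)\<^sup>2"
      unfolding Lp_norm2_diff_sq[OF I(1) Lp2_scaleR[OF f(2), of ?c]] 2 by (simp add: Lp_norm2_scaleR)
    also have "\<dots> \<le> ?c * ((Lp_norm 2 (ft f))\<^sup>2 - (?N n)\<^sup>2)"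
    proof -
      have "(?c * Lp_norm 2 f)\<^sup>2 = ?c * (Lp_norm 2 (ft f))\<^sup>2"
        unfolding plancherel(2)[OF f] by (simp add: power_mult_distrib power2_eq_square)
      then show ?thesis using 1 unfolding right_diff_distrib by linarith
    qed
    finally show "norm (Lp_norm 2 (\<lambda>x. ift ?p x - ?c *\<^sub>R f x)) \<le> sqrt (?c * ((Lp_norm 2 (ft f))\<^sup>2 - (?N n)\<^sup>2))"
      by (simp add: Lp_norm2_nonneg real_le_rsqrt)
  qed
qed

section \<open>Smooth functions and band-limited functions\<close>

lemma dir_deriv_eq: "(f has_derivative f') (at x) \<Longrightarrow> dir_deriv v f x = f' v"
  unfolding dir_deriv_def using frechet_derivative_at by metis

lemma has_derivative_dir_deriv:
  assumes "f differentiable (at x)"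
  shows "(f has_derivative (\<lambda>v. dir_deriv v f x)) (at x)"
  using assms unfolding dir_deriv_def frechet_derivative_works .

lemma dir_deriv_add:
  assumes "f differentiable (at x)" "g differentiable (at x)"
  shows "dir_deriv v (\<lambda>x. f x + g x) x = dir_deriv v f x + dir_deriv v g x"
  by (rule dir_deriv_eq) (intro has_derivative_add has_derivative_dir_deriv assms)

lemma dir_deriv_scaleR_fun:
  fixes \<phi> :: "_ \<Rightarrow> real"
  assumes "\<phi> differentiable (at x)" "f differentiable (at x)"
  shows "dir_deriv v (\<lambda>x. \<phi> x *\<^sub>R f x) x = \<phi> x *\<^sub>R dir_deriv v f x + dir_deriv v \<phi> x *\<^sub>R f x"
  by (rule dir_deriv_eq) (intro has_derivative_scaleR has_derivative_dir_deriv assms)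

text \<open>Smoothness graded by order: product and chain rules are proved by induction on n, each
  derivative lowering n by one, and \<open>smooth\<close> is the conjunction over all n.\<close>

definition C_k :: "nat \<Rightarrow> ('a::real_normed_vector \<Rightarrow> 'b::real_normed_vector) \<Rightarrow> bool" where
  "C_k n f \<longleftrightarrow> (\<forall>vs. length vs \<le> n \<longrightarrow> (\<forall>x. foldr dir_deriv vs f differentiable (at x)))"

lemma smooth_iff_C_k: "smooth f \<longleftrightarrow> (\<forall>n. C_k n f)"
  by (auto simp: smooth_def C_k_def)

lemma C_k_0: "C_k 0 f \<longleftrightarrow> (\<forall>x. f differentiable (at x))"
  by (simp add: C_k_def)

lemma C_k_Suc: "C_k (Suc n) f \<longleftrightarrow> (\<forall>x. f differentiable (at x)) \<and> (\<forall>v. C_k n (dir_deriv v f))"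
proof (intro iffI conjI allI)
  assume L: "C_k (Suc n) f"
  show "f differentiable (at x)" for x using L unfolding C_k_def by (elim allE[of _ "[]"]) simp
  show "C_k n (dir_deriv v f)" for v
    unfolding C_k_def
  proof (intro allI impI)
    fix vs :: "'a list" and x assume "length vs \<le> n"
    then have "\<forall>x. foldr dir_deriv (vs @ [v]) f differentiable (at x)"
      using L unfolding C_k_def by (elim allE[of _ "vs @ [v]"]) simp
    then show "foldr dir_deriv vs (dir_deriv v f) differentiable (at x)" by simp
  qed
next
  assume R: "(\<forall>x. f differentiable (at x)) \<and> (\<forall>v. C_k n (dir_deriv v f))"
  show "C_k (Suc n) f"
    unfolding C_k_def
  proof (intro allI impI)
    fix vs :: "'a list" and x assume "length vs \<le> Suc n"
    then show "foldr dir_deriv vs f differentiable (at x)"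
      using R by (cases vs rule: rev_cases) (auto simp: C_k_def)
  qed
qed

lemma C_k_le: "C_k n f \<Longrightarrow> k \<le> n \<Longrightarrow> C_k k f"
  by (auto simp: C_k_def)

lemma C_k_const: "C_k n (\<lambda>x. c)"
proof (induction n arbitrary: c)
  case (Suc n)
  have "dir_deriv v (\<lambda>x. c) = (\<lambda>x::'a. 0)" for v
    by (rule ext, rule dir_deriv_eq) simp
  then show ?case using Suc by (simp add: C_k_Suc)
qed (simp add: C_k_0)

lemma C_k_add: "C_k n f \<Longrightarrow> C_k n g \<Longrightarrow> C_k n (\<lambda>x. f x + g x)"
proof (induction n arbitrary: f g)
  case (Suc n)
  have "dir_deriv v (\<lambda>x. f x + g x) = (\<lambda>x. dir_deriv v f x + dir_deriv v g x)" for v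
    using Suc.prems by (intro ext dir_deriv_add) (auto simp: C_k_Suc)
  then show ?case using Suc by (simp add: C_k_Suc)
qed (simp add: C_k_0)

lemma C_k_scaleR:
  fixes \<phi> :: "_ \<Rightarrow> real"
  shows "C_k n \<phi> \<Longrightarrow> C_k n f \<Longrightarrow> C_k n (\<lambda>x. \<phi> x *\<^sub>R f x)"
proof (induction n arbitrary: f \<phi>)
  case (Suc n)
  have "dir_deriv v (\<lambda>x. \<phi> x *\<^sub>R f x) = (\<lambda>x. \<phi> x *\<^sub>R dir_deriv v f x + dir_deriv v \<phi> x *\<^sub>R f x)" for v
    using Suc.prems by (intro ext dir_deriv_scaleR_fun) (auto simp: C_k_Suc)
  moreover have "C_k n \<phi>" "C_k n f" using Suc.prems C_k_le[of "Suc n" _ n] by auto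
  ultimately show ?case using Suc by (simp add: C_k_Suc C_k_add)
qed (simp add: C_k_0)

lemma C_k_mult:
  fixes \<phi> f :: "_ \<Rightarrow> real"
  shows "C_k n \<phi> \<Longrightarrow> C_k n f \<Longrightarrow> C_k n (\<lambda>x. \<phi> x * f x)"
  using C_k_scaleR[of n \<phi> f] by simp

lemma C_k_linear:
  assumes "bounded_linear f"
  shows "C_k n f"
proof (cases n)
  case 0 then show ?thesis using bounded_linear_imp_differentiable[OF assms] by (simp add: C_k_0)
next
  case (Suc k)
  have "dir_deriv v f = (\<lambda>x. f v)" for v
    by (rule ext, rule dir_deriv_eq) (rule bounded_linear_imp_has_derivative[OF assms])
  then show ?thesis
    using bounded_linear_imp_differentiable[OF assms] Suc by (simp add: C_k_Suc C_k_const)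
qed

text \<open>Meant for inverse transforms of band-limited amplitudes, whose directional derivatives
  are again of that kind.\<close>

lemma smooth_coinduct:
  assumes "P f" and step: "\<And>g. P g \<Longrightarrow> (\<forall>x. g differentiable (at x)) \<and> (\<forall>v. P (dir_deriv v g))"
  shows "smooth f"
proof -
  have "P g \<Longrightarrow> C_k n g" for n g
    by (induction n arbitrary: g) (auto simp: C_k_0 C_k_Suc dest: step)
  then show ?thesis using assms(1) by (simp add: smooth_iff_C_k)
qed

lemma smooth_dir_deriv: "smooth f \<Longrightarrow> smooth (dir_deriv v f)"
  by (metis C_k_Suc smooth_iff_C_k)

lemma smooth_differentiable: "smooth f \<Longrightarrow> f differentiable (at x)"
  using C_k_0[of f] by (auto simp: smooth_iff_C_k)

lemma smooth_continuous: "smooth f \<Longrightarrow> continuous_on S f"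
  by (meson continuous_at_imp_continuous_on differentiable_imp_continuous_within smooth_differentiable)

lemma smooth_mult: "smooth f \<Longrightarrow> smooth g \<Longrightarrow> smooth (\<lambda>x. f x * g x :: real)"
  by (simp add: smooth_iff_C_k C_k_mult)

lemma smooth_const: "smooth (\<lambda>x. c)"
  by (simp add: smooth_iff_C_k C_k_const)

lemma smooth_cmult: "smooth f \<Longrightarrow> smooth (\<lambda>x. c * f x :: real)"
  by (rule smooth_mult[OF smooth_const])

lemma dir_deriv_scaling:
  assumes "f differentiable (at (s *\<^sub>R x))"
  shows "dir_deriv v (\<lambda>x. f (s *\<^sub>R x)) x = s *\<^sub>R dir_deriv v f (s *\<^sub>R x)"
proof (rule dir_deriv_eq)
  have "((\<lambda>x. f (s *\<^sub>R x)) has_derivative (\<lambda>v. dir_deriv (s *\<^sub>R v) f (s *\<^sub>R x))) (at x)"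
    by (rule has_derivative_compose[where f="\<lambda>x. s *\<^sub>R x", OF _ has_derivative_dir_deriv[OF assms]])
      (rule bounded_linear_imp_has_derivative[OF bounded_linear_scaleR_right])
  also have "(\<lambda>v. dir_deriv (s *\<^sub>R v) f (s *\<^sub>R x)) = (\<lambda>v. s *\<^sub>R dir_deriv v f (s *\<^sub>R x))"
    using linear_scale[OF has_derivative_linear[OF has_derivative_dir_deriv[OF assms]]] by auto
  finally show "((\<lambda>x. f (s *\<^sub>R x)) has_derivative (\<lambda>v. s *\<^sub>R dir_deriv v f (s *\<^sub>R x))) (at x)" .
qed

lemma smooth_scaling:
  fixes f :: "'a::real_normed_vector \<Rightarrow> real"
  assumes "smooth f" shows "smooth (\<lambda>x. f (s *\<^sub>R x))"
proof -
  have "smooth f \<Longrightarrow> C_k n (\<lambda>x. f (s *\<^sub>R x))" for n and f :: "'a \<Rightarrow> real"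
  proof (induction n arbitrary: f)
    case 0
    have "(\<lambda>x. f (s *\<^sub>R x)) differentiable (at x)" for x
      by (rule differentiable_compose[OF smooth_differentiable[OF 0]]) (auto intro!: derivative_intros)
    then show ?case by (simp add: C_k_0)
  next
    case (Suc n)
    have "(\<lambda>x. f (s *\<^sub>R x)) differentiable (at x)" for x
      by (rule differentiable_compose[OF smooth_differentiable[OF Suc.prems]]) (auto intro!: derivative_intros)
    moreover have "dir_deriv v (\<lambda>x. f (s *\<^sub>R x)) = (\<lambda>x. s * dir_deriv v f (s *\<^sub>R x))" for v
      using dir_deriv_scaling[OF smooth_differentiable[OF Suc.prems]] by (intro ext) simp
    ultimately show ?case
      using Suc.IH[OF smooth_dir_deriv[OF Suc.prems]] by (simp add: C_k_Suc C_k_mult C_k_const)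
  qed
  then show ?thesis using assms by (simp add: smooth_iff_C_k)
qed

section \<open>A smooth bump built from exp (- 1/s)\<close>

definition flat_exp :: "nat \<Rightarrow> real \<Rightarrow> real" where
  "flat_exp k s = (if 0 < s then exp (- inverse s) * inverse s ^ k else 0)"

lemma flat_exp_tendsto_0: "(flat_exp k \<longlongrightarrow> 0) (at 0)"
  unfolding filterlim_at_split
proof
  show "(flat_exp k \<longlongrightarrow> 0) (at_left 0)"
    by (rule tendsto_eventually) (auto simp: flat_exp_def eventually_at_filter)
  have "((\<lambda>s. inverse s ^ k / exp (inverse s)) \<longlongrightarrow> 0) (at_right (0::real))"
    by (rule filterlim_compose[OF tendsto_power_div_exp_0 filterlim_inverse_at_top_right])
  then show "(flat_exp k \<longlongrightarrow> 0) (at_right 0)"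
    by (rule Lim_transform_eventually)
      (auto simp: flat_exp_def eventually_at_filter exp_minus field_simps)
qed

text \<open>The powers of 1/s are included so that the family is closed under differentiation, up to
  linear combinations. At s = 0 the difference quotient of one member is the next member, which
  tends to 0.\<close>

lemma flat_exp_deriv:
  "(flat_exp k has_real_derivative flat_exp (k + 2) s - real k * flat_exp (k + 1) s) (at s)"
proof (cases s "0::real" rule: linorder_cases)
  case less
  have "\<forall>\<^sub>F x in nhds s. 0 = flat_exp k x"
    using eventually_nhds_in_open[of "{..<0}" s] less by (auto elim!: eventually_mono simp: flat_exp_def)
  then have "((\<lambda>x. 0) has_real_derivative 0) (at s) = (flat_exp k has_real_derivative 0) (at s)"
    by (intro DERIV_cong_ev refl)
  then have "(flat_exp k has_real_derivative 0) (at s)" by simp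
  then show ?thesis using less by (simp add: flat_exp_def)
next
  case equal
  have "((\<lambda>h. (flat_exp k (0 + h) - flat_exp k 0) / h) \<longlongrightarrow> 0) (at 0)"
  proof (rule Lim_transform_eventually[OF flat_exp_tendsto_0[of "k + 1"]])
    show "\<forall>\<^sub>F h in at 0. flat_exp (k + 1) h = (flat_exp k (0 + h) - flat_exp k 0) / h"
      by (auto simp: eventually_at_filter flat_exp_def field_simps)
  qed
  then show ?thesis using equal by (simp add: DERIV_def flat_exp_def)
next
  case greater
  have "((\<lambda>x. exp (- inverse x) * inverse x ^ k) has_real_derivative
    exp (- inverse s) * inverse s ^ (k + 2) - real k * (exp (- inverse s) * inverse s ^ (k + 1))) (at s)"
  proof -
    have i: "(inverse has_real_derivative - (inverse s * inverse s)) (at s)"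
      using DERIV_inverse[of s] greater by (simp add: power2_eq_square)
    have "((\<lambda>x. inverse x ^ k) has_real_derivative - (real k * inverse s ^ (k + 1))) (at s)"
    proof (induction k)
      case (Suc k)
      have "((\<lambda>x. inverse x * inverse x ^ k) has_real_derivative
        - (inverse s * inverse s) * inverse s ^ k + - (real k * inverse s ^ (k + 1)) * inverse s) (at s)"
        by (rule DERIV_mult[OF i Suc])
      then show ?case by (simp add: algebra_simps)
    qed simp
    moreover have "((\<lambda>x. exp (- inverse x)) has_real_derivative exp (- inverse s) * (inverse s * inverse s)) (at s)"
      using DERIV_chain2[OF DERIV_exp DERIV_minus[OF i]] by simp
    ultimately have "((\<lambda>x. exp (- inverse x) * inverse x ^ k) has_real_derivative
      exp (- inverse s) * (inverse s * inverse s) * inverse s ^ k + - (real k * inverse s ^ (k + 1)) * exp (- inverse s)) (at s)"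
      by (intro DERIV_mult)
    then show ?thesis by (simp add: algebra_simps)
  qed
  moreover have "\<forall>\<^sub>F x in nhds s. exp (- inverse x) * inverse x ^ k = flat_exp k x"
    using eventually_nhds_in_open[of "{0<..}" s] greater by (auto elim!: eventually_mono simp: flat_exp_def)
  ultimately have "(flat_exp k has_real_derivative
    exp (- inverse s) * inverse s ^ (k + 2) - real k * (exp (- inverse s) * inverse s ^ (k + 1))) (at s)"
    using DERIV_cong_ev[OF refl _ refl, where x=s and f="\<lambda>x. exp (- inverse x) * inverse x ^ k" and g="flat_exp k"] by simp
  then show ?thesis using greater by (simp add: flat_exp_def)
qed


text \<open>The induction on the order keeps k arbitrary, because every differentiation raises
  it.\<close>

lemma C_k_flat_exp:
  fixes q :: "'a::real_normed_vector \<Rightarrow> real"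
  assumes "smooth q"
  shows "C_k n (\<lambda>x. flat_exp k (q x))"
proof (induction n arbitrary: k)
  case (Suc n)
  have D: "((\<lambda>x. flat_exp k (q x)) has_derivative
      (\<lambda>v. (flat_exp (k + 2) (q x) - real k * flat_exp (k + 1) (q x)) * dir_deriv v q x)) (at x)" for k x
    by (rule has_derivative_compose[where f=q, OF has_derivative_dir_deriv[OF smooth_differentiable[OF assms]]])
      (use flat_exp_deriv[of k "q x"] in \<open>simp add: has_field_derivative_def\<close>)
  have "(\<lambda>x. flat_exp k (q x)) differentiable (at x)" for x
    using D by (rule differentiableI)
  moreover have "dir_deriv v (\<lambda>x. flat_exp k (q x)) =
      (\<lambda>x. (flat_exp (k + 2) (q x) + (- real k) * flat_exp (k + 1) (q x)) * dir_deriv v q x)" for v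
    using dir_deriv_eq[OF D] by auto
  moreover have "C_k n (\<lambda>x. (flat_exp (k + 2) (q x) + (- real k) * flat_exp (k + 1) (q x)) * dir_deriv v q x)" for v
    using smooth_dir_deriv[OF assms, of v] by (intro C_k_mult C_k_add C_k_const Suc.IH) (simp add: smooth_iff_C_k)
  ultimately show ?case by (simp add: C_k_Suc)
next
  case 0
  have "(\<lambda>x. flat_exp k (q x)) differentiable (at x)" for x
    by (rule differentiableI, rule has_derivative_compose[where f=q, OF has_derivative_dir_deriv[OF smooth_differentiable[OF assms]]])
      (use flat_exp_deriv[of k "q x"] in \<open>simp add: has_field_derivative_def\<close>)
  then show ?case by (simp add: C_k_0)
qed

lemma test_function_iff: "test_function \<phi> \<longleftrightarrow> smooth \<phi> \<and> (\<exists>R. \<forall>x. R < norm x \<longrightarrow> \<phi> x = 0)"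
proof -
  have "bounded {x. \<phi> x \<noteq> 0} \<longleftrightarrow> (\<exists>R. \<forall>x. R < norm x \<longrightarrow> \<phi> x = 0)"
    unfolding bounded_iff by (auto simp: not_less intro: leI) (metis not_le)
  then show ?thesis by (simp add: test_function_def compact_closure)
qed

lemma exists_bump: "\<exists>\<eta> :: 'a::euclidean_space \<Rightarrow> real. test_function \<eta> \<and> \<eta> 0 = 1"
proof -
  define q where "q x = 1 + (-1) * (\<Sum>b\<in>Basis. (x \<bullet> b) * (x \<bullet> b))" for x :: 'a
  have qn: "q x = 1 - (norm x)\<^sup>2" for x
    by (simp add: q_def power2_norm_eq_inner euclidean_inner[of x x])
  have "C_k n (\<lambda>x. \<Sum>b\<in>A. (x \<bullet> b) * (x \<bullet> b))" if "finite A" for n and A :: "'a set"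
    using that by induction (simp_all add: C_k_const C_k_add C_k_mult C_k_linear bounded_linear_inner_left)
  then have q: "smooth q"
    unfolding smooth_iff_C_k q_def[abs_def] by (intro allI C_k_add C_k_const C_k_mult) auto
  \<comment> \<open>The factor \<open>exp 1\<close> normalises the value at the origin, where q is 1
    and \<open>flat_exp 0 1\<close> is exp (- 1).\<close>
  define \<eta> where "\<eta> x = exp 1 * flat_exp 0 (q x)" for x
  have "smooth \<eta>"
    unfolding \<eta>_def[abs_def] by (rule smooth_cmult) (use C_k_flat_exp[OF q] in \<open>simp add: smooth_iff_C_k\<close>)
  moreover have "\<eta> x = 0" if "1 < norm x" for x
  proof -
    have "1 < (norm x)\<^sup>2" by (rule one_less_power[OF that]) simp
    then have "\<not> 0 < q x" unfolding qn by linarith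
    then show ?thesis by (simp add: \<eta>_def flat_exp_def)
  qed
  moreover have "\<eta> 0 = 1" by (simp add: \<eta>_def flat_exp_def qn exp_minus)
  ultimately show ?thesis unfolding test_function_iff by blast
qed

lemma test_function_dir_deriv:
  fixes \<phi> :: "'a::euclidean_space \<Rightarrow> real"
  assumes "test_function \<phi>"
  shows "test_function (dir_deriv v \<phi>)"
proof -
  obtain R where R: "\<And>x. R < norm x \<Longrightarrow> \<phi> x = 0" and s: "smooth \<phi>"
    using assms by (auto simp: test_function_iff)
  have "dir_deriv v \<phi> x = 0" if "R < norm x" for x
  proof (rule dir_deriv_eq)
    show "(\<phi> has_derivative (\<lambda>v. 0)) (at x)"
    proof (rule has_derivative_transform_within_open[where f="\<lambda>x. 0" and s="- cball 0 R"])
      show "0 = \<phi> y" if "y \<in> - cball 0 R" for y using R[of y] that by auto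
    qed (use that in auto)
  qed
  then show ?thesis using smooth_dir_deriv[OF s] by (auto simp: test_function_iff)
qed

lemma test_function_foldr: "test_function \<phi> \<Longrightarrow> test_function (foldr dir_deriv vs \<phi>)"
  for \<phi> :: "'a::euclidean_space \<Rightarrow> real"
  by (induction vs) (auto intro: test_function_dir_deriv)

lemma test_function_mult: "test_function \<phi> \<Longrightarrow> smooth f \<Longrightarrow> test_function (\<lambda>x. \<phi> x * f x)"
  by (auto simp: test_function_iff smooth_mult)

lemma test_function_scaling:
  assumes "test_function \<phi>" "s > 0"
  shows "test_function (\<lambda>x. \<phi> (s *\<^sub>R x))"
proof -
  obtain R where R: "\<And>x. R < norm x \<Longrightarrow> \<phi> x = 0" using assms by (auto simp: test_function_iff)
  have "\<phi> (s *\<^sub>R x) = 0" if "R / s < norm x" for x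
    using that assms(2) by (intro R) (simp add: field_simps)
  then show ?thesis using assms smooth_scaling by (auto simp: test_function_iff)
qed

lemma test_function_continuous: "test_function \<phi> \<Longrightarrow> continuous_on S \<phi>"
  by (auto simp: test_function_def intro: smooth_continuous)

lemma test_function_measurable: "test_function \<phi> \<Longrightarrow> \<phi> \<in> borel_measurable borel"
  by (intro borel_measurable_continuous_onI test_function_continuous)

lemma continuous_compact_support_bounded:
  fixes g :: "'a::euclidean_space \<Rightarrow> real"
  assumes "continuous_on UNIV g" "\<And>x. R < norm x \<Longrightarrow> g x = 0"
  shows "\<exists>M\<ge>0. \<forall>x. \<bar>g x\<bar> \<le> M"
proof -
  have "bounded (g ` cball 0 R)"
    by (intro compact_imp_bounded compact_continuous_image continuous_on_subset[OF assms(1)]) auto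
  then obtain M where "\<forall>x\<in>cball 0 R. \<bar>g x\<bar> \<le> M" by (auto simp: bounded_iff)
  then have M: "\<And>x. x \<in> cball 0 R \<Longrightarrow> \<bar>g x\<bar> \<le> M" by blast
  have "\<bar>g x\<bar> \<le> max M 0" for x
    using M[of x] assms(2)[of x] by (cases "norm x \<le> R") auto
  then show ?thesis by (intro exI[of _ "max M 0"]) auto
qed

lemma test_function_bounded:
  fixes \<phi> :: "'a::euclidean_space \<Rightarrow> real"
  assumes "test_function \<phi>"
  shows "\<exists>M\<ge>0. \<forall>x. \<bar>\<phi> x\<bar> \<le> M"
proof -
  obtain R where R: "\<And>x. R < norm x \<Longrightarrow> \<phi> x = 0"
    using assms by (auto simp: test_function_iff)
  show ?thesis by (rule continuous_compact_support_bounded[OF test_function_continuous[OF assms] R])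
qed

lemma bounded_support_Lp:
  fixes f :: "'a::euclidean_space \<Rightarrow> 'b::euclidean_space"
  assumes "f \<in> borel_measurable borel" "\<And>x. norm (f x) \<le> M" "\<And>x. R < norm x \<Longrightarrow> f x = 0"
  shows "f \<in> Lp 1" "f \<in> Lp 2"
proof -
  have M: "0 \<le> M" using assms(2)[of 0] norm_ge_zero order_trans by blast
  have 1: "integrable lborel (\<lambda>x::'a. indicator (cball 0 R) x *\<^sub>R M)"
    and 2: "integrable lborel (\<lambda>x::'a. indicator (cball 0 R) x *\<^sub>R M\<^sup>2)" by (rule integrable_cball_const)+
  have "integrable lborel f"
    by (rule Bochner_Integration.integrable_bound[OF 1])
      (use assms M in \<open>auto simp: indicator_def\<close>)
  then show "f \<in> Lp 1" by (simp add: Lp1_iff)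
  have "integrable lborel (\<lambda>x. (norm (f x))\<^sup>2)"
    by (rule Bochner_Integration.integrable_bound[OF 2])
      (use assms M in \<open>auto simp: indicator_def intro!: power_mono\<close>)
  then show "f \<in> Lp 2" using assms(1) by (simp add: Lp2_iff)
qed

lemma test_function_Lp:
  fixes \<phi> :: "'a::euclidean_space \<Rightarrow> real" and e :: "'b::euclidean_space"
  assumes "test_function \<phi>"
  shows "(\<lambda>x. \<phi> x *\<^sub>R e) \<in> Lp 1" "(\<lambda>x. \<phi> x *\<^sub>R e) \<in> Lp 2"
proof -
  obtain R where R: "\<And>x. R < norm x \<Longrightarrow> \<phi> x = 0" using assms by (auto simp: test_function_iff)
  obtain M where M: "\<And>x. \<bar>\<phi> x\<bar> \<le> M" using test_function_bounded[OF assms] by blast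
  have *: "(\<lambda>x. \<phi> x *\<^sub>R e) \<in> borel_measurable borel" "norm (\<phi> x *\<^sub>R e) \<le> M * norm e"
    "R < norm x \<Longrightarrow> \<phi> x *\<^sub>R e = 0" for x
    using test_function_measurable[OF assms] M R by (auto intro: mult_right_mono)
  show "(\<lambda>x. \<phi> x *\<^sub>R e) \<in> Lp 1" "(\<lambda>x. \<phi> x *\<^sub>R e) \<in> Lp 2"
    using bounded_support_Lp[OF *(1) *(2) *(3)] by auto
qed

lemma test_function_Lp': "test_function \<phi> \<Longrightarrow> \<phi> \<in> Lp 1" "test_function \<phi> \<Longrightarrow> \<phi> \<in> Lp 2"
  for \<phi> :: "'a::euclidean_space \<Rightarrow> real"
  using test_function_Lp[of \<phi> "1::real"] by auto

text \<open>The difference quotients along v have integral zero by translation invariance, and they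
  converge to the derivative under a common majorant. This replaces integration by parts in
  coordinates.\<close>

lemma integral_dir_deriv_eq_0:
  fixes g :: "'a::euclidean_space \<Rightarrow> real"
  assumes d: "\<And>x. g differentiable (at x)" and c: "continuous_on UNIV (dir_deriv v g)"
    and supp: "\<And>x. R < norm x \<Longrightarrow> g x = 0"
  shows "(LINT x|lborel. dir_deriv v g x) = 0"
proof -
  have D: "(g has_derivative (\<lambda>v. dir_deriv v g x)) (at x)" for x
    by (rule has_derivative_dir_deriv[OF d])
  have line: "((\<lambda>s. g (x + s *\<^sub>R v)) has_real_derivative dir_deriv v g (x + s *\<^sub>R v)) (at s)" for x s
  proof -
    have "((\<lambda>s. g (x + s *\<^sub>R v)) has_derivative (\<lambda>h. dir_deriv (h *\<^sub>R v) g (x + s *\<^sub>R v))) (at s)"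
      by (rule has_derivative_compose[where f="\<lambda>s. x + s *\<^sub>R v", OF _ D]) (auto intro!: derivative_eq_intros)
    moreover have "(\<lambda>h. dir_deriv (h *\<^sub>R v) g (x + s *\<^sub>R v)) = (*) (dir_deriv v g (x + s *\<^sub>R v))"
      using linear_scale[OF has_derivative_linear[OF D]] by (simp add: fun_eq_iff mult.commute)
    ultimately show ?thesis by (simp add: has_field_derivative_def)
  qed
  have g0: "dir_deriv v g x = 0" if "R < norm x" for x
  proof (rule dir_deriv_eq)
    show "(g has_derivative (\<lambda>v. 0)) (at x)"
    proof (rule has_derivative_transform_within_open[where f="\<lambda>x. 0" and s="- cball 0 R"])
      show "0 = g y" if "y \<in> - cball 0 R" for y using supp[of y] that by auto
    qed (use that in auto)
  qed
  obtain M where M: "0 \<le> M" "\<And>x. \<bar>dir_deriv v g x\<bar> \<le> M"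
    using continuous_compact_support_bounded[OF c g0] by blast
  have cg: "continuous_on UNIV g"
    using d by (meson continuous_at_imp_continuous_on differentiable_imp_continuous_within)
  then have gm[measurable]: "g \<in> borel_measurable borel" by (rule borel_measurable_continuous_onI)
  obtain Mg where Mg: "\<And>x. \<bar>g x\<bar> \<le> Mg" using continuous_compact_support_bounded[OF cg supp] by blast
  have gi: "integrable lborel g"
    using bounded_support_Lp(1)[OF gm, of Mg R] Mg supp by (simp add: Lp1_iff)
  let ?q = "\<lambda>n x. real (Suc n) * (g (inverse (real (Suc n)) *\<^sub>R v + x) - g x)"
  have q0: "integral\<^sup>L lborel (?q n) = 0" for n
  proof -
    have "integral\<^sup>L lborel (?q n) = real (Suc n) * ((LINT x|lborel. g (inverse (real (Suc n)) *\<^sub>R v + x)) - (LINT x|lborel. g x))"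
      using gi lborel_integrable_translation[OF gi] by (subst Bochner_Integration.integral_diff[symmetric]) auto
    then show ?thesis using lborel_integral_translation[OF gm] by simp
  qed
  have "(\<lambda>n. integral\<^sup>L lborel (?q n)) \<longlonglongrightarrow> (LINT x|lborel. dir_deriv v g x)"
  proof (rule integral_dominated_convergence[where w="\<lambda>x. indicator (cball 0 (\<bar>R\<bar> + norm v)) x *\<^sub>R M"])
    show "dir_deriv v g \<in> borel_measurable lborel"
      using borel_measurable_continuous_onI[OF c] by simp
    show "?q n \<in> borel_measurable lborel" for n
      using gi lborel_integrable_translation[OF gi] by (intro borel_measurable_integrable) auto
    show "integrable lborel (\<lambda>x::'a. indicator (cball 0 (\<bar>R\<bar> + norm v)) x *\<^sub>R M)" by (rule integrable_cball_const)
    show "AE x in lborel. (\<lambda>n. ?q n x) \<longlonglongrightarrow> dir_deriv v g x"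
    proof (rule AE_I2)
      fix x
      have "((\<lambda>h. (g (x + (0 + h) *\<^sub>R v) - g (x + 0 *\<^sub>R v)) / h) \<longlongrightarrow> dir_deriv v g (x + 0 *\<^sub>R v)) (at 0)"
        using line[of x 0] by (simp only: DERIV_def)
      moreover have "filterlim (\<lambda>n. inverse (real (Suc n))) (at 0) sequentially"
        unfolding filterlim_at using LIMSEQ_inverse_real_of_nat by auto
      ultimately have "(\<lambda>n. (g (x + (0 + inverse (real (Suc n))) *\<^sub>R v) - g (x + 0 *\<^sub>R v)) / inverse (real (Suc n))) \<longlonglongrightarrow> dir_deriv v g (x + 0 *\<^sub>R v)"
        by (rule filterlim_compose)
      then show "(\<lambda>n. ?q n x) \<longlonglongrightarrow> dir_deriv v g x" by (simp add: divide_inverse mult.commute add.commute)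
    qed
    \<comment> \<open>The mean value theorem bounds the quotient by M. The ball exceeds the support
      by norm v because the shift by v / (n + 1) can move the support by that much.\<close>
    show "AE x in lborel. norm (?q n x) \<le> indicator (cball 0 (\<bar>R\<bar> + norm v)) x *\<^sub>R M" for n
    proof (rule AE_I2)
      fix x
      let ?h = "inverse (real (Suc n))"
      have h: "0 < ?h" "?h \<le> 1" by (auto simp: inverse_le_1_iff)
      obtain z where z: "g (x + ?h *\<^sub>R v) - g (x + 0 *\<^sub>R v) = (?h - 0) * dir_deriv v g (x + z *\<^sub>R v)"
        using MVT2[OF h(1), of "\<lambda>s. g (x + s *\<^sub>R v)" "\<lambda>s. dir_deriv v g (x + s *\<^sub>R v)"] line by blast
      have "?q n x = real (Suc n) * (?h * dir_deriv v g (x + z *\<^sub>R v))"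
        using z by (simp add: add.commute)
      also have "\<dots> = dir_deriv v g (x + z *\<^sub>R v)" by (simp only: mult.assoc[symmetric]) simp
      finally have 1: "\<bar>?q n x\<bar> \<le> M" using M(2) by simp
      show "norm (?q n x) \<le> indicator (cball 0 (\<bar>R\<bar> + norm v)) x *\<^sub>R M"
      proof (cases "x \<in> cball 0 (\<bar>R\<bar> + norm v)")
        case False
        then have x: "\<bar>R\<bar> + norm v < norm x" by simp
        have "norm (?h *\<^sub>R v) \<le> norm v" using h by (simp add: mult_left_le_one_le del: of_nat_Suc)
        then have "R < norm (?h *\<^sub>R v + x)" using x norm_diff_ineq[of x "?h *\<^sub>R v"] by (simp add: add.commute)
        moreover have "R < norm x" using x norm_ge_zero[of v] by linarith
        ultimately show ?thesis using supp M(1) by (simp add: indicator_def)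
      qed (use 1 in simp)
    qed
  qed
  from LIMSEQ_unique[OF this[unfolded q0] tendsto_const] show ?thesis .
qed

section \<open>Multiplication by - i in the pair encoding, and band-limited amplitudes\<close>

definition Jrot :: "'b::real_vector \<times> 'b \<Rightarrow> 'b \<times> 'b" where
  "Jrot p = (snd p, - fst p)"

text \<open>Multiplication by \<open>- i (\<xi> \<bullet> v)\<close>, the symbol of the derivative in direction \<open>v\<close>.\<close>

definition mulJ :: "'a::real_inner \<Rightarrow> ('a \<Rightarrow> 'b::real_vector \<times> 'b) \<Rightarrow> 'a \<Rightarrow> 'b \<times> 'b" where
  "mulJ v \<psi> = (\<lambda>\<xi>. (\<xi> \<bullet> v) *\<^sub>R Jrot (\<psi> \<xi>))"

lemma norm_Jrot [simp]: "norm (Jrot p) = norm p"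
  by (cases p) (simp add: Jrot_def norm_Pair add.commute)

lemma Jrot_scaleR: "Jrot (a *\<^sub>R p) = a *\<^sub>R Jrot p"
  by (simp add: Jrot_def)

lemma Jrot_add: "Jrot (p + q) = Jrot p + Jrot q"
  by (simp add: Jrot_def)

lemma inner_Jrot: "Jrot p \<bullet> q = - (p \<bullet> Jrot q)"
  by (cases p; cases q) (simp add: Jrot_def)

lemma bounded_linear_Jrot: "bounded_linear (Jrot :: 'b::real_normed_vector \<times> 'b \<Rightarrow> _)"
  by (rule bounded_linear_intro[where K=1]) (auto simp: Jrot_add Jrot_scaleR)

lemma Jrot_measurable:
  fixes \<psi> :: "'a \<Rightarrow> 'b::euclidean_space \<times> 'b"
  assumes "\<psi> \<in> borel_measurable M"
  shows "(\<lambda>\<xi>. Jrot (\<psi> \<xi>)) \<in> borel_measurable M"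
  using measurable_compose[OF assms borel_measurable_continuous_onI[OF linear_continuous_on[OF bounded_linear_Jrot]]] .

lemma foldr_mulJ:
  "foldr mulJ vs \<psi> \<xi> = prod_list (map (\<lambda>v. \<xi> \<bullet> v) vs) *\<^sub>R (Jrot ^^ length vs) (\<psi> \<xi>)"
  by (induction vs) (auto simp: mulJ_def Jrot_scaleR)

lemma norm_Jrot_pow [simp]: "norm ((Jrot ^^ n) p) = norm p"
  by (induction n) auto

lemma inner_Jrot_pow: "(Jrot ^^ n) p \<bullet> q = (-1) ^ n * (p \<bullet> (Jrot ^^ n) q)"
proof (induction n arbitrary: p q)
  case (Suc n)
  have "(Jrot ^^ Suc n) p \<bullet> q = - ((Jrot ^^ n) p \<bullet> Jrot q)" by (simp add: inner_Jrot)
  also have "\<dots> = (-1) ^ Suc n * (p \<bullet> (Jrot ^^ n) (Jrot q))" by (simp add: Suc)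
  finally show ?case by (simp add: funpow_swap1)
qed simp

text \<open>Each \<open>Jrot\<close> is skew, so transposing the list costs one sign per derivative,
  the same sign as integration by parts.\<close>

lemma inner_foldr_mulJ: "foldr mulJ vs \<psi> \<xi> \<bullet> q = (-1) ^ length vs * (\<psi> \<xi> \<bullet> foldr mulJ vs (\<lambda>_. q) \<xi>)"
  by (simp add: foldr_mulJ inner_Jrot_pow)

lemma abs_prod_list_inner_le: "\<bar>prod_list (map (\<lambda>v. \<xi> \<bullet> v) vs)\<bar> \<le> prod_list (map norm vs) * norm \<xi> ^ length vs"
proof (induction vs)
  case (Cons v vs)
  have "\<bar>\<xi> \<bullet> v\<bar> * \<bar>prod_list (map (\<lambda>v. \<xi> \<bullet> v) vs)\<bar> \<le> (norm \<xi> * norm v) * (prod_list (map norm vs) * norm \<xi> ^ length vs)"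
    by (intro mult_mono Cons Cauchy_Schwarz_ineq2) auto
  then show ?case by (simp add: abs_mult mult_ac)
qed simp

text \<open>The band-limited amplitudes. They lie in L^1 as well, and the class is stable under
  polynomial multipliers and under the flow, so on it every formula can be differentiated and
  inverted pointwise.\<close>

definition L2_bdd_supp :: "('a::euclidean_space \<Rightarrow> 'b::euclidean_space) \<Rightarrow> bool" where
  "L2_bdd_supp \<psi> \<longleftrightarrow> \<psi> \<in> Lp 2 \<and> (\<exists>R. \<forall>\<xi>. R < norm \<xi> \<longrightarrow> \<psi> \<xi> = 0)"

lemma L2_bdd_supp_cutoff: "f \<in> Lp 2 \<Longrightarrow> L2_bdd_supp (cutoff R f)"
  unfolding L2_bdd_supp_def by (intro conjI cutoff_Lp2 exI[of _ R]) (auto simp: cutoff_def)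

lemma L2_bdd_supp_Lp2: "L2_bdd_supp \<psi> \<Longrightarrow> \<psi> \<in> Lp 2"
  by (simp add: L2_bdd_supp_def)

lemma L2_bdd_supp_Lp1:
  assumes "L2_bdd_supp \<psi>" shows "\<psi> \<in> Lp 1"
proof -
  obtain R where R: "\<And>\<xi>. R < norm \<xi> \<Longrightarrow> \<psi> \<xi> = 0" using assms by (auto simp: L2_bdd_supp_def)
  have "cutoff R \<psi> = \<psi>" using R by (auto simp: cutoff_def indicator_def fun_eq_iff not_le)
  then show ?thesis using cutoff_Lp1[OF L2_bdd_supp_Lp2[OF assms], of R] by simp
qed

lemma L2_bdd_supp_integrable: "L2_bdd_supp \<psi> \<Longrightarrow> integrable lborel \<psi>"
  using L2_bdd_supp_Lp1 Lp1_iff by blast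

lemma L2_bdd_supp_measurable: "L2_bdd_supp \<psi> \<Longrightarrow> \<psi> \<in> borel_measurable borel"
  by (simp add: L2_bdd_supp_def Lp2_iff)

text \<open>On a bounded support a factor that is monotone in |\<xi>| is bounded by its value at the
  edge.\<close>

lemma L2_bdd_supp_bound:
  assumes "L2_bdd_supp \<psi>" "g \<in> borel_measurable borel"
    and le: "\<And>\<xi>. norm (g \<xi>) \<le> M (norm \<xi>) * norm (\<psi> \<xi>)" and M: "\<And>r s. 0 \<le> r \<Longrightarrow> r \<le> s \<Longrightarrow> M r \<le> M s"
  shows "L2_bdd_supp g"
proof -
  obtain R where R: "\<And>\<xi>. R < norm \<xi> \<Longrightarrow> \<psi> \<xi> = 0" using assms by (auto simp: L2_bdd_supp_def)
  have "norm (g \<xi>) \<le> M (max 0 R) * norm (\<psi> \<xi>)" for \<xi>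
  proof (cases "R < norm \<xi>")
    case True then show ?thesis using le[of \<xi>] R by simp
  next
    case False
    then have "M (norm \<xi>) * norm (\<psi> \<xi>) \<le> M (max 0 R) * norm (\<psi> \<xi>)"
      by (intro mult_right_mono M) auto
    then show ?thesis using le[of \<xi>] by simp
  qed
  then have "g \<in> Lp 2" by (rule Lp2_bound[OF L2_bdd_supp_Lp2[OF assms(1)] assms(2)])
  moreover have "g \<xi> = 0" if "R < norm \<xi>" for \<xi> using le[of \<xi>] R[OF that] by simp
  ultimately show ?thesis unfolding L2_bdd_supp_def by blast
qed

lemma L2_bdd_supp_mulJ:
  fixes \<psi> :: "'a::euclidean_space \<Rightarrow> 'b::euclidean_space \<times> 'b"
  assumes "L2_bdd_supp \<psi>" shows "L2_bdd_supp (mulJ v \<psi>)"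
proof (rule L2_bdd_supp_bound[OF assms, where M="\<lambda>r. r * norm v"])
  show "mulJ v \<psi> \<in> borel_measurable borel"
    unfolding mulJ_def using Jrot_measurable[OF L2_bdd_supp_measurable[OF assms]] by simp
  show "norm (mulJ v \<psi> \<xi>) \<le> norm \<xi> * norm v * norm (\<psi> \<xi>)" for \<xi>
    unfolding mulJ_def by (simp add: mult_right_mono Cauchy_Schwarz_ineq2)
qed (simp add: mult_right_mono)

lemma L2_bdd_supp_foldr_mulJ: "L2_bdd_supp \<psi> \<Longrightarrow> L2_bdd_supp (foldr mulJ vs \<psi>)"
  for \<psi> :: "'a::euclidean_space \<Rightarrow> 'b::euclidean_space \<times> 'b"
  by (induction vs) (auto intro: L2_bdd_supp_mulJ)

text \<open>Differentiating the integrand of \<open>ift\<close> turns (a, b) into (b, - a), which is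
  \<open>Jrot\<close>; the quadratic remainder is what makes differentiation under the integral
  explicit.\<close>

lemma trig_taylor:
  fixes a b :: "'b::real_inner"
  shows "norm (cos (s + d) *\<^sub>R a + sin (s + d) *\<^sub>R b - (cos s *\<^sub>R a + sin s *\<^sub>R b)
      - d *\<^sub>R (cos s *\<^sub>R b + sin s *\<^sub>R (- a))) \<le> d\<^sup>2 * norm (a, b)"
proof -
  let ?p = "cos s *\<^sub>R a + sin s *\<^sub>R b" and ?q = "cos s *\<^sub>R b + sin s *\<^sub>R (- a)"
  have eq: "cos (s + d) *\<^sub>R a + sin (s + d) *\<^sub>R b - ?p - d *\<^sub>R ?q = (cos d - 1) *\<^sub>R ?p + (sin d - d) *\<^sub>R ?q"
    by (simp add: cos_add sin_add algebra_simps)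
  have c: "\<bar>cos d - 1\<bar> \<le> d\<^sup>2 / 2"
  proof -
    have "cos d = 1 - 2 * (sin (d / 2))\<^sup>2" using cos_double_sin[of "d / 2"] by simp
    moreover have "(sin (d / 2))\<^sup>2 \<le> (d / 2)\<^sup>2"
      using abs_sin_x_le_abs_x[of "d / 2"] by (simp only: abs_le_square_iff[symmetric])
    ultimately show ?thesis by (simp add: power2_eq_square)
  qed
  have sn: "\<bar>sin d - d\<bar> \<le> d\<^sup>2 / 2"
    using Maclaurin_sin_bound[of d 2] by (simp add: sin_coeff_def numeral_2_eq_2 power2_eq_square)
  have p: "norm ?p \<le> norm (a, b)" by (rule norm_ift_integrand_le)
  have q: "norm ?q \<le> norm (a, b)"
    using norm_ift_integrand_le[of s b "- a"] by (simp add: norm_Pair add.commute)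
  have "norm ((cos d - 1) *\<^sub>R ?p + (sin d - d) *\<^sub>R ?q) \<le> \<bar>cos d - 1\<bar> * norm ?p + \<bar>sin d - d\<bar> * norm ?q"
    by (rule norm_triangle_le) simp
  also have "\<dots> \<le> d\<^sup>2 / 2 * norm (a, b) + d\<^sup>2 / 2 * norm (a, b)"
    by (intro add_mono mult_mono c sn p q) auto
  finally show ?thesis unfolding eq by (simp add: mult.commute)
qed

text \<open>Differentiation under the integral, with remainder |y - x|^2 times the integral of
  |\<xi>|^2 |\<psi>|; that integral is finite because the support is bounded.\<close>

lemma ift_has_derivative:
  fixes \<psi> :: "'a::euclidean_space \<Rightarrow> 'b::euclidean_space \<times> 'b"
  assumes b: "L2_bdd_supp \<psi>"
  shows "(ift \<psi> has_derivative (\<lambda>v. ift (mulJ v \<psi>) x)) (at x)"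
proof -
  note i = L2_bdd_supp_integrable[OF b]
  note iJ = L2_bdd_supp_integrable[OF L2_bdd_supp_mulJ[OF b]]
  have lin: "linear (\<lambda>v. ift (mulJ v \<psi>) x)"
  proof (rule linearI)
    fix v w :: 'a and r :: real
    have "mulJ (v + w) \<psi> = (\<lambda>\<xi>. mulJ v \<psi> \<xi> + mulJ w \<psi> \<xi>)"
      by (auto simp: mulJ_def inner_add_right scaleR_add_left)
    then show "ift (mulJ (v + w) \<psi>) x = ift (mulJ v \<psi>) x + ift (mulJ w \<psi>) x"
      using ift_add[OF iJ iJ, of v w x] by simp
    have "mulJ (r *\<^sub>R v) \<psi> = (\<lambda>\<xi>. r *\<^sub>R mulJ v \<psi> \<xi>)" by (auto simp: mulJ_def)
    then show "ift (mulJ (r *\<^sub>R v) \<psi>) x = r *\<^sub>R ift (mulJ v \<psi>) x"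
      using ift_scaleR[of r "mulJ v \<psi>" x] by simp
  qed
  have b2: "L2_bdd_supp (\<lambda>\<xi>. (norm \<xi>)\<^sup>2 *\<^sub>R \<psi> \<xi>)"
    by (rule L2_bdd_supp_bound[OF b, where M="\<lambda>r. r\<^sup>2"]) (use L2_bdd_supp_measurable[OF b] in \<open>auto intro: power_mono\<close>)
  let ?C = "LINT \<xi>|lborel. norm ((norm \<xi>)\<^sup>2 *\<^sub>R \<psi> \<xi>)"
  have rem: "norm (ift \<psi> y - ift \<psi> x - ift (mulJ (y - x) \<psi>) x) \<le> ?C * (norm (y - x))\<^sup>2" for y
  proof -
    define k where "k \<psi> x \<xi> = cos (x \<bullet> \<xi>) *\<^sub>R fst (\<psi> \<xi>) + sin (x \<bullet> \<xi>) *\<^sub>R snd (\<psi> \<xi>)" for \<psi> :: "'a \<Rightarrow> 'b \<times> 'b" and x \<xi>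
    have kift: "ift \<psi> x = (LINT \<xi>|lborel. k \<psi> x \<xi>)" for \<psi> :: "'a \<Rightarrow> 'b \<times> 'b" and x
      by (simp add: ift_def k_def)
    have I: "integrable lborel (k \<psi> y)" "integrable lborel (k \<psi> x)" "integrable lborel (k (mulJ (y - x) \<psi>) x)"
      unfolding k_def by (rule ift_integrable[OF i] ift_integrable[OF iJ])+
    have pw: "norm (k \<psi> y \<xi> - k \<psi> x \<xi> - k (mulJ (y - x) \<psi>) x \<xi>) \<le> (norm (y - x))\<^sup>2 * norm ((norm \<xi>)\<^sup>2 *\<^sub>R \<psi> \<xi>)" for \<xi>
    proof -
      let ?s = "x \<bullet> \<xi>" and ?d = "(y - x) \<bullet> \<xi>"
      have e: "k \<psi> y \<xi> - k \<psi> x \<xi> - k (mulJ (y - x) \<psi>) x \<xi> =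
        cos (?s + ?d) *\<^sub>R fst (\<psi> \<xi>) + sin (?s + ?d) *\<^sub>R snd (\<psi> \<xi>) - (cos ?s *\<^sub>R fst (\<psi> \<xi>) + sin ?s *\<^sub>R snd (\<psi> \<xi>))
        - ?d *\<^sub>R (cos ?s *\<^sub>R snd (\<psi> \<xi>) + sin ?s *\<^sub>R (- fst (\<psi> \<xi>)))"
      proof -
        have y: "y \<bullet> \<xi> = ?s + ?d" by (simp add: inner_diff_left)
        have m: "k (mulJ (y - x) \<psi>) x \<xi> = ?d *\<^sub>R (cos ?s *\<^sub>R snd (\<psi> \<xi>) + sin ?s *\<^sub>R (- fst (\<psi> \<xi>)))"
          unfolding k_def mulJ_def Jrot_def inner_commute[of \<xi> "y - x"]
          by (simp only: fst_scaleR snd_scaleR fst_conv snd_conv scaleR_add_right scaleR_left_commute[of ?d])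
        show ?thesis unfolding m by (simp only: k_def y)
      qed
      have "?d\<^sup>2 \<le> (norm (y - x) * norm \<xi>)\<^sup>2"
        using Cauchy_Schwarz_ineq2[of "y - x" \<xi>] power_mono[of "\<bar>?d\<bar>" "norm (y - x) * norm \<xi>" 2] by simp
      then have "?d\<^sup>2 * norm (\<psi> \<xi>) \<le> (norm (y - x) * norm \<xi>)\<^sup>2 * norm (\<psi> \<xi>)" by (rule mult_right_mono) simp
      then show "norm (k \<psi> y \<xi> - k \<psi> x \<xi> - k (mulJ (y - x) \<psi>) x \<xi>) \<le> (norm (y - x))\<^sup>2 * norm ((norm \<xi>)\<^sup>2 *\<^sub>R \<psi> \<xi>)"
        unfolding e using trig_taylor[of ?s ?d "fst (\<psi> \<xi>)" "snd (\<psi> \<xi>)"] by (simp add: power_mult_distrib)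
    qed
    define D where "D \<xi> = k \<psi> y \<xi> - k \<psi> x \<xi> - k (mulJ (y - x) \<psi>) x \<xi>" for \<xi>
    define N where "N \<xi> = norm ((norm \<xi>)\<^sup>2 *\<^sub>R \<psi> \<xi>)" for \<xi>
    have DI: "integrable lborel D"
      unfolding D_def using I by (intro Bochner_Integration.integrable_diff)
    have NI: "integrable lborel N"
      unfolding N_def by (rule integrable_norm[OF L2_bdd_supp_integrable[OF b2]])
    have "ift \<psi> y - ift \<psi> x - ift (mulJ (y - x) \<psi>) x = integral\<^sup>L lborel D"
      unfolding kift D_def using I by (simp only: Bochner_Integration.integral_diff Bochner_Integration.integrable_diff)
    also have "norm \<dots> \<le> (LINT \<xi>|lborel. norm (D \<xi>))"
      by (rule integral_norm_bound)
    also have "\<dots> \<le> (LINT \<xi>|lborel. (norm (y - x))\<^sup>2 * N \<xi>)"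
      by (rule integral_mono[OF integrable_norm[OF DI] integrable_mult_right[OF NI]])
        (use pw in \<open>simp only: D_def N_def\<close>)
    also have "\<dots> = integral\<^sup>L lborel N * (norm (y - x))\<^sup>2" by (simp add: mult.commute)
    finally show ?thesis unfolding N_def .
  qed
  show ?thesis
  proof (rule has_derivativeI_sandwich[where e=1 and H="\<lambda>y. ?C * norm (y - x)"])
    show "bounded_linear (\<lambda>v. ift (mulJ v \<psi>) x)" using lin by (simp add: linear_conv_bounded_linear)
    show "norm (ift \<psi> y - ift \<psi> x - ift (mulJ (y - x) \<psi>) x) / norm (y - x) \<le> ?C * norm (y - x)" if "y \<noteq> x" for y
      using rem[of y] that by (simp add: divide_le_eq power2_eq_square mult.assoc)
    have "((\<lambda>y. ?C * norm (y - x)) \<longlongrightarrow> ?C * norm (x - x)) (at x)" by (intro tendsto_intros)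
    then show "((\<lambda>y. ?C * norm (y - x)) \<longlongrightarrow> 0) (at x)" by simp
  qed simp
qed

lemma dir_deriv_ift: "L2_bdd_supp \<psi> \<Longrightarrow> dir_deriv v (ift \<psi>) = ift (mulJ v \<psi>)"
  by (rule ext, rule dir_deriv_eq, rule ift_has_derivative)

lemma smooth_ift:
  fixes \<psi> :: "'a::euclidean_space \<Rightarrow> 'b::euclidean_space \<times> 'b"
  assumes "L2_bdd_supp \<psi>"
  shows "smooth (ift \<psi>)"
proof (rule smooth_coinduct[where P="\<lambda>g. \<exists>\<psi>. L2_bdd_supp \<psi> \<and> g = ift \<psi>"])
  fix g :: "'a \<Rightarrow> 'b" assume "\<exists>\<psi>. L2_bdd_supp \<psi> \<and> g = ift \<psi>"
  then obtain \<psi> where "L2_bdd_supp \<psi>" "g = ift \<psi>" by blast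
  then show "(\<forall>x. g differentiable (at x)) \<and> (\<forall>v. \<exists>\<psi>. L2_bdd_supp \<psi> \<and> dir_deriv v g = ift \<psi>)"
    using ift_has_derivative dir_deriv_ift L2_bdd_supp_mulJ by (metis differentiableI)
qed (use assms in blast)

lemma foldr_dir_deriv_ift: "L2_bdd_supp \<psi> \<Longrightarrow> foldr dir_deriv vs (ift \<psi>) = ift (foldr mulJ vs \<psi>)"
  by (induction vs) (auto simp: dir_deriv_ift L2_bdd_supp_foldr_mulJ)

lemma L2_bdd_supp_ift_Lp2: "L2_bdd_supp \<psi> \<Longrightarrow> ift \<psi> \<in> Lp 2"
  by (intro ift_L2 L2_bdd_supp_Lp1 L2_bdd_supp_Lp2)

lemma L2_bdd_supp_ift_norm:
  fixes \<psi> :: "'a::euclidean_space \<Rightarrow> 'b::euclidean_space \<times> 'b"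
  assumes "L2_bdd_supp \<psi>"
  shows "Lp_norm 2 (ift \<psi>) \<le> sqrt ((2 * pi) ^ DIM('a)) * Lp_norm 2 \<psi>"
  using assms by (intro ift_L2 L2_bdd_supp_Lp1 L2_bdd_supp_Lp2)

text \<open>Integration by parts: the products of \<phi> with cosine and sine have compact support,
  so their directional derivatives integrate to zero.\<close>

lemma ft_dir_deriv:
  fixes \<phi> :: "'a::euclidean_space \<Rightarrow> real" and e :: "'b::euclidean_space"
  assumes t: "test_function \<phi>"
  shows "ft (\<lambda>x. dir_deriv v \<phi> x *\<^sub>R e) = mulJ v (ft (\<lambda>x. \<phi> x *\<^sub>R e))"
proof
  fix \<xi>
  have sm: "smooth \<phi>" using t by (simp add: test_function_def)
  note i = integrable_trig[OF test_function_Lp'(1)[OF t, unfolded Lp1_iff], of \<xi>]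
  note di = integrable_trig[OF test_function_Lp'(1)[OF test_function_dir_deriv[OF t, of v], unfolded Lp1_iff], of \<xi>]
  obtain R where R: "\<And>x. R < norm x \<Longrightarrow> \<phi> x = 0" using t by (auto simp: test_function_iff)
  have D: "(\<phi> has_derivative (\<lambda>v. dir_deriv v \<phi> x)) (at x)" for x
    by (rule has_derivative_dir_deriv[OF smooth_differentiable[OF sm]])
  have c1: "continuous_on UNIV \<phi>" "continuous_on UNIV (dir_deriv v \<phi>)"
    by (intro smooth_continuous smooth_dir_deriv sm)+
  have Dc: "((\<lambda>x. cos (x \<bullet> \<xi>) * \<phi> x) has_derivative
      (\<lambda>v. cos (x \<bullet> \<xi>) * dir_deriv v \<phi> x - (v \<bullet> \<xi>) * (sin (x \<bullet> \<xi>) * \<phi> x))) (at x)" for x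
    by (rule derivative_eq_intros D refl | simp add: fun_eq_iff)+
  have Ds: "((\<lambda>x. sin (x \<bullet> \<xi>) * \<phi> x) has_derivative
      (\<lambda>v. sin (x \<bullet> \<xi>) * dir_deriv v \<phi> x + (v \<bullet> \<xi>) * (cos (x \<bullet> \<xi>) * \<phi> x))) (at x)" for x
    by (rule derivative_eq_intros D refl | simp add: fun_eq_iff)+
  have dc: "dir_deriv v (\<lambda>x. cos (x \<bullet> \<xi>) * \<phi> x) = (\<lambda>x. cos (x \<bullet> \<xi>) * dir_deriv v \<phi> x - (v \<bullet> \<xi>) * (sin (x \<bullet> \<xi>) * \<phi> x))"
    using dir_deriv_eq[OF Dc] by auto
  have ds: "dir_deriv v (\<lambda>x. sin (x \<bullet> \<xi>) * \<phi> x) = (\<lambda>x. sin (x \<bullet> \<xi>) * dir_deriv v \<phi> x + (v \<bullet> \<xi>) * (cos (x \<bullet> \<xi>) * \<phi> x))"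
    using dir_deriv_eq[OF Ds] by auto
  have "(LINT x|lborel. dir_deriv v (\<lambda>x. cos (x \<bullet> \<xi>) * \<phi> x) x) = 0"
    by (rule integral_dir_deriv_eq_0[where R=R]) (use R differentiableI[OF Dc] in \<open>auto simp: dc intro!: continuous_intros c1\<close>)
  then have C: "(LINT x|lborel. cos (x \<bullet> \<xi>) * dir_deriv v \<phi> x) = (v \<bullet> \<xi>) * (LINT x|lborel. sin (x \<bullet> \<xi>) * \<phi> x)"
    unfolding dc using i di by simp
  have "(LINT x|lborel. dir_deriv v (\<lambda>x. sin (x \<bullet> \<xi>) * \<phi> x) x) = 0"
    by (rule integral_dir_deriv_eq_0[where R=R]) (use R differentiableI[OF Ds] in \<open>auto simp: ds intro!: continuous_intros c1\<close>)
  then have S: "(LINT x|lborel. sin (x \<bullet> \<xi>) * dir_deriv v \<phi> x) = - (v \<bullet> \<xi>) * (LINT x|lborel. cos (x \<bullet> \<xi>) * \<phi> x)"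
    unfolding ds using i di by simp
  have pull: "(LINT x|lborel. f x *\<^sub>R (g x *\<^sub>R e)) = (LINT x|lborel. f x * g x) *\<^sub>R e"
    if "integrable lborel (\<lambda>x. f x *\<^sub>R g x)" for f g :: "'a \<Rightarrow> real"
    unfolding scaleR_scaleR by (rule integral_scaleR_left) (use that in simp)
  show "ft (\<lambda>x. dir_deriv v \<phi> x *\<^sub>R e) \<xi> = mulJ v (ft (\<lambda>x. \<phi> x *\<^sub>R e)) \<xi>"
    unfolding ft_def mulJ_def Jrot_def pull[OF i(1)] pull[OF i(2)] pull[OF di(1)] pull[OF di(2)] C S by (simp add: inner_commute)
qed

lemma ft_foldr_dir_deriv:
  fixes \<phi> :: "'a::euclidean_space \<Rightarrow> real" and e :: "'b::euclidean_space"
  shows "test_function \<phi> \<Longrightarrow> ft (\<lambda>x. foldr dir_deriv vs \<phi> x *\<^sub>R e) = foldr mulJ vs (ft (\<lambda>x. \<phi> x *\<^sub>R e))"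
  by (induction vs) (auto simp: ft_dir_deriv test_function_foldr)

section \<open>Weak identities with tests of unbounded support\<close>

definition L2conv :: "(nat \<Rightarrow> 'a::euclidean_space \<Rightarrow> 'b::euclidean_space) \<Rightarrow> ('a \<Rightarrow> 'b) \<Rightarrow> bool" where
  "L2conv F f \<longleftrightarrow> (\<forall>n. F n \<in> Lp 2) \<and> f \<in> Lp 2 \<and> (\<lambda>n. Lp_norm 2 (\<lambda>x. F n x - f x)) \<longlonglongrightarrow> 0"

lemma L2conv_add:
  assumes "L2conv F f" "L2conv G g"
  shows "L2conv (\<lambda>n x. F n x + G n x) (\<lambda>x. f x + g x)"
proof -
  have "(\<lambda>n. Lp_norm 2 (\<lambda>x. F n x - f x) + Lp_norm 2 (\<lambda>x. G n x - g x)) \<longlonglongrightarrow> 0"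
    using assms tendsto_add[of _ 0 _ _ 0] by (auto simp: L2conv_def)
  moreover have "Lp_norm 2 (\<lambda>x. F n x + G n x - (f x + g x)) \<le> Lp_norm 2 (\<lambda>x. F n x - f x) + Lp_norm 2 (\<lambda>x. G n x - g x)" for n
    using assms Lp_norm2_triangle[OF Lp2_diff Lp2_diff, of "F n" f "G n" g] by (simp add: L2conv_def add_diff_add)
  ultimately have "(\<lambda>n. Lp_norm 2 (\<lambda>x. F n x + G n x - (f x + g x))) \<longlonglongrightarrow> 0"
    by (intro Lim_null_comparison[of "\<lambda>n. Lp_norm 2 (\<lambda>x. F n x + G n x - (f x + g x))"]) (auto simp: Lp_norm2_nonneg)
  then show ?thesis using assms by (simp add: L2conv_def Lp2_add)
qed

lemma L2conv_scaleR:
  assumes "L2conv F f" "s \<longlonglongrightarrow> c"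
  shows "L2conv (\<lambda>n x. s n *\<^sub>R F n x) (\<lambda>x. c *\<^sub>R f x)"
proof -
  have "(\<lambda>n. \<bar>s n\<bar> * Lp_norm 2 (\<lambda>x. F n x - f x) + \<bar>s n - c\<bar> * Lp_norm 2 f) \<longlonglongrightarrow> \<bar>c\<bar> * 0 + \<bar>c - c\<bar> * Lp_norm 2 f"
    using assms by (intro tendsto_intros) (auto simp: L2conv_def)
  moreover have "Lp_norm 2 (\<lambda>x. s n *\<^sub>R F n x - c *\<^sub>R f x) \<le> \<bar>s n\<bar> * Lp_norm 2 (\<lambda>x. F n x - f x) + \<bar>s n - c\<bar> * Lp_norm 2 f" for n
  proof -
    have eq: "(\<lambda>x. s n *\<^sub>R F n x - c *\<^sub>R f x) = (\<lambda>x. s n *\<^sub>R (F n x - f x) + (s n - c) *\<^sub>R f x)"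
      by (simp add: fun_eq_iff algebra_simps)
    have "F n \<in> Lp 2" "f \<in> Lp 2" using assms by (auto simp: L2conv_def)
    from Lp_norm2_triangle[OF Lp2_scaleR[OF Lp2_diff[OF this]] Lp2_scaleR[OF this(2)], of "s n" "s n - c"]
    show ?thesis unfolding eq Lp_norm2_scaleR .
  qed
  ultimately have "(\<lambda>n. Lp_norm 2 (\<lambda>x. s n *\<^sub>R F n x - c *\<^sub>R f x)) \<longlonglongrightarrow> 0"
    by (intro Lim_null_comparison[of "\<lambda>n. Lp_norm 2 (\<lambda>x. s n *\<^sub>R F n x - c *\<^sub>R f x)"]) (auto simp: Lp_norm2_nonneg)
  then show ?thesis using assms by (simp add: L2conv_def Lp2_scaleR)
qed

lemma L2conv_inner: "L2conv F f \<Longrightarrow> g \<in> Lp 2 \<Longrightarrow> (\<lambda>n. LINT x|lborel. F n x \<bullet> g x) \<longlonglongrightarrow> (LINT x|lborel. f x \<bullet> g x)"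
  unfolding L2conv_def by (intro Lp2_inner_tendsto) auto

text \<open>The enlarged class of tests: inverse transforms of band-limited amplitudes belong to it,
  though in general they are not compactly supported.\<close>

definition smooth_L2 :: "('a::euclidean_space \<Rightarrow> real) \<Rightarrow> bool" where
  "smooth_L2 \<Phi> \<longleftrightarrow> smooth \<Phi> \<and> (\<forall>vs. foldr dir_deriv vs \<Phi> \<in> Lp 2)"

lemma smooth_L2_dir_deriv: "smooth_L2 \<Phi> \<Longrightarrow> smooth_L2 (dir_deriv v \<Phi>)"
  unfolding smooth_L2_def
proof (intro conjI allI)
  assume a: "smooth \<Phi> \<and> (\<forall>vs. foldr dir_deriv vs \<Phi> \<in> Lp 2)"
  show "smooth (dir_deriv v \<Phi>)" using a smooth_dir_deriv by blast
  show "foldr dir_deriv vs (dir_deriv v \<Phi>) \<in> Lp 2" for vs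
    using a[THEN conjunct2, THEN spec, of "vs @ [v]"] by simp
qed

lemma smooth_L2_ift: "L2_bdd_supp \<psi> \<Longrightarrow> smooth_L2 (ift \<psi>)"
  unfolding smooth_L2_def by (auto simp: smooth_ift foldr_dir_deriv_ift L2_bdd_supp_ift_Lp2 L2_bdd_supp_foldr_mulJ)

lemma foldr_dir_deriv_add:
  assumes "smooth f" "smooth g"
  shows "foldr dir_deriv vs (\<lambda>x. f x + g x) = (\<lambda>x. foldr dir_deriv vs f x + foldr dir_deriv vs g x)"
proof (induction vs)
  case (Cons v vs)
  have *: "foldr dir_deriv vs h differentiable (at x)" if "smooth h" for h x and vs :: "'a list"
    using that by (simp add: smooth_def)
  show ?case using assms by (auto simp: Cons * dir_deriv_add)
qed simp

lemma foldr_dir_deriv_cmult: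
  fixes f :: "_ \<Rightarrow> real"
  assumes "smooth f"
  shows "foldr dir_deriv vs (\<lambda>x. c * f x) = (\<lambda>x. c * foldr dir_deriv vs f x)"
proof (induction vs)
  case (Cons v vs)
  have *: "foldr dir_deriv vs f differentiable (at x)" for x
    using assms by (simp add: smooth_def)
  have "dir_deriv v (\<lambda>x. c * foldr dir_deriv vs f x) x = c * dir_deriv v (foldr dir_deriv vs f) x" for x
    by (rule dir_deriv_eq) (intro has_derivative_mult_right has_derivative_dir_deriv *)
  then show ?case by (auto simp: Cons)
qed simp

text \<open>Every derivative that falls on the dilated cutoff carries a factor 1 / (n + 1) and
  disappears in the limit. The cutoff stays an arbitrary test function, with its value at 0 in the
  limit, because in the induction it is replaced by its own derivatives.\<close>

lemma L2conv_cutoff_foldr: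
  fixes \<eta> \<Phi> :: "'a::euclidean_space \<Rightarrow> real"
  assumes "test_function \<eta>" "smooth_L2 \<Phi>"
  shows "L2conv (\<lambda>n. foldr dir_deriv vs (\<lambda>x. \<eta> (inverse (real (Suc n)) *\<^sub>R x) * \<Phi> x)) (\<lambda>x. \<eta> 0 * foldr dir_deriv vs \<Phi> x)"
  using assms
proof (induction vs arbitrary: \<eta> \<Phi> rule: rev_induct)
  case Nil
  obtain M where M: "0 \<le> M" "\<And>x. \<bar>\<eta> x\<bar> \<le> M" using test_function_bounded[OF Nil(1)] by blast
  have P: "\<Phi> \<in> Lp 2" using Nil(2)[unfolded smooth_L2_def, THEN conjunct2, THEN spec, of "[]"] by simp
  have [measurable]: "\<Phi> \<in> borel_measurable borel" "\<eta> \<in> borel_measurable borel"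
    using P test_function_measurable[OF Nil(1)] by (auto simp: Lp2_iff)
  have "(\<lambda>n. LINT x|lborel. (norm (\<eta> (inverse (real (Suc n)) *\<^sub>R x) * \<Phi> x - \<eta> 0 * \<Phi> x))\<^sup>2) \<longlonglongrightarrow> (LINT x::'a|lborel. 0)"
  proof (rule integral_dominated_convergence[where w="\<lambda>x. (2 * M)\<^sup>2 * (norm (\<Phi> x))\<^sup>2"])
    show "AE x in lborel. (\<lambda>n. (norm (\<eta> (inverse (real (Suc n)) *\<^sub>R x) * \<Phi> x - \<eta> 0 * \<Phi> x))\<^sup>2) \<longlonglongrightarrow> 0"
    proof (rule AE_I2)
      fix x :: 'a
      have "(\<lambda>n. inverse (real (Suc n)) *\<^sub>R x) \<longlonglongrightarrow> 0"
        using tendsto_scaleR[OF LIMSEQ_inverse_real_of_nat tendsto_const[of x]] by simp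
      then have "(\<lambda>n. \<eta> (inverse (real (Suc n)) *\<^sub>R x)) \<longlonglongrightarrow> \<eta> 0"
        by (rule continuous_on_tendsto_compose[OF test_function_continuous[OF Nil(1), of UNIV]]) auto
      then have "(\<lambda>n. (norm (\<eta> (inverse (real (Suc n)) *\<^sub>R x) * \<Phi> x - \<eta> 0 * \<Phi> x))\<^sup>2) \<longlonglongrightarrow> (norm (\<eta> 0 * \<Phi> x - \<eta> 0 * \<Phi> x))\<^sup>2"
        by (intro tendsto_intros)
      then show "(\<lambda>n. (norm (\<eta> (inverse (real (Suc n)) *\<^sub>R x) * \<Phi> x - \<eta> 0 * \<Phi> x))\<^sup>2) \<longlonglongrightarrow> 0" by simp
    qed
    show "AE x in lborel. norm ((norm (\<eta> (inverse (real (Suc n)) *\<^sub>R x) * \<Phi> x - \<eta> 0 * \<Phi> x))\<^sup>2) \<le> (2 * M)\<^sup>2 * (norm (\<Phi> x))\<^sup>2" for n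
    proof (rule AE_I2)
      fix x
      have "\<bar>\<eta> (inverse (real (Suc n)) *\<^sub>R x) - \<eta> 0\<bar> \<le> 2 * M"
        using M(2)[of "inverse (real (Suc n)) *\<^sub>R x"] M(2)[of 0] by linarith
      then have "\<bar>\<eta> (inverse (real (Suc n)) *\<^sub>R x) - \<eta> 0\<bar> * \<bar>\<Phi> x\<bar> \<le> (2 * M) * \<bar>\<Phi> x\<bar>" by (rule mult_right_mono) simp
      then have "norm (\<eta> (inverse (real (Suc n)) *\<^sub>R x) * \<Phi> x - \<eta> 0 * \<Phi> x) \<le> (2 * M) * norm (\<Phi> x)"
        by (simp only: left_diff_distrib[symmetric] real_norm_def abs_mult)
      from power_mono[OF this norm_ge_zero, of 2]
      show "norm ((norm (\<eta> (inverse (real (Suc n)) *\<^sub>R x) * \<Phi> x - \<eta> 0 * \<Phi> x))\<^sup>2) \<le> (2 * M)\<^sup>2 * (norm (\<Phi> x))\<^sup>2"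
        by (simp only: power_mult_distrib real_norm_def abs_of_nonneg[OF zero_le_power2])
    qed
  qed (use P in \<open>simp_all add: Lp2_iff\<close>)
  then have lim: "(\<lambda>n. Lp_norm 2 (\<lambda>x. \<eta> (inverse (real (Suc n)) *\<^sub>R x) * \<Phi> x - \<eta> 0 * \<Phi> x)) \<longlonglongrightarrow> 0"
    unfolding Lp_norm2 using tendsto_real_sqrt by fastforce
  have "(\<lambda>x. \<eta> (inverse (real (Suc n)) *\<^sub>R x) * \<Phi> x) \<in> Lp 2" for n
    by (intro test_function_Lp'(2) test_function_mult test_function_scaling Nil(1)) (use Nil(2) in \<open>auto simp: smooth_L2_def\<close>)
  moreover have "(\<lambda>x. \<eta> 0 * \<Phi> x) \<in> Lp 2" using Lp2_scaleR[OF P, of "\<eta> 0"] by simp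
  ultimately show ?case using lim by (simp add: L2conv_def)
next
  case (snoc v vs)
  let ?s = "\<lambda>n. inverse (real (Suc n))"
  have sm: "smooth \<eta>" "smooth \<Phi>" using snoc.prems by (auto simp: test_function_def smooth_L2_def)
  have s1: "smooth (\<lambda>x. \<eta> (?s n *\<^sub>R x))" "smooth (\<lambda>x. dir_deriv v \<eta> (?s n *\<^sub>R x))" for n
    by (intro smooth_scaling smooth_dir_deriv sm)+
  have 1: "dir_deriv v (\<lambda>x. \<eta> (?s n *\<^sub>R x) * \<Phi> x) = (\<lambda>x. \<eta> (?s n *\<^sub>R x) * dir_deriv v \<Phi> x + ?s n * (dir_deriv v \<eta> (?s n *\<^sub>R x) * \<Phi> x))" for n
    using dir_deriv_scaleR_fun[OF smooth_differentiable[OF s1(1)[of n]] smooth_differentiable[OF sm(2)], of v]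
      dir_deriv_scaling[OF smooth_differentiable[OF sm(1)], of v "?s n"] by (auto simp: fun_eq_iff)
  have 2: "foldr dir_deriv (vs @ [v]) (\<lambda>x. \<eta> (?s n *\<^sub>R x) * \<Phi> x) = (\<lambda>x.
      foldr dir_deriv vs (\<lambda>x. \<eta> (?s n *\<^sub>R x) * dir_deriv v \<Phi> x) x
      + ?s n *\<^sub>R foldr dir_deriv vs (\<lambda>x. dir_deriv v \<eta> (?s n *\<^sub>R x) * \<Phi> x) x)" for n
  proof -
    have "foldr dir_deriv (vs @ [v]) (\<lambda>x. \<eta> (?s n *\<^sub>R x) * \<Phi> x) = foldr dir_deriv vs (\<lambda>x. \<eta> (?s n *\<^sub>R x) * dir_deriv v \<Phi> x + ?s n * (dir_deriv v \<eta> (?s n *\<^sub>R x) * \<Phi> x))"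
      by (simp only: foldr_append foldr.simps comp_apply id_apply 1)
    also have "\<dots> = (\<lambda>x. foldr dir_deriv vs (\<lambda>x. \<eta> (?s n *\<^sub>R x) * dir_deriv v \<Phi> x) x
      + foldr dir_deriv vs (\<lambda>x. ?s n * (dir_deriv v \<eta> (?s n *\<^sub>R x) * \<Phi> x)) x)"
      by (intro foldr_dir_deriv_add smooth_mult smooth_cmult s1 smooth_dir_deriv sm)
    also have "foldr dir_deriv vs (\<lambda>x. ?s n * (dir_deriv v \<eta> (?s n *\<^sub>R x) * \<Phi> x)) = (\<lambda>x. ?s n * foldr dir_deriv vs (\<lambda>x. dir_deriv v \<eta> (?s n *\<^sub>R x) * \<Phi> x) x)"
      by (intro foldr_dir_deriv_cmult smooth_mult s1 sm)
    finally show ?thesis by simp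
  qed
  have "L2conv (\<lambda>n x. foldr dir_deriv vs (\<lambda>x. \<eta> (?s n *\<^sub>R x) * dir_deriv v \<Phi> x) x
      + ?s n *\<^sub>R foldr dir_deriv vs (\<lambda>x. dir_deriv v \<eta> (?s n *\<^sub>R x) * \<Phi> x) x)
      (\<lambda>x. \<eta> 0 * foldr dir_deriv vs (dir_deriv v \<Phi>) x + 0 *\<^sub>R (dir_deriv v \<eta> 0 * foldr dir_deriv vs \<Phi> x))"
    by (intro L2conv_add L2conv_scaleR snoc.IH LIMSEQ_inverse_real_of_nat snoc.prems smooth_L2_dir_deriv test_function_dir_deriv)
  then show ?case unfolding 2 by simp
qed

text \<open>Both sides are continuous in L^2 along the cutoffs of \<Phi>, which are genuine test
  functions.\<close>

lemma weak_identity_extend: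
  fixes w g \<Phi> :: "'a::euclidean_space \<Rightarrow> real"
  assumes w: "w \<in> Lp 2" and g: "g \<in> Lp 2"
    and weak: "\<And>\<phi>. test_function \<phi> \<Longrightarrow> (LINT x|lborel. foldr dir_deriv vs \<phi> x * w x) = c * (LINT x|lborel. \<phi> x * g x)"
    and \<Phi>: "smooth_L2 \<Phi>"
  shows "(LINT x|lborel. foldr dir_deriv vs \<Phi> x * w x) = c * (LINT x|lborel. \<Phi> x * g x)"
proof -
  obtain \<eta> :: "'a \<Rightarrow> real" where \<eta>: "test_function \<eta>" "\<eta> 0 = 1" using exists_bump by blast
  let ?F = "\<lambda>n x. \<eta> (inverse (real (Suc n)) *\<^sub>R x) * \<Phi> x"
  have sm: "smooth \<Phi>" using \<Phi> by (simp add: smooth_L2_def)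
  have t: "test_function (?F n)" for n
    by (intro test_function_mult test_function_scaling \<eta> sm) simp
  have "(\<lambda>n. LINT x|lborel. foldr dir_deriv vs (?F n) x * w x) \<longlonglongrightarrow> (LINT x|lborel. foldr dir_deriv vs \<Phi> x * w x)"
    using L2conv_inner[OF L2conv_cutoff_foldr[OF \<eta>(1) \<Phi>, of vs] w] \<eta>(2) by simp
  moreover have "(\<lambda>n. c * (LINT x|lborel. ?F n x * g x)) \<longlonglongrightarrow> c * (LINT x|lborel. \<Phi> x * g x)"
    using L2conv_inner[OF L2conv_cutoff_foldr[OF \<eta>(1) \<Phi>, of "[]"] g] \<eta>(2) by (intro tendsto_mult tendsto_const) simp
  ultimately show ?thesis unfolding weak[OF t] by (rule LIMSEQ_unique)
qed

section \<open>Linear flows and the compensating matrix\<close>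

text \<open>The exponential exp (t L) applied to a vector, for a bare linear map \<open>L\<close>,
  since the generator used later acts on pairs of vectors rather than as a matrix.\<close>

definition lflow :: "('a::euclidean_space \<Rightarrow> 'a) \<Rightarrow> real \<Rightarrow> 'a \<Rightarrow> 'a" where
  "lflow L t v = (\<Sum>k. (t ^ k / fact k) *\<^sub>R (L ^^ k) v)"

lemma linear_norm_bound:
  assumes "linear (L :: 'a::euclidean_space \<Rightarrow> 'b::real_normed_vector)"
  obtains C where "0 \<le> C" "\<And>v. norm (L v) \<le> C * norm v"
proof -
  have "bounded_linear L" using assms by (simp add: linear_conv_bounded_linear)
  from bounded_linear.nonneg_bounded[OF this] show ?thesis using that by (metis mult.commute)
qed

lemma norm_funpow_le:
  fixes L :: "'a::real_normed_vector \<Rightarrow> 'a"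
  assumes "0 \<le> C" "\<And>v. norm (L v) \<le> C * norm v"
  shows "norm ((L ^^ k) v) \<le> C ^ k * norm v"
proof (induction k)
  case (Suc k)
  have "norm (L ((L ^^ k) v)) \<le> C * (C ^ k * norm v)"
    using assms(2)[of "(L ^^ k) v"] mult_left_mono[OF Suc assms(1)] by linarith
  then show ?case by (simp add: mult.assoc)
qed simp

lemma lflow_summable:
  fixes L :: "'a::euclidean_space \<Rightarrow> 'a"
  assumes "linear L"
  shows "summable (\<lambda>k. (t ^ k / fact k) *\<^sub>R (L ^^ k) v)"
proof -
  obtain C where C: "0 \<le> C" "\<And>v. norm (L v) \<le> C * norm v" using linear_norm_bound[OF assms] by blast
  show ?thesis
  proof (rule summable_comparison_test'[where N=0])
    show "summable (\<lambda>k. inverse (fact k) * (\<bar>t\<bar> * C) ^ k * norm v)"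
      by (intro summable_mult2 summable_exp)
    have "norm ((t ^ k / fact k) *\<^sub>R (L ^^ k) v) \<le> \<bar>t\<bar> ^ k / fact k * (C ^ k * norm v)" for k
      using mult_left_mono[OF norm_funpow_le[OF C, of k v], of "\<bar>t\<bar> ^ k / fact k"] by (simp add: power_abs)
    then show "norm ((t ^ k / fact k) *\<^sub>R (L ^^ k) v) \<le> inverse (fact k) * (\<bar>t\<bar> * C) ^ k * norm v" for k
      by (simp add: power_mult_distrib divide_inverse mult_ac)
  qed
qed

lemma linear_funpow:
  fixes L :: "'a::real_vector \<Rightarrow> 'a"
  assumes "linear L" shows "linear (L ^^ k)"
  by (induction k) (auto intro: linear_compose[unfolded o_def] simp: assms linear_id[unfolded id_def] comp_def id_def)

lemma lflow_commute:
  fixes L :: "'a::euclidean_space \<Rightarrow> 'a" and M :: "'b::euclidean_space \<Rightarrow> 'b"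
  assumes "linear L" "linear M" "bounded_linear T" "\<And>v. T (L v) = M (T v)"
  shows "T (lflow L t v) = lflow M t (T v)"
proof -
  have T: "T ((L ^^ k) v) = (M ^^ k) (T v)" for k by (induction k) (auto simp: assms)
  have "T (lflow L t v) = (\<Sum>k. T ((t ^ k / fact k) *\<^sub>R (L ^^ k) v))"
    unfolding lflow_def by (rule bounded_linear.suminf[OF assms(3) lflow_summable[OF assms(1)]])
  then show ?thesis unfolding lflow_def
    by (simp add: linear_scale[OF bounded_linear.linear[OF assms(3)]] T)
qed

lemma lflow_add:
  fixes L :: "'a::euclidean_space \<Rightarrow> 'a"
  assumes "linear L" shows "lflow L t (v + w) = lflow L t v + lflow L t w"
  unfolding lflow_def
  by (subst suminf_add[OF lflow_summable lflow_summable, OF assms assms])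
    (simp add: linear_add[OF linear_funpow[OF assms]] scaleR_add_right)

lemma lflow_scaleR:
  fixes L :: "'a::euclidean_space \<Rightarrow> 'a"
  assumes "linear L" shows "lflow L t (a *\<^sub>R v) = a *\<^sub>R lflow L t v"
proof -
  have "a *\<^sub>R lflow L t v = (\<Sum>k. a *\<^sub>R ((t ^ k / fact k) *\<^sub>R (L ^^ k) v))"
    unfolding lflow_def
    by (rule bounded_linear.suminf[OF bounded_linear_scaleR_right lflow_summable[OF assms]])
  then show ?thesis
    unfolding lflow_def by (simp add: linear_scale[OF linear_funpow[OF assms]] mult.commute)
qed

lemma lflow_linear: "linear L \<Longrightarrow> linear (lflow L t)"
  by (rule linearI) (auto simp: lflow_add lflow_scaleR)

lemma lflow_0: "lflow L 0 v = v"
proof -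
  have "lflow L 0 v = (\<Sum>k\<in>{0}. (0 ^ k / fact k) *\<^sub>R (L ^^ k) v)"
    unfolding lflow_def by (rule suminf_finite) auto
  then show ?thesis by simp
qed

lemma lflow_zero_vec: "linear L \<Longrightarrow> lflow L t 0 = 0"
  using linear_0[OF lflow_linear] by blast

lemma lflow_adjoint:
  fixes L :: "'a::euclidean_space \<Rightarrow> 'a"
  assumes "linear L" "linear M" and adj: "\<And>v w. L v \<bullet> w = v \<bullet> M w"
  shows "lflow L t v \<bullet> w = v \<bullet> lflow M t w"
proof -
  have p: "(L ^^ k) v \<bullet> w = v \<bullet> (M ^^ k) w" for k
  proof (induction k arbitrary: w)
    case (Suc k)
    have "(L ^^ Suc k) v \<bullet> w = v \<bullet> (M ^^ k) (M w)" by (simp add: adj Suc)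
    then show ?case by (simp only: funpow_Suc_right comp_apply)
  qed simp
  have "lflow L t v \<bullet> w = (\<Sum>k. ((t ^ k / fact k) *\<^sub>R (L ^^ k) v) \<bullet> w)"
    unfolding lflow_def by (rule bounded_linear.suminf[OF bounded_linear_inner_left lflow_summable[OF assms(1)]])
  also have "\<dots> = (\<Sum>k. v \<bullet> ((t ^ k / fact k) *\<^sub>R (M ^^ k) w))" by (simp add: p)
  also have "\<dots> = v \<bullet> lflow M t w"
    unfolding lflow_def by (rule bounded_linear.suminf[OF bounded_linear_inner_right lflow_summable[OF assms(2)], symmetric])
  finally show ?thesis .
qed

text \<open>In each coordinate the flow is a real power series in t, so termwise differentiation
  applies; shifting the coefficients inserts one \<open>L\<close>.\<close>

lemma lflow_has_vector_derivative:
  fixes L :: "'a::euclidean_space \<Rightarrow> 'a"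
  assumes "linear L"
  shows "((\<lambda>t. lflow L t v) has_vector_derivative L (lflow L t v)) (at t within S)"
proof -
  have "((\<lambda>t. lflow L t v) has_derivative (\<lambda>h. h *\<^sub>R L (lflow L t v))) (at t)"
  proof (subst has_derivative_componentwise_within, rule ballI)
    fix b :: 'a assume "b \<in> Basis"
    define c where "c k = ((L ^^ k) v \<bullet> b) / fact k" for k
    have eq: "lflow L s w \<bullet> b = (\<Sum>k. ((L ^^ k) w \<bullet> b) / fact k * s ^ k)"
      and sm: "summable (\<lambda>k. ((L ^^ k) w \<bullet> b) / fact k * s ^ k)" for s w
      unfolding lflow_def bounded_linear.suminf[OF bounded_linear_inner_left lflow_summable[OF assms]]
      using bounded_linear.summable[OF bounded_linear_inner_left lflow_summable[OF assms], of s w b]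
      by (simp_all add: mult.commute)
    have "summable (\<lambda>k. c k * (\<bar>t\<bar> + 1) ^ k)" unfolding c_def by (rule sm)
    then have "DERIV (\<lambda>s. \<Sum>k. c k * s ^ k) t :> (\<Sum>k. diffs c k * t ^ k)"
      by (rule termdiffs_strong) auto
    moreover have "diffs c k = ((L ^^ k) (L v) \<bullet> b) / fact k" for k
      by (simp add: diffs_def c_def funpow_swap1 divide_simps del: of_nat_Suc)
    ultimately have "DERIV (\<lambda>s. lflow L s v \<bullet> b) t :> lflow L t (L v) \<bullet> b"
      by (simp add: eq c_def)
    moreover have "lflow L t (L v) = L (lflow L t v)"
      using lflow_commute[OF assms assms, of L t v] assms by (simp add: linear_conv_bounded_linear)
    ultimately show "((\<lambda>t. lflow L t v \<bullet> b) has_derivative (\<lambda>h. (h *\<^sub>R L (lflow L t v)) \<bullet> b)) (at t)"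
      by (simp add: has_field_derivative_def mult.commute[of _ "L (lflow L t v) \<bullet> b"] fun_eq_iff)
  qed
  then show ?thesis unfolding has_vector_derivative_def by (rule has_derivative_at_withinI)
qed

lemma lflow_measurable:
  fixes L :: "'x::euclidean_space \<Rightarrow> 'a::euclidean_space \<Rightarrow> 'a"
  assumes L: "\<And>g. g \<in> borel_measurable borel \<Longrightarrow> (\<lambda>\<xi>. L \<xi> (g \<xi>)) \<in> borel_measurable borel"
    and g: "g \<in> borel_measurable borel"
  shows "(\<lambda>\<xi>. lflow (L \<xi>) t (g \<xi>)) \<in> borel_measurable borel"
proof -
  have "(\<lambda>\<xi>. (L \<xi> ^^ k) (g \<xi>)) \<in> borel_measurable borel" for k
    by (induction k) (auto simp: g L)
  then show ?thesis unfolding lflow_def by (intro borel_measurable_suminf borel_measurable_scaleR) auto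
qed

text \<open>Contractivity keeps the constants independent of the times involved: the derivative is
  at most C |v|, so the flow is Lipschitz, and applying \<open>L\<close> once more makes the
  derivative Lipschitz with constant C^2 |v|.\<close>

lemma lflow_taylor:
  fixes L :: "'a::euclidean_space \<Rightarrow> 'a"
  assumes lin: "linear L" and C: "0 \<le> C" "\<And>v. norm (L v) \<le> C * norm v"
    and contr: "\<And>s v. 0 \<le> s \<Longrightarrow> norm (lflow L s v) \<le> norm v" and "0 \<le> s" "0 \<le> t"
  shows "norm (lflow L t v - lflow L s v - (t - s) *\<^sub>R L (lflow L s v)) \<le> C\<^sup>2 * (t - s)\<^sup>2 * norm v"
    and "norm (lflow L t v - lflow L s v) \<le> C * \<bar>t - s\<bar> * norm v"
proof -
  note d = lflow_has_vector_derivative[OF lin]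
  have lip: "norm (lflow L b v - lflow L a v) \<le> C * \<bar>b - a\<bar> * norm v" if "0 \<le> a" "0 \<le> b" for a b
  proof -
    have "norm (lflow L b v - lflow L a v) \<le> C * norm v * norm (b - a)"
    proof (rule differentiable_bound[where S="{0..}" and f'="\<lambda>s h. h *\<^sub>R L (lflow L s v)"])
      show "((\<lambda>s. lflow L s v) has_derivative (\<lambda>h. h *\<^sub>R L (lflow L x v))) (at x within {0..})" for x
        using d unfolding has_vector_derivative_def .
      show "onorm (\<lambda>h. h *\<^sub>R L (lflow L x v)) \<le> C * norm v" if "x \<in> {0..}" for x
      proof (rule onorm_le)
        fix h :: real
        have "norm (L (lflow L x v)) \<le> C * norm v"
          using C(2)[of "lflow L x v"] contr[of x v] that C(1) mult_left_mono[of "norm (lflow L x v)" "norm v" C] by auto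
        then show "norm (h *\<^sub>R L (lflow L x v)) \<le> C * norm v * norm h"
          using mult_left_mono[of "norm (L (lflow L x v))" "C * norm v" "\<bar>h\<bar>"] by (simp add: mult.commute)
      qed
    qed (use that in auto)
    then show ?thesis by (simp add: mult_ac)
  qed
  then show "norm (lflow L t v - lflow L s v) \<le> C * \<bar>t - s\<bar> * norm v" using assms by blast
  have "norm (lflow L t v - lflow L s v - (t - s) *\<^sub>R L (lflow L s v)) \<le> norm (t - s) * (C * (C * \<bar>t - s\<bar> * norm v))"
  proof (rule vector_differentiable_bound_linearization[where S="closed_segment s t" and f'="\<lambda>s. L (lflow L s v)"])
    fix x assume x: "x \<in> closed_segment s t"
    then have x0: "0 \<le> x" and xs: "\<bar>x - s\<bar> \<le> \<bar>t - s\<bar>"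
      using assms by (auto simp: closed_segment_eq_real_ivl split: if_splits)
    show "norm (L (lflow L x v) - L (lflow L s v)) \<le> C * (C * \<bar>t - s\<bar> * norm v)"
    proof -
      have "norm (L (lflow L x v) - L (lflow L s v)) \<le> C * norm (lflow L x v - lflow L s v)"
        using C(2) by (simp add: linear_diff[OF lin, symmetric])
      also have "\<dots> \<le> C * (C * \<bar>x - s\<bar> * norm v)"
        by (intro mult_left_mono lip C x0 assms)
      also have "\<dots> \<le> C * (C * \<bar>t - s\<bar> * norm v)"
        by (intro mult_left_mono mult_right_mono C xs) auto
      finally show ?thesis .
    qed
  qed (use d in auto)
  then show "norm (lflow L t v - lflow L s v - (t - s) *\<^sub>R L (lflow L s v)) \<le> C\<^sup>2 * (t - s)\<^sup>2 * norm v"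
    by (simp add: power2_eq_square mult_ac abs_mult_self_eq)
qed

lemma gronwall_exp:
  fixes y :: "real \<Rightarrow> real"
  assumes d: "\<And>s. 0 \<le> s \<Longrightarrow> (y has_real_derivative y' s) (at s)"
    and le: "\<And>s. 0 \<le> s \<Longrightarrow> y' s \<le> - d * y s + k * exp (- \<mu> * s)" and "\<mu> < d" "0 \<le> k" "0 \<le> t"
  shows "y t \<le> exp (- d * t) * y 0 + k / (d - \<mu>) * exp (- \<mu> * t)"
proof -
  \<comment> \<open>The integrating factor times y, minus the same factor times the particular
    solution k / (d - \<mu>) exp (- \<mu> s); the differential inequality says that this difference
    decreases.\<close>
  define z where "z s = exp (d * s) * y s - k / (d - \<mu>) * exp ((d - \<mu>) * s)" for s
  have "z t \<le> z 0"
  proof (rule DERIV_nonpos_imp_nonincreasing[OF \<open>0 \<le> t\<close>])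
    fix s assume s: "0 \<le> s" "s \<le> t"
    have "(z has_real_derivative (exp (d * s) * d * y s + y' s * exp (d * s)
      - k / (d - \<mu>) * (exp ((d - \<mu>) * s) * (d - \<mu>)))) (at s)"
      unfolding z_def[abs_def] using assms(3) by (auto intro!: derivative_eq_intros d s)
    moreover have "exp (d * s) * d * y s + y' s * exp (d * s) - k / (d - \<mu>) * (exp ((d - \<mu>) * s) * (d - \<mu>)) \<le> 0"
    proof -
      have "exp (d * s) * y' s \<le> exp (d * s) * (- d * y s + k * exp (- \<mu> * s))"
        using le[OF s(1)] by simp
      also have "\<dots> = - (exp (d * s) * d * y s) + k * exp ((d - \<mu>) * s)"
        by (simp add: exp_add[symmetric] algebra_simps)
      finally show ?thesis using assms(3) by (simp add: mult_ac)
    qed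
    ultimately show "\<exists>u. (z has_real_derivative u) (at s) \<and> u \<le> 0" by blast
  qed
  moreover have "0 \<le> k / (d - \<mu>)" using assms(3,4) by simp
  ultimately have "exp (d * t) * y t \<le> y 0 + k / (d - \<mu>) * exp ((d - \<mu>) * t)"
    by (simp add: z_def)
  then have "exp (- d * t) * (exp (d * t) * y t) \<le> exp (- d * t) * (y 0 + k / (d - \<mu>) * exp ((d - \<mu>) * t))"
    by (rule mult_left_mono) simp
  also have "exp (- d * t) * (exp (d * t) * y t) = y t"
    by (simp add: mult.assoc[symmetric] exp_add[symmetric])
  also have "exp (- d * t) * (y 0 + k / (d - \<mu>) * exp ((d - \<mu>) * t))
    = exp (- d * t) * y 0 + k / (d - \<mu>) * (exp (- d * t) * exp ((d - \<mu>) * t))"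
    by (simp only: distrib_left mult.left_commute)
  also have "exp (- d * t) * exp ((d - \<mu>) * t) = exp (- \<mu> * t)"
    by (simp add: exp_add[symmetric] algebra_simps)
  finally show ?thesis .
qed

section \<open>Symmetric matrices and the equation Q + [[Q, G], G] = R\<close>

lemma bounded_bilinear_mv: "bounded_bilinear ((*v) :: real^'n^'m \<Rightarrow> real^'n \<Rightarrow> real^'m)"
  unfolding bilinear_conv_bounded_bilinear[symmetric] bilinear_def
  by (intro conjI allI linearI)
    (simp_all add: matrix_vector_mult_add_rdistrib matrix_vector_right_distrib matrix_vector_mult_scaleR scaleR_matrix_vector_assoc)

lemmas mv_simps = matrix_vector_mult_add_rdistrib matrix_vector_mult_diff_rdistrib matrix_vector_right_distrib
  matrix_vector_mult_diff_distrib matrix_vector_mult_scaleR scaleR_matrix_vector_assoc[symmetric] matrix_vector_mul_assoc[symmetric]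

lemma inner_transpose: "x \<bullet> (transpose B *v y) = (B *v x) \<bullet> y" for B :: "real^'n^'m"
  by (simp add: inner_commute[of x] dot_lmul_matrix) (simp add: inner_commute)

lemma inner_sym: "transpose G = G \<Longrightarrow> x \<bullet> (G *v y) = (G *v x) \<bullet> y" for G :: "real^'n^'n"
  using inner_transpose[of x G y] by simp

text \<open>The inner product of matrices is the Frobenius one, and right multiplication by a
  symmetric matrix acts on each row separately.\<close>

lemma inner_mult_right_sym:
  fixes X Y G :: "real^'n^'n"
  assumes "transpose G = G"
  shows "(X ** G) \<bullet> Y = X \<bullet> (Y ** G)"
proof -
  have row: "(Z ** G) $ i = G *v (Z $ i)" for Z :: "real^'n^'n" and i
  proof -
    have "(Z ** G) $ i = transpose G *v (Z $ i)"
      by (simp add: vec_eq_iff matrix_matrix_mult_def vector_matrix_mult_def mult.commute)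
    then show ?thesis by (simp only: assms)
  qed
  show ?thesis unfolding inner_vec_def[of "X ** G"] inner_vec_def[of X] row
    using inner_sym[OF assms] by (simp add: inner_commute)
qed

lemma inner_matrix_transpose: "transpose X \<bullet> transpose Y = X \<bullet> Y" for X Y :: "real^'n^'n"
proof -
  have "transpose X \<bullet> transpose Y = (\<Sum>i\<in>UNIV. \<Sum>j\<in>UNIV. X $ j $ i * Y $ j $ i)"
    by (simp add: inner_vec_def transpose_def)
  also have "\<dots> = (\<Sum>j\<in>UNIV. \<Sum>i\<in>UNIV. X $ j $ i * Y $ j $ i)" by (rule sum.swap)
  finally show ?thesis by (simp add: inner_vec_def)
qed

lemma inner_mult_left_sym:
  fixes X Y G :: "real^'n^'n"
  assumes "transpose G = G"
  shows "(G ** X) \<bullet> Y = X \<bullet> (G ** Y)"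
proof -
  have "(G ** X) \<bullet> Y = (transpose X ** G) \<bullet> transpose Y"
    by (subst inner_matrix_transpose[symmetric]) (simp add: matrix_transpose_mul assms)
  also have "\<dots> = transpose X \<bullet> (transpose Y ** G)" by (rule inner_mult_right_sym[OF assms])
  also have "\<dots> = X \<bullet> (G ** Y)"
    by (subst (2) inner_matrix_transpose[symmetric]) (simp add: matrix_transpose_mul assms)
  finally show ?thesis .
qed

definition comm :: "real^'n^'n \<Rightarrow> real^'n^'n \<Rightarrow> real^'n^'n" where
  "comm Q G = Q ** G - G ** Q"

lemma comm_linear: "linear (\<lambda>Q. comm Q G)"
  by (rule linearI) (simp_all add: comm_def matrix_matrix_mult_def vec_eq_iff sum.distrib sum_distrib_left algebra_simps)

lemma inner_comm: "transpose G = G \<Longrightarrow> comm X G \<bullet> Y = X \<bullet> comm Y G"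
  by (simp add: comm_def inner_diff_left inner_diff_right inner_mult_right_sym inner_mult_left_sym)

text \<open>For symmetric G the commutator with G is self-adjoint in the Frobenius inner product, so
  the left side is the identity plus the square of a self-adjoint map. It dominates the identity,
  hence is injective and, in finite dimension, onto, with an inverse of norm at most 1.\<close>

lemma lyapunov_exists:
  fixes G R :: "real^'n^'n"
  assumes G: "transpose G = G"
  shows "\<exists>Q. Q + comm (comm Q G) G = R"
    and "Q + comm (comm Q G) G = R \<Longrightarrow> norm Q \<le> norm R"
proof -
  have lb: "(norm Q)\<^sup>2 \<le> Q \<bullet> (Q + comm (comm Q G) G)" for Q :: "real^'n^'n"
  proof -
    have "Q \<bullet> comm (comm Q G) G = comm Q G \<bullet> comm Q G" using inner_comm[OF G, of Q "comm Q G"] by simp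
    also have "\<dots> \<ge> 0" by simp
    finally show ?thesis by (simp add: inner_add_right power2_norm_eq_inner)
  qed
  have lin: "linear (\<lambda>Q. Q + comm (comm Q G) G)"
    using linear_compose_add[OF linear_id linear_compose[OF comm_linear comm_linear]] by (simp add: o_def id_def)
  have "inj (\<lambda>Q. Q + comm (comm Q G) G)"
    unfolding linear_injective_0[OF lin] using lb by (metis inner_zero_right norm_eq_zero power2_less_eq_zero_iff)
  then have "surj (\<lambda>Q. Q + comm (comm Q G) G)" by (rule linear_inj_imp_surj[OF lin])
  from surjD[OF this, of R] show "\<exists>Q. Q + comm (comm Q G) G = R" by auto
  assume "Q + comm (comm Q G) G = R"
  then have "(norm Q)\<^sup>2 \<le> norm Q * norm R" using lb[of Q] norm_cauchy_schwarz[of Q R] by simp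
  then show "norm Q \<le> norm R" by (cases "Q = 0") (auto simp: power2_eq_square)
qed

text \<open>Transposition changes the sign of each commutator with G, so the double commutator is
  preserved; uniqueness does the rest.\<close>

lemma lyapunov_symmetric:
  fixes G R :: "real^'n^'n"
  assumes G: "transpose G = G" and R: "transpose R = R" and Q: "Q + comm (comm Q G) G = R"
  shows "transpose Q = Q"
proof -
  have td: "transpose (X - Y) = transpose X - transpose Y" and ta: "transpose (X + Y) = transpose X + transpose Y"
    for X Y :: "real^'n^'n" by (simp_all add: transpose_def vec_eq_iff)
  have tc: "transpose (comm X G) = - comm (transpose X) G" for X
    by (simp add: comm_def td matrix_transpose_mul G)
  have neg: "comm (- X) G = - comm X G" for X using linear_neg[OF comm_linear] .
  have "transpose Q + comm (comm (transpose Q) G) G = R"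
    using arg_cong[OF Q, of transpose] by (simp add: R ta tc neg)
  moreover have "(transpose Q - Q) + comm (comm (transpose Q - Q) G) G
      = (transpose Q + comm (comm (transpose Q) G) G) - (Q + comm (comm Q G) G)"
    by (simp add: linear_diff[OF comm_linear])
  ultimately have "(transpose Q - Q) + comm (comm (transpose Q - Q) G) G = 0"
    using Q by simp
  then have "norm (transpose Q - Q) \<le> norm (0 :: real^'n^'n)" by (rule lyapunov_exists(2)[OF G])
  then show ?thesis by simp
qed


text \<open>The expansion Q G^2 - 2 G Q G + G^2 Q on vectors, the form in which both the quadratic
  form and the continuity of the equation are read off.\<close>

lemma lyapunov_apply:
  fixes G R Q :: "real^'n^'n"
  shows "(Q + comm (comm Q G) G) *v y = Q *v y + Q *v (G *v (G *v y)) - 2 *\<^sub>R (G *v (Q *v (G *v y))) + G *v (G *v (Q *v y))"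
  by (simp add: comm_def mv_simps scaleR_2)

text \<open>Moving from x along R x changes the quadratic form by 2 s |R x|^2 to first order, which
  a small negative s would make negative.\<close>

lemma psd_null_vector:
  fixes R :: "'a::real_inner \<Rightarrow> 'a"
  assumes Z: "subspace Z" and lin: "linear R" and sym: "\<And>x y. x \<in> Z \<Longrightarrow> y \<in> Z \<Longrightarrow> x \<bullet> R y = R x \<bullet> y"
    and psd: "\<And>y. y \<in> Z \<Longrightarrow> 0 \<le> y \<bullet> R y" and x: "x \<in> Z" "R x \<in> Z" "x \<bullet> R x = 0"
  shows "R x = 0"
proof -
  define y where "y = R x"
  have q: "0 \<le> 2 * s * (y \<bullet> y) + s\<^sup>2 * (y \<bullet> R y)" for s
  proof -
    have "x + s *\<^sub>R y \<in> Z" using Z x by (simp add: y_def subspace_add subspace_scale)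
    from psd[OF this] have "0 \<le> x \<bullet> R x + s * (x \<bullet> R y) + s * (y \<bullet> R x) + s\<^sup>2 * (y \<bullet> R y)"
      by (simp add: linear_add[OF lin] linear_scale[OF lin] inner_simps power2_eq_square algebra_simps)
    moreover have "x \<bullet> R y = y \<bullet> y" "y \<bullet> R x = y \<bullet> y" using sym[of x y] x by (auto simp: y_def)
    ultimately show ?thesis using x(3) by simp
  qed
  have "y \<bullet> y = 0"
  proof (rule ccontr)
    assume "y \<bullet> y \<noteq> 0"
    then have pos: "0 < y \<bullet> y" by simp
    define k where "k = y \<bullet> R y"
    have k: "0 \<le> k" using psd[of y] x by (simp add: k_def y_def)
    \<comment> \<open>Small enough that the quadratic contribution |s| k stays below |y|^2; the
      added 1 keeps the denominator positive when k = 0.\<close>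
    define s where "s = - (y \<bullet> y) / (k + 1)"
    have s: "s < 0" using pos k by (simp add: s_def)
    have "0 \<le> s * (2 * (y \<bullet> y) + s * k)" using q[of s] by (simp add: k_def power2_eq_square algebra_simps)
    then have "2 * (y \<bullet> y) + s * k \<le> 0" using s by (simp add: zero_le_mult_iff)
    moreover have "- s * k \<le> y \<bullet> y" using pos k by (simp add: s_def field_simps)
    ultimately show False using pos by linarith
  qed
  then show ?thesis by (simp add: y_def)
qed

text \<open>A minimiser of the Rayleigh quotient on the unit sphere of Z: there R - \<nu> is
  positive semidefinite and vanishes at the minimiser, so \<open>psd_null_vector\<close>
  applies.\<close>

lemma symmetric_eigenvector:
  fixes R :: "'a::euclidean_space \<Rightarrow> 'a"
  assumes Z: "subspace Z" and "x \<in> Z" "x \<noteq> 0" and lin: "linear R"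
    and sym: "\<And>x y. x \<bullet> R y = R x \<bullet> y" and inv: "\<And>z. z \<in> Z \<Longrightarrow> R z \<in> Z"
  obtains z \<nu> where "z \<in> Z" "norm z = 1" "R z = \<nu> *\<^sub>R z" "\<And>y. y \<in> Z \<Longrightarrow> \<nu> * (norm y)\<^sup>2 \<le> y \<bullet> R y"
proof -
  let ?S = "sphere 0 1 \<inter> Z"
  have "compact ?S" by (intro compact_Int_closed closed_subspace Z) auto
  moreover have "x /\<^sub>R norm x \<in> ?S" using assms by (simp add: subspace_scale)
  moreover have "continuous_on ?S (\<lambda>y. y \<bullet> R y)"
    by (intro continuous_on_inner continuous_on_id linear_continuous_on) (simp add: lin linear_conv_bounded_linear[symmetric])
  ultimately obtain z where z: "z \<in> ?S" "\<And>y. y \<in> ?S \<Longrightarrow> z \<bullet> R z \<le> y \<bullet> R y"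
    using continuous_attains_inf[of ?S "\<lambda>y. y \<bullet> R y"] by blast
  define \<nu> where "\<nu> = z \<bullet> R z"
  have min: "\<nu> * (norm y)\<^sup>2 \<le> y \<bullet> R y" if "y \<in> Z" for y
  proof (cases "y = 0")
    case False
    have "y /\<^sub>R norm y \<in> ?S" using that False Z by (simp add: subspace_scale)
    from z(2)[OF this] have "\<nu> \<le> inverse (norm y) * (inverse (norm y) * (y \<bullet> R y))"
      by (simp add: \<nu>_def linear_scale[OF lin])
    then show ?thesis using False by (simp add: field_simps power2_eq_square)
  qed (simp add: linear_0[OF lin])
  have "R z - \<nu> *\<^sub>R z = 0"
  proof (rule psd_null_vector[where R="\<lambda>y. R y - \<nu> *\<^sub>R y", OF Z])
    show "linear (\<lambda>y. R y - \<nu> *\<^sub>R y)" by (rule linear_compose_sub[OF lin]) (simp add: linear_iff scaleR_add_right)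
    show "x \<bullet> (R y - \<nu> *\<^sub>R y) = (R x - \<nu> *\<^sub>R x) \<bullet> y" for x y
      by (simp add: inner_diff_left inner_diff_right sym)
    show "0 \<le> y \<bullet> (R y - \<nu> *\<^sub>R y)" if "y \<in> Z" for y
      using min[OF that] by (simp add: inner_diff_right power2_norm_eq_inner)
    show "z \<in> Z" using z by simp
    then show "R z - \<nu> *\<^sub>R z \<in> Z" using inv[of z] Z by (simp add: subspace_diff subspace_scale)
    show "z \<bullet> (R z - \<nu> *\<^sub>R z) = 0" using z(1) by (simp add: \<nu>_def inner_diff_right norm_eq_1)
  qed
  then show thesis using that[of z \<nu>] z(1) min by simp
qed

text \<open>Let z be a unit eigenvector for the least eigenvalue \<nu> of Q. The quadratic form of
  the equation at z gives |P z|^2 = \<nu> + 2 \<nu> |G z|^2 - 2 (G z) . Q (G z), at most \<nu> by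
  minimality, so \<nu> >= 0. If \<nu> = 0, the same identity shows that the kernel of Q is invariant
  under G and annihilated by P; it then contains an eigenvector of G that the hypothesis
  excludes.\<close>

lemma lyapunov_positive:
  fixes G P Q :: "real^'n^'n"
  assumes G: "transpose G = G" and P: "transpose P = P" "P ** P = P"
    and no: "\<And>v \<mu>. v \<noteq> 0 \<Longrightarrow> G *v v = \<mu> *\<^sub>R v \<Longrightarrow> P *v v \<noteq> 0"
    and Q: "Q + comm (comm Q G) G = P" and "x \<noteq> 0"
  shows "0 < x \<bullet> (Q *v x)"
proof -
  have Qs: "transpose Q = Q" by (rule lyapunov_symmetric[OF G P(1) Q])
  note sQ = inner_sym[OF Qs] and sG = inner_sym[OF G]
  have PP: "y \<bullet> (P *v y) = (norm (P *v y))\<^sup>2" for y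
    using inner_sym[OF P(1), of y "P *v y"] by (simp add: matrix_vector_mul_assoc P(2) power2_norm_eq_inner)
  \<comment> \<open>The equation for \<open>Q\<close> as a quadratic form, with the symmetry of
    \<open>Q\<close> and \<open>G\<close> used to balance the factors.\<close>
  have key: "(norm (P *v y))\<^sup>2 = y \<bullet> (Q *v y) + 2 * ((Q *v y) \<bullet> (G *v (G *v y))) - 2 * ((G *v y) \<bullet> (Q *v (G *v y)))" for y
  proof -
    have "P *v y = Q *v y + Q *v (G *v (G *v y)) - 2 *\<^sub>R (G *v (Q *v (G *v y))) + G *v (G *v (Q *v y))"
      using lyapunov_apply[of Q G y] Q by simp
    then have "y \<bullet> (P *v y) = y \<bullet> (Q *v y) + y \<bullet> (Q *v (G *v (G *v y))) - 2 * (y \<bullet> (G *v (Q *v (G *v y)))) + y \<bullet> (G *v (G *v (Q *v y)))"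
      by (simp add: inner_add_right inner_diff_right)
    moreover have "y \<bullet> (Q *v (G *v (G *v y))) = (Q *v y) \<bullet> (G *v (G *v y))" by (rule sQ)
    moreover have "y \<bullet> (G *v (Q *v (G *v y))) = (G *v y) \<bullet> (Q *v (G *v y))" by (rule sG)
    moreover have "y \<bullet> (G *v (G *v (Q *v y))) = (Q *v y) \<bullet> (G *v (G *v y))"
      by (simp only: sG[of y] sG[of "G *v y"]) (simp add: inner_commute)
    ultimately show ?thesis using PP[of y] by simp
  qed
  obtain z \<nu> where z: "norm z = 1" "Q *v z = \<nu> *\<^sub>R z" and min: "\<And>y. \<nu> * (norm y)\<^sup>2 \<le> y \<bullet> (Q *v y)"
    using symmetric_eigenvector[of UNIV x "(*v) Q"] \<open>x \<noteq> 0\<close> sQ by auto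
  have "(norm (P *v z))\<^sup>2 \<le> \<nu>"
  proof -
    have "z \<bullet> (G *v (G *v z)) = (norm (G *v z))\<^sup>2" by (simp add: sG power2_norm_eq_inner)
    then show ?thesis using key[of z] min[of "G *v z"] z by (simp add: norm_eq_1 power2_norm_eq_inner[symmetric])
  qed
  then have l0: "0 \<le> \<nu>" by (rule order_trans[OF zero_le_power2])
  have "\<nu> \<noteq> 0"
  proof
    assume 0: "\<nu> = 0"
    let ?Z = "{y. Q *v y = 0}"
    have Z: "subspace ?Z" by (simp add: subspace_def mv_simps)
    have psd: "0 \<le> y \<bullet> (Q *v y)" for y using min[of y] 0 by simp
    have ker: "P *v y = 0 \<and> G *v y \<in> ?Z" if "y \<in> ?Z" for y
    proof -
      have "(norm (P *v y))\<^sup>2 + 2 * ((G *v y) \<bullet> (Q *v (G *v y))) = 0" using key[of y] that by simp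
      moreover have "0 \<le> (norm (P *v y))\<^sup>2" by simp
      ultimately have "(norm (P *v y))\<^sup>2 = 0" and g: "(G *v y) \<bullet> (Q *v (G *v y)) = 0"
        using psd[of "G *v y"] by linarith+
      moreover have "Q *v (G *v y) = 0"
        by (rule psd_null_vector[where R="(*v) Q" and Z=UNIV]) (use sQ psd g in auto)
      ultimately show ?thesis by simp
    qed
    have "z \<in> ?Z" "z \<noteq> 0" using z 0 by auto
    then obtain u \<mu> where u: "u \<in> ?Z" "norm u = 1" "G *v u = \<mu> *\<^sub>R u"
      using symmetric_eigenvector[OF Z, of z "(*v) G"] sG ker by (metis matrix_vector_mul_linear)
    then show False using no[of u \<mu>] ker[of u] by force
  qed
  then have "0 < \<nu> * (norm x)\<^sup>2" using l0 \<open>x \<noteq> 0\<close> by simp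
  then show ?thesis using min[of x] by linarith
qed

lemma symbol_add: "symbol A (\<xi> + \<zeta>) = symbol A \<xi> + symbol A \<zeta>"
  by (simp add: symbol_def scaleR_add_left sum.distrib)

lemma symbol_scaleR: "symbol A (r *\<^sub>R \<xi>) = r *\<^sub>R symbol A \<xi>"
  by (simp add: symbol_def scaleR_sum_right)

lemma symbol_linear: "linear (symbol A)"
  by (rule linearI) (auto simp: symbol_add symbol_scaleR)

lemma symbol_transpose: "(\<And>\<alpha>. transpose (A \<alpha>) = A \<alpha>) \<Longrightarrow> transpose (symbol A \<xi>) = symbol A \<xi>"
  by (simp add: symbol_def transpose_def vec_eq_iff)

text \<open>The solution \<open>Q\<close> of \<open>Q + [[Q, G], G] = P\<close> is \<open>\<integral>\<^sub>0\<^sup>\<infinity> e\<^sup>-\<^sup>s Re (e\<^sup>-\<^sup>i\<^sup>s\<^sup>G P e\<^sup>i\<^sup>s\<^sup>G) ds\<close>; it is positive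
  because of the eigenvector condition, and \<open>[Q, G]\<close> is a compensating matrix in the sense of Kawashima.\<close>

lemma compensator_uniform:
  fixes A :: "'m::finite \<Rightarrow> real^'n^'n" and P :: "real^'n^'n"
  assumes A: "\<And>\<alpha>. transpose (A \<alpha>) = A \<alpha>" and P: "transpose P = P" "P ** P = P"
    and no: "\<And>\<xi> v \<mu>. \<xi> \<noteq> 0 \<Longrightarrow> v \<noteq> 0 \<Longrightarrow> symbol A \<xi> *v v = \<mu> *\<^sub>R v \<Longrightarrow> P *v v \<noteq> 0"
  obtains c \<kappa> where "0 < c" "0 < \<kappa>"
    "\<And>\<omega>. norm \<omega> = 1 \<Longrightarrow> \<exists>Q. transpose Q = Q \<and> Q + comm (comm Q (symbol A \<omega>)) (symbol A \<omega>) = P \<and>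
      (\<forall>x. c * (norm x)\<^sup>2 \<le> x \<bullet> (Q *v x)) \<and> (\<forall>x. norm (comm Q (symbol A \<omega>) *v x) \<le> \<kappa> * norm x)"
proof -
  note bb = bounded_bilinear.continuous_on[OF bounded_bilinear_mv]
  have sT: "transpose (symbol A \<omega>) = symbol A \<omega>" for \<omega> by (rule symbol_transpose) (rule A)
  have sA: "continuous_on S (symbol A)" for S
    by (rule linear_continuous_on) (simp add: linear_conv_bounded_linear[symmetric] symbol_linear)
  have sA1: "continuous_on S (\<lambda>p. symbol A (fst p))" for S :: "((real^'m) \<times> 'b::topological_space) set"
    by (rule continuous_on_compose2[OF sA[of UNIV]]) (auto intro: continuous_intros)
  \<comment> \<open>Triples (direction, solution, unit vector) instead of a map from directions to
    solutions: closedness is immediate from the equation and boundedness from |Q| <= |P|, so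
    compactness holds without any continuity of the solution in the direction.\<close>
  define S where "S = {p :: (real^'m) \<times> (real^'n^'n) \<times> (real^'n). norm (fst p) = 1 \<and> norm (snd (snd p)) = 1 \<and>
    (fst (snd p) + comm (comm (fst (snd p)) (symbol A (fst p))) (symbol A (fst p)) = P)}"
  \<comment> \<open>The matrix equation is tested on all vectors, so that closedness needs only the
    continuity of matrix times vector.\<close>
  have eqv: "X = P \<longleftrightarrow> (\<forall>y. X *v y = P *v y)" for X :: "real^'n^'n"
    by (metis matrix_eq)
  have "closed S"
    unfolding S_def eqv lyapunov_apply
    by (intro closed_Collect_conj closed_Collect_all closed_Collect_eq continuous_intros bb sA1)
  moreover have "bounded S"
  proof -
    have "S \<subseteq> sphere 0 1 \<times> cball 0 (norm P) \<times> sphere 0 1"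
    proof
      fix p assume p: "p \<in> S"
      then have "norm (fst (snd p)) \<le> norm P"
        using lyapunov_exists(2)[OF sT[of "fst p"], of "fst (snd p)" P] by (simp add: S_def)
      then show "p \<in> sphere 0 1 \<times> cball 0 (norm P) \<times> sphere 0 1" using p by (auto simp: S_def mem_Times_iff)
    qed
    then show ?thesis by (rule bounded_subset[rotated]) (intro bounded_Times bounded_cball bounded_sphere)
  qed
  ultimately have comp: "compact S" by (simp add: compact_eq_bounded_closed)
  let ?f = "\<lambda>p :: (real^'m) \<times> (real^'n^'n) \<times> (real^'n). snd (snd p) \<bullet> (fst (snd p) *v snd (snd p))"
  let ?g = "\<lambda>p :: (real^'m) \<times> (real^'n^'n) \<times> (real^'n). norm (comm (fst (snd p)) (symbol A (fst p)) *v snd (snd p))"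
  have cf: "continuous_on S ?f" by (intro continuous_intros bb)
  have cg: "continuous_on S ?g"
    unfolding comm_def matrix_vector_mult_diff_rdistrib matrix_vector_mul_assoc[symmetric]
    by (intro continuous_intros bb sA1)
  have pos: "0 < ?f p" if "p \<in> S" for p
  proof -
    have n1: "norm (fst p) = 1" "norm (snd (snd p)) = 1" using that by (auto simp: S_def)
    then have "fst p \<noteq> 0" "snd (snd p) \<noteq> 0" by (metis norm_zero zero_neq_one)+
    then show ?thesis
      using that no[of "fst p"] by (intro lyapunov_positive[OF sT P]) (auto simp: S_def)
  qed
  obtain c where c: "0 < c" "\<And>p. p \<in> S \<Longrightarrow> c \<le> ?f p"
  proof (cases "S = {}")
    case False
    obtain p where "p \<in> S" "\<And>q. q \<in> S \<Longrightarrow> ?f p \<le> ?f q"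
      using continuous_attains_inf[OF comp False cf] by blast
    then show ?thesis using that[of "?f p"] pos[of p] by blast
  qed (use that[of 1] in auto)
  have "bounded (?g ` S)" by (intro compact_imp_bounded compact_continuous_image cg comp)
  then obtain \<kappa>0 where k0: "\<forall>p\<in>S. \<bar>?g p\<bar> \<le> \<kappa>0" by (auto simp: bounded_iff)
  \<comment> \<open>The maximum with 1 makes the bound positive even if all commutators on
    \<open>S\<close> vanish.\<close>
  define \<kappa> where "\<kappa> = max \<kappa>0 1"
  have k: "?g p \<le> \<kappa>" if "p \<in> S" for p using k0 that by (force simp: \<kappa>_def)
  show thesis
  proof (rule that[of c \<kappa>])
    fix \<omega> :: "real^'m" assume w: "norm \<omega> = 1"
    let ?G = "symbol A \<omega>"
    have G: "transpose ?G = ?G" by (rule sT)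
    obtain Q where Q: "Q + comm (comm Q ?G) ?G = P" using lyapunov_exists(1)[OF G] by blast
    have S: "(\<omega>, Q, x /\<^sub>R norm x) \<in> S" if "x \<noteq> 0" for x using that w Q by (simp add: S_def)
    have "c * (norm x)\<^sup>2 \<le> x \<bullet> (Q *v x)" for x
    proof (cases "x = 0")
      case False
      then show ?thesis using c(2)[OF S[OF False]]
        by (simp add: mv_simps field_simps power2_eq_square)
    qed simp
    moreover have "norm (comm Q ?G *v x) \<le> \<kappa> * norm x" for x
    proof (cases "x = 0")
      case False
      then show ?thesis using k[OF S[OF False]] by (simp add: mv_simps field_simps)
    qed simp
    ultimately show "\<exists>Q. transpose Q = Q \<and> Q + comm (comm Q ?G) ?G = P \<and>
      (\<forall>x. c * (norm x)\<^sup>2 \<le> x \<bullet> (Q *v x)) \<and> (\<forall>x. norm (comm Q ?G *v x) \<le> \<kappa> * norm x)"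
      using Q lyapunov_symmetric[OF G P(1) Q] by blast
  qed (use c in \<open>auto simp: \<kappa>_def\<close>)
qed

section \<open>Decay of the flow in Fourier variables\<close>

definition Eop :: "real^'n^'n \<Rightarrow> real^'n^'n \<Rightarrow> (real^'n) \<times> (real^'n) \<Rightarrow> (real^'n) \<times> (real^'n)" where
  \<comment> \<open>\<open>B + iG\<close> acting on \<open>\<complex>\<^sup>n\<close>; the sign is \<open>+\<close> because \<open>ift\<close> turns \<open>\<partial>\<^sub>\<alpha>\<close> into \<open>- i \<xi>\<^sub>\<alpha>\<close>\<close>
  "Eop B G p = (B *v fst p - G *v snd p, B *v snd p + G *v fst p)"

definition gen :: "('m::finite \<Rightarrow> real^('n1::finite+'n2::finite)^('n1+'n2)) \<Rightarrow> real^'n2^'n2 \<Rightarrow> real^'m \<Rightarrow>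
    (real^('n1+'n2)) \<times> (real^('n1+'n2)) \<Rightarrow> (real^('n1+'n2)) \<times> (real^('n1+'n2))" where
  "gen A D \<xi> = Eop (block_B D) (symbol A \<xi>)"

lemma Eop_linear: "linear (Eop B G)"
  by (rule linearI) (simp_all add: Eop_def mv_simps scaleR_diff_right scaleR_add_right)

lemma gen_linear: "linear (gen A D \<xi>)"
  by (simp add: gen_def Eop_linear)

text \<open>Complex conjugate transposition of B + i G with G symmetric gives the transpose of B
  minus i G, a system of the same type.\<close>

lemma Eop_adjoint:
  assumes "transpose G = G"
  shows "Eop B G p \<bullet> q = p \<bullet> Eop (transpose B) (- G) q"
proof -
  have n: "(- G) *v x = - (G *v x)" for x using mv_simps(2)[of 0 G x] by simp
  show ?thesis
    unfolding Eop_def inner_prod_def fst_conv snd_conv n inner_diff_left inner_diff_right inner_add_left inner_add_right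
      inner_transpose inner_minus_right diff_minus_eq_add inner_sym[OF assms, symmetric]
    using inner_sym[OF assms, of "fst p" "snd q"] inner_sym[OF assms, of "snd p" "fst q"] by simp
qed

lemma Eop_Jrot: "Eop B G (Jrot p) = Jrot (Eop B G p)"
  using linear_neg[OF matrix_vector_mul_linear] by (simp add: Eop_def Jrot_def) (simp add: linear_neg)

lemma gen_Jrot: "gen A D \<xi> (Jrot p) = Jrot (gen A D \<xi> p)"
  by (simp add: gen_def Eop_Jrot)

lemma transpose_block_B: "transpose (block_B D) = block_B (transpose D)"
  by (auto simp: vec_eq_iff transpose_def block_B_def split: sum.splits)

lemma symbol_uminus: "symbol (\<lambda>\<alpha>. - A \<alpha>) \<xi> = - symbol A \<xi>"
  by (simp add: symbol_def sum_negf)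

lemma gen_adjoint:
  assumes "\<And>\<alpha>. transpose (A \<alpha>) = A \<alpha>"
  shows "gen A D \<xi> p \<bullet> q = p \<bullet> gen (\<lambda>\<alpha>. - A \<alpha>) (transpose D) \<xi> q"
  unfolding gen_def symbol_uminus transpose_block_B[symmetric]
  by (rule Eop_adjoint) (rule symbol_transpose, rule assms)

lemma sum_Plus_UNIV: "(\<Sum>i\<in>UNIV. f i) = (\<Sum>i\<in>UNIV. f (Inl i)) + (\<Sum>j\<in>UNIV. f (Inr j))"
  for f :: "'a::finite + 'b::finite \<Rightarrow> 'c::comm_monoid_add"
  using sum.Plus[of UNIV UNIV f] by (simp add: UNIV_Plus_UNIV[symmetric] del: UNIV_Plus_UNIV)

lemma L0_block_B: "L0 (block_B D *v x) = 0"
  by (simp add: L0_def block_B_def matrix_vector_mult_def vec_eq_iff)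

lemma Lminus_block_B: "Lminus (block_B D *v x) = D *v Lminus x"
  by (simp add: Lminus_def block_B_def matrix_vector_mult_def vec_eq_iff sum_Plus_UNIV)

lemma inner_split: "x \<bullet> y = L0 x \<bullet> L0 y + Lminus x \<bullet> Lminus y"
  by (simp add: inner_vec_def sum_Plus_UNIV L0_def Lminus_def)

lemma norm_split: "(norm x)\<^sup>2 = (norm (L0 x))\<^sup>2 + (norm (Lminus x))\<^sup>2"
  unfolding power2_norm_eq_inner by (rule inner_split)

lemma L0_linear: "linear L0" and Lminus_linear: "linear Lminus"
  by (rule linearI; simp add: L0_def Lminus_def vec_eq_iff)+

lemma split_eqI: "L0 x = L0 y \<Longrightarrow> Lminus x = Lminus y \<Longrightarrow> x = y"
proof -
  assume "L0 x = L0 y" "Lminus x = Lminus y"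
  then have "x $ i = y $ i" for i by (cases i) (auto simp: L0_def Lminus_def vec_eq_iff)
  then show "x = y" by (simp add: vec_eq_iff)
qed

abbreviation Pm :: "real^('n1::finite+'n2::finite)^('n1+'n2)" where "Pm \<equiv> block_B (mat 1)"

lemma Pm_simps:
  fixes x :: "real^('n1::finite+'n2::finite)"
  shows "L0 (Pm *v x) = 0" "Lminus (Pm *v x) = Lminus x" "norm (Pm *v x) = norm (Lminus x)"
  by (simp_all add: L0_block_B Lminus_block_B norm_eq_sqrt_inner[of "Pm *v x"] inner_split norm_eq_sqrt_inner[of "Lminus x"])

lemma Pm_projection: "transpose Pm = (Pm :: real^('n1::finite+'n2::finite)^('n1+'n2))"
  "Pm ** Pm = (Pm :: real^('n1::finite+'n2::finite)^('n1+'n2))"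
proof -
  show "transpose Pm = (Pm :: real^('n1::finite+'n2::finite)^('n1+'n2))" by (simp add: transpose_block_B transpose_mat)
  have "Pm *v (Pm *v x) = Pm *v x" for x :: "real^('n1+'n2)" by (rule split_eqI) (simp_all add: Pm_simps)
  then show "Pm ** Pm = (Pm :: real^('n1::finite+'n2::finite)^('n1+'n2))"
    by (simp add: matrix_eq matrix_vector_mul_assoc[symmetric])
qed

text \<open>Dissipation of the Lyapunov function |a|^2 + |b|^2 - 2 \<delta> m b . K a, K = [Q, G],
  at distance r from the origin in frequency. The energy alone dissipates only the P components;
  differentiating the mixed term along i r G yields r/2 times the form of Q minus that of P, which
  is coercive on all components. With m = min r (1/r) one has m r = min 1 (r^2), and m <= 1 keeps
  the correction below the energy for all r.\<close>

lemma energy_pointwise: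
  fixes G Q B P :: "real^'n^'n" and a b :: "real^'n"
  assumes r: "0 < r" and G: "transpose G = G" and Q: "transpose Q = Q" "Q + comm (comm Q G) G = P"
    and P: "transpose P = P" "P ** P = P"
    and c: "0 < c" "\<And>x. c * (norm x)\<^sup>2 \<le> x \<bullet> (Q *v x)"
    and k: "0 \<le> \<kappa>" "\<And>x. norm (comm Q G *v x) \<le> \<kappa> * norm x"
    and B: "0 \<le> \<beta>" "\<And>x. x \<bullet> (B *v x) \<le> - d * (norm (P *v x))\<^sup>2" "\<And>x. norm (B *v x) \<le> \<beta> * norm (P *v x)"
    and \<delta>: "0 < \<delta>" "\<delta> * (1 + 2 * (\<beta> * \<kappa>)\<^sup>2 / c) \<le> 2 * d"
  defines "m \<equiv> min r (1 / r)" and "q \<equiv> min 1 (r\<^sup>2)"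
  defines "a' \<equiv> B *v a - r *\<^sub>R (G *v b)" and "b' \<equiv> B *v b + r *\<^sub>R (G *v a)"
  shows "2 * (a \<bullet> a' + b \<bullet> b') - 2 * \<delta> * m * (b \<bullet> (comm Q G *v a') + b' \<bullet> (comm Q G *v a))
    \<le> - (\<delta> * q * c / 2) * ((norm a)\<^sup>2 + (norm b)\<^sup>2)"
proof -
  let ?K = "comm Q G"
  note sQ = inner_sym[OF Q(1)] and sG = inner_sym[OF G]
  define pa pb where "pa = norm (P *v a)" and "pb = norm (P *v b)"
  define p N where "p = pa\<^sup>2 + pb\<^sup>2" and "N = (norm a)\<^sup>2 + (norm b)\<^sup>2"
  have PP: "y \<bullet> (P *v y) = (norm (P *v y))\<^sup>2" for y
    using inner_sym[OF P(1), of y "P *v y"] by (simp add: matrix_vector_mul_assoc P(2) power2_norm_eq_inner)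
  have K: "?K *v x = Q *v (G *v x) - G *v (Q *v x)" for x by (simp add: comm_def mv_simps)
  \<comment> \<open>The quadratic form of the equation for \<open>Q\<close> again: the difference
    between G Q G and the symmetrised Q G^2 is half of Q - P.\<close>
  have half: "(G *v y) \<bullet> (Q *v (G *v y)) - (Q *v y) \<bullet> (G *v (G *v y)) = (y \<bullet> (Q *v y) - (norm (P *v y))\<^sup>2) / 2" for y
  proof -
    have "P *v y = Q *v y + Q *v (G *v (G *v y)) - 2 *\<^sub>R (G *v (Q *v (G *v y))) + G *v (G *v (Q *v y))"
      using lyapunov_apply[of Q G y] Q(2) by simp
    then have "y \<bullet> (P *v y) = y \<bullet> (Q *v y) + y \<bullet> (Q *v (G *v (G *v y))) - 2 * (y \<bullet> (G *v (Q *v (G *v y)))) + y \<bullet> (G *v (G *v (Q *v y)))"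
      by (simp add: inner_add_right inner_diff_right)
    moreover have "y \<bullet> (Q *v (G *v (G *v y))) = (Q *v y) \<bullet> (G *v (G *v y))" by (rule sQ)
    moreover have "y \<bullet> (G *v (Q *v (G *v y))) = (G *v y) \<bullet> (Q *v (G *v y))" by (rule sG)
    moreover have "y \<bullet> (G *v (G *v (Q *v y))) = (Q *v y) \<bullet> (G *v (G *v y))"
      by (simp only: sG[of y] sG[of "G *v y"]) (simp add: inner_commute)
    ultimately show ?thesis using PP[of y] by simp
  qed
  have T2: "b \<bullet> (G *v a) = a \<bullet> (G *v b)" using sG[of b a] by (simp add: inner_commute)
  have T1: "a \<bullet> a' + b \<bullet> b' \<le> - d * p"
    using B(2)[of a] B(2)[of b] T2 by (simp add: a'_def b'_def inner_diff_right inner_add_right p_def pa_def pb_def algebra_simps)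
  have A3: "(G *v a) \<bullet> (?K *v a) = (a \<bullet> (Q *v a) - pa\<^sup>2) / 2"
    using half[of a] sG[of "G *v a" "Q *v a"] by (simp add: K inner_diff_right pa_def inner_commute)
  have B3: "b \<bullet> (?K *v (G *v b)) = - (b \<bullet> (Q *v b) - pb\<^sup>2) / 2"
    using half[of b] sG[of b "Q *v (G *v b)"] sQ[of b "G *v (G *v b)"] by (simp add: K inner_diff_right pb_def)
  define e where "e = (B *v b) \<bullet> (?K *v a) + b \<bullet> (?K *v (B *v a))"
  \<comment> \<open>The coercive gain, with \<open>e\<close> collecting what the dissipation matrix
    contributes.\<close>
  have X: "b \<bullet> (?K *v a') + b' \<bullet> (?K *v a) = r / 2 * (a \<bullet> (Q *v a) + b \<bullet> (Q *v b) - p) + e"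
  proof -
    have "b \<bullet> (?K *v a') = b \<bullet> (?K *v (B *v a)) - r * (b \<bullet> (?K *v (G *v b)))"
      by (simp add: a'_def matrix_vector_mult_diff_distrib matrix_vector_mult_scaleR inner_diff_right)
    moreover have "b' \<bullet> (?K *v a) = (B *v b) \<bullet> (?K *v a) + r * ((G *v a) \<bullet> (?K *v a))"
      by (simp add: b'_def inner_add_left)
    ultimately show ?thesis unfolding A3 B3 by (simp add: e_def p_def field_simps)
  qed
  have m: "0 < m" "m * r = q" "m\<^sup>2 \<le> q"
  proof -
    show "0 < m" using r by (simp add: m_def)
    show "m * r = q"
    proof (cases "r \<le> 1")
      case True
      then have "r \<le> 1 / r" using r by (simp add: field_simps mult_le_one)
      moreover have "r\<^sup>2 \<le> 1" using True r by (simp add: power_le_one)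
      ultimately show ?thesis by (simp add: m_def q_def power2_eq_square)
    next
      case False
      then have "1 / r \<le> r" using r by (simp add: field_simps) (smt (verit) mult_less_cancel_left2 mult.commute)
      moreover have "1 \<le> r\<^sup>2" using False r by simp
      ultimately show ?thesis using r by (simp add: m_def q_def)
    qed
    show "m\<^sup>2 \<le> q"
    proof -
      have "m * m \<le> m * r" using \<open>0 < m\<close> by (intro mult_left_mono) (auto simp: m_def)
      then show ?thesis using \<open>m * r = q\<close> by (simp add: power2_eq_square)
    qed
  qed
  have q: "0 \<le> q" "q \<le> 1" by (auto simp: q_def)
  define s where "s = pb * norm a + pa * norm b"
  have s: "0 \<le> s" "s\<^sup>2 \<le> p * N"
  proof -
    show "0 \<le> s" by (simp add: s_def pa_def pb_def)
    have "p * N - s\<^sup>2 = (pa * norm a - pb * norm b)\<^sup>2"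
      by (simp add: p_def N_def s_def power2_eq_square algebra_simps)
    then show "s\<^sup>2 \<le> p * N" using zero_le_power2[of "pa * norm a - pb * norm b"] by linarith
  qed
  have e: "\<bar>e\<bar> \<le> \<beta> * \<kappa> * s"
  proof -
    have "\<bar>(B *v b) \<bullet> (?K *v a)\<bar> \<le> (\<beta> * pb) * (\<kappa> * norm a)"
      using Cauchy_Schwarz_ineq2[of "B *v b" "?K *v a"] mult_mono[OF B(3)[of b] k(2)[of a]] B(1) by (simp add: pb_def)
    moreover have "norm (?K *v (B *v a)) \<le> \<kappa> * (\<beta> * pa)"
      using k(2)[of "B *v a"] mult_left_mono[OF B(3)[of a] k(1)] by (simp add: pa_def)
    then have "\<bar>b \<bullet> (?K *v (B *v a))\<bar> \<le> norm b * (\<kappa> * (\<beta> * pa))"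
      using Cauchy_Schwarz_ineq2[of b "?K *v (B *v a)"] mult_left_mono[of "norm (?K *v (B *v a))" "\<kappa> * (\<beta> * pa)" "norm b"]
      by (meson norm_ge_zero order_trans)
    ultimately have "\<bar>e\<bar> \<le> (\<beta> * pb) * (\<kappa> * norm a) + norm b * (\<kappa> * (\<beta> * pa))"
      unfolding e_def by linarith
    then show ?thesis by (simp add: s_def algebra_simps)
  qed
  have pN: "0 \<le> p" "0 \<le> N" by (auto simp: p_def N_def)
  define l where "l = 2 * (\<beta> * \<kappa>)\<^sup>2 / c"
  \<comment> \<open>Weighted arithmetic-geometric mean on squares. Half of the gain c q N is spent,
    and l is the resulting price in terms of the dissipation p; m^2 <= q makes this work for small
    and large r alike.\<close>
  have amgm: "2 * m * \<bar>e\<bar> \<le> c / 2 * q * N + l * p"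
  proof (rule power2_le_imp_le)
    have "(2 * m * \<bar>e\<bar>)\<^sup>2 \<le> (2 * m * (\<beta> * \<kappa> * s))\<^sup>2"
      using e m by (intro power_mono mult_left_mono) auto
    also have "\<dots> = 4 * (\<beta> * \<kappa>)\<^sup>2 * (m\<^sup>2 * s\<^sup>2)" by (simp add: power_mult_distrib)
    also have "\<dots> \<le> 4 * (\<beta> * \<kappa>)\<^sup>2 * (q * (p * N))"
      by (intro mult_left_mono mult_mono m s) (auto simp: q)
    also have "\<dots> = 4 * (c / 2 * q * N) * (l * p)"
      using c by (simp add: l_def)
    also have "\<dots> \<le> (c / 2 * q * N + l * p)\<^sup>2"
    proof -
      have "4 * X * Y \<le> (X + Y)\<^sup>2" for X Y :: real
        using zero_le_power2[of "X - Y"] by (simp add: power2_eq_square algebra_simps)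
      then show ?thesis .
    qed
    finally show "(2 * m * \<bar>e\<bar>)\<^sup>2 \<le> (c / 2 * q * N + l * p)\<^sup>2" .
    show "0 \<le> c / 2 * q * N + l * p" using c pN q by (simp add: l_def)
  qed
  have cN: "c * N \<le> a \<bullet> (Q *v a) + b \<bullet> (Q *v b)" using c(2)[of a] c(2)[of b] by (simp add: N_def algebra_simps)
  have "- 2 * \<delta> * m * (b \<bullet> (?K *v a') + b' \<bullet> (?K *v a))
      = - \<delta> * ((m * r) * (a \<bullet> (Q *v a) + b \<bullet> (Q *v b) - p) + 2 * m * e)"
    unfolding X by (simp add: algebra_simps)
  also have "\<dots> \<le> - \<delta> * (q * (c * N - p) - (c / 2 * q * N + l * p))"
  proof -
    have "q * (c * N - p) \<le> q * (a \<bullet> (Q *v a) + b \<bullet> (Q *v b) - p)" using cN q by (intro mult_left_mono) auto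
    moreover have "- (2 * m * e) \<le> 2 * m * \<bar>e\<bar>" using m(1) by (simp add: abs_if)
    ultimately have "q * (c * N - p) - (c / 2 * q * N + l * p) \<le> (m * r) * (a \<bullet> (Q *v a) + b \<bullet> (Q *v b) - p) + 2 * m * e"
      using amgm unfolding m(2) by linarith
    then show ?thesis using \<delta>(1) by simp
  qed
  also have "\<dots> = - (\<delta> * q * c / 2) * N + \<delta> * (q + l) * p" by (simp add: algebra_simps)
  \<comment> \<open>The smallness of \<delta> says that the energy dissipation 2 d p pays for the
    loss \<delta> (q + l) p, as q <= 1.\<close>
  also have "\<dots> \<le> - (\<delta> * q * c / 2) * N + 2 * d * p"
  proof -
    have "0 \<le> l" using c by (simp add: l_def)
    then have "\<delta> * (q + l) \<le> \<delta> * (1 + l)" using \<delta>(1) q by simp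
    then have "\<delta> * (q + l) \<le> 2 * d" using \<delta>(2) by (simp add: l_def)
    then show ?thesis using pN by (simp add: mult_right_mono)
  qed
  finally have 1: "- 2 * \<delta> * m * (b \<bullet> (?K *v a') + b' \<bullet> (?K *v a)) \<le> - (\<delta> * q * c / 2) * N + 2 * d * p" .
  have "2 * u - 2 * \<delta> * m * E \<le> R" if "u \<le> - d * p" "- 2 * \<delta> * m * E \<le> R + 2 * d * p" for u E R
    using that by (simp add: algebra_simps)
  from this[OF T1 1] show ?thesis unfolding N_def .
qed

text \<open>For definite D the null space of \<open>block_B D\<close> is the set where
  \<open>Lminus\<close> vanishes. Stated with \<open>Lminus\<close>, the eigenvector condition is
  literally the same for the adjoint system.\<close>

locale kawashima =
  fixes A :: "'m::finite \<Rightarrow> real^('n1::finite+'n2::finite)^('n1+'n2)" and D :: "real^'n2^'n2"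
  assumes A_sym: "transpose (A \<alpha>) = A \<alpha>"
    and D_neg: "x \<noteq> 0 \<Longrightarrow> x \<bullet> (D *v x) < 0"
    and no_eigenvector: "\<xi> \<noteq> 0 \<Longrightarrow> v \<noteq> 0 \<Longrightarrow> symbol A \<xi> *v v = \<mu> *\<^sub>R v \<Longrightarrow> Lminus v \<noteq> 0"
begin

lemma symbol_sym: "transpose (symbol A \<xi>) = symbol A \<xi>"
  by (rule symbol_transpose) (rule A_sym)

text \<open>The class of systems is closed under adjoints, so every estimate proved in the locale is
  also available for the flow acting on test amplitudes.\<close>

lemma adjoint_kawashima: "kawashima (\<lambda>\<alpha>. - A \<alpha>) (transpose D)"
proof
  show "transpose (- A \<alpha>) = - A \<alpha>" for \<alpha> using A_sym[of \<alpha>] by (simp add: transpose_def vec_eq_iff)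
  show "x \<bullet> (transpose D *v x) < 0" if "x \<noteq> 0" for x
    unfolding inner_transpose using D_neg[OF that] by (simp only: inner_commute)
  fix \<xi> :: "real^'m" and v :: "real^('n1+'n2)" and \<mu> assume a: "\<xi> \<noteq> 0" "v \<noteq> 0" "symbol (\<lambda>\<alpha>. - A \<alpha>) \<xi> *v v = \<mu> *\<^sub>R v"
  have "(- symbol A \<xi>) *v v = - (symbol A \<xi> *v v)" using mv_simps(2)[of 0 "symbol A \<xi>" v] by simp
  then have "symbol A \<xi> *v v = (- \<mu>) *\<^sub>R v" using a(3) unfolding symbol_uminus by (metis minus_minus scaleR_minus_left)
  then show "Lminus v \<noteq> 0" using no_eigenvector a by blast
qed

lemma D_bound: "\<exists>d>0. \<forall>x. x \<bullet> (D *v x) \<le> - d * (norm x)\<^sup>2"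
proof -
  let ?S = "sphere (0 :: real^'n2) 1"
  have "compact ?S" by simp
  moreover have "axis undefined 1 \<in> ?S" by simp
  moreover have "continuous_on ?S (\<lambda>x. - (x \<bullet> (D *v x)))" by (intro continuous_intros)
  ultimately obtain z where z: "z \<in> ?S" "\<And>y. y \<in> ?S \<Longrightarrow> - (z \<bullet> (D *v z)) \<le> - (y \<bullet> (D *v y))"
    using continuous_attains_inf[of ?S "\<lambda>x. - (x \<bullet> (D *v x))"] by blast
  define d where "d = - (z \<bullet> (D *v z))"
  have "z \<noteq> 0" using z(1) by auto
  then have "0 < d" using D_neg[of z] by (simp add: d_def)
  moreover have "x \<bullet> (D *v x) \<le> - d * (norm x)\<^sup>2" for x
  proof (cases "x = 0")
    case False
    then have "x /\<^sub>R norm x \<in> ?S" by simp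
    from z(2)[OF this] have "d \<le> - (inverse (norm x) * (inverse (norm x) * (x \<bullet> (D *v x))))"
      by (simp add: d_def mv_simps)
    then show ?thesis using False by (simp add: field_simps power2_eq_square)
  qed simp
  ultimately show ?thesis by blast
qed

lemma B_bounds: "\<exists>d \<beta>. 0 < d \<and> 0 \<le> \<beta> \<and> (\<forall>x :: real^('n1+'n2). x \<bullet> (block_B D *v x) \<le> - d * (norm (Pm *v x))\<^sup>2) \<and>
   (\<forall>x :: real^('n1+'n2). norm (block_B D *v x) \<le> \<beta> * norm (Pm *v x))"
proof -
  obtain d where d: "0 < d" "\<And>x. x \<bullet> (D *v x) \<le> - d * (norm x)\<^sup>2" using D_bound by blast
  obtain \<beta> where b: "0 \<le> \<beta>" "\<And>x. norm (D *v x) \<le> \<beta> * norm x"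
    using linear_norm_bound[OF matrix_vector_mul_linear[of D]] by blast
  have "(norm (block_B D *v x))\<^sup>2 = (norm (D *v Lminus x))\<^sup>2" for x :: "real^('n1+'n2)"
    using norm_split[of "block_B D *v x"] by (simp add: L0_block_B Lminus_block_B)
  then have n: "norm (block_B D *v x) = norm (D *v Lminus x)" for x :: "real^('n1+'n2)" by simp
  have "x \<bullet> (block_B D *v x) \<le> - d * (norm (Pm *v x))\<^sup>2" for x :: "real^('n1+'n2)"
    using d(2)[of "Lminus x"] by (simp add: Pm_simps inner_split L0_block_B Lminus_block_B)
  moreover have "norm (block_B D *v x) \<le> \<beta> * norm (Pm *v x)" for x :: "real^('n1+'n2)"
    using b(2)[of "Lminus x"] by (simp add: Pm_simps n)
  ultimately show ?thesis using d(1) b(1) by blast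
qed

lemma flow_components:
  fixes \<xi> v
  defines "w \<equiv> \<lambda>t. lflow (gen A D \<xi>) t v"
  shows "((\<lambda>t. fst (w t)) has_vector_derivative (block_B D *v fst (w t) - symbol A \<xi> *v snd (w t))) (at t)"
    and "((\<lambda>t. snd (w t)) has_vector_derivative (block_B D *v snd (w t) + symbol A \<xi> *v fst (w t))) (at t)"
  using bounded_linear.has_vector_derivative[OF bounded_linear_fst lflow_has_vector_derivative[OF gen_linear, of A D \<xi> v t UNIV]]
    bounded_linear.has_vector_derivative[OF bounded_linear_snd lflow_has_vector_derivative[OF gen_linear, of A D \<xi> v t UNIV]]
  by (simp_all add: w_def gen_def Eop_def)

lemma has_real_derivative_inner:
  assumes "(f has_vector_derivative f') (at t)" "(g has_vector_derivative g') (at t)"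
  shows "((\<lambda>t. f t \<bullet> g t) has_real_derivative (f t \<bullet> g' + f' \<bullet> g t)) (at t)"
  using bounded_bilinear.has_vector_derivative[OF bounded_bilinear_inner assms]
  by (simp add: has_real_derivative_iff_has_vector_derivative)

lemma norm_pair_sq: "(norm p)\<^sup>2 = fst p \<bullet> fst p + snd p \<bullet> snd p" for p :: "'x::real_inner \<times> 'y::real_inner"
  by (simp add: power2_norm_eq_inner inner_prod_def)

text \<open>The coupling through the symmetric symbol is skew on pairs and cancels in the energy,
  leaving the dissipation by the block D.\<close>

lemma flow_contraction:
  assumes "0 \<le> t"
  shows "norm (lflow (gen A D \<xi>) t v) \<le> norm v"
proof -
  obtain d where d: "0 < d" "\<And>x :: real^('n1+'n2). x \<bullet> (block_B D *v x) \<le> - d * (norm (Pm *v x))\<^sup>2" using B_bounds by blast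
  have B: "x \<bullet> (block_B D *v x) \<le> 0" for x :: "real^('n1+'n2)"
  proof -
    have "0 \<le> d * (norm (Pm *v x))\<^sup>2" using d(1) by simp
    then show ?thesis using d(2)[of x] by linarith
  qed
  define w where "w t = lflow (gen A D \<xi>) t v" for t
  note F = flow_components[of \<xi> v, folded w_def]
  have "fst (w t) \<bullet> fst (w t) + snd (w t) \<bullet> snd (w t) \<le> fst (w 0) \<bullet> fst (w 0) + snd (w 0) \<bullet> snd (w 0)"
  proof (rule DERIV_nonpos_imp_nonincreasing[OF assms])
    fix s
    let ?a = "fst (w s)" and ?b = "snd (w s)"
    have "((\<lambda>s. fst (w s) \<bullet> fst (w s) + snd (w s) \<bullet> snd (w s)) has_real_derivative
      (?a \<bullet> (block_B D *v ?a - symbol A \<xi> *v ?b) + (block_B D *v ?a - symbol A \<xi> *v ?b) \<bullet> ?a) +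
      (?b \<bullet> (block_B D *v ?b + symbol A \<xi> *v ?a) + (block_B D *v ?b + symbol A \<xi> *v ?a) \<bullet> ?b)) (at s)"
      by (intro DERIV_add has_real_derivative_inner F)
    moreover have "?b \<bullet> (symbol A \<xi> *v ?a) = ?a \<bullet> (symbol A \<xi> *v ?b)"
      using inner_sym[OF symbol_sym, of ?b \<xi> ?a] by (simp add: inner_commute)
    ultimately have "((\<lambda>s. fst (w s) \<bullet> fst (w s) + snd (w s) \<bullet> snd (w s)) has_real_derivative
        2 * (?a \<bullet> (block_B D *v ?a)) + 2 * (?b \<bullet> (block_B D *v ?b))) (at s)"
      by (simp add: inner_diff_left inner_diff_right inner_add_left inner_add_right inner_commute algebra_simps)
    moreover have "2 * (?a \<bullet> (block_B D *v ?a)) + 2 * (?b \<bullet> (block_B D *v ?b)) \<le> 0"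
      using B[of ?a] B[of ?b] by simp
    ultimately show "\<exists>y. ((\<lambda>s. fst (w s) \<bullet> fst (w s) + snd (w s) \<bullet> snd (w s)) has_real_derivative y) (at s) \<and> y \<le> 0"
      by blast
  qed
  then have "(norm (w t))\<^sup>2 \<le> (norm v)\<^sup>2" unfolding norm_pair_sq by (simp add: w_def lflow_0)
  then show ?thesis unfolding w_def by (rule power2_le_imp_le) simp
qed

text \<open>The Lyapunov function stays between N/2 and 3N/2, which accounts for the factor 3. The
  compensator is taken in the direction of \<xi>; at \<xi> = 0 no direction exists, but there the
  claimed rate is 0 and contraction suffices.\<close>

lemma flow_decay:
  "\<exists>\<nu>>0. \<forall>\<xi> t v. 0 \<le> t \<longrightarrow>
     (norm (lflow (gen A D \<xi>) t v))\<^sup>2 \<le> 3 * exp (- \<nu> * min 1 ((norm \<xi>)\<^sup>2) * t) * (norm v)\<^sup>2"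
proof -
  obtain d \<beta> where d: "0 < d" and \<beta>: "0 \<le> \<beta>"
    and B: "\<And>x :: real^('n1+'n2). x \<bullet> (block_B D *v x) \<le> - d * (norm (Pm *v x))\<^sup>2" "\<And>x :: real^('n1+'n2). norm (block_B D *v x) \<le> \<beta> * norm (Pm *v x)"
    using B_bounds by blast
  have no: "Pm *v v \<noteq> 0" if "\<xi> \<noteq> 0" "v \<noteq> 0" "symbol A \<xi> *v v = \<mu> *\<^sub>R v" for \<xi> v \<mu>
    using no_eigenvector[OF that] Pm_simps(2)[of v] linear_0[OF Lminus_linear] by metis
  obtain c \<kappa> where c: "0 < c" and \<kappa>: "0 < \<kappa>" and comp: "\<And>\<omega>. norm \<omega> = 1 \<Longrightarrow>
      \<exists>Q. transpose Q = Q \<and> Q + comm (comm Q (symbol A \<omega>)) (symbol A \<omega>) = Pm \<and>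
      (\<forall>x. c * (norm x)\<^sup>2 \<le> x \<bullet> (Q *v x)) \<and> (\<forall>x. norm (comm Q (symbol A \<omega>) *v x) \<le> \<kappa> * norm x)"
    by (rule compensator_uniform[of A Pm]) (use A_sym Pm_projection no in blast)+
  define l where "l = 1 + 2 * (\<beta> * \<kappa>)\<^sup>2 / c"
  have l: "1 \<le> l" using c by (simp add: l_def)
  \<comment> \<open>The first bound is the smallness required by \<open>energy_pointwise\<close>;
    the second keeps the correction below half of the energy.\<close>
  define \<delta> where "\<delta> = min (2 * d / l) (1 / (2 * \<kappa>))"
  have \<delta>: "0 < \<delta>" "\<delta> * l \<le> 2 * d" "\<delta> * \<kappa> \<le> 1 / 2"
  proof -
    show "0 < \<delta>" using d l \<kappa> by (simp add: \<delta>_def)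
    have "\<delta> \<le> 2 * d / l" "\<delta> \<le> 1 / (2 * \<kappa>)" by (auto simp: \<delta>_def)
    then show "\<delta> * l \<le> 2 * d" "\<delta> * \<kappa> \<le> 1 / 2" using l \<kappa> by (auto simp: field_simps)
  qed
  \<comment> \<open>The rate \<delta> c / 2 relative to N, divided by 3/2 because it is compared
    with a Lyapunov function of size up to 3N/2.\<close>
  define \<nu> where "\<nu> = \<delta> * c / 3"
  have "0 < \<nu>" using \<delta> c by (simp add: \<nu>_def)
  moreover have "(norm (lflow (gen A D \<xi>) t v))\<^sup>2 \<le> 3 * exp (- \<nu> * min 1 ((norm \<xi>)\<^sup>2) * t) * (norm v)\<^sup>2"
    if t: "0 \<le> t" for \<xi> t v
  proof (cases "\<xi> = 0")
    case True
    have "(norm (lflow (gen A D \<xi>) t v))\<^sup>2 \<le> (norm v)\<^sup>2" by (intro power_mono flow_contraction t) simp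
    also have "\<dots> \<le> 3 * (norm v)\<^sup>2" by simp
    finally show ?thesis using True by simp
  next
    case False
    define r where "r = norm \<xi>"
    have r: "0 < r" using False by (simp add: r_def)
    define \<omega> where "\<omega> = \<xi> /\<^sub>R r"
    have \<omega>: "norm \<omega> = 1" "\<xi> = r *\<^sub>R \<omega>" using r by (auto simp: \<omega>_def r_def)
    define G where "G = symbol A \<omega>"
    have G: "transpose G = G" by (simp add: G_def symbol_sym)
    have sG: "symbol A \<xi> *v x = r *\<^sub>R (G *v x)" for x by (simp add: \<omega>(2) symbol_scaleR G_def scaleR_matrix_vector_assoc)
    obtain Q where Q: "transpose Q = Q" "Q + comm (comm Q G) G = Pm"
      "\<And>x. c * (norm x)\<^sup>2 \<le> x \<bullet> (Q *v x)" and K: "\<And>x. norm (comm Q G *v x) \<le> \<kappa> * norm x"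
      using comp[OF \<omega>(1)] unfolding G_def by blast
    let ?K = "comm Q G"
    define m q where "m = min r (1 / r)" and "q = min 1 (r\<^sup>2)"
    have m: "0 \<le> m" "m \<le> 1"
    proof -
      show "0 \<le> m" using r by (simp add: m_def)
      show "m \<le> 1" using r by (cases "r \<le> 1") (auto simp: m_def min_le_iff_disj)
    qed
    define w where "w t = lflow (gen A D \<xi>) t v" for t
    note F = flow_components[of \<xi> v, folded w_def, unfolded sG]
    define a' b' where "a' s = block_B D *v fst (w s) - r *\<^sub>R (G *v snd (w s))"
      and "b' s = block_B D *v snd (w s) + r *\<^sub>R (G *v fst (w s))" for s
    note F' = F[folded a'_def b'_def]
    define N where "N s = (norm (fst (w s)))\<^sup>2 + (norm (snd (w s)))\<^sup>2" for s
    define \<Lambda> where "\<Lambda> s = (fst (w s) \<bullet> fst (w s) + snd (w s) \<bullet> snd (w s)) - 2 * \<delta> * m * (snd (w s) \<bullet> (?K *v fst (w s)))" for s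
    have N: "N s = (norm (w s))\<^sup>2" for s by (simp add: N_def norm_pair_sq power2_norm_eq_inner)
    have close: "\<bar>\<Lambda> s - N s\<bar> \<le> N s / 2" for s
    proof -
      let ?a = "fst (w s)" and ?b = "snd (w s)"
      have "\<bar>?b \<bullet> (?K *v ?a)\<bar> \<le> norm ?b * (\<kappa> * norm ?a)"
        using Cauchy_Schwarz_ineq2[of ?b "?K *v ?a"] mult_left_mono[OF K[of ?a], of "norm ?b"] by simp
      also have "\<dots> \<le> \<kappa> * (N s / 2)"
      proof -
        have "2 * (norm ?b * norm ?a) \<le> (norm ?b)\<^sup>2 + (norm ?a)\<^sup>2"
          using sum_squares_bound[of "norm ?b" "norm ?a"] by (simp only: mult.assoc)
        moreover have "x \<le> (B + A) / 2" if "2 * x \<le> A + B" for x A B :: real using that by simp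
        ultimately have "norm ?b * norm ?a \<le> N s / 2" unfolding N_def by blast
        from mult_left_mono[OF this, of \<kappa>] show ?thesis using \<kappa> by (simp only: mult.left_commute)
      qed
      finally have 1: "\<bar>?b \<bullet> (?K *v ?a)\<bar> \<le> \<kappa> * (N s / 2)" .
      have "\<bar>\<Lambda> s - N s\<bar> = 2 * \<delta> * m * \<bar>?b \<bullet> (?K *v ?a)\<bar>"
        using \<delta>(1) m by (simp add: \<Lambda>_def N_def power2_norm_eq_inner abs_mult)
      also have "\<dots> \<le> 2 * \<delta> * 1 * (\<kappa> * (N s / 2))"
        using 1 \<delta>(1) m by (intro mult_mono) auto
      also have "\<dots> = (\<delta> * \<kappa>) * N s" by simp
      also have "\<dots> \<le> 1 / 2 * N s" using \<delta>(3) by (intro mult_right_mono) (auto simp: N_def)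
      finally show ?thesis by simp
    qed
    have d\<Lambda>: "(\<Lambda> has_real_derivative (2 * (fst (w s) \<bullet> a' s + snd (w s) \<bullet> b' s)
        - 2 * \<delta> * m * (snd (w s) \<bullet> (?K *v a' s) + b' s \<bullet> (?K *v fst (w s))))) (at s)" for s
    proof -
      have "(\<Lambda> has_real_derivative ((fst (w s) \<bullet> a' s + a' s \<bullet> fst (w s)) + (snd (w s) \<bullet> b' s + b' s \<bullet> snd (w s)))
        - 2 * \<delta> * m * (snd (w s) \<bullet> (?K *v a' s) + b' s \<bullet> (?K *v fst (w s)))) (at s)"
        unfolding \<Lambda>_def[abs_def]
        by (intro DERIV_diff DERIV_add DERIV_cmult has_real_derivative_inner F'
          bounded_linear.has_vector_derivative[OF matrix_vector_mul_bounded_linear])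
      then show ?thesis by (simp add: inner_commute)
    qed
    \<comment> \<open>There is no forcing, so k = 0, and \<mu> may be any number below the
      rate.\<close>
    have "\<Lambda> t \<le> exp (- (\<nu> * q) * t) * \<Lambda> 0 + 0 / (\<nu> * q - (\<nu> * q - 1)) * exp (- (\<nu> * q - 1) * t)"
    proof (rule gronwall_exp[OF d\<Lambda>])
      fix s
      have "2 * (fst (w s) \<bullet> a' s + snd (w s) \<bullet> b' s) - 2 * \<delta> * m * (snd (w s) \<bullet> (?K *v a' s) + b' s \<bullet> (?K *v fst (w s)))
        \<le> - (\<delta> * q * c / 2) * N s"
        unfolding a'_def b'_def m_def q_def N_def
        by (rule energy_pointwise[OF r G Q(1,2) Pm_projection c Q(3) less_imp_le[OF \<kappa>] K \<beta> B \<delta>(1)])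
          (use \<delta>(2) in \<open>simp add: l_def\<close>)
      also have "\<dots> \<le> - (\<nu> * q) * \<Lambda> s"
      proof -
        have "\<Lambda> s \<le> 3 / 2 * N s" using close[of s] by linarith
        then have "\<nu> * q * \<Lambda> s \<le> \<nu> * q * (3 / 2 * N s)" using \<open>0 < \<nu>\<close> by (intro mult_left_mono) (auto simp: q_def)
        also have "\<dots> = (\<delta> * q * c / 2) * N s" by (simp add: \<nu>_def)
        finally show ?thesis by simp
      qed
      finally show "2 * (fst (w s) \<bullet> a' s + snd (w s) \<bullet> b' s) - 2 * \<delta> * m * (snd (w s) \<bullet> (?K *v a' s) + b' s \<bullet> (?K *v fst (w s)))
        \<le> - (\<nu> * q) * \<Lambda> s + 0 * exp (- (\<nu> * q - 1) * s)" by simp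
    qed (use t in auto)
    then have "\<Lambda> t \<le> exp (- \<nu> * q * t) * \<Lambda> 0" by simp
    moreover have "N t \<le> 2 * \<Lambda> t" using close[of t] by linarith
    moreover have "exp (- \<nu> * q * t) * \<Lambda> 0 \<le> exp (- \<nu> * q * t) * (3 / 2 * N 0)"
    proof (rule mult_left_mono)
      show "\<Lambda> 0 \<le> 3 / 2 * N 0" using close[of 0] by linarith
    qed simp
    ultimately have "N t \<le> 3 * exp (- \<nu> * q * t) * N 0" by linarith
    then show ?thesis by (simp add: N q_def r_def w_def lflow_0)
  qed
  ultimately show ?thesis by blast
qed

end

section \<open>Block estimates at low frequencies\<close>

definition Z0 :: "(real^('n1::finite+'n2::finite)) \<times> (real^('n1+'n2)) \<Rightarrow> (real^'n1) \<times> (real^'n1)" where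
  "Z0 p = (L0 (fst p), L0 (snd p))"

definition Zm :: "(real^('n1::finite+'n2::finite)) \<times> (real^('n1+'n2)) \<Rightarrow> (real^'n2) \<times> (real^'n2)" where
  "Zm p = (Lminus (fst p), Lminus (snd p))"

definition PP :: "(real^('n1::finite+'n2::finite)) \<times> (real^('n1+'n2)) \<Rightarrow> (real^('n1+'n2)) \<times> (real^('n1+'n2))" where
  "PP p = (Pm *v fst p, Pm *v snd p)"

lemma Z0_linear: "linear Z0" and Zm_linear: "linear Zm"
  by (rule linearI; simp add: Z0_def Zm_def linear_add[OF L0_linear] linear_scale[OF L0_linear] linear_add[OF Lminus_linear] linear_scale[OF Lminus_linear])+

lemma inner_Z: "p \<bullet> q = Z0 p \<bullet> Z0 q + Zm p \<bullet> Zm q"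
  by (cases p; cases q) (simp add: Z0_def Zm_def inner_split)

lemma norm_Z: "(norm p)\<^sup>2 = (norm (Z0 p))\<^sup>2 + (norm (Zm p))\<^sup>2"
  unfolding power2_norm_eq_inner by (rule inner_Z)

lemma norm_Z_le: "norm (Z0 p) \<le> norm p" "norm (Zm p) \<le> norm p"
  by (rule power2_le_imp_le; simp add: norm_Z[of p])+

lemma Z_PP: "Z0 (PP p) = 0" "Zm (PP p) = Zm p" "Z0 (p - PP p) = Z0 p" "Zm (p - PP p) = 0"
  by (simp_all add: Z0_def Zm_def PP_def Pm_simps linear_diff[OF L0_linear] linear_diff[OF Lminus_linear] zero_prod_def)

lemma norm_PP: "norm (PP p) = norm (Zm p)" "norm (p - PP p) = norm (Z0 p)"
  using norm_Z[of "PP p"] norm_Z[of "p - PP p"] by (simp_all add: Z_PP)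

context kawashima
begin

lemma symbol_bound: "\<exists>\<alpha>\<ge>0. \<forall>\<xi> x. norm (symbol A \<xi> *v x) \<le> \<alpha> * norm \<xi> * norm x"
proof -
  obtain K where K: "0 \<le> K" "\<And>(M::real^('n1+'n2)^('n1+'n2)) x. norm (M *v x) \<le> norm M * norm x * K"
    using bounded_bilinear.nonneg_bounded[OF bounded_bilinear_mv] by blast
  obtain C where C: "0 \<le> C" "\<And>\<xi>. norm (symbol A \<xi>) \<le> C * norm \<xi>"
    using linear_norm_bound[OF symbol_linear[of A]] by blast
  have "norm (symbol A \<xi> *v x) \<le> (C * K) * norm \<xi> * norm x" for \<xi> x
  proof -
    have "norm (symbol A \<xi>) * (norm x * K) \<le> C * norm \<xi> * (norm x * K)"
      using K(1) by (intro mult_right_mono C) simp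
    then show ?thesis using K(2)[of "symbol A \<xi>" x] by (simp add: mult_ac)
  qed
  then show ?thesis using K C by (intro exI[of _ "C * K"]) auto
qed

text \<open>The dissipative block obeys its own equation, damped by D and forced by the other block
  through the symbol, of size |\<xi>|. Hence any decay known for the non-dissipative block is
  inherited with an extra factor |\<xi>|, after a transient exp (- d t) of the initial dissipative
  part. The bound \<mu> <= d/2 keeps the two rates apart.\<close>

lemma minus_bound:
  "\<exists>d \<alpha>. 0 < d \<and> 0 < \<alpha> \<and> (\<forall>\<xi> v k \<mu> t. 0 \<le> k \<longrightarrow> \<mu> \<le> d / 2 \<longrightarrow> 0 \<le> t \<longrightarrow>
    (\<forall>s\<ge>0. (norm (Z0 (lflow (gen A D \<xi>) s v)))\<^sup>2 \<le> k * exp (- \<mu> * s)) \<longrightarrow>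
    (norm (Zm (lflow (gen A D \<xi>) t v)))\<^sup>2 \<le> exp (- d * t) * (norm (Zm v))\<^sup>2 + (\<alpha> * norm \<xi>)\<^sup>2 * k * exp (- \<mu> * t))"
proof -
  obtain d where d: "0 < d" "\<And>x. x \<bullet> (D *v x) \<le> - d * (norm x)\<^sup>2" using D_bound by blast
  obtain \<alpha>0 where \<alpha>0: "0 \<le> \<alpha>0" "\<And>\<xi> x. norm (symbol A \<xi> *v x) \<le> \<alpha>0 * norm \<xi> * norm x"
    using symbol_bound by blast
  \<comment> \<open>Since d - \<mu> >= d/2, the constant from \<open>gronwall_exp\<close> is at most
    2 / d^2 times the squared forcing; adding 1 to \<alpha>0 ensures positivity.\<close>
  define \<alpha> where "\<alpha> = 2 * (\<alpha>0 + 1) / d"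
  have \<alpha>: "0 < \<alpha>" using \<alpha>0 d by (simp add: \<alpha>_def)
  have main: "(norm (Zm (lflow (gen A D \<xi>) t v)))\<^sup>2 \<le> exp (- d * t) * (norm (Zm v))\<^sup>2 + (\<alpha> * norm \<xi>)\<^sup>2 * k * exp (- \<mu> * t)"
    if k: "0 \<le> k" and \<mu>: "\<mu> \<le> d / 2" and t: "0 \<le> t"
      and Z: "\<And>s. 0 \<le> s \<Longrightarrow> (norm (Z0 (lflow (gen A D \<xi>) s v)))\<^sup>2 \<le> k * exp (- \<mu> * s)"
    for \<xi> v k \<mu> t
  proof -
    define w where "w t = lflow (gen A D \<xi>) t v" for t
    define e where "e = \<alpha>0 * norm \<xi>"
    have e: "0 \<le> e" using \<alpha>0 by (simp add: e_def)
    note F = flow_components[of \<xi> v, folded w_def]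
    have bl: "bounded_linear (Lminus :: real^('n1+'n2) \<Rightarrow> _)"
      using Lminus_linear by (simp add: linear_conv_bounded_linear)
    have dL: "Lminus (block_B D *v x - symbol A \<xi> *v y) = D *v Lminus x - Lminus (symbol A \<xi> *v y)"
      "Lminus (block_B D *v x + symbol A \<xi> *v y) = D *v Lminus x + Lminus (symbol A \<xi> *v y)" for x y
      by (simp_all add: linear_diff[OF Lminus_linear] linear_add[OF Lminus_linear] Lminus_block_B)
    define y where "y s = Lminus (fst (w s)) \<bullet> Lminus (fst (w s)) + Lminus (snd (w s)) \<bullet> Lminus (snd (w s))" for s
    have y: "y s = (norm (Zm (w s)))\<^sup>2" for s by (simp add: y_def Zm_def norm_pair_sq)
    define y' where "y' s = 2 * (Lminus (fst (w s)) \<bullet> (D *v Lminus (fst (w s)))) + 2 * (Lminus (snd (w s)) \<bullet> (D *v Lminus (snd (w s))))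
        + 2 * (Lminus (snd (w s)) \<bullet> Lminus (symbol A \<xi> *v fst (w s)) - Lminus (fst (w s)) \<bullet> Lminus (symbol A \<xi> *v snd (w s)))" for s
    have dy: "(y has_real_derivative y' s) (at s)" for s
    proof -
      have "(y has_real_derivative
        (Lminus (fst (w s)) \<bullet> (D *v Lminus (fst (w s)) - Lminus (symbol A \<xi> *v snd (w s))) + (D *v Lminus (fst (w s)) - Lminus (symbol A \<xi> *v snd (w s))) \<bullet> Lminus (fst (w s)))
        + (Lminus (snd (w s)) \<bullet> (D *v Lminus (snd (w s)) + Lminus (symbol A \<xi> *v fst (w s))) + (D *v Lminus (snd (w s)) + Lminus (symbol A \<xi> *v fst (w s))) \<bullet> Lminus (snd (w s)))) (at s)"
        unfolding y_def[abs_def] dL[symmetric]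
        by (intro DERIV_add has_real_derivative_inner bounded_linear.has_vector_derivative[OF bl] F)
      then show ?thesis
        by (simp add: y'_def inner_add_left inner_add_right inner_diff_left inner_diff_right inner_commute algebra_simps)
    qed
    have y'le: "y' s \<le> - d * y s + (e\<^sup>2 / d) * (norm (Z0 (w s)))\<^sup>2" for s
    proof -
      let ?a = "fst (w s)" and ?b = "snd (w s)" and ?G = "symbol A \<xi>"
      let ?Pa = "Pm *v ?a" and ?Pb = "Pm *v ?b"
      have Pin: "Lminus x \<bullet> Lminus z = (Pm *v x) \<bullet> z" for x z :: "real^('n1+'n2)"
        by (simp add: inner_split[of "Pm *v x"] Pm_simps)
      \<comment> \<open>The coupling of the dissipative block with itself is skew and drops out,
        leaving only the forcing by the \<open>L0\<close> components.\<close>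
      have sw: "?Pb \<bullet> (?G *v ?Pa) = ?Pa \<bullet> (?G *v ?Pb)"
        using inner_sym[OF symbol_sym, of ?Pb \<xi> ?Pa] by (simp add: inner_commute)
      have n0: "norm (x - Pm *v x) = norm (L0 x)" for x :: "real^('n1+'n2)"
      proof -
        have "(norm (x - Pm *v x))\<^sup>2 = (norm (L0 x))\<^sup>2"
          using norm_split[of "x - Pm *v x"] by (simp add: linear_diff[OF L0_linear] linear_diff[OF Lminus_linear] Pm_simps)
        then show ?thesis by simp
      qed
      \<comment> \<open>Young's inequality with weight d: the forcing consumes half of the damping 2
        d y, so d y remains.\<close>
      have one: "2 * \<bar>(Pm *v x) \<bullet> (?G *v (z - Pm *v z))\<bar> \<le> d * (norm (Lminus x))\<^sup>2 + e\<^sup>2 / d * (norm (L0 z))\<^sup>2" for x z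
      proof -
        have "\<bar>(Pm *v x) \<bullet> (?G *v (z - Pm *v z))\<bar> \<le> norm (Lminus x) * (e * norm (L0 z))"
          using Cauchy_Schwarz_ineq2[of "Pm *v x" "?G *v (z - Pm *v z)"]
            mult_left_mono[OF \<alpha>0(2)[of \<xi> "z - Pm *v z"], of "norm (Lminus x)"]
          by (simp add: n0 Pm_simps e_def)
        moreover have "2 * (norm (Lminus x) * (e * norm (L0 z))) \<le> d * (norm (Lminus x))\<^sup>2 + e\<^sup>2 / d * (norm (L0 z))\<^sup>2"
        proof -
          have "0 \<le> (d * norm (Lminus x) - e * norm (L0 z))\<^sup>2 / d" using d(1) by simp
          also have "\<dots> = d * (norm (Lminus x))\<^sup>2 + e\<^sup>2 / d * (norm (L0 z))\<^sup>2 - 2 * (norm (Lminus x) * (e * norm (L0 z)))"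
            using d(1) by (simp add: power2_eq_square field_simps)
          finally show ?thesis by simp
        qed
        ultimately show ?thesis by linarith
      qed
      have "Lminus ?b \<bullet> Lminus (?G *v ?a) - Lminus ?a \<bullet> Lminus (?G *v ?b)
        = ?Pb \<bullet> (?G *v (?a - ?Pa)) - ?Pa \<bullet> (?G *v (?b - ?Pb))"
        unfolding Pin using sw by (simp add: matrix_vector_mult_diff_distrib inner_diff_right)
      note diff_eq = this
      have "2 * (Lminus ?b \<bullet> Lminus (?G *v ?a) - Lminus ?a \<bullet> Lminus (?G *v ?b))
        \<le> d * ((norm (Lminus ?a))\<^sup>2 + (norm (Lminus ?b))\<^sup>2) + e\<^sup>2 / d * ((norm (L0 ?a))\<^sup>2 + (norm (L0 ?b))\<^sup>2)"
      proof -
        have aux: "2 * z \<le> (a2 + a1) + (b1 + b2)"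
          if "z = X - Y" "2 * \<bar>X\<bar> \<le> a1 + b1" "2 * \<bar>Y\<bar> \<le> a2 + b2" for z X Y a1 a2 b1 b2 :: real
          using that by linarith
        from aux[OF diff_eq one one] show ?thesis unfolding distrib_left .
      qed
      moreover have "(norm (Lminus ?a))\<^sup>2 + (norm (Lminus ?b))\<^sup>2 = y s" by (simp add: y_def power2_norm_eq_inner)
      moreover have "(norm (L0 ?a))\<^sup>2 + (norm (L0 ?b))\<^sup>2 = (norm (Z0 (w s)))\<^sup>2"
        by (simp add: Z0_def norm_pair_sq power2_norm_eq_inner)
      moreover have "Lminus ?a \<bullet> (D *v Lminus ?a) + Lminus ?b \<bullet> (D *v Lminus ?b) \<le> - d * y s"
        using d(2)[of "Lminus ?a"] d(2)[of "Lminus ?b"] by (simp add: y_def power2_norm_eq_inner algebra_simps)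
      ultimately show ?thesis by (simp add: y'_def)
    qed
    have "y t \<le> exp (- d * t) * y 0 + (e\<^sup>2 / d * k) / (d - \<mu>) * exp (- \<mu> * t)"
    proof (rule gronwall_exp[OF dy _ _ _ t])
      fix s :: real assume "0 \<le> s"
      then have "(e\<^sup>2 / d) * (norm (Z0 (w s)))\<^sup>2 \<le> (e\<^sup>2 / d) * (k * exp (- \<mu> * s))"
        using Z[of s] d(1) by (intro mult_left_mono) (auto simp: w_def)
      then show "y' s \<le> - d * y s + e\<^sup>2 / d * k * exp (- \<mu> * s)" using y'le[of s] by (simp add: mult.assoc)
    qed (use d \<mu> k in auto)
    moreover have "(e\<^sup>2 / d * k) / (d - \<mu>) * exp (- \<mu> * t) \<le> (\<alpha> * norm \<xi>)\<^sup>2 * k * exp (- \<mu> * t)"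
    proof (rule mult_right_mono)
      have "(e\<^sup>2 / d * k) / (d - \<mu>) \<le> (e\<^sup>2 / d * k) / (d / 2)"
        using d(1) \<mu> k by (intro divide_left_mono) auto
      also have "\<dots> = 2 / d\<^sup>2 * e\<^sup>2 * k" using d(1) by (simp add: field_simps power2_eq_square)
      also have "\<dots> \<le> 4 / d\<^sup>2 * (((\<alpha>0 + 1) * norm \<xi>)\<^sup>2) * k"
        using \<alpha>0 d(1) k unfolding e_def
        by (intro mult_right_mono mult_mono power_mono divide_right_mono) auto
      also have "\<dots> = (\<alpha> * norm \<xi>)\<^sup>2 * k" by (simp only: \<alpha>_def power_mult_distrib power_divide) simp
      finally show "(e\<^sup>2 / d * k) / (d - \<mu>) \<le> (\<alpha> * norm \<xi>)\<^sup>2 * k" .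
    qed simp
    ultimately show ?thesis by (simp add: y w_def lflow_0)
  qed
  show ?thesis
  proof (rule exI[of _ d], rule exI[of _ \<alpha>], intro conjI allI impI)
    fix \<xi> :: "real^'m" and v :: "(real^('n1+'n2)) \<times> (real^('n1+'n2))" and k \<mu> t :: real
    assume "0 \<le> k" "\<mu> \<le> d / 2" "0 \<le> t" and Z: "\<forall>s\<ge>0. (norm (Z0 (lflow (gen A D \<xi>) s v)))\<^sup>2 \<le> k * exp (- \<mu> * s)"
    then show "(norm (Zm (lflow (gen A D \<xi>) t v)))\<^sup>2 \<le> exp (- d * t) * (norm (Zm v))\<^sup>2 + (\<alpha> * norm \<xi>)\<^sup>2 * k * exp (- \<mu> * t)"
      by (intro main) simp_all
  qed (rule d(1), rule \<alpha>)
qed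

text \<open>Without a dissipative part in the data, \<open>minus_bound\<close> has no transient;
  what remains is the forced response, with the diffusive decay of \<open>flow_decay\<close> and one
  factor |\<xi>|.\<close>

lemma offdiagonal_bound:
  "\<exists>C>0. \<exists>\<nu>>0. \<forall>\<xi> t v. norm \<xi> \<le> 1 \<longrightarrow> 0 \<le> t \<longrightarrow> Zm v = 0 \<longrightarrow>
     norm (Zm (lflow (gen A D \<xi>) t v)) \<le> C * norm \<xi> * exp (- \<nu> * (norm \<xi>)\<^sup>2 * t) * norm v"
proof -
  obtain d \<alpha> where d: "0 < d" "0 < \<alpha>" and mb0: "\<forall>\<xi> v k \<mu> t. 0 \<le> k \<longrightarrow> \<mu> \<le> d / 2 \<longrightarrow> 0 \<le> t \<longrightarrow>
    (\<forall>s\<ge>0. (norm (Z0 (lflow (gen A D \<xi>) s v)))\<^sup>2 \<le> k * exp (- \<mu> * s)) \<longrightarrow>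
    (norm (Zm (lflow (gen A D \<xi>) t v)))\<^sup>2 \<le> exp (- d * t) * (norm (Zm v))\<^sup>2 + (\<alpha> * norm \<xi>)\<^sup>2 * k * exp (- \<mu> * t)"
    using minus_bound by (elim exE conjE) (rule that; assumption)
  note mb = mb0[rule_format]
  obtain \<nu>0 where \<nu>0: "0 < \<nu>0" and dec: "\<And>\<xi> t v. 0 \<le> t \<Longrightarrow>
      (norm (lflow (gen A D \<xi>) t v))\<^sup>2 \<le> 3 * exp (- \<nu>0 * min 1 ((norm \<xi>)\<^sup>2) * t) * (norm v)\<^sup>2"
    using flow_decay by blast
  \<comment> \<open>Squared quantities decay at rate 2 \<nu> |\<xi>|^2, which must not exceed the
    rate of \<open>flow_decay\<close> nor, for |\<xi>| <= 1, the threshold d/2.\<close>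
  define \<nu> where "\<nu> = min \<nu>0 (d / 2) / 2"
  have \<nu>: "0 < \<nu>" "2 * \<nu> \<le> \<nu>0" "2 * \<nu> \<le> d / 2" using \<nu>0 d by (auto simp: \<nu>_def)
  have "norm (Zm (lflow (gen A D \<xi>) t v)) \<le> (2 * \<alpha>) * norm \<xi> * exp (- \<nu> * (norm \<xi>)\<^sup>2 * t) * norm v"
    if x: "norm \<xi> \<le> 1" and t: "0 \<le> t" and v: "Zm v = 0" for \<xi> t v
  proof (rule power2_le_imp_le)
    have x2: "(norm \<xi>)\<^sup>2 \<le> 1" using x by (simp add: power_le_one)
    have "2 * \<nu> * (norm \<xi>)\<^sup>2 \<le> d / 2 * 1" using \<nu> x2 by (intro mult_mono) auto
    then have \<mu>: "2 * \<nu> * (norm \<xi>)\<^sup>2 \<le> d / 2" by simp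
    have Z: "(norm (Z0 (lflow (gen A D \<xi>) s v)))\<^sup>2 \<le> (3 * (norm v)\<^sup>2) * exp (- (2 * \<nu> * (norm \<xi>)\<^sup>2) * s)" if s: "0 \<le> s" for s
    proof -
      have "(norm (Z0 (lflow (gen A D \<xi>) s v)))\<^sup>2 \<le> (norm (lflow (gen A D \<xi>) s v))\<^sup>2"
        by (intro power_mono norm_Z_le) simp
      also have "\<dots> \<le> 3 * exp (- \<nu>0 * (norm \<xi>)\<^sup>2 * s) * (norm v)\<^sup>2" using dec[OF s, of \<xi> v] x2 by (simp add: min_absorb2)
      also have "\<dots> \<le> 3 * exp (- (2 * \<nu> * (norm \<xi>)\<^sup>2) * s) * (norm v)\<^sup>2"
        using \<nu>(2) s by (intro mult_right_mono mult_left_mono) (auto intro!: mult_right_mono)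
      finally show ?thesis by (simp add: mult_ac)
    qed
    have "(norm (Zm (lflow (gen A D \<xi>) t v)))\<^sup>2 \<le> exp (- d * t) * (norm (Zm v))\<^sup>2 +
        (\<alpha> * norm \<xi>)\<^sup>2 * (3 * (norm v)\<^sup>2) * exp (- (2 * \<nu> * (norm \<xi>)\<^sup>2) * t)"
      by (rule mb[OF _ \<mu> t Z]) simp_all
    also have "\<dots> = 3 * ((\<alpha> * norm \<xi>)\<^sup>2 * (norm v)\<^sup>2 * exp (- (2 * \<nu> * (norm \<xi>)\<^sup>2) * t))" using v by simp
    also have "\<dots> \<le> 4 * ((\<alpha> * norm \<xi>)\<^sup>2 * (norm v)\<^sup>2 * exp (- (2 * \<nu> * (norm \<xi>)\<^sup>2) * t))"
      by (intro mult_right_mono) auto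
    also have "\<dots> = ((2 * \<alpha>) * norm \<xi> * exp (- \<nu> * (norm \<xi>)\<^sup>2 * t) * norm v)\<^sup>2"
      by (simp add: power_mult_distrib exp_double[symmetric] mult_ac)
    finally show "(norm (Zm (lflow (gen A D \<xi>) t v)))\<^sup>2 \<le> ((2 * \<alpha>) * norm \<xi> * exp (- \<nu> * (norm \<xi>)\<^sup>2 * t) * norm v)\<^sup>2" .
  qed (use d in simp)
  then show ?thesis using d \<nu> by (intro exI[of _ "2 * \<alpha>"] exI[of _ \<nu>] conjI) auto
qed

lemma flow_adjoint:
  "lflow (gen A D \<xi>) t p \<bullet> q = p \<bullet> lflow (gen (\<lambda>\<alpha>. - A \<alpha>) (transpose D) \<xi>) t q"
  by (rule lflow_adjoint[OF gen_linear gen_linear gen_adjoint]) (rule A_sym)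

text \<open>One argument for each of the four blocks. Non-dissipative to itself:
  \<open>flow_decay\<close>. Non-dissipative to dissipative: \<open>offdiagonal_bound\<close>. The
  opposite direction: the transpose of that block for the adjoint system. Dissipative to itself:
  \<open>minus_bound\<close> fed with the third block, which adds the second factor |\<xi>| and
  leaves the transient.\<close>

lemma low_frequency_bound:
  "\<exists>C>0. \<exists>\<nu>>0. \<forall>\<xi> t v. norm \<xi> \<le> 1 \<longrightarrow> 0 \<le> t \<longrightarrow>
     norm (Z0 (lflow (gen A D \<xi>) t v)) \<le> C * exp (- \<nu> * (norm \<xi>)\<^sup>2 * t) * (norm (Z0 v) + norm \<xi> * norm (Zm v)) \<and>
     norm (Zm (lflow (gen A D \<xi>) t v)) \<le> C * exp (- \<nu> * (norm \<xi>)\<^sup>2 * t) * (norm \<xi> * norm (Z0 v) + (norm \<xi>)\<^sup>2 * norm (Zm v))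
       + C * exp (- \<nu> * t) * norm (Zm v)"
proof -
  interpret adj: kawashima "\<lambda>\<alpha>. - A \<alpha>" "transpose D" by (rule adjoint_kawashima)
  obtain d \<alpha> where d: "0 < d" "0 < \<alpha>" and mb0: "\<forall>\<xi> v k \<mu> t. 0 \<le> k \<longrightarrow> \<mu> \<le> d / 2 \<longrightarrow> 0 \<le> t \<longrightarrow>
    (\<forall>s\<ge>0. (norm (Z0 (lflow (gen A D \<xi>) s v)))\<^sup>2 \<le> k * exp (- \<mu> * s)) \<longrightarrow>
    (norm (Zm (lflow (gen A D \<xi>) t v)))\<^sup>2 \<le> exp (- d * t) * (norm (Zm v))\<^sup>2 + (\<alpha> * norm \<xi>)\<^sup>2 * k * exp (- \<mu> * t)"
    using minus_bound by (elim exE conjE) (rule that; assumption)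
  note mb = mb0[rule_format]
  obtain \<nu>0 where \<nu>0: "0 < \<nu>0" and dec: "\<And>\<xi> t v. 0 \<le> t \<Longrightarrow>
      (norm (lflow (gen A D \<xi>) t v))\<^sup>2 \<le> 3 * exp (- \<nu>0 * min 1 ((norm \<xi>)\<^sup>2) * t) * (norm v)\<^sup>2"
    using flow_decay by blast
  obtain C1 \<nu>1 where C1: "0 < C1" "0 < \<nu>1" and o1: "\<And>\<xi> t v. norm \<xi> \<le> 1 \<Longrightarrow> 0 \<le> t \<Longrightarrow> Zm v = 0 \<Longrightarrow>
     norm (Zm (lflow (gen A D \<xi>) t v)) \<le> C1 * norm \<xi> * exp (- \<nu>1 * (norm \<xi>)\<^sup>2 * t) * norm v"
    using offdiagonal_bound by blast
  obtain C2 \<nu>2 where C2: "0 < C2" "0 < \<nu>2" and o2: "\<And>\<xi> t v. norm \<xi> \<le> 1 \<Longrightarrow> 0 \<le> t \<Longrightarrow> Zm v = 0 \<Longrightarrow>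
     norm (Zm (lflow (gen (\<lambda>\<alpha>. - A \<alpha>) (transpose D) \<xi>) t v)) \<le> C2 * norm \<xi> * exp (- \<nu>2 * (norm \<xi>)\<^sup>2 * t) * norm v"
    using adj.offdiagonal_bound by blast
  \<comment> \<open>Half of \<nu>0 because \<open>flow_decay\<close> bounds a square; d/4 so that 2
    \<nu> |\<xi>|^2 <= d/2, as \<open>minus_bound\<close> demands; \<nu>1 and \<nu>2 belong to the
    system and its adjoint.\<close>
  define \<nu> where "\<nu> = min (min (\<nu>0 / 2) (d / 4)) (min \<nu>1 \<nu>2)"
  have \<nu>: "0 < \<nu>" "\<nu> \<le> \<nu>0 / 2" "\<nu> \<le> d / 4" "\<nu> \<le> \<nu>1" "\<nu> \<le> \<nu>2" using \<nu>0 d C1 C2 by (auto simp: \<nu>_def)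
  define C where "C = 2 + C1 + C2 + \<alpha> * C2"
  have C: "0 < C" "2 \<le> C" "C1 \<le> C" "C2 \<le> C" "\<alpha> * C2 \<le> C" 
  proof -
    have "0 < \<alpha> * C2" using C2 d by simp
    then show "0 < C" "2 \<le> C" "C1 \<le> C" "C2 \<le> C" "\<alpha> * C2 \<le> C" using C1 C2 unfolding C_def by linarith+
  qed
  show ?thesis
  proof (rule exI[of _ C], intro conjI C(1), rule exI[of _ \<nu>], intro conjI allI impI \<nu>(1))
    fix \<xi> :: "real^'m" and t :: real and v :: "(real^('n1+'n2)) \<times> (real^('n1+'n2))"
    assume x: "norm \<xi> \<le> 1" and t: "0 \<le> t"
    let ?S = "\<lambda>s. lflow (gen A D \<xi>) s"
    let ?e = "\<lambda>s. exp (- \<nu> * (norm \<xi>)\<^sup>2 * s)"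
    have x2: "(norm \<xi>)\<^sup>2 \<le> 1" using x by (simp add: power_le_one)
    have exp_le: "exp (- \<nu>' * (norm \<xi>)\<^sup>2 * s) \<le> ?e s" if "\<nu> \<le> \<nu>'" "0 \<le> s" for \<nu>' s
      using that by (auto intro!: mult_right_mono)
    define v0 v1 where "v0 = v - PP v" and "v1 = PP v"
    have v: "v = v0 + v1" by (simp add: v0_def v1_def)
    have vZ: "Zm v0 = 0" "Z0 v1 = 0" "norm v0 = norm (Z0 v)" "norm v1 = norm (Zm v)" "Zm v1 = Zm v"
      by (simp_all add: v0_def v1_def Z_PP norm_PP)
    have S: "?S s v = ?S s v0 + ?S s v1" for s unfolding v by (rule lflow_add[OF gen_linear])
    have e00: "norm (Z0 (?S s v0)) \<le> C * ?e s * norm (Z0 v)" if s: "0 \<le> s" for s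
    proof -
      have "(norm (?S s v0))\<^sup>2 \<le> (2 * ?e s * norm v0)\<^sup>2"
      proof -
        have "(norm (?S s v0))\<^sup>2 \<le> 3 * exp (- \<nu>0 * (norm \<xi>)\<^sup>2 * s) * (norm v0)\<^sup>2" using dec[OF s, of \<xi> v0] x2 by (simp add: min_absorb2)
        also have "\<dots> \<le> 4 * exp (- (2 * \<nu>) * (norm \<xi>)\<^sup>2 * s) * (norm v0)\<^sup>2"
          using \<nu>(2) s by (intro mult_right_mono mult_mono) (auto intro!: mult_right_mono)
        also have "\<dots> = (2 * ?e s * norm v0)\<^sup>2" by (simp add: power_mult_distrib exp_double[symmetric] mult_ac)
        finally show ?thesis .
      qed
      then have "norm (?S s v0) \<le> 2 * ?e s * norm v0" by (rule power2_le_imp_le) simp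
      also have "\<dots> \<le> C * ?e s * norm v0" using C by (intro mult_right_mono) auto
      finally show ?thesis using norm_Z_le(1)[of "?S s v0"] by (simp add: vZ)
    qed
    have em0: "norm (Zm (?S s v0)) \<le> C * ?e s * (norm \<xi> * norm (Z0 v))" if s: "0 \<le> s" for s
    proof -
      have "norm (Zm (?S s v0)) \<le> C1 * norm \<xi> * exp (- \<nu>1 * (norm \<xi>)\<^sup>2 * s) * norm v0" by (rule o1[OF x s vZ(1)])
      also have "\<dots> \<le> C * norm \<xi> * ?e s * norm v0"
        using C C1 exp_le[OF \<nu>(4) s] by (intro mult_right_mono mult_mono) auto
      finally show ?thesis by (simp add: vZ mult_ac)
    qed
    \<comment> \<open>Paired with its own non-dissipative part z, the solution is moved to the
      adjoint flow of z. That vector has no dissipative component, so the off-diagonal bound of the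
      adjoint system applies, and one factor |z| cancels.\<close>
    have e0m: "norm (Z0 (?S s v1)) \<le> C2 * ?e s * (norm \<xi> * norm (Zm v))" if s: "0 \<le> s" for s
    proof -
      define z where "z = ?S s v1 - PP (?S s v1)"
      have z: "Zm z = 0" "Z0 z = Z0 (?S s v1)" "norm z = norm (Z0 (?S s v1))" by (simp_all add: z_def Z_PP norm_PP)
      let ?T = "lflow (gen (\<lambda>\<alpha>. - A \<alpha>) (transpose D) \<xi>) s z"
      have "(norm z)\<^sup>2 = z \<bullet> ?S s v1" by (simp add: inner_Z z power2_norm_eq_inner)
      also have "\<dots> = ?T \<bullet> v1" using flow_adjoint[of \<xi> s v1 z] by (simp add: inner_commute)
      also have "\<dots> = Zm ?T \<bullet> Zm v1" by (simp add: inner_Z[of ?T] vZ)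
      also have "\<dots> \<le> norm (Zm ?T) * norm (Zm v1)" by (rule norm_cauchy_schwarz)
      also have "\<dots> \<le> (C2 * norm \<xi> * exp (- \<nu>2 * (norm \<xi>)\<^sup>2 * s) * norm z) * norm (Zm v1)"
        by (intro mult_right_mono o2 x s z) simp
      also have "\<dots> \<le> (C2 * norm \<xi> * ?e s * norm z) * norm (Zm v1)"
        using C2 exp_le[OF \<nu>(5) s] by (intro mult_right_mono mult_left_mono) auto
      finally have "norm z * norm z \<le> norm z * (C2 * ?e s * (norm \<xi> * norm (Zm v)))"
        by (simp add: power2_eq_square vZ mult_ac)
      then show ?thesis using C2 by (cases "norm z = 0") (auto simp: z(3)[symmetric])
    qed
    have emm: "norm (Zm (?S t v1)) \<le> C * ?e t * ((norm \<xi>)\<^sup>2 * norm (Zm v)) + C * exp (- \<nu> * t) * norm (Zm v)"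
    proof -
      \<comment> \<open>The non-dissipative response to dissipative data is already of order
        |\<xi>|; it acts as the forcing and is multiplied by |\<xi>| once more.\<close>
      let ?k = "(C2 * norm \<xi> * norm (Zm v))\<^sup>2"
      have "2 * \<nu> * (norm \<xi>)\<^sup>2 \<le> d / 2 * 1" using \<nu> x2 by (intro mult_mono) auto
      then have \<mu>: "2 * \<nu> * (norm \<xi>)\<^sup>2 \<le> d / 2" by simp
      have "(norm (Zm (?S t v1)))\<^sup>2 \<le> exp (- d * t) * (norm (Zm v1))\<^sup>2 + (\<alpha> * norm \<xi>)\<^sup>2 * ?k * exp (- (2 * \<nu> * (norm \<xi>)\<^sup>2) * t)"
      proof (rule mb[OF _ \<mu> t])
        fix s :: real assume "0 \<le> s"
        from power_mono[OF e0m[OF this] norm_ge_zero, of 2]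
        show "(norm (Z0 (?S s v1)))\<^sup>2 \<le> ?k * exp (- (2 * \<nu> * (norm \<xi>)\<^sup>2) * s)"
          by (simp add: power_mult_distrib exp_double[symmetric] mult_ac)
      qed simp
      also have "\<dots> \<le> (exp (- \<nu> * t) * norm (Zm v))\<^sup>2 + (\<alpha> * C2 * ?e t * ((norm \<xi>)\<^sup>2 * norm (Zm v)))\<^sup>2"
      proof (rule add_mono)
        have "exp (- d * t) \<le> exp (- (2 * \<nu>) * t)" using \<nu>(3) d t by (auto intro!: mult_right_mono)
        also have "\<dots> = (exp (- \<nu> * t))\<^sup>2" by (simp add: exp_double[symmetric] mult_ac)
        finally show "exp (- d * t) * (norm (Zm v1))\<^sup>2 \<le> (exp (- \<nu> * t) * norm (Zm v))\<^sup>2"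
          by (simp add: power_mult_distrib vZ mult_right_mono)
        show "(\<alpha> * norm \<xi>)\<^sup>2 * ?k * exp (- (2 * \<nu> * (norm \<xi>)\<^sup>2) * t) \<le> (\<alpha> * C2 * ?e t * ((norm \<xi>)\<^sup>2 * norm (Zm v)))\<^sup>2"
        proof -
          have ee: "(?e t)\<^sup>2 = exp (- (2 * \<nu> * (norm \<xi>)\<^sup>2) * t)" by (simp add: exp_double[symmetric])
          have "(a * r)\<^sup>2 * (c * r * z)\<^sup>2 * E\<^sup>2 = (a * c * E * (r\<^sup>2 * z))\<^sup>2" for a r c z E :: real
            by (simp add: power2_eq_square)
          then show ?thesis unfolding ee[symmetric] by simp
        qed
      qed
      also have "\<dots> \<le> (exp (- \<nu> * t) * norm (Zm v) + \<alpha> * C2 * ?e t * ((norm \<xi>)\<^sup>2 * norm (Zm v)))\<^sup>2"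
        using d C2 by (simp add: power2_sum)
      finally have "norm (Zm (?S t v1)) \<le> exp (- \<nu> * t) * norm (Zm v) + \<alpha> * C2 * ?e t * ((norm \<xi>)\<^sup>2 * norm (Zm v))"
        by (rule power2_le_imp_le) (use d C2 in simp)
      also have "\<dots> \<le> C * exp (- \<nu> * t) * norm (Zm v) + C * ?e t * ((norm \<xi>)\<^sup>2 * norm (Zm v))"
        using C by (intro add_mono mult_right_mono) auto
      finally show ?thesis by simp
    qed
    have "norm (Z0 (?S t v)) \<le> norm (Z0 (?S t v0)) + norm (Z0 (?S t v1))"
      unfolding S linear_add[OF Z0_linear] by (rule norm_triangle_ineq)
    also have "\<dots> \<le> C * ?e t * norm (Z0 v) + C * ?e t * (norm \<xi> * norm (Zm v))"
    proof (rule add_mono[OF e00[OF t] order_trans[OF e0m[OF t]]])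
      show "C2 * ?e t * (norm \<xi> * norm (Zm v)) \<le> C * ?e t * (norm \<xi> * norm (Zm v))"
        by (intro mult_right_mono C(4)) simp_all
    qed
    finally show "norm (Z0 (?S t v)) \<le> C * ?e t * (norm (Z0 v) + norm \<xi> * norm (Zm v))" by (simp add: distrib_left)
    have "norm (Zm (?S t v)) \<le> norm (Zm (?S t v0)) + norm (Zm (?S t v1))"
      unfolding S linear_add[OF Zm_linear] by (rule norm_triangle_ineq)
    also have "\<dots> \<le> C * ?e t * (norm \<xi> * norm (Z0 v)) + (C * ?e t * ((norm \<xi>)\<^sup>2 * norm (Zm v)) + C * exp (- \<nu> * t) * norm (Zm v))"
      using em0[OF t] emm by (rule add_mono)
    finally show "norm (Zm (?S t v)) \<le> C * ?e t * (norm \<xi> * norm (Z0 v) + (norm \<xi>)\<^sup>2 * norm (Zm v)) + C * exp (- \<nu> * t) * norm (Zm v)"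
      by (simp add: distrib_left)
  qed
qed

end

section \<open>Weak derivatives and Gaussian bounds\<close>

text \<open>Repeats the choice term inside \<open>partial_deriv\<close>, so that both denote the
  same list; the estimates use only its length and the unit norm of its entries.\<close>

definition mi_dirs :: "nat ^ 'm::finite \<Rightarrow> (real ^ 'm) list" where
  "mi_dirs \<beta> = map (\<lambda>i. axis i 1) (SOME is. \<forall>i. count_list is i = \<beta> $ i)"

lemma partial_deriv_foldr: "partial_deriv \<beta> f = foldr dir_deriv (mi_dirs \<beta>) f"
  by (simp add: partial_deriv_def mi_dirs_def)

text \<open>The index type is finite, so \<beta> is the multiplicity function of a multiset, and any
  enumeration of it shows that the choice is not vacuous.\<close>

lemma mi_dirs_list: "\<exists>is. mi_dirs \<beta> = map (\<lambda>i. axis i 1) is \<and> length is = mi_order \<beta>"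
  for \<beta> :: "nat ^ 'm::finite"
proof -
  obtain xs where "mset xs = Abs_multiset (\<lambda>i. \<beta> $ i)" using ex_mset by blast
  then have "\<forall>i. count_list xs i = \<beta> $ i"
    by (simp add: count_mset[symmetric])
  then have ex: "\<exists>is. \<forall>i. count_list is i = \<beta> $ i" by blast
  define is' where "is' = (SOME is. \<forall>i. count_list is i = \<beta> $ i)"
  have c: "\<forall>i. count_list is' i = \<beta> $ i" unfolding is'_def by (rule someI_ex[OF ex])
  have "length is' = sum (count_list is') UNIV" by (rule sum_count_set[symmetric]) auto
  then have "length is' = mi_order \<beta>" by (simp add: c mi_order_def)
  then show ?thesis by (auto simp: mi_dirs_def is'_def)
qed

lemma length_mi_dirs: "length (mi_dirs \<beta>) = mi_order \<beta>"
  using mi_dirs_list[of \<beta>] by auto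

lemma norm_mi_dirs: "prod_list (map norm (mi_dirs \<beta>)) = 1"
proof -
  obtain xs where "mi_dirs \<beta> = map (\<lambda>i. axis i 1) xs" using mi_dirs_list by blast
  moreover have "prod_list (map norm (map (\<lambda>i. axis i (1::real)) xs)) = 1" for xs :: "'b::finite list"
    by (induction xs) auto
  ultimately show ?thesis by simp
qed

lemma Lp2_locally_integrable: "f \<in> Lp 2 \<Longrightarrow> locally_integrable f"
  unfolding locally_integrable_def
proof (intro conjI allI impI)
  assume f: "f \<in> Lp 2"
  then show "f \<in> borel_measurable lborel" by (simp add: Lp2_iff)
  fix S :: "'a set" assume "compact S"
  then have "bounded S" by (rule compact_imp_bounded)
  then obtain R where R: "\<forall>x\<in>S. norm x \<le> R" by (auto simp: bounded_iff)
  have "S \<in> sets borel" using \<open>compact S\<close> by (simp add: borel_compact)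
  show "set_integrable lborel S f"
    unfolding set_integrable_def
  proof (rule Bochner_Integration.integrable_bound)
    show "integrable lborel (cutoff R f)" using cutoff_Lp1[OF f] by (simp add: Lp1_iff)
    show "(\<lambda>x. indicat_real S x *\<^sub>R f x) \<in> borel_measurable lborel"
      using f \<open>S \<in> sets borel\<close> by (intro borel_measurable_scaleR borel_measurable_indicator) (auto simp: Lp2_iff)
    have "norm (indicat_real S x *\<^sub>R f x) \<le> norm (cutoff R f x)" for x
      using R by (auto simp: cutoff_def indicator_def)
    then show "AE x in lborel. norm (indicat_real S x *\<^sub>R f x) \<le> norm (cutoff R f x)" by simp
  qed
qed

lemma Lp2_inner_const:
  assumes "f \<in> Lp 2" shows "(\<lambda>x. f x \<bullet> e) \<in> Lp 2"
proof (rule Lp2_bound[OF assms, where M="norm e"])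
  show "(\<lambda>x. f x \<bullet> e) \<in> borel_measurable borel"
    by (intro borel_measurable_inner Lp2_measurable[OF assms]) simp
  show "norm (f x \<bullet> e) \<le> norm e * norm (f x)" for x
    using Cauchy_Schwarz_ineq2[of "f x" e] by (simp add: mult.commute)
qed

lemma test_scaleR_integrable:
  fixes \<phi> :: "'a::euclidean_space \<Rightarrow> real" and f :: "'a \<Rightarrow> 'b::euclidean_space"
  assumes "test_function \<phi>" "f \<in> Lp 2"
  shows "integrable lborel (\<lambda>x. \<phi> x *\<^sub>R f x)"
proof -
  have "integrable lborel (\<lambda>x. (\<phi> x *\<^sub>R f x) \<bullet> e)" for e
    using Lp2_inner[OF test_function_Lp'(2)[OF assms(1)] Lp2_inner_const[OF assms(2), of e]] by simp
  then have "integrable lborel (\<lambda>x. \<Sum>e\<in>Basis. ((\<phi> x *\<^sub>R f x) \<bullet> e) *\<^sub>R e)"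
    by (intro Bochner_Integration.integrable_sum integrable_scaleR_left)
  then show ?thesis by (simp only: euclidean_representation)
qed

lemma test_integral_inner:
  fixes \<phi> :: "'a::euclidean_space \<Rightarrow> real" and f :: "'a \<Rightarrow> 'b::euclidean_space"
  assumes "test_function \<phi>" "f \<in> Lp 2"
  shows "(LINT x|lborel. \<phi> x *\<^sub>R f x) \<bullet> e = (LINT x|lborel. (\<phi> x *\<^sub>R e) \<bullet> f x)"
  using integral_inner_left[of e lborel "\<lambda>x. \<phi> x *\<^sub>R f x"] test_scaleR_integrable[OF assms]
  by (simp add: inner_commute)

lemma has_weak_derivI:
  fixes f g :: "real ^ 'm::finite \<Rightarrow> 'b::euclidean_space"
  assumes f: "f \<in> Lp 2" and g: "g \<in> Lp 2"
    and eq: "\<And>\<phi> e. test_function \<phi> \<Longrightarrow> (LINT x|lborel. (foldr dir_deriv (mi_dirs \<beta>) \<phi> x *\<^sub>R e) \<bullet> f x)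
      = (- 1) ^ mi_order \<beta> * (LINT x|lborel. (\<phi> x *\<^sub>R e) \<bullet> g x)"
  shows "has_weak_deriv \<beta> f g"
  unfolding has_weak_deriv_def partial_deriv_foldr
proof (intro conjI allI impI Lp2_locally_integrable f g)
  fix \<phi> :: "real ^ 'm \<Rightarrow> real" assume t: "test_function \<phi>"
  show "(LINT x|lborel. foldr dir_deriv (mi_dirs \<beta>) \<phi> x *\<^sub>R f x) = (- 1) ^ mi_order \<beta> *\<^sub>R (LINT x|lborel. \<phi> x *\<^sub>R g x)"
    by (rule euclidean_eqI, subst inner_scaleR_left)
      (simp only: test_integral_inner[OF test_function_foldr[OF t] f] test_integral_inner[OF t g] eq[OF t])
qed

lemma ift_map:
  fixes \<psi> :: "'a::euclidean_space \<Rightarrow> 'b::euclidean_space \<times> 'b"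
  assumes "L2_bdd_supp \<psi>" "bounded_linear T"
  shows "T (ift \<psi> x) = ift (\<lambda>\<xi>. (T (fst (\<psi> \<xi>)), T (snd (\<psi> \<xi>)))) x"
  unfolding ift_def
  by (subst integral_bounded_linear[OF assms(2) ift_integrable[OF L2_bdd_supp_integrable[OF assms(1)]], symmetric])
    (simp add: linear_add[OF bounded_linear.linear[OF assms(2)]] linear_scale[OF bounded_linear.linear[OF assms(2)]])

lemma fst_snd_measurable:
  fixes \<psi> :: "'a::euclidean_space \<Rightarrow> 'b::euclidean_space \<times> 'c::euclidean_space"
  assumes "\<psi> \<in> borel_measurable borel"
  shows "(\<lambda>\<xi>. fst (\<psi> \<xi>)) \<in> borel_measurable borel" "(\<lambda>\<xi>. snd (\<psi> \<xi>)) \<in> borel_measurable borel"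
proof -
  have p: "\<psi> \<in> borel \<rightarrow>\<^sub>M borel \<Otimes>\<^sub>M borel" using assms by (simp add: borel_prod)
  show "(\<lambda>\<xi>. fst (\<psi> \<xi>)) \<in> borel_measurable borel" "(\<lambda>\<xi>. snd (\<psi> \<xi>)) \<in> borel_measurable borel"
    using measurable_compose[OF p measurable_fst] measurable_compose[OF p measurable_snd] by auto
qed

lemma L2_bdd_supp_map:
  fixes \<psi> :: "'a::euclidean_space \<Rightarrow> 'b::euclidean_space \<times> 'b" and T :: "'b \<Rightarrow> 'c::euclidean_space"
  assumes "L2_bdd_supp \<psi>" and T: "bounded_linear T"
  shows "L2_bdd_supp (\<lambda>\<xi>. (T (fst (\<psi> \<xi>)), T (snd (\<psi> \<xi>))))"
proof -
  obtain K where K: "0 \<le> K" "\<And>x. norm (T x) \<le> K * norm x"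
    using bounded_linear.nonneg_bounded[OF T] by (metis mult.commute)
  have Tm: "T \<in> borel_measurable borel" by (intro borel_measurable_continuous_onI linear_continuous_on T)
  show ?thesis
  proof (rule L2_bdd_supp_bound[OF assms(1), where M="\<lambda>r. 2 * K"])
    show "(\<lambda>\<xi>. (T (fst (\<psi> \<xi>)), T (snd (\<psi> \<xi>)))) \<in> borel_measurable borel"
      by (intro borel_measurable_Pair measurable_compose[OF _ Tm] fst_snd_measurable L2_bdd_supp_measurable[OF assms(1)])
    show "norm (T (fst (\<psi> \<xi>)), T (snd (\<psi> \<xi>))) \<le> 2 * K * norm (\<psi> \<xi>)" for \<xi>
    proof -
      have "norm (T (fst (\<psi> \<xi>)), T (snd (\<psi> \<xi>))) \<le> norm (T (fst (\<psi> \<xi>))) + norm (T (snd (\<psi> \<xi>)))"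
        by (rule norm_Pair_le)
      also have "\<dots> \<le> K * norm (\<psi> \<xi>) + K * norm (\<psi> \<xi>)"
        using K norm_fst_le[of "fst (\<psi> \<xi>)" "snd (\<psi> \<xi>)"] norm_snd_le[of "snd (\<psi> \<xi>)" "fst (\<psi> \<xi>)"]
        by (intro add_mono order_trans[OF K(2)] mult_left_mono) auto
      finally show ?thesis by simp
    qed
  qed simp
qed

lemma inner_integral_Basis:
  fixes f g :: "'a::euclidean_space \<Rightarrow> 'b::euclidean_space"
  assumes "f \<in> Lp 2" "g \<in> Lp 2"
  shows "(LINT x|lborel. f x \<bullet> g x) = (\<Sum>e\<in>Basis. LINT x|lborel. (f x \<bullet> e) * (g x \<bullet> e))"
proof -
  have "integrable lborel (\<lambda>x. (f x \<bullet> e) * (g x \<bullet> e))" for e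
    using Lp2_inner[OF Lp2_inner_const[OF assms(1), of e] Lp2_inner_const[OF assms(2), of e]] by simp
  then show ?thesis by (subst euclidean_inner) (rule Bochner_Integration.integral_sum)
qed

text \<open>The defining identity is carried over to the tests \<open>ift \<psi>\<close>, whose
  derivatives are the multipliers \<open>mulJ\<close>. It is done for each component separately
  because test functions are scalar.\<close>

lemma weak_deriv_ift:
  fixes w g :: "real ^ 'm::finite \<Rightarrow> 'b::euclidean_space"
  assumes wd: "has_weak_deriv \<beta> w g" and w: "w \<in> Lp 2" and g: "g \<in> Lp 2" and \<psi>: "L2_bdd_supp \<psi>"
  shows "(LINT x|lborel. ift (foldr mulJ (mi_dirs \<beta>) \<psi>) x \<bullet> w x) = (- 1) ^ mi_order \<beta> * (LINT x|lborel. ift \<psi> x \<bullet> g x)"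
proof -
  have e: "(LINT x|lborel. (ift (foldr mulJ (mi_dirs \<beta>) \<psi>) x \<bullet> e) * (w x \<bullet> e)) = (- 1) ^ mi_order \<beta> * (LINT x|lborel. (ift \<psi> x \<bullet> e) * (g x \<bullet> e))" for e
  proof -
    let ?\<psi> = "\<lambda>\<xi>. (fst (\<psi> \<xi>) \<bullet> e, snd (\<psi> \<xi>) \<bullet> e)"
    have b: "L2_bdd_supp ?\<psi>" by (rule L2_bdd_supp_map[OF \<psi> bounded_linear_inner_left])
    have i0: "ift ?\<psi> x = ift \<psi> x \<bullet> e" for x
      using ift_map[OF \<psi> bounded_linear_inner_left] by simp
    have m: "foldr mulJ vs ?\<psi> = (\<lambda>\<xi>. (fst (foldr mulJ vs \<psi> \<xi>) \<bullet> e, snd (foldr mulJ vs \<psi> \<xi>) \<bullet> e))" for vs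
      by (induction vs) (auto simp: mulJ_def Jrot_def)
    have i1: "foldr dir_deriv (mi_dirs \<beta>) (ift ?\<psi>) x = ift (foldr mulJ (mi_dirs \<beta>) \<psi>) x \<bullet> e" for x
      unfolding foldr_dir_deriv_ift[OF b] m
      using ift_map[OF L2_bdd_supp_foldr_mulJ[OF \<psi>] bounded_linear_inner_left] by simp
    have "(LINT x|lborel. foldr dir_deriv (mi_dirs \<beta>) (ift ?\<psi>) x * (w x \<bullet> e)) = (- 1) ^ mi_order \<beta> * (LINT x|lborel. ift ?\<psi> x * (g x \<bullet> e))"
    proof (rule weak_identity_extend[OF Lp2_inner_const[OF w] Lp2_inner_const[OF g] _ smooth_L2_ift[OF b]])
      fix \<phi> :: "real ^ 'm \<Rightarrow> real" assume t: "test_function \<phi>"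
      have "(LINT x|lborel. foldr dir_deriv (mi_dirs \<beta>) \<phi> x *\<^sub>R w x) \<bullet> e = ((- 1) ^ mi_order \<beta> *\<^sub>R (LINT x|lborel. \<phi> x *\<^sub>R g x)) \<bullet> e"
        using wd t by (simp add: has_weak_deriv_def partial_deriv_foldr)
      then have "(LINT x|lborel. (foldr dir_deriv (mi_dirs \<beta>) \<phi> x *\<^sub>R e) \<bullet> w x) = (- 1) ^ mi_order \<beta> * (LINT x|lborel. (\<phi> x *\<^sub>R e) \<bullet> g x)"
        by (simp only: inner_scaleR_left[of _ "LINT x|lborel. \<phi> x *\<^sub>R g x"] test_integral_inner[OF test_function_foldr[OF t] w] test_integral_inner[OF t g])
      then show "(LINT x|lborel. foldr dir_deriv (mi_dirs \<beta>) \<phi> x * (w x \<bullet> e)) = (- 1) ^ mi_order \<beta> * (LINT x|lborel. \<phi> x * (g x \<bullet> e))"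
        by (simp add: inner_commute)
    qed
    then show ?thesis unfolding i0 i1 .
  qed
  show ?thesis
    unfolding inner_integral_Basis[OF L2_bdd_supp_ift_Lp2[OF L2_bdd_supp_foldr_mulJ[OF \<psi>]] w] inner_integral_Basis[OF L2_bdd_supp_ift_Lp2[OF \<psi>] g] e
    by (simp add: sum_distrib_left)
qed

text \<open>The cosine and sine parts are bounded separately, whence the factor 2.\<close>

lemma norm_ft_le:
  fixes f :: "'a::euclidean_space \<Rightarrow> 'b::euclidean_space"
  assumes "integrable lborel f"
  shows "norm (ft f \<xi>) \<le> 2 * (LINT x|lborel. norm (f x))"
proof -
  have 1: "norm (LINT x|lborel. cos (x \<bullet> \<xi>) *\<^sub>R f x) \<le> (LINT x|lborel. norm (f x))"
    by (rule order_trans[OF integral_norm_bound integral_mono[OF integrable_norm[OF integrable_trig(1)[OF assms]] integrable_norm[OF assms]]])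
      (simp add: mult_left_le_one_le)
  have 2: "norm (LINT x|lborel. sin (x \<bullet> \<xi>) *\<^sub>R f x) \<le> (LINT x|lborel. norm (f x))"
    by (rule order_trans[OF integral_norm_bound integral_mono[OF integrable_norm[OF integrable_trig(2)[OF assms]] integrable_norm[OF assms]]])
      (simp add: mult_left_le_one_le)
  show ?thesis unfolding ft_def using norm_Pair_le[of "LINT x|lborel. cos (x \<bullet> \<xi>) *\<^sub>R f x" "LINT x|lborel. sin (x \<bullet> \<xi>) *\<^sub>R f x"] 1 2 by linarith
qed

lemma ft_map:
  assumes "integrable lborel f" "bounded_linear T"
  shows "ft (\<lambda>x. T (f x)) \<xi> = (T (fst (ft f \<xi>)), T (snd (ft f \<xi>)))"
  unfolding ft_def
  by (simp add: integral_bounded_linear[OF assms(2) integrable_trig(1)[OF assms(1)], symmetric]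
    integral_bounded_linear[OF assms(2) integrable_trig(2)[OF assms(1)], symmetric]
    linear_scale[OF bounded_linear.linear[OF assms(2)]])

text \<open>With max 1 t as base the laws of powers hold for all t >= 0, without a separate case at
  the origin.\<close>

lemma decay_eq: "0 \<le> \<gamma> \<Longrightarrow> 0 \<le> t \<Longrightarrow> decay \<gamma> t = max 1 t powr (- \<gamma>)"
proof (cases "t = 0")
  case False
  assume g: "0 \<le> \<gamma>" "0 \<le> t"
  show ?thesis
  proof (cases "t \<le> 1")
    case True
    then have "1 \<le> t powr (- \<gamma>)" using g False powr_mono2'[of "- \<gamma>" t 1] by simp
    then show ?thesis using True False by (simp add: decay_def max_def)
  next
    case f: False
    then have "t powr (- \<gamma>) \<le> t powr 0" using g by (intro powr_mono) auto
    then show ?thesis using f by (simp add: decay_def max_def)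
  qed
qed (simp add: decay_def)

section \<open>Gaussian moments and interpolation\<close>

lemma power_le_exp:
  fixes x :: real
  assumes "0 \<le> x" shows "x ^ n / fact n \<le> exp x"
proof -
  have s: "summable (\<lambda>n. x ^ n /\<^sub>R fact n)" by (rule summable_exp_generic)
  have "(\<Sum>k\<in>{n}. x ^ k /\<^sub>R fact k) \<le> (\<Sum>k. x ^ k /\<^sub>R fact k)"
    by (rule sum_le_suminf[OF s]) (use assms in auto)
  then show ?thesis by (simp add: exp_def divide_inverse mult.commute)
qed

text \<open>Half of the exponent absorbs the power, by a single term of the exponential series; x^j
  <= 1 + (x^j)^2 first passes to a power of x^2.\<close>

lemma power_gaussian_bound:
  fixes a :: real
  assumes "0 < a"
  obtains C where "0 < C" "\<And>x. 0 \<le> x \<Longrightarrow> x ^ j * exp (- (2 * a) * x\<^sup>2) \<le> C * exp (- a * x\<^sup>2)"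
proof (rule that[of "1 + fact j / a ^ j"])
  show "0 < 1 + fact j / a ^ j" using assms by (simp add: add_pos_nonneg)
  fix x :: real assume x: "0 \<le> x"
  have "(a * x\<^sup>2) ^ j / fact j \<le> exp (a * x\<^sup>2)" using assms by (intro power_le_exp) simp
  then have 1: "(x ^ j)\<^sup>2 \<le> fact j / a ^ j * exp (a * x\<^sup>2)"
    using assms by (simp add: power_mult_distrib field_simps power_mult[symmetric] mult.commute)
  have "x ^ j \<le> 1 + (x ^ j)\<^sup>2"
    using zero_le_power2[of "x ^ j - 1"] zero_le_power[OF x, of j] by (simp add: power2_diff del: zero_le_power2)
  also have "1 + (x ^ j)\<^sup>2 \<le> 1 * exp (a * x\<^sup>2) + fact j / a ^ j * exp (a * x\<^sup>2)"
    by (rule add_mono[OF _ 1]) (use assms in simp)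
  also have "\<dots> = (1 + fact j / a ^ j) * exp (a * x\<^sup>2)" by (rule distrib_right[symmetric])
  finally have "x ^ j \<le> (1 + fact j / a ^ j) * exp (a * x\<^sup>2)" .
  then have "x ^ j * exp (- (2 * a) * x\<^sup>2) \<le> (1 + fact j / a ^ j) * exp (a * x\<^sup>2) * exp (- (2 * a) * x\<^sup>2)"
    by (rule mult_right_mono) simp
  also have "\<dots> = (1 + fact j / a ^ j) * exp (- a * x\<^sup>2)" by (simp add: mult.assoc exp_add[symmetric])
  finally show "x ^ j * exp (- (2 * a) * x\<^sup>2) \<le> (1 + fact j / a ^ j) * exp (- a * x\<^sup>2)" .
qed

text \<open>For t <= 1 the volume of the unit ball suffices; for t > 1 the dilation by sqrt t
  compares the integral with a fixed Gaussian moment and produces the power of t.\<close>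

lemma heat_integral_bound:
  assumes "0 < \<mu>"
  shows "\<exists>C>0. \<forall>t\<ge>0. (LINT \<xi>|(lborel::'a::euclidean_space measure). indicator (cball 0 1) \<xi> * (norm \<xi> ^ j * exp (- \<mu> * (norm \<xi>)\<^sup>2 * t)))
    \<le> C * max 1 t powr (- (real DIM('a) + real j) / 2)"
proof -
  let ?I = "\<lambda>t (\<xi>::'a). indicator (cball 0 1) \<xi> * (norm \<xi> ^ j * exp (- \<mu> * (norm \<xi>)\<^sup>2 * t))"
  let ?h = "\<lambda>\<xi>::'a. norm \<xi> ^ j * exp (- \<mu> * (norm \<xi>)\<^sup>2)"
  have ball: "integrable lborel (\<lambda>\<xi>::'a. indicator (cball 0 1) \<xi> * (1::real))"
    using integrable_cball_const[of 1 "1::real"] by simp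
  have Im: "?I t \<in> borel_measurable lborel" for t
    by (intro borel_measurable_times borel_measurable_indicator) auto
  have Ile: "?I t \<xi> \<le> indicator (cball 0 1) \<xi> * 1" "0 \<le> ?I t \<xi>" if "0 \<le> t" for t \<xi>
    using that assms by (auto simp: indicator_def intro!: mult_le_one power_le_one)
  have Ii: "integrable lborel (?I t)" if "0 \<le> t" for t
    by (rule Bochner_Integration.integrable_bound[OF ball Im]) (use Ile[OF that] in auto)
  have hi: "integrable lborel ?h"
  proof -
    define a where "a = \<mu> / 2"
    have a: "0 < a" using assms by (simp add: a_def)
    obtain C where C: "0 < C" "\<And>x. 0 \<le> x \<Longrightarrow> x ^ j * exp (- (2 * a) * x\<^sup>2) \<le> C * exp (- a * x\<^sup>2)"
      using power_gaussian_bound[OF a, of j] by blast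
    have g: "integrable lborel (\<lambda>\<xi>::'a. C * gaussian (0 + sqrt (2 * a) *\<^sub>R \<xi>))"
      using a by (intro integrable_mult_right lborel_integrable_scaling gaussian_integrable) simp
    show ?thesis
    proof (rule Bochner_Integration.integrable_bound[OF g])
      have "norm (?h \<xi>) \<le> norm (C * gaussian (0 + sqrt (2 * a) *\<^sub>R \<xi>))" for \<xi> :: 'a
        using C(2)[of "norm \<xi>"] C(1) a by (simp add: gaussian_def power_mult_distrib a_def abs_mult)
      then show "AE \<xi> in lborel. norm (?h \<xi>) \<le> norm (C * gaussian (0 + sqrt (2 * a) *\<^sub>R \<xi>))" by simp
    qed simp
  qed
  define C where "C = max 1 (max (LINT \<xi>|(lborel::'a measure). indicator (cball 0 1) \<xi> * 1) (integral\<^sup>L lborel ?h))"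
  have "integral\<^sup>L lborel (?I t) \<le> C * max 1 t powr (- (real DIM('a) + real j) / 2)" if t: "0 \<le> t" for t
  proof (cases "t \<le> 1")
    case True
    have "integral\<^sup>L lborel (?I t) \<le> (LINT \<xi>|(lborel::'a measure). indicator (cball 0 1) \<xi> * 1)"
      by (rule integral_mono[OF Ii[OF t] ball]) (rule Ile(1)[OF t])
    also have "\<dots> \<le> C" by (simp add: C_def)
    finally show ?thesis using max_absorb1[OF True] by (simp only: powr_one_eq_one mult_1_right)
  next
    case False
    then have t1: "1 < t" by simp
    let ?s = "sqrt t"
    have s: "0 < ?s" "?s\<^sup>2 = t" using t1 by auto
    have eq: "?h (0 + ?s *\<^sub>R \<xi>) = ?s ^ j * (norm \<xi> ^ j * exp (- \<mu> * (norm \<xi>)\<^sup>2 * t))" for \<xi> :: 'a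
      using s t1 by (simp add: power_mult_distrib mult_ac)
    have hs: "integrable lborel (\<lambda>\<xi>. ?h (0 + ?s *\<^sub>R \<xi>))"
      using s by (intro lborel_integrable_scaling hi) auto
    have "?s ^ j * integral\<^sup>L lborel (?I t) = (LINT \<xi>|lborel. ?s ^ j * ?I t \<xi>)" by simp
    also have "\<dots> \<le> (LINT \<xi>|lborel. ?h (0 + ?s *\<^sub>R \<xi>))"
    proof (rule integral_mono[OF _ hs])
      show "integrable lborel (\<lambda>\<xi>. ?s ^ j * ?I t \<xi>)" using Ii[OF t] by simp
      show "?s ^ j * ?I t \<xi> \<le> ?h (0 + ?s *\<^sub>R \<xi>)" for \<xi>
        unfolding eq using s by (auto simp: indicator_def)
    qed
    finally have "?s ^ DIM('a) * (?s ^ j * integral\<^sup>L lborel (?I t)) \<le> ?s ^ DIM('a) * (LINT \<xi>|lborel. ?h (0 + ?s *\<^sub>R \<xi>))"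
      using s by (intro mult_left_mono) auto
    also have "\<dots> = integral\<^sup>L lborel ?h"
      using lborel_integral_scaling[of ?h ?s 0] s by simp
    also have "\<dots> \<le> C" by (simp add: C_def)
    finally have "?s ^ (DIM('a) + j) * integral\<^sup>L lborel (?I t) \<le> C" by (simp add: power_add mult.assoc)
    moreover have "?s ^ (DIM('a) + j) = t powr ((real DIM('a) + real j) / 2)"
      using t1 by (simp add: powr_half_sqrt[symmetric] powr_powr powr_realpow[symmetric] del: powr_half_sqrt_powr)
    ultimately have "t powr ((real DIM('a) + real j) / 2) * integral\<^sup>L lborel (?I t) \<le> C" by simp
    then have "t powr (- ((real DIM('a) + real j) / 2)) * (t powr ((real DIM('a) + real j) / 2) * integral\<^sup>L lborel (?I t)) \<le> t powr (- ((real DIM('a) + real j) / 2)) * C"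
      by (rule mult_left_mono) simp
    then have "integral\<^sup>L lborel (?I t) \<le> t powr (- ((real DIM('a) + real j) / 2)) * C"
      using t1 by (simp add: mult.assoc[symmetric] powr_add[symmetric])
    then show ?thesis using t1 by (simp add: max_def mult.commute minus_divide_left)
  qed
  then show ?thesis by (intro exI[of _ C]) (auto simp: C_def)
qed

text \<open>For finite q, |f|^q is at most sup^(q - 2) |f|^2, and the rates m/2 and m/4 combine to
  (m/2) (1 - 2/q) + (m/4) (2/q) = (m/2) (1 - 1/q). For p = \<infinity> the pointwise bound is the
  claim.\<close>

lemma Lp_interpolation:
  fixes f :: "real ^ 'm::finite \<Rightarrow> 'b::euclidean_space"
  assumes f: "f \<in> Lp 2" and "0 \<le> M" and R: "1 \<le> R" and p: "2 \<le> p"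
    and sup: "\<And>x. norm (f x) \<le> M * R powr (- (real CARD('m) / 2))"
    and L2: "Lp_norm 2 f \<le> M * R powr (- (real CARD('m) / 4))"
  shows "f \<in> Lp p" "Lp_norm p f \<le> M * R powr (- base_rate TYPE('m) p)"
proof -
  have m[measurable]: "f \<in> borel_measurable borel" using f by (simp add: Lp2_iff)
  define X where "X = M * R powr (- (real CARD('m) / 2))"
  have X: "0 \<le> X" "\<And>x. norm (f x) \<le> X" using assms by (auto simp: X_def)
  have "f \<in> Lp p \<and> Lp_norm p f \<le> M * R powr (- base_rate TYPE('m) p)"
  proof (cases "p = \<infinity>")
    case True
    have e: "esssup lborel (\<lambda>x. ennreal (norm (f x))) \<le> ennreal X"
      by (rule esssup_I) (auto simp: X ennreal_leI)
    then have "esssup lborel (\<lambda>x. ennreal (norm (f x))) < \<infinity>" by (rule le_less_trans) simp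
    moreover have "enn2real (esssup lborel (\<lambda>x. ennreal (norm (f x)))) \<le> X"
      using enn2real_mono[OF e] X(1) by simp
    ultimately show ?thesis using True m by (simp add: Lp_def Lp_norm_def base_rate_def X_def)
  next
    case False
    define q where "q = enn2real p"
    have pq: "p = ennreal q" using False by (simp add: q_def ennreal_enn2real_if)
    have q: "2 \<le> q"
    proof -
      have "ennreal 2 \<le> ennreal q" using p pq by simp
      moreover have "0 \<le> q" by (simp add: q_def)
      ultimately show ?thesis by (subst (asm) ennreal_le_iff) auto
    qed
    have br: "base_rate TYPE('m) p = real CARD('m) / 2 * (1 - 1 / q)"
    proof -
      have "inverse (ennreal q) = ennreal (inverse q)" using q by (intro inverse_ennreal) simp
      then have "enn2real (inverse p) = inverse q" using q by (subst pq) simp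
      then show ?thesis by (simp add: base_rate_def inverse_eq_divide)
    qed
    have le: "norm (f x) powr q \<le> X powr (q - 2) * (norm (f x))\<^sup>2" for x
    proof (cases "f x = 0")
      case False
      then have "norm (f x) powr q = norm (f x) powr (q - 2) * norm (f x) powr 2"
        using powr_add[of "norm (f x)" "q - 2" 2] by simp
      also have "\<dots> = norm (f x) powr (q - 2) * (norm (f x))\<^sup>2" using False by simp
      also have "\<dots> \<le> X powr (q - 2) * (norm (f x))\<^sup>2"
        using X(2)[of x] q by (intro mult_right_mono powr_mono2) auto
      finally show ?thesis .
    qed simp
    have int2: "integrable lborel (\<lambda>x. X powr (q - 2) * (norm (f x))\<^sup>2)" using f by (simp add: Lp2_iff)
    have int: "integrable lborel (\<lambda>x. norm (f x) powr q)"
      by (rule Bochner_Integration.integrable_bound[OF int2]) (use le in \<open>auto intro: order_trans\<close>)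
    then have fp: "f \<in> Lp p" using False m by (simp add: Lp_def q_def)
    have "(LINT x|lborel. norm (f x) powr q) \<le> X powr (q - 2) * (Lp_norm 2 f)\<^sup>2"
      using integral_mono[OF int int2 le] by (simp add: Lp_norm2_sq)
    also have "\<dots> \<le> X powr (q - 2) * (M * R powr (- (real CARD('m) / 4)))\<^sup>2"
      by (intro mult_left_mono power_mono L2 Lp_norm2_nonneg) simp
    finally have 1: "(LINT x|lborel. norm (f x) powr q) \<le> X powr (q - 2) * (M * R powr (- (real CARD('m) / 4)))\<^sup>2" .
    have "Lp_norm p f = (LINT x|lborel. norm (f x) powr q) powr (1 / q)" using False by (simp add: Lp_norm_def q_def)
    also have "\<dots> \<le> (X powr (q - 2) * (M * R powr (- (real CARD('m) / 4)))\<^sup>2) powr (1 / q)"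
      using q by (intro powr_mono2 1) (auto simp: integral_nonneg_AE)
    also have "\<dots> = M * R powr (- base_rate TYPE('m) p)"
    proof (cases "M = 0")
      case False
      then have M: "0 < M" using \<open>0 \<le> M\<close> by simp
      let ?d = "real CARD('m)"
      have R0: "0 < R" using R by simp
      have "X powr (q - 2) = M powr (q - 2) * R powr (- (?d / 2) * (q - 2))"
        using M by (simp add: X_def powr_mult powr_powr)
      moreover have "(M * R powr (- (?d / 4)))\<^sup>2 = M powr 2 * R powr (- (?d / 2))"
        using M R0 by (simp add: power_mult_distrib power2_eq_square[of "R powr _"] powr_add[symmetric])
      ultimately have "X powr (q - 2) * (M * R powr (- (?d / 4)))\<^sup>2 = (M powr (q - 2) * M powr 2) * (R powr (- (?d / 2) * (q - 2)) * R powr (- (?d / 2)))"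
        by simp
      also have "\<dots> = M powr q * R powr (- (?d / 2) * (q - 1))"
      proof -
        have "- (?d / 2) * (q - 2) + - (?d / 2) = - (?d / 2) * (q - 1)" by (simp add: field_simps)
        then show ?thesis by (simp only: powr_add[symmetric]) simp
      qed
      finally have "(X powr (q - 2) * (M * R powr (- (?d / 4)))\<^sup>2) powr (1 / q) = M * R powr (- (?d / 2) * (q - 1) / q)"
        using M q by (simp add: powr_mult powr_powr)
      moreover have "- (?d / 2) * (q - 1) / q = - base_rate TYPE('m) p"
        unfolding br using q by (simp add: field_simps)
      ultimately show ?thesis by simp
    qed simp
    finally show ?thesis using fp by simp
  qed
  then show "f \<in> Lp p" "Lp_norm p f \<le> M * R powr (- base_rate TYPE('m) p)" by auto
qed

text \<open>The sup norm is bounded by the L^1 norm of the amplitude, the L^2 norm by Plancherel,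
  and the rest is interpolation. Three monomials are carried because the dissipative block has three
  contributions.\<close>

lemma low_frequency_Lp:
  assumes \<mu>: "0 < \<mu>"
  shows "\<exists>C>0. \<forall>(\<psi> :: real ^ 'm::finite \<Rightarrow> 'b::euclidean_space \<times> 'b) t a1 a2 a3 p.
    \<psi> \<in> borel_measurable borel \<longrightarrow> 0 \<le> t \<longrightarrow> 0 \<le> a1 \<longrightarrow> 0 \<le> a2 \<longrightarrow> 0 \<le> a3 \<longrightarrow>
    (\<forall>\<xi>. norm (\<psi> \<xi>) \<le> indicator (cball 0 1) \<xi> * ((a1 * norm \<xi> ^ j1 + a2 * norm \<xi> ^ j2 + a3 * norm \<xi> ^ j3) * exp (- \<mu> * (norm \<xi>)\<^sup>2 * t))) \<longrightarrow>
    2 \<le> p \<longrightarrow> ift \<psi> \<in> Lp p \<and>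
    Lp_norm p (ift \<psi>) \<le> C * (a1 * max 1 t powr (- real j1 / 2) + a2 * max 1 t powr (- real j2 / 2) + a3 * max 1 t powr (- real j3 / 2))
      * max 1 t powr (- base_rate TYPE('m) p)"
proof -
  let ?m = "real CARD('m)"
  define I where "I \<mu> j t = (\<lambda>\<xi>::real^'m. indicator (cball 0 1) \<xi> * (norm \<xi> ^ j * exp (- \<mu> * (norm \<xi>)\<^sup>2 * t)))" for \<mu> t :: real and j
  have Imeas: "I \<mu> j t \<in> borel_measurable borel" for \<mu> t j
    unfolding I_def by (intro borel_measurable_times borel_measurable_indicator) auto
  have Iint: "integrable lborel (I \<mu> j t)" if "0 < \<mu>" "0 \<le> t" for \<mu> t j
  proof (rule Bochner_Integration.integrable_bound)
    show "integrable lborel (\<lambda>\<xi>::real^'m. indicator (cball 0 1) \<xi> *\<^sub>R (1::real))" by (rule integrable_cball_const)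
    have "norm (I \<mu> j t \<xi>) \<le> norm (indicator (cball 0 1) \<xi> *\<^sub>R (1::real))" for \<xi>
      using that by (auto simp: I_def indicator_def abs_mult intro!: mult_le_one power_le_one)
    then show "AE \<xi> in lborel. norm (I \<mu> j t \<xi>) \<le> norm (indicator (cball 0 1) \<xi> *\<^sub>R (1::real))" by simp
  qed (use Imeas in simp)
  have H: "\<exists>C>0. \<forall>t\<ge>0. integral\<^sup>L lborel (I \<mu> j t) \<le> C * max 1 t powr (- (?m + real j) / 2)" if "0 < \<mu>" for \<mu> j
    using heat_integral_bound[OF that, of j, where 'a="real^'m"] by (simp add: I_def)
  \<comment> \<open>One constant for each pair of rate and power, fixed before t, \<psi> and the
    coefficients are introduced.\<close>
  define Cs where "Cs \<mu> j = (SOME C. C > 0 \<and> (\<forall>t\<ge>0. integral\<^sup>L lborel (I \<mu> j t) \<le> C * max 1 t powr (- (?m + real j) / 2)))" for \<mu> j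
  have Cs: "Cs \<mu> j > 0" "0 \<le> t \<Longrightarrow> integral\<^sup>L lborel (I \<mu> j t) \<le> Cs \<mu> j * max 1 t powr (- (?m + real j) / 2)" if "0 < \<mu>" for \<mu> j t
    using someI_ex[OF H[OF that, of j, unfolded Bex_def]] unfolding Cs_def by blast+
  define c where "c = sqrt ((2 * pi) ^ DIM(real^'m))"
  define C1 where "C1 = Cs \<mu> j1 + Cs \<mu> j2 + Cs \<mu> j3"
  \<comment> \<open>The doubled arguments come from squaring the majorant, which is again of the
    same form; the 3 comes from (x + y + z)^2 <= 3 (x^2 + y^2 + z^2).\<close>
  define C2 where "C2 = 3 * (Cs (2*\<mu>) (2*j1) + Cs (2*\<mu>) (2*j2) + Cs (2*\<mu>) (2*j3))"
  define C where "C = C1 + c * sqrt C2"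
  have C1: "Cs \<mu> j1 \<le> C1" "Cs \<mu> j2 \<le> C1" "Cs \<mu> j3 \<le> C1" "0 < C1"
    using Cs(1)[OF \<mu>, of j1] Cs(1)[OF \<mu>, of j2] Cs(1)[OF \<mu>, of j3] unfolding C1_def by linarith+
  have \<mu>2: "0 < 2 * \<mu>" using \<mu> by simp
  have C2: "3 * Cs (2*\<mu>) (2*j1) \<le> C2" "3 * Cs (2*\<mu>) (2*j2) \<le> C2" "3 * Cs (2*\<mu>) (2*j3) \<le> C2" "0 < C2"
    using Cs(1)[OF \<mu>2, of "2*j1"] Cs(1)[OF \<mu>2, of "2*j2"] Cs(1)[OF \<mu>2, of "2*j3"] by (simp_all add: C2_def)
  have c: "0 < c" by (simp add: c_def)
  have C: "0 < C" "C1 \<le> C" "c * sqrt C2 \<le> C" using C1 C2 c by (auto simp: C_def intro: add_pos_nonneg)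
  show ?thesis
  proof (rule exI[of _ C], rule conjI[OF C(1)], intro allI impI)
    fix \<psi> :: "real ^ 'm \<Rightarrow> 'b \<times> 'b" and t a1 a2 a3 :: real and p :: ennreal
    assume m: "\<psi> \<in> borel_measurable borel" and t: "0 \<le> t" and a: "0 \<le> a1" "0 \<le> a2" "0 \<le> a3" and p: "2 \<le> p"
      and le: "\<forall>\<xi>. norm (\<psi> \<xi>) \<le> indicator (cball 0 1) \<xi> * ((a1 * norm \<xi> ^ j1 + a2 * norm \<xi> ^ j2 + a3 * norm \<xi> ^ j3) * exp (- \<mu> * (norm \<xi>)\<^sup>2 * t))"
    define R where "R = max 1 t"
    have R: "1 \<le> R" by (simp add: R_def)
    define b1 b2 b3 where "b1 = a1 * R powr (- real j1 / 2)" and "b2 = a2 * R powr (- real j2 / 2)" and "b3 = a3 * R powr (- real j3 / 2)"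
    have b: "0 \<le> b1" "0 \<le> b2" "0 \<le> b3" using a by (auto simp: b1_def b2_def b3_def)
    let ?J = "\<lambda>\<xi>. a1 * I \<mu> j1 t \<xi> + a2 * I \<mu> j2 t \<xi> + a3 * I \<mu> j3 t \<xi>"
    let ?J2 = "\<lambda>\<xi>. 3 * (a1\<^sup>2 * I (2*\<mu>) (2*j1) t \<xi> + a2\<^sup>2 * I (2*\<mu>) (2*j2) t \<xi> + a3\<^sup>2 * I (2*\<mu>) (2*j3) t \<xi>)"
    have J: "norm (\<psi> \<xi>) \<le> ?J \<xi>" for \<xi> using le[rule_format, of \<xi>] by (simp add: I_def algebra_simps)
    have sq: "(I \<mu> j t \<xi>)\<^sup>2 = I (2*\<mu>) (2*j) t \<xi>" for j \<xi>
      by (auto simp: I_def indicator_def power_mult_distrib power_mult[symmetric] exp_double[symmetric] mult_ac)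
    have J2: "(norm (\<psi> \<xi>))\<^sup>2 \<le> ?J2 \<xi>" for \<xi>
    proof -
      have "(norm (\<psi> \<xi>))\<^sup>2 \<le> (?J \<xi>)\<^sup>2" by (rule power_mono[OF J]) simp
      also have "\<dots> \<le> 3 * ((a1 * I \<mu> j1 t \<xi>)\<^sup>2 + (a2 * I \<mu> j2 t \<xi>)\<^sup>2 + (a3 * I \<mu> j3 t \<xi>)\<^sup>2)"
      proof -
        have "(x + y + z)\<^sup>2 \<le> 3 * (x\<^sup>2 + y\<^sup>2 + z\<^sup>2)" for x y z :: real
        proof -
          have "3 * (x\<^sup>2 + y\<^sup>2 + z\<^sup>2) - (x + y + z)\<^sup>2 = (x - y)\<^sup>2 + (y - z)\<^sup>2 + (x - z)\<^sup>2"
            by (simp add: power2_eq_square algebra_simps)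
          then show ?thesis by (smt (verit) zero_le_power2)
        qed
        then show ?thesis .
      qed
      finally show ?thesis by (simp only: power_mult_distrib sq)
    qed
    note Ii = Iint[OF \<mu> t] Iint[OF \<mu>2 t]
    have Ji: "integrable lborel ?J" by (intro Bochner_Integration.integrable_add integrable_mult_right Ii)
    have J2i: "integrable lborel ?J2" by (intro Bochner_Integration.integrable_add integrable_mult_right Ii)
    have pi: "integrable lborel \<psi>"
    proof (rule Bochner_Integration.integrable_bound[OF Ji])
      have "norm (\<psi> \<xi>) \<le> norm (?J \<xi>)" for \<xi>
        unfolding real_norm_def by (rule order_trans[OF J abs_ge_self])
      then show "AE \<xi> in lborel. norm (\<psi> \<xi>) \<le> norm (?J \<xi>)" by (intro AE_I2)
    qed (use m in simp)
    have p2i: "integrable lborel (\<lambda>\<xi>. (norm (\<psi> \<xi>))\<^sup>2)"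
    proof (rule Bochner_Integration.integrable_bound[OF J2i])
      have "norm ((norm (\<psi> \<xi>))\<^sup>2) \<le> norm (?J2 \<xi>)" for \<xi>
        unfolding real_norm_def abs_of_nonneg[OF zero_le_power2] by (rule order_trans[OF J2 abs_ge_self])
      then show "AE \<xi> in lborel. norm ((norm (\<psi> \<xi>))\<^sup>2) \<le> norm (?J2 \<xi>)" by (intro AE_I2)
    qed (use m in simp)
    have pL: "\<psi> \<in> Lp 1" "\<psi> \<in> Lp 2" using pi p2i m by (auto simp: Lp1_iff Lp2_iff)
    have split: "R powr (- (?m + real j) / 2) = R powr (- (?m / 2)) * R powr (- real j / 2)" for j
    proof -
      have e: "- (?m + real j) / 2 = - (?m / 2) + - real j / 2" by (simp add: field_simps)
      show ?thesis unfolding e by (rule powr_add)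
    qed
    have "(LINT \<xi>|lborel. norm (\<psi> \<xi>)) \<le> integral\<^sup>L lborel ?J"
      by (rule integral_mono[OF integrable_norm[OF pi] Ji J])
    also have "\<dots> = a1 * integral\<^sup>L lborel (I \<mu> j1 t) + a2 * integral\<^sup>L lborel (I \<mu> j2 t) + a3 * integral\<^sup>L lborel (I \<mu> j3 t)"
      using Ii by simp
    also have "\<dots> \<le> a1 * (C1 * R powr (- (?m + real j1) / 2)) + a2 * (C1 * R powr (- (?m + real j2) / 2)) + a3 * (C1 * R powr (- (?m + real j3) / 2))"
      using C1 by (intro add_mono mult_left_mono a order_trans[OF Cs(2)[OF \<mu> t, folded R_def]] mult_right_mono) auto
    also have "\<dots> = C1 * (b1 + b2 + b3) * R powr (- (?m / 2))"
      unfolding split b1_def b2_def b3_def by (simp add: algebra_simps)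
    also have "\<dots> \<le> C * (b1 + b2 + b3) * R powr (- (?m / 2))"
      using C b by (intro mult_right_mono) auto
    finally have sup: "norm (ift \<psi> x) \<le> C * (b1 + b2 + b3) * R powr (- (?m / 2))" for x
      using norm_ift_le[OF pi, of x] by linarith
    have "(Lp_norm 2 \<psi>)\<^sup>2 \<le> integral\<^sup>L lborel ?J2"
      unfolding Lp_norm2_sq by (rule integral_mono[OF p2i J2i J2])
    also have "\<dots> = 3 * (a1\<^sup>2 * integral\<^sup>L lborel (I (2*\<mu>) (2*j1) t) + a2\<^sup>2 * integral\<^sup>L lborel (I (2*\<mu>) (2*j2) t) + a3\<^sup>2 * integral\<^sup>L lborel (I (2*\<mu>) (2*j3) t))"
      using Ii by simp
    also have "\<dots> \<le> 3 * (a1\<^sup>2 * (C2 / 3 * R powr (- (?m + real (2*j1)) / 2)) + a2\<^sup>2 * (C2 / 3 * R powr (- (?m + real (2*j2)) / 2)) + a3\<^sup>2 * (C2 / 3 * R powr (- (?m + real (2*j3)) / 2)))"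
      using C2 by (intro add_mono mult_left_mono order_trans[OF Cs(2)[OF \<mu>2 t, folded R_def]] mult_right_mono) auto
    also have "\<dots> = C2 * (b1\<^sup>2 + b2\<^sup>2 + b3\<^sup>2) * R powr (- (?m / 2))"
    proof -
      have "R powr (- real (2*j) / 2) = (R powr (- real j / 2))\<^sup>2" for j
        by (simp add: power2_eq_square powr_add[symmetric])
      then show ?thesis unfolding split b1_def b2_def b3_def power_mult_distrib by (simp add: algebra_simps)
    qed
    also have "\<dots> \<le> C2 * (b1 + b2 + b3)\<^sup>2 * R powr (- (?m / 2))"
    proof -
      have "b1\<^sup>2 + b2\<^sup>2 + b3\<^sup>2 \<le> (b1 + b2 + b3)\<^sup>2"
        using b by (simp add: power2_eq_square algebra_simps add_nonneg_nonneg)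
      then show ?thesis using C2 by (intro mult_right_mono mult_left_mono) auto
    qed
    also have "\<dots> = (sqrt C2 * (b1 + b2 + b3) * R powr (- (?m / 4)))\<^sup>2"
      using C2 by (simp add: power_mult_distrib power2_eq_square[of "R powr _"] powr_add[symmetric])
    finally have "Lp_norm 2 \<psi> \<le> sqrt C2 * (b1 + b2 + b3) * R powr (- (?m / 4))"
      by (rule power2_le_imp_le) (use b C2 in auto)
    then have "c * Lp_norm 2 \<psi> \<le> c * (sqrt C2 * (b1 + b2 + b3) * R powr (- (?m / 4)))"
      using c by (intro mult_left_mono) auto
    also have "\<dots> \<le> C * (b1 + b2 + b3) * R powr (- (?m / 4))"
      using C(3) b mult_right_mono[OF C(3), of "(b1 + b2 + b3) * R powr (- (?m / 4))"] by (simp add: mult_ac)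
    finally have L2: "Lp_norm 2 (ift \<psi>) \<le> C * (b1 + b2 + b3) * R powr (- (?m / 4))"
      using ift_L2(2)[OF pL] unfolding c_def by linarith
    have "0 \<le> C * (b1 + b2 + b3)" using C b by simp
    from Lp_interpolation[OF ift_L2(1)[OF pL] this R p sup L2]
    show "ift \<psi> \<in> Lp p \<and> Lp_norm p (ift \<psi>) \<le> C * (a1 * max 1 t powr (- real j1 / 2) + a2 * max 1 t powr (- real j2 / 2) + a3 * max 1 t powr (- real j3 / 2))
      * max 1 t powr (- base_rate TYPE('m) p)"
      by (simp add: b1_def b2_def b3_def R_def)
  qed
qed

section \<open>Weak solutions in Fourier variables\<close>

lemma mv_measurable:
  fixes M :: "real^'n^'k" and f :: "'a::topological_space \<Rightarrow> real^'n"
  assumes "f \<in> borel_measurable borel"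
  shows "(\<lambda>x. M *v f x) \<in> borel_measurable borel"
  by (rule measurable_compose[OF assms borel_measurable_continuous_onI[OF matrix_vector_mult_linear_continuous_on]])

lemma mv_Lp2:
  fixes M :: "real^'n^'n" and w :: "real^'m \<Rightarrow> real^'n"
  assumes "w \<in> Lp 2"
  shows "(\<lambda>x. M *v w x) \<in> Lp 2"
proof -
  obtain K where K: "\<And>x. norm (M *v x) \<le> K * norm x"
    using linear_norm_bound[OF matrix_vector_mul_linear[of M]] by blast
  show ?thesis
    by (rule Lp2_bound[OF assms mv_measurable[OF Lp2_measurable[OF assms]] K])
qed

lemma mv_inner_norm:
  fixes M :: "real^'n^'n" and e :: "real^'n"
  shows "\<exists>K\<ge>0. \<forall>w \<in> (Lp 2 :: (real^'m \<Rightarrow> real^'n) set). Lp_norm 2 (\<lambda>x. (M *v w x) \<bullet> e) \<le> K * Lp_norm 2 w"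
proof -
  obtain K where K: "0 \<le> K" "\<And>x. norm (M *v x) \<le> K * norm x"
    using linear_norm_bound[OF matrix_vector_mul_linear[of M]] by blast
  have "Lp_norm 2 (\<lambda>x. (M *v w x) \<bullet> e) \<le> (norm e * K) * Lp_norm 2 w" if w: "w \<in> Lp 2" for w :: "real^'m \<Rightarrow> real^'n"
  proof (rule Lp_norm2_mono[OF w])
    show "(\<lambda>x. (M *v w x) \<bullet> e) \<in> borel_measurable borel"
      by (rule Lp2_measurable[OF Lp2_inner_const[OF mv_Lp2[OF w]]])
    show "norm ((M *v w x) \<bullet> e) \<le> (norm e * K) * norm (w x)" for x
    proof -
      have "norm ((M *v w x) \<bullet> e) \<le> norm (M *v w x) * norm e" by (simp add: Cauchy_Schwarz_ineq2)
      also have "\<dots> \<le> (K * norm (w x)) * norm e" by (intro mult_right_mono K) simp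
      finally show ?thesis by (simp add: mult_ac)
    qed
  qed (use K in simp)
  then show ?thesis using K(1) by (intro exI[of _ "norm e * K"]) auto
qed

lemma symbol_mv: "symbol A \<xi> *v x = (\<Sum>\<alpha>\<in>UNIV. (\<xi> $ \<alpha>) *\<^sub>R (A \<alpha> *v x))"
  unfolding symbol_def bounded_bilinear.sum_left[OF bounded_bilinear_mv] by (simp add: mv_simps)

lemma symbol_mv_measurable:
  fixes A :: "'m::finite \<Rightarrow> real^'n^'n" and f :: "real^'m \<Rightarrow> real^'n"
  assumes "f \<in> borel_measurable borel"
  shows "(\<lambda>\<xi>. symbol A \<xi> *v f \<xi>) \<in> borel_measurable borel"
  unfolding symbol_mv
proof (intro borel_measurable_sum borel_measurable_scaleR mv_measurable assms)
  show "(\<lambda>\<xi>::real^'m. \<xi> $ \<alpha>) \<in> borel_measurable borel" for \<alpha>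
    by (intro borel_measurable_continuous_onI continuous_intros)
qed

lemma gen_measurable:
  assumes "g \<in> borel_measurable borel"
  shows "(\<lambda>\<xi>. gen A D \<xi> (g \<xi>)) \<in> borel_measurable borel"
  unfolding gen_def Eop_def
  by (intro borel_measurable_Pair borel_measurable_add borel_measurable_diff mv_measurable symbol_mv_measurable
    fst_snd_measurable assms)

lemma flow_measurable:
  assumes "g \<in> borel_measurable borel"
  shows "(\<lambda>\<xi>. lflow (gen A D \<xi>) t (g \<xi>)) \<in> borel_measurable borel"
  by (rule lflow_measurable[OF gen_measurable assms])

lemma L2_bdd_supp_add:
  assumes "L2_bdd_supp f" "L2_bdd_supp g"
  shows "L2_bdd_supp (\<lambda>x. f x + g x)"
proof -
  obtain R S where "\<forall>x. R < norm x \<longrightarrow> f x = 0" "\<forall>x. S < norm x \<longrightarrow> g x = 0"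
    using assms by (auto simp: L2_bdd_supp_def)
  then have "\<forall>x. max R S < norm x \<longrightarrow> f x + g x = 0" by simp
  then show ?thesis using assms Lp2_add unfolding L2_bdd_supp_def by blast
qed

lemma L2_bdd_supp_scaleR:
  assumes "L2_bdd_supp f" shows "L2_bdd_supp (\<lambda>x. a *\<^sub>R f x)"
proof -
  obtain R where "\<forall>x. R < norm x \<longrightarrow> f x = 0" using assms by (auto simp: L2_bdd_supp_def)
  then have "\<forall>x. R < norm x \<longrightarrow> a *\<^sub>R f x = 0" by simp
  then show ?thesis using assms Lp2_scaleR unfolding L2_bdd_supp_def by blast
qed

lemma L2_bdd_supp_diff: "L2_bdd_supp f \<Longrightarrow> L2_bdd_supp g \<Longrightarrow> L2_bdd_supp (\<lambda>x. f x - g x)"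
  using L2_bdd_supp_add[of f "\<lambda>x. (-1) *\<^sub>R g x"] L2_bdd_supp_scaleR[of g "-1"] by simp

lemma L2_bdd_supp_0: "L2_bdd_supp (\<lambda>x. 0)"
  by (simp add: L2_bdd_supp_def Lp2_iff)

lemma L2_bdd_supp_sum: "finite S \<Longrightarrow> (\<And>i. i \<in> S \<Longrightarrow> L2_bdd_supp (f i)) \<Longrightarrow> L2_bdd_supp (\<lambda>x. \<Sum>i\<in>S. f i x)"
  by (induction S rule: finite_induct) (simp_all add: L2_bdd_supp_0 L2_bdd_supp_add)

lemma ift_diff:
  assumes "L2_bdd_supp f" "L2_bdd_supp g"
  shows "ift (\<lambda>\<xi>. f \<xi> - g \<xi>) x = ift f x - ift g x"
  using ift_add[OF L2_bdd_supp_integrable[OF assms(1)] L2_bdd_supp_integrable[OF L2_bdd_supp_scaleR[OF assms(2), of "-1"]], of x]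
    ift_scaleR[of "-1" g x] by simp

lemma ift_sum:
  assumes "finite S" "\<And>i. i \<in> S \<Longrightarrow> L2_bdd_supp (f i)"
  shows "ift (\<lambda>\<xi>. \<Sum>i\<in>S. f i \<xi>) x = (\<Sum>i\<in>S. ift (f i) x)"
  using assms
proof (induction S rule: finite_induct)
  case empty
  show ?case by (simp add: ift_def)
next
  case (insert i S)
  then show ?case by (simp add: ift_add[OF L2_bdd_supp_integrable L2_bdd_supp_integrable] L2_bdd_supp_sum)
qed

text \<open>Its purpose is the boundedness of the norm on compact time intervals, which makes the
  remainders below uniform in time.\<close>

lemma weak_solution_norm_continuous:
  assumes "weak_solution A B w0 w"
  shows "continuous_on {0..} (\<lambda>t. Lp_norm 2 (w t))"
  unfolding continuous_on_def
proof
  fix t :: real assume t: "t \<in> {0..}"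
  have L: "w s \<in> Lp 2" if "0 \<le> s" for s using assms that by (simp add: weak_solution_def)
  have lim: "((\<lambda>s. Lp_norm 2 (\<lambda>x. w s x - w t x)) \<longlongrightarrow> 0) (at t within {0..})"
    using assms t by (simp add: weak_solution_def)
  show "((\<lambda>t. Lp_norm 2 (w t)) \<longlongrightarrow> Lp_norm 2 (w t)) (at t within {0..})"
  proof (rule Lim_null[THEN iffD2], rule Lim_null_comparison[OF _ lim])
    show "\<forall>\<^sub>F s in at t within {0..}. norm (Lp_norm 2 (w s) - Lp_norm 2 (w t)) \<le> Lp_norm 2 (\<lambda>x. w s x - w t x)"
      unfolding eventually_at_filter
    proof (rule always_eventually, intro allI impI)
      fix s :: real assume "s \<in> {0..}"
      then have ws: "w s \<in> Lp 2" and wt: "w t \<in> Lp 2" using L t by auto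
      have "Lp_norm 2 (w s) \<le> Lp_norm 2 (\<lambda>x. w s x - w t x) + Lp_norm 2 (w t)"
        using Lp_norm2_triangle[OF Lp2_diff[OF ws wt] wt] by simp
      moreover have "Lp_norm 2 (w t) \<le> Lp_norm 2 (\<lambda>x. w t x - w s x) + Lp_norm 2 (w s)"
        using Lp_norm2_triangle[OF Lp2_diff[OF wt ws] ws] by simp
      moreover have "Lp_norm 2 (\<lambda>x. w t x - w s x) = Lp_norm 2 (\<lambda>x. w s x - w t x)"
        by (simp add: Lp_norm2 norm_minus_commute)
      ultimately show "norm (Lp_norm 2 (w s) - Lp_norm 2 (w t)) \<le> Lp_norm 2 (\<lambda>x. w s x - w t x)" by simp
    qed
  qed
qed

lemma weak_solution_norm_bounded:
  assumes "weak_solution A B w0 w"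
  obtains W where "0 \<le> W" "\<And>s. 0 \<le> s \<Longrightarrow> s \<le> T \<Longrightarrow> Lp_norm 2 (w s) \<le> W"
proof -
  have "compact ((\<lambda>t. Lp_norm 2 (w t)) ` {0..T})"
    by (intro compact_continuous_image continuous_on_subset[OF weak_solution_norm_continuous[OF assms]]) auto
  then have "bounded ((\<lambda>t. Lp_norm 2 (w t)) ` {0..T})" by (rule compact_imp_bounded)
  then obtain a where "\<forall>t\<in>{0..T}. \<bar>Lp_norm 2 (w t)\<bar> \<le> a" by (auto simp: bounded_iff)
  then show thesis by (intro that[of "max a 0"]) (auto simp: abs_le_iff intro: max.coboundedI1)
qed

text \<open>For a test of unbounded support the derivative is a limit along cutoffs. Limit and time
  derivative may be exchanged because the derivatives converge uniformly on bounded time intervals,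
  where the L^2 norm of the solution is bounded.\<close>

lemma weak_solution_scalar:
  fixes A :: "'m::finite \<Rightarrow> real^'n::finite^'n" and \<Phi> :: "real^'m \<Rightarrow> real"
  assumes ws: "weak_solution A B w0 w" and \<Phi>: "smooth_L2 \<Phi>" and t: "0 \<le> t"
  shows "((\<lambda>s. LINT x|lborel. \<Phi> x * (w s x \<bullet> e)) has_real_derivative
    (\<Sum>\<alpha>\<in>UNIV. LINT x|lborel. dir_deriv (axis \<alpha> 1) \<Phi> x * ((A \<alpha> *v w t x) \<bullet> e)) + (LINT x|lborel. \<Phi> x * ((B *v w t x) \<bullet> e)))
    (at t within {0..})"
proof -
  have L: "w s \<in> Lp 2" if "0 \<le> s" for s using ws that by (simp add: weak_solution_def)
  obtain \<eta> :: "real^'m \<Rightarrow> real" where \<eta>: "test_function \<eta>" "\<eta> 0 = 1" using exists_bump by blast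
  define \<phi> where "\<phi> n = (\<lambda>x. \<eta> (inverse (real (Suc n)) *\<^sub>R x) * \<Phi> x)" for n
  have sm: "smooth \<Phi>" using \<Phi> by (simp add: smooth_L2_def)
  have tf: "test_function (\<phi> n)" for n
    unfolding \<phi>_def by (intro test_function_mult test_function_scaling \<eta> sm) simp
  have conv: "L2conv (\<lambda>n. foldr dir_deriv vs (\<phi> n)) (foldr dir_deriv vs \<Phi>)" for vs
    using L2conv_cutoff_foldr[OF \<eta>(1) \<Phi>, of vs] by (simp add: \<phi>_def \<eta>(2))
  have c0: "L2conv \<phi> \<Phi>" using conv[of "[]"] by simp
  have c1: "L2conv (\<lambda>n. dir_deriv v (\<phi> n)) (dir_deriv v \<Phi>)" for v using conv[of "[v]"] by simp
  define Dn where "Dn f s = (\<Sum>\<alpha>\<in>UNIV. LINT x|lborel. dir_deriv (axis \<alpha> 1) f x * ((A \<alpha> *v w s x) \<bullet> e)) + (LINT x|lborel. f x * ((B *v w s x) \<bullet> e))"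
    for f :: "real^'m \<Rightarrow> real" and s
  have der: "((\<lambda>s. LINT x|lborel. \<phi> n x * (w s x \<bullet> e)) has_real_derivative Dn (\<phi> n) s) (at s within {0..})" if s: "0 \<le> s" for n s
  proof -
    have 1: "((\<lambda>s. (LINT x|lborel. \<phi> n x *\<^sub>R w s x) \<bullet> e) has_vector_derivative
       (LINT x|lborel. (\<Sum>\<alpha>\<in>UNIV. dir_deriv (axis \<alpha> 1) (\<phi> n) x *\<^sub>R (A \<alpha> *v w s x)) + \<phi> n x *\<^sub>R (B *v w s x)) \<bullet> e) (at s within {0..})"
      using ws tf[of n] s unfolding weak_solution_def
      by (intro bounded_linear.has_vector_derivative[OF bounded_linear_inner_left]) blast
    have i1: "integrable lborel (\<lambda>x. dir_deriv (axis \<alpha> 1) (\<phi> n) x *\<^sub>R (A \<alpha> *v w s x))" for \<alpha>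
      by (intro test_scaleR_integrable test_function_dir_deriv tf mv_Lp2 L s)
    have i2: "integrable lborel (\<lambda>x. \<phi> n x *\<^sub>R (B *v w s x))"
      by (intro test_scaleR_integrable tf mv_Lp2 L s)
    have 2: "(LINT x|lborel. (\<Sum>\<alpha>\<in>UNIV. dir_deriv (axis \<alpha> 1) (\<phi> n) x *\<^sub>R (A \<alpha> *v w s x)) + \<phi> n x *\<^sub>R (B *v w s x)) \<bullet> e = Dn (\<phi> n) s"
    proof -
      have "(LINT x|lborel. (\<Sum>\<alpha>\<in>UNIV. dir_deriv (axis \<alpha> 1) (\<phi> n) x *\<^sub>R (A \<alpha> *v w s x)) + \<phi> n x *\<^sub>R (B *v w s x))
        = (\<Sum>\<alpha>\<in>UNIV. LINT x|lborel. dir_deriv (axis \<alpha> 1) (\<phi> n) x *\<^sub>R (A \<alpha> *v w s x)) + (LINT x|lborel. \<phi> n x *\<^sub>R (B *v w s x))"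
        using i1 i2 by (simp add: Bochner_Integration.integral_sum)
      then show ?thesis
        by (simp only: Dn_def inner_add_left inner_sum_left test_integral_inner[OF test_function_dir_deriv[OF tf] mv_Lp2[OF L[OF s]]]
          test_integral_inner[OF tf mv_Lp2[OF L[OF s]]] inner_scaleR_left inner_commute[of e])
    qed
    have 3: "0 \<le> r \<Longrightarrow> (LINT x|lborel. \<phi> n x *\<^sub>R w r x) \<bullet> e = (LINT x|lborel. \<phi> n x * (w r x \<bullet> e))" for r
      using test_integral_inner[OF tf L, of r n e] by (simp add: inner_commute)
    show ?thesis
      unfolding has_real_derivative_iff_has_vector_derivative
      by (rule has_vector_derivative_transform[OF _ _ 1[unfolded 2]]) (use s 3 in auto)
  qed
  \<comment> \<open>One unit beyond t, so that differentiability within {0..T} and within {0..} mean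
    the same at t.\<close>
  define T where "T = t + 1"
  obtain W where W: "0 \<le> W" "\<And>s. 0 \<le> s \<Longrightarrow> s \<le> T \<Longrightarrow> Lp_norm 2 (w s) \<le> W"
    using weak_solution_norm_bounded[OF ws] by blast
  obtain KA where KA: "\<And>\<alpha>. 0 \<le> KA \<alpha>" "\<And>\<alpha> w. w \<in> (Lp 2 :: (real^'m \<Rightarrow> real^'n) set) \<Longrightarrow> Lp_norm 2 (\<lambda>x. (A \<alpha> *v w x) \<bullet> e) \<le> KA \<alpha> * Lp_norm 2 w"
  proof -
    have "\<forall>\<alpha>. \<exists>K\<ge>0. \<forall>w \<in> (Lp 2 :: (real^'m \<Rightarrow> real^'n) set). Lp_norm 2 (\<lambda>x. (A \<alpha> *v w x) \<bullet> e) \<le> K * Lp_norm 2 w"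
      using mv_inner_norm by blast
    from choice[OF this] show thesis using that by blast
  qed
  obtain KB where KB: "0 \<le> KB" "\<And>w. w \<in> (Lp 2 :: (real^'m \<Rightarrow> real^'n) set) \<Longrightarrow> Lp_norm 2 (\<lambda>x. (B *v w x) \<bullet> e) \<le> KB * Lp_norm 2 w"
    using mv_inner_norm by blast
  \<comment> \<open>Bounds the difference of the derivatives for the n-th cutoff and for \<Phi>,
    uniformly for s in {0..T}, and tends to 0.\<close>
  define d where "d n = (\<Sum>\<alpha>\<in>UNIV. Lp_norm 2 (\<lambda>x. dir_deriv (axis \<alpha> 1) (\<phi> n) x - dir_deriv (axis \<alpha> 1) \<Phi> x) * (KA \<alpha> * W))
      + Lp_norm 2 (\<lambda>x. \<phi> n x - \<Phi> x) * (KB * W)" for n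
  have "d \<longlonglongrightarrow> (\<Sum>\<alpha>\<in>(UNIV::'m set). 0 * (KA \<alpha> * W)) + 0 * (KB * W)"
    unfolding d_def using c0 c1 by (intro tendsto_intros) (auto simp: L2conv_def)
  then have d0: "d \<longlonglongrightarrow> 0" by simp
  have one: "\<bar>(LINT x|lborel. f x * g x) - (LINT x|lborel. h x * g x)\<bar> \<le> Lp_norm 2 (\<lambda>x. f x - h x) * (K * W)"
    if "f \<in> Lp 2" "h \<in> Lp 2" "g \<in> Lp 2" "Lp_norm 2 g \<le> K * W" for f g h :: "real^'m \<Rightarrow> real" and K
  proof -
    have "(LINT x|lborel. f x * g x) - (LINT x|lborel. h x * g x) = (LINT x|lborel. (f x - h x) \<bullet> g x)"
      using Lp2_inner[OF that(1,3)] Lp2_inner[OF that(2,3)] by (simp add: left_diff_distrib)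
    also have "\<bar>\<dots>\<bar> \<le> Lp_norm 2 (\<lambda>x. f x - h x) * Lp_norm 2 g"
      by (rule Lp2_Cauchy_Schwarz[OF Lp2_diff[OF that(1,2)] that(3)])
    also have "\<dots> \<le> Lp_norm 2 (\<lambda>x. f x - h x) * (K * W)"
      by (rule mult_left_mono[OF that(4) Lp_norm2_nonneg])
    finally show ?thesis .
  qed
  have close: "\<bar>Dn (\<phi> n) s - Dn \<Phi> s\<bar> \<le> d n" if s: "0 \<le> s" "s \<le> T" for n s
  proof -
    have KW: "Lp_norm 2 (\<lambda>x. (A \<alpha> *v w s x) \<bullet> e) \<le> KA \<alpha> * W" "Lp_norm 2 (\<lambda>x. (B *v w s x) \<bullet> e) \<le> KB * W" for \<alpha>
      using KA(2)[OF L[OF s(1)], of \<alpha>] KB(2)[OF L[OF s(1)]] mult_left_mono[OF W(2)[OF s] KA(1)[of \<alpha>]] mult_left_mono[OF W(2)[OF s] KB(1)]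
      by linarith+
    have gL: "(\<lambda>x. (M *v w s x) \<bullet> e) \<in> Lp 2" for M by (intro Lp2_inner_const mv_Lp2 L s)
    have fL: "\<phi> n \<in> Lp 2" "\<Phi> \<in> Lp 2" "dir_deriv v (\<phi> n) \<in> Lp 2" "dir_deriv v \<Phi> \<in> Lp 2" for v
      using c0 c1[of v] by (auto simp: L2conv_def)
    let ?a = "\<lambda>f \<alpha>. LINT x|lborel. dir_deriv (axis \<alpha> 1) f x * ((A \<alpha> *v w s x) \<bullet> e)"
    let ?b = "\<lambda>f. LINT x|lborel. f x * ((B *v w s x) \<bullet> e)"
    have aux: "\<bar>(\<Sum>\<alpha>\<in>UNIV. X \<alpha>) + Y\<bar> \<le> (\<Sum>\<alpha>\<in>UNIV. \<bar>X \<alpha>\<bar>) + \<bar>Y\<bar>" for X :: "'m \<Rightarrow> real" and Y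
      using sum_abs[of X UNIV] abs_triangle_ineq[of "sum X UNIV" Y] by linarith
    have eq: "Dn (\<phi> n) s - Dn \<Phi> s = (\<Sum>\<alpha>\<in>UNIV. ?a (\<phi> n) \<alpha> - ?a \<Phi> \<alpha>) + (?b (\<phi> n) - ?b \<Phi>)"
      by (simp add: Dn_def sum_subtractf)
    have "\<bar>Dn (\<phi> n) s - Dn \<Phi> s\<bar> \<le> (\<Sum>\<alpha>\<in>UNIV. \<bar>?a (\<phi> n) \<alpha> - ?a \<Phi> \<alpha>\<bar>) + \<bar>?b (\<phi> n) - ?b \<Phi>\<bar>"
      unfolding eq by (rule aux)
    also have "\<dots> \<le> d n"
    proof -
      have a: "\<bar>?a (\<phi> n) \<alpha> - ?a \<Phi> \<alpha>\<bar> \<le> Lp_norm 2 (\<lambda>x. dir_deriv (axis \<alpha> 1) (\<phi> n) x - dir_deriv (axis \<alpha> 1) \<Phi> x) * (KA \<alpha> * W)" for \<alpha>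
        using one[of "dir_deriv (axis \<alpha> 1) (\<phi> n)" "dir_deriv (axis \<alpha> 1) \<Phi>" "\<lambda>x. (A \<alpha> *v w s x) \<bullet> e" "KA \<alpha>"] fL gL KW by blast
      have b: "\<bar>?b (\<phi> n) - ?b \<Phi>\<bar> \<le> Lp_norm 2 (\<lambda>x. \<phi> n x - \<Phi> x) * (KB * W)"
        using one[of "\<phi> n" "\<Phi>" "\<lambda>x. (B *v w s x) \<bullet> e" "KB"] fL gL KW by blast
      show ?thesis
        unfolding d_def by (rule add_mono[OF _ b], rule sum_mono, rule a)
    qed
    finally show ?thesis .
  qed
  have "\<exists>g. \<forall>s\<in>{0..T}. (\<lambda>n. LINT x|lborel. \<phi> n x * (w s x \<bullet> e)) \<longlonglongrightarrow> g s \<and> (g has_derivative (\<lambda>h. Dn \<Phi> s * h)) (at s within {0..T})"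
  proof (rule has_derivative_sequence)
    show "((\<lambda>s. LINT x|lborel. \<phi> n x * (w s x \<bullet> e)) has_derivative (\<lambda>h. Dn (\<phi> n) s * h)) (at s within {0..T})" if "s \<in> {0..T}" for n s
      using der[of s n] that unfolding has_field_derivative_def
      by (intro has_derivative_subset[where s="{0..}" and t="{0..T}"]) auto
    show "\<forall>\<^sub>F n in sequentially. \<forall>s\<in>{0..T}. \<forall>h. norm (Dn (\<phi> n) s * h - Dn \<Phi> s * h) \<le> r * norm h" if r: "0 < r" for r
    proof -
      have "\<forall>\<^sub>F n in sequentially. d n < r" using order_tendstoD(2)[OF d0 r] .
      then show ?thesis
      proof (rule eventually_mono, intro ballI allI)
        fix n s h assume "d n < r" "s \<in> {0..T}"
        then have "\<bar>Dn (\<phi> n) s - Dn \<Phi> s\<bar> \<le> r" using close[of s n] by auto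
        from mult_right_mono[OF this abs_ge_zero[of h]]
        show "norm (Dn (\<phi> n) s * h - Dn \<Phi> s * h) \<le> r * norm h"
          by (simp only: left_diff_distrib[symmetric] real_norm_def abs_mult)
      qed
    qed
    show "0 \<in> {0..T}" using t by (simp add: T_def)
    show "(\<lambda>n. LINT x|lborel. \<phi> n x * (w 0 x \<bullet> e)) \<longlonglongrightarrow> (LINT x|lborel. \<Phi> x * (w 0 x \<bullet> e))"
      using L2conv_inner[OF c0 Lp2_inner_const[OF L[of 0], of e]] by simp
  qed simp
  then obtain g where g: "\<And>s. s \<in> {0..T} \<Longrightarrow> (\<lambda>n. LINT x|lborel. \<phi> n x * (w s x \<bullet> e)) \<longlonglongrightarrow> g s"
    "\<And>s. s \<in> {0..T} \<Longrightarrow> (g has_derivative (\<lambda>h. Dn \<Phi> s * h)) (at s within {0..T})" by blast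
  have geq: "g s = (LINT x|lborel. \<Phi> x * (w s x \<bullet> e))" if "s \<in> {0..T}" for s
    using LIMSEQ_unique[OF g(1)[OF that]] L2conv_inner[OF c0 Lp2_inner_const[OF L[of s], of e]] that by simp
  have tT: "t \<in> {0..T}" using t by (simp add: T_def)
  have "((\<lambda>s. LINT x|lborel. \<Phi> x * (w s x \<bullet> e)) has_derivative (\<lambda>h. Dn \<Phi> t * h)) (at t within {0..T})"
    by (rule has_derivative_transform[OF tT _ g(2)[OF tT]]) (simp add: geq)
  moreover have "at t within {0..T} = at t within {0..}"
    by (rule at_within_nhd[of _ "{..<T}"]) (auto simp: T_def)
  ultimately show ?thesis by (simp add: has_field_derivative_def Dn_def)
qed

context kawashima
begin

lemma gen_bound: "\<exists>K\<ge>0. \<forall>\<xi> p. norm (gen A D \<xi> p) \<le> K * (1 + norm \<xi>) * norm p"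
proof -
  obtain \<beta> where \<beta>: "0 \<le> \<beta>" "\<And>x. norm ((block_B D :: real^('n1+'n2)^('n1+'n2)) *v x) \<le> \<beta> * norm x"
    using linear_norm_bound[OF matrix_vector_mul_linear[of "block_B D :: real^('n1+'n2)^('n1+'n2)"]] by blast
  obtain \<alpha> where \<alpha>: "0 \<le> \<alpha>" "\<And>\<xi> x. norm (symbol A \<xi> *v x) \<le> \<alpha> * norm \<xi> * norm x" using symbol_bound by blast
  have "norm (gen A D \<xi> p) \<le> (2 * (\<beta> + \<alpha>)) * (1 + norm \<xi>) * norm p" for \<xi> p
  proof -
    have f: "norm (fst p) \<le> norm p" "norm (snd p) \<le> norm p"
      using norm_fst_le[of "fst p" "snd p"] norm_snd_le[of "snd p" "fst p"] by auto
    have one: "norm (block_B D *v x) + norm (symbol A \<xi> *v y) \<le> (\<beta> + \<alpha> * norm \<xi>) * norm p" if "norm x \<le> norm p" "norm y \<le> norm p" for x y :: "real^('n1+'n2)"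
    proof -
      have "norm (block_B D *v x) \<le> \<beta> * norm p" using \<beta>(2)[of x] mult_left_mono[OF that(1) \<beta>(1)] by linarith
      moreover have "norm (symbol A \<xi> *v y) \<le> \<alpha> * norm \<xi> * norm p"
        using \<alpha>(2)[of \<xi> y] mult_left_mono[OF that(2), of "\<alpha> * norm \<xi>"] \<alpha>(1) by simp
      ultimately show ?thesis by (simp add: distrib_right)
    qed
    have "norm (gen A D \<xi> p) \<le> norm (block_B D *v fst p - symbol A \<xi> *v snd p) + norm (block_B D *v snd p + symbol A \<xi> *v fst p)"
      unfolding gen_def Eop_def by (rule norm_Pair_le)
    also have "\<dots> \<le> (\<beta> + \<alpha> * norm \<xi>) * norm p + (\<beta> + \<alpha> * norm \<xi>) * norm p"
      by (intro add_mono order_trans[OF norm_triangle_ineq4 one] order_trans[OF norm_triangle_ineq one] f)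
    also have "\<dots> = 2 * (\<beta> + \<alpha> * norm \<xi>) * norm p" by simp
    also have "\<dots> \<le> (2 * (\<beta> + \<alpha>)) * (1 + norm \<xi>) * norm p"
      using \<alpha>(1) \<beta>(1) by (intro mult_right_mono) (auto simp: algebra_simps)
    finally show ?thesis .
  qed
  then show ?thesis using \<alpha>(1) \<beta>(1) by (intro exI[of _ "2 * (\<beta> + \<alpha>)"]) auto
qed

lemma gen_L2_bdd_supp:
  assumes "L2_bdd_supp \<psi>" shows "L2_bdd_supp (\<lambda>\<xi>. gen A D \<xi> (\<psi> \<xi>))"
proof -
  obtain K where K: "0 \<le> K" "\<And>\<xi> p. norm (gen A D \<xi> p) \<le> K * (1 + norm \<xi>) * norm p" using gen_bound by blast
  show ?thesis
    by (rule L2_bdd_supp_bound[OF assms gen_measurable[OF L2_bdd_supp_measurable[OF assms]], where M="\<lambda>r. K * (1 + r)"])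
      (use K in \<open>auto intro: mult_left_mono\<close>)
qed

lemma flow_L2_bdd_supp:
  assumes "L2_bdd_supp \<psi>" "0 \<le> t" shows "L2_bdd_supp (\<lambda>\<xi>. lflow (gen A D \<xi>) t (\<psi> \<xi>))"
  by (rule L2_bdd_supp_bound[OF assms(1) flow_measurable[OF L2_bdd_supp_measurable[OF assms(1)]], where M="\<lambda>r. 1"])
    (use flow_contraction[OF assms(2)] in auto)

lemma flow_Lp2:
  assumes "f \<in> Lp 2" "0 \<le> t" shows "(\<lambda>\<xi>. lflow (gen A D \<xi>) t (f \<xi>)) \<in> Lp 2"
  by (rule Lp2_bound[OF assms(1) flow_measurable[OF Lp2_measurable[OF assms(1)]], where M=1])
    (use flow_contraction[OF assms(2)] in auto)

text \<open>Symmetry and transposition move the coefficients from the solution to the test. There A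
  \<alpha> meets the multiplier - i times the component \<alpha> of \<xi>, and the sum over \<alpha>
  together with the transpose of B is the adjoint generator.\<close>

lemma weak_solution_ift:
  assumes ws: "weak_solution A (block_B D) w0 w" and \<psi>: "L2_bdd_supp \<psi>" and t: "0 \<le> t"
  shows "((\<lambda>s. LINT x|lborel. ift \<psi> x \<bullet> w s x) has_real_derivative
    (LINT x|lborel. ift (\<lambda>\<xi>. gen (\<lambda>\<alpha>. - A \<alpha>) (transpose D) \<xi> (\<psi> \<xi>)) x \<bullet> w t x)) (at t within {0..})"
proof -
  let ?B = "block_B D :: real^('n1+'n2)^('n1+'n2)"
  have L: "w s \<in> Lp 2" if "0 \<le> s" for s using ws that by (simp add: weak_solution_def)
  note iL = L2_bdd_supp_ift_Lp2[OF \<psi>]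
  define \<psi>e where "\<psi>e e = (\<lambda>\<xi>. (fst (\<psi> \<xi>) \<bullet> e, snd (\<psi> \<xi>) \<bullet> e))" for e
  have be: "L2_bdd_supp (\<psi>e e)" for e unfolding \<psi>e_def by (rule L2_bdd_supp_map[OF \<psi> bounded_linear_inner_left])
  have ie: "ift (\<psi>e e) x = ift \<psi> x \<bullet> e" for e x
    unfolding \<psi>e_def using ift_map[OF \<psi> bounded_linear_inner_left] by simp
  have de: "dir_deriv v (ift (\<psi>e e)) x = ift (mulJ v \<psi>) x \<bullet> e" for v e x
  proof -
    have m: "mulJ v (\<psi>e e) = (\<lambda>\<xi>. (fst (mulJ v \<psi> \<xi>) \<bullet> e, snd (mulJ v \<psi> \<xi>) \<bullet> e))"
      by (simp add: mulJ_def \<psi>e_def Jrot_def)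
    show ?thesis
      unfolding dir_deriv_ift[OF be] m using ift_map[OF L2_bdd_supp_mulJ[OF \<psi>] bounded_linear_inner_left] by simp
  qed
  \<comment> \<open>Scalar tests see one component at a time, so the vector pairing is summed over
    an orthonormal basis.\<close>
  have "((\<lambda>s. \<Sum>e\<in>Basis. LINT x|lborel. (ift \<psi> x \<bullet> e) * (w s x \<bullet> e)) has_real_derivative
     (\<Sum>e\<in>Basis. (\<Sum>\<alpha>\<in>UNIV. LINT x|lborel. (ift (mulJ (axis \<alpha> 1) \<psi>) x \<bullet> e) * ((A \<alpha> *v w t x) \<bullet> e))
       + (LINT x|lborel. (ift \<psi> x \<bullet> e) * ((?B *v w t x) \<bullet> e)))) (at t within {0..})"
    using weak_solution_scalar[OF ws smooth_L2_ift[OF be] t] unfolding ie de by (intro DERIV_sum)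
  also have "(\<Sum>e\<in>Basis. (\<Sum>\<alpha>\<in>UNIV. LINT x|lborel. (ift (mulJ (axis \<alpha> 1) \<psi>) x \<bullet> e) * ((A \<alpha> *v w t x) \<bullet> e))
       + (LINT x|lborel. (ift \<psi> x \<bullet> e) * ((?B *v w t x) \<bullet> e)))
     = (\<Sum>\<alpha>\<in>UNIV. LINT x|lborel. ift (mulJ (axis \<alpha> 1) \<psi>) x \<bullet> (A \<alpha> *v w t x)) + (LINT x|lborel. ift \<psi> x \<bullet> (?B *v w t x))"
    unfolding sum.distrib inner_integral_Basis[OF iL mv_Lp2[OF L[OF t]]] inner_integral_Basis[OF L2_bdd_supp_ift_Lp2[OF L2_bdd_supp_mulJ[OF \<psi>]] mv_Lp2[OF L[OF t]]]
    by (subst sum.swap) simp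
  also have "\<dots> = (LINT x|lborel. (\<Sum>\<alpha>\<in>UNIV. ift (mulJ (axis \<alpha> 1) \<psi>) x \<bullet> (A \<alpha> *v w t x)) + ift \<psi> x \<bullet> (?B *v w t x))"
    using Lp2_inner[OF iL mv_Lp2[OF L[OF t]]] Lp2_inner[OF L2_bdd_supp_ift_Lp2[OF L2_bdd_supp_mulJ[OF \<psi>]] mv_Lp2[OF L[OF t]]]
    by (simp add: Bochner_Integration.integral_sum)
  also have "\<dots> = (LINT x|lborel. ift (\<lambda>\<xi>. gen (\<lambda>\<alpha>. - A \<alpha>) (transpose D) \<xi> (\<psi> \<xi>)) x \<bullet> w t x)"
  proof (rule Bochner_Integration.integral_cong[OF refl])
    fix x
    define C where "C M \<phi> = (\<lambda>\<xi>. (M *v fst (\<phi> \<xi>), M *v snd (\<phi> \<xi>)))"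
      for M :: "real^('n1+'n2)^('n1+'n2)" and \<phi> :: "real^'m \<Rightarrow> (real^('n1+'n2)) \<times> (real^('n1+'n2))"
    have Cb: "L2_bdd_supp \<phi> \<Longrightarrow> L2_bdd_supp (C M \<phi>)" for M \<phi> unfolding C_def by (rule L2_bdd_supp_map) auto
    have Ci: "L2_bdd_supp \<phi> \<Longrightarrow> ift (C M \<phi>) x = M *v ift \<phi> x" for M \<phi>
      unfolding C_def by (subst ift_map[symmetric, where T="(*v) M"]) auto
    have g: "gen (\<lambda>\<alpha>. - A \<alpha>) (transpose D) \<xi> (\<psi> \<xi>) = (\<Sum>\<alpha>\<in>UNIV. C (A \<alpha>) (mulJ (axis \<alpha> 1) \<psi>) \<xi>) + C (transpose ?B) \<psi> \<xi>" for \<xi>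
    proof -
      have n: "(- symbol A \<xi>) *v y = - (symbol A \<xi> *v y)" for y using mv_simps(2)[of 0 "symbol A \<xi>" y] by simp
      show ?thesis
        by (simp add: gen_def Eop_def symbol_uminus n transpose_block_B[symmetric] C_def mulJ_def Jrot_def inner_axis
          symbol_mv mv_simps prod_eq_iff fst_sum snd_sum sum_negf linear_neg[OF matrix_vector_mul_linear] del: transpose_matrix_vector)
    qed
    have i: "ift (\<lambda>\<xi>. gen (\<lambda>\<alpha>. - A \<alpha>) (transpose D) \<xi> (\<psi> \<xi>)) x = (\<Sum>\<alpha>\<in>UNIV. A \<alpha> *v ift (mulJ (axis \<alpha> 1) \<psi>) x) + transpose ?B *v ift \<psi> x"
      unfolding g
      by (subst ift_add) (simp_all add: L2_bdd_supp_integrable L2_bdd_supp_sum Cb L2_bdd_supp_mulJ \<psi> ift_sum Ci del: transpose_matrix_vector)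
    show "(\<Sum>\<alpha>\<in>UNIV. ift (mulJ (axis \<alpha> 1) \<psi>) x \<bullet> (A \<alpha> *v w t x)) + ift \<psi> x \<bullet> (?B *v w t x)
      = ift (\<lambda>\<xi>. gen (\<lambda>\<alpha>. - A \<alpha>) (transpose D) \<xi> (\<psi> \<xi>)) x \<bullet> w t x"
    proof -
      have tr: "(transpose ?B *v ift \<psi> x) \<bullet> w t x = ift \<psi> x \<bullet> (?B *v w t x)"
        using inner_transpose[of "w t x" ?B "ift \<psi> x"] by (simp add: inner_commute)
      have sy: "(A \<alpha> *v u) \<bullet> w t x = u \<bullet> (A \<alpha> *v w t x)" for \<alpha> u
        using inner_sym[OF A_sym[of \<alpha>], of u "w t x"] by simp
      show ?thesis
        unfolding i inner_add_left inner_sum_left tr sy ..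
    qed
  qed
  finally have "((\<lambda>s. \<Sum>e\<in>Basis. LINT x|lborel. (ift \<psi> x \<bullet> e) * (w s x \<bullet> e)) has_real_derivative
    (LINT x|lborel. ift (\<lambda>\<xi>. gen (\<lambda>\<alpha>. - A \<alpha>) (transpose D) \<xi> (\<psi> \<xi>)) x \<bullet> w t x)) (at t within {0..})" .
  then show ?thesis
    unfolding has_field_derivative_def
    by (rule has_derivative_transform[rotated 2]) (use t inner_integral_Basis[OF iL L] in auto)
qed

end

section \<open>Pairing a weak solution with the adjoint flow\<close>

lemma has_derivative_zero_quadratic:
  fixes E :: "real \<Rightarrow> real"
  assumes le: "\<And>s. s \<in> S \<Longrightarrow> \<bar>E s\<bar> \<le> M * (s - s0)\<^sup>2" and "s0 \<in> S"
  shows "(E has_real_derivative 0) (at s0 within S)"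
proof -
  have E0: "E s0 = 0" using le[OF \<open>s0 \<in> S\<close>] by simp
  have "((\<lambda>s. M * \<bar>s - s0\<bar>) \<longlongrightarrow> M * \<bar>s0 - s0\<bar>) (at s0 within S)" by (intro tendsto_intros)
  then have lim: "((\<lambda>s. M * \<bar>s - s0\<bar>) \<longlongrightarrow> 0) (at s0 within S)" by simp
  have "\<forall>\<^sub>F s in at s0 within S. norm ((E s - E s0) / (s - s0)) \<le> M * \<bar>s - s0\<bar>"
    unfolding eventually_at_filter
  proof (rule always_eventually, intro allI impI)
    fix s assume s: "s \<noteq> s0" "s \<in> S"
    then have "\<bar>E s\<bar> \<le> (M * \<bar>s - s0\<bar>) * \<bar>s - s0\<bar>" using le[OF s(2)] by (simp add: power2_eq_square mult.assoc)
    then show "norm ((E s - E s0) / (s - s0)) \<le> M * \<bar>s - s0\<bar>" using s(1) by (simp add: E0 pos_divide_le_eq)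
  qed
  then show ?thesis
    unfolding has_field_derivative_iff by (rule Lim_null_comparison[OF _ lim])
qed

context kawashima
begin

abbreviation Sadj :: "real \<Rightarrow> real^'m \<Rightarrow> (real^('n1+'n2)) \<times> (real^('n1+'n2)) \<Rightarrow> (real^('n1+'n2)) \<times> (real^('n1+'n2))" where
  "Sadj t \<xi> \<equiv> lflow (gen (\<lambda>\<alpha>. - A \<alpha>) (transpose D) \<xi>) t"

text \<open>The pairing of \<open>w s\<close> with the solution at time \<open>t - s\<close> of the adjoint problem does not depend on \<open>s\<close>.\<close>

lemma weak_solution_duality:
  assumes ws: "weak_solution A (block_B D) w0 w" and w0: "w0 \<in> Lp 2" and \<psi>: "L2_bdd_supp \<psi>" and t: "0 \<le> t"
  shows "(LINT x|lborel. ift \<psi> x \<bullet> w t x) = (LINT x|lborel. ift (\<lambda>\<xi>. Sadj t \<xi> (\<psi> \<xi>)) x \<bullet> w0 x)"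
proof -
  interpret adj: kawashima "\<lambda>\<alpha>. - A \<alpha>" "transpose D" by (rule adjoint_kawashima)
  have L: "w s \<in> Lp 2" if "0 \<le> s" for s using ws that by (simp add: weak_solution_def)
  let ?G = "gen (\<lambda>\<alpha>. - A \<alpha>) (transpose D)"
  define \<Psi> where "\<Psi> s = (\<lambda>\<xi>. Sadj (t - s) \<xi> (\<psi> \<xi>))" for s
  have b\<Psi>: "L2_bdd_supp (\<Psi> s)" if "s \<le> t" for s
    unfolding \<Psi>_def by (rule adj.flow_L2_bdd_supp[OF \<psi>]) (use that in simp)
  obtain R where R: "0 \<le> R" "\<And>\<xi>. R < norm \<xi> \<Longrightarrow> \<psi> \<xi> = 0"
  proof -
    obtain R where "\<forall>\<xi>. R < norm \<xi> \<longrightarrow> \<psi> \<xi> = 0" using \<psi> by (auto simp: L2_bdd_supp_def)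
    then show thesis by (intro that[of "max R 0"]) auto
  qed
  obtain K where K: "0 \<le> K" "\<And>\<xi> p. norm (?G \<xi> p) \<le> K * (1 + norm \<xi>) * norm p" using adj.gen_bound by blast
  \<comment> \<open>On the support of \<psi> all generators are bounded by the same constant, which
    makes the Taylor remainder uniform in \<xi> and hence small in L^2.\<close>
  define C where "C = K * (1 + R)"
  have C: "0 \<le> C" "norm \<xi> \<le> R \<Longrightarrow> norm (?G \<xi> p) \<le> C * norm p" for \<xi> p
  proof -
    show "0 \<le> C" using K(1) R(1) by (simp add: C_def)
    assume "norm \<xi> \<le> R"
    then have "K * (1 + norm \<xi>) * norm p \<le> C * norm p"
      unfolding C_def using K(1) by (intro mult_right_mono mult_left_mono) auto
    then show "norm (?G \<xi> p) \<le> C * norm p" using K(2)[of \<xi> p] by linarith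
  qed
  \<comment> \<open>The test runs backwards in time, hence the plus sign in front of the
    generator.\<close>
  have taylor: "norm (\<Psi> s \<xi> - \<Psi> s0 \<xi> + (s - s0) *\<^sub>R ?G \<xi> (\<Psi> s0 \<xi>)) \<le> (C\<^sup>2 * (s - s0)\<^sup>2) * norm (\<psi> \<xi>)"
    if s: "s \<in> {0..t}" "s0 \<in> {0..t}" for s s0 \<xi>
  proof (cases "norm \<xi> \<le> R")
    case True
    have "norm (Sadj (t - s) \<xi> (\<psi> \<xi>) - Sadj (t - s0) \<xi> (\<psi> \<xi>) - ((t - s) - (t - s0)) *\<^sub>R ?G \<xi> (Sadj (t - s0) \<xi> (\<psi> \<xi>)))
       \<le> C\<^sup>2 * ((t - s) - (t - s0))\<^sup>2 * norm (\<psi> \<xi>)"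
      by (rule lflow_taylor(1)[OF gen_linear C(1) C(2)[OF True] adj.flow_contraction]) (use s in auto)
    moreover have "- (((t - s) - (t - s0)) *\<^sub>R v) = (s - s0) *\<^sub>R v" for v :: "(real^('n1+'n2)) \<times> (real^('n1+'n2))"
      by (simp add: scaleR_minus_left[symmetric])
    moreover have "((t - s) - (t - s0))\<^sup>2 = (s - s0)\<^sup>2" by (simp add: power2_commute)
    ultimately show ?thesis unfolding \<Psi>_def by (simp only: diff_conv_add_uminus[of "_ - _" "(_ - _) *\<^sub>R _"])
  next
    case False
    then have "\<psi> \<xi> = 0" using R(2) by simp
    then show ?thesis by (simp add: \<Psi>_def lflow_zero_vec[OF gen_linear] linear_0[OF gen_linear])
  qed
  obtain W where W: "0 \<le> W" "\<And>s. 0 \<le> s \<Longrightarrow> s \<le> t \<Longrightarrow> Lp_norm 2 (w s) \<le> W"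
    using weak_solution_norm_bounded[OF ws] by blast
  define J where "J s = (LINT x|lborel. ift (\<Psi> s) x \<bullet> w s x)" for s
  have der: "(J has_real_derivative 0) (at s0 within {0..t})" if s0: "s0 \<in> {0..t}" for s0
  proof -
    define Y0 where "Y0 = (\<lambda>\<xi>. ?G \<xi> (\<Psi> s0 \<xi>))"
    have bY: "L2_bdd_supp Y0" unfolding Y0_def by (rule adj.gen_L2_bdd_supp[OF b\<Psi>]) (use s0 in simp)
    define X where "X s = (LINT x|lborel. ift Y0 x \<bullet> w s x)" for s
    define J2 where "J2 s = (LINT x|lborel. ift (\<Psi> s0) x \<bullet> w s x)" for s
    \<comment> \<open>Both factors of \<open>J\<close> depend on s, and the solution is
      differentiable only against fixed tests, so no product rule applies. The test is frozen at s0,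
      its motion to first order is collected in \<open>X\<close>, and the rest is a quadratic
      remainder.\<close>
    define Er where "Er s = J s - J2 s + (s - s0) * X s" for s
    have sub: "(f has_real_derivative d) (at s0 within {0..t})" if "(f has_real_derivative d) (at s0 within {0..})" for f d
      by (rule has_field_derivative_subset[OF that]) auto
    have dJ2: "(J2 has_real_derivative X s0) (at s0 within {0..t})"
      unfolding J2_def X_def Y0_def
      by (rule sub[OF weak_solution_ift[OF ws b\<Psi>]]) (use s0 in auto)
    obtain X' where dX: "(X has_real_derivative X') (at s0 within {0..t})"
      unfolding X_def using sub[OF weak_solution_ift[OF ws bY]] s0 by auto
    have dE: "(Er has_real_derivative 0) (at s0 within {0..t})"
    proof (rule has_derivative_zero_quadratic[OF _ s0])
      fix s assume s: "s \<in> {0..t}"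
      then have ws2: "w s \<in> Lp 2" using L by simp
      have b1: "L2_bdd_supp (\<Psi> s)" "L2_bdd_supp (\<Psi> s0)" using b\<Psi> s s0 by auto
      define Z where "Z = (\<lambda>\<xi>. \<Psi> s \<xi> - \<Psi> s0 \<xi> + (s - s0) *\<^sub>R Y0 \<xi>)"
      have bZ: "L2_bdd_supp Z" unfolding Z_def by (intro L2_bdd_supp_add L2_bdd_supp_diff L2_bdd_supp_scaleR b1 bY)
      have iZ: "ift Z x = ift (\<Psi> s) x - ift (\<Psi> s0) x + (s - s0) *\<^sub>R ift Y0 x" for x
        unfolding Z_def
        by (simp add: ift_add[OF L2_bdd_supp_integrable[OF L2_bdd_supp_diff[OF b1]] L2_bdd_supp_integrable[OF L2_bdd_supp_scaleR[OF bY]]] ift_diff[OF b1] ift_scaleR)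
      have "Er s = (LINT x|lborel. ift Z x \<bullet> w s x)"
        using Lp2_inner[OF L2_bdd_supp_ift_Lp2[OF b1(1)] ws2] Lp2_inner[OF L2_bdd_supp_ift_Lp2[OF b1(2)] ws2] Lp2_inner[OF L2_bdd_supp_ift_Lp2[OF bY] ws2]
        by (simp add: Er_def J_def J2_def X_def iZ inner_add_left inner_diff_left)
      then have "\<bar>Er s\<bar> \<le> Lp_norm 2 (ift Z) * Lp_norm 2 (w s)"
        using Lp2_Cauchy_Schwarz[OF L2_bdd_supp_ift_Lp2[OF bZ] ws2] by simp
      also have "\<dots> \<le> (sqrt ((2 * pi) ^ DIM(real^'m)) * (C\<^sup>2 * (s - s0)\<^sup>2 * Lp_norm 2 \<psi>)) * W"
      proof (rule mult_mono)
        have "Lp_norm 2 Z \<le> C\<^sup>2 * (s - s0)\<^sup>2 * Lp_norm 2 \<psi>"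
          by (rule Lp_norm2_mono[OF L2_bdd_supp_Lp2[OF \<psi>] L2_bdd_supp_measurable[OF bZ]])
            (use taylor[OF s s0] in \<open>auto simp: Z_def Y0_def\<close>)
        then show "Lp_norm 2 (ift Z) \<le> sqrt ((2 * pi) ^ DIM(real^'m)) * (C\<^sup>2 * (s - s0)\<^sup>2 * Lp_norm 2 \<psi>)"
          by (intro order_trans[OF L2_bdd_supp_ift_norm[OF bZ]] mult_left_mono) auto
        show "Lp_norm 2 (w s) \<le> W" using W s by simp
      qed (auto simp: Lp_norm2_nonneg intro!: mult_nonneg_nonneg)
      finally show "\<bar>Er s\<bar> \<le> (sqrt ((2 * pi) ^ DIM(real^'m)) * C\<^sup>2 * Lp_norm 2 \<psi> * W) * (s - s0)\<^sup>2"
        by (simp add: mult_ac)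
    qed
    \<comment> \<open>The derivative X s0 due to the solution cancels the one due to the test; the
      remaining term carries the factor s0 - s0.\<close>
    have "((\<lambda>s. Er s + (J2 s - (s - s0) * X s)) has_real_derivative 0 + (X s0 - (1 * X s0 + X' * (s0 - s0)))) (at s0 within {0..t})"
      by (intro DERIV_add DERIV_diff dE dJ2 DERIV_mult dX) (auto intro!: derivative_eq_intros)
    moreover have "(\<lambda>s. Er s + (J2 s - (s - s0) * X s)) = J" by (auto simp: Er_def)
    ultimately show ?thesis by simp
  qed
  obtain c where c: "\<And>s. s \<in> {0..t} \<Longrightarrow> J s = c"
    using has_field_derivative_zero_constant[of "{0..t}" J] der by auto
  have "J t = J 0" using c[of t] c[of 0] t by simp
  moreover have "\<Psi> t = \<psi>" by (simp add: \<Psi>_def lflow_0)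
  moreover have "J 0 = (LINT x|lborel. ift (\<Psi> 0) x \<bullet> w0 x)"
    unfolding J_def
  proof (rule integral_cong_AE)
    have m: "ift (\<Psi> 0) \<in> borel_measurable borel" by (rule ift_measurable[OF L2_bdd_supp_measurable[OF b\<Psi>[OF t]]])
    show "(\<lambda>x. ift (\<Psi> 0) x \<bullet> w 0 x) \<in> borel_measurable lborel" "(\<lambda>x. ift (\<Psi> 0) x \<bullet> w0 x) \<in> borel_measurable lborel"
      using m Lp2_measurable[OF L[of 0]] Lp2_measurable[OF w0] by (auto intro!: borel_measurable_inner)
    have "AE x in lborel. w 0 x = w0 x" using ws by (simp add: weak_solution_def)
    then show "AE x in lborel. ift (\<Psi> 0) x \<bullet> w 0 x = ift (\<Psi> 0) x \<bullet> w0 x" by (rule AE_mp) simp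
  qed
  ultimately show ?thesis by (simp add: J_def \<Psi>_def)
qed

lemma Sadj_cutoff: "cutoff R (\<lambda>\<xi>. Sadj t \<xi> (f \<xi>)) = (\<lambda>\<xi>. Sadj t \<xi> (cutoff R f \<xi>))"
  by (simp add: cutoff_def lflow_scaleR[OF gen_linear])

lemma L2_bdd_supp_Sadj_cutoff:
  assumes "f \<in> Lp 1" "f \<in> Lp 2" "0 \<le> t"
  shows "L2_bdd_supp (cutoff R (\<lambda>\<xi>. Sadj t \<xi> (ft f \<xi>)))"
proof -
  interpret adj: kawashima "\<lambda>\<alpha>. - A \<alpha>" "transpose D" by (rule adjoint_kawashima)
  show ?thesis
    unfolding Sadj_cutoff by (rule adj.flow_L2_bdd_supp[OF L2_bdd_supp_cutoff[OF plancherel(1)[OF assms(1,2)]] assms(3)])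
qed

text \<open>The pairing with \<open>w t\<close> is determined by \<open>w0\<close> alone, which
  contains uniqueness. Duality holds for band-limited tests; L^2 inversion removes the cutoff on the
  side of \<open>w t\<close>, whereas on the side of \<open>w0\<close> it stays inside the
  limit.\<close>

lemma weak_solution_pairing:
  assumes ws: "weak_solution A (block_B D) w0 w" and w0: "w0 \<in> Lp 2" and f: "f \<in> Lp 1" "f \<in> Lp 2" and t: "0 \<le> t"
  shows "(\<lambda>n. LINT x|lborel. ift (cutoff (real n) (\<lambda>\<xi>. Sadj t \<xi> (ft f \<xi>))) x \<bullet> w0 x)
    \<longlonglongrightarrow> (2 * pi) ^ DIM(real^'m) * (LINT x|lborel. f x \<bullet> w t x)"
proof -
  have L: "w t \<in> Lp 2" using ws t by (simp add: weak_solution_def)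
  note b = L2_bdd_supp_cutoff[OF plancherel(1)[OF f]]
  have "(\<lambda>n. LINT x|lborel. ift (cutoff (real n) (ft f)) x \<bullet> w t x) \<longlonglongrightarrow> (LINT x|lborel. ((2 * pi) ^ DIM(real^'m) *\<^sub>R f x) \<bullet> w t x)"
    by (rule Lp2_inner_tendsto[OF L2_bdd_supp_ift_Lp2[OF b] Lp2_scaleR[OF f(2)] L fourier_inversion_L2[OF f]])
  then show ?thesis
    unfolding Sadj_cutoff by (simp add: weak_solution_duality[OF ws w0 b t] del: DIM_cart)
qed

end

section \<open>Low and high frequencies\<close>

lemma Jrot_pow_scaleR: "(Jrot ^^ n) (a *\<^sub>R p) = a *\<^sub>R (Jrot ^^ n) p"
  by (induction n) (simp_all add: Jrot_scaleR)

lemma has_weak_deriv_ift: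
  fixes \<psi> :: "real^'m::finite \<Rightarrow> 'b::euclidean_space \<times> 'b"
  assumes \<psi>: "L2_bdd_supp \<psi>"
  shows "has_weak_deriv \<beta> (ift \<psi>) (ift (foldr mulJ (mi_dirs \<beta>) \<psi>))"
proof (rule has_weak_derivI[OF L2_bdd_supp_ift_Lp2[OF \<psi>] L2_bdd_supp_ift_Lp2[OF L2_bdd_supp_foldr_mulJ[OF \<psi>]]])
  fix \<phi> :: "real^'m \<Rightarrow> real" and e :: 'b
  assume \<phi>: "test_function \<phi>"
  let ?vs = "mi_dirs \<beta>"
  have i: "integrable lborel (\<lambda>x. \<phi> x *\<^sub>R e)" "integrable lborel (\<lambda>x. foldr dir_deriv ?vs \<phi> x *\<^sub>R e)"
    using test_function_Lp(1)[OF \<phi>] test_function_Lp(1)[OF test_function_foldr[OF \<phi>]] by (simp_all add: Lp1_iff)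
  have "(LINT x|lborel. (foldr dir_deriv ?vs \<phi> x *\<^sub>R e) \<bullet> ift \<psi> x)
      = (LINT \<xi>|lborel. foldr mulJ ?vs (ft (\<lambda>x. \<phi> x *\<^sub>R e)) \<xi> \<bullet> \<psi> \<xi>)"
    by (simp only: ft_ift_adjoint[OF i(2) L2_bdd_supp_integrable[OF \<psi>]] ft_foldr_dir_deriv[OF \<phi>])
  also have "\<dots> = (LINT \<xi>|lborel. (- 1) ^ mi_order \<beta> * (ft (\<lambda>x. \<phi> x *\<^sub>R e) \<xi> \<bullet> foldr mulJ ?vs \<psi> \<xi>))"
    by (simp add: foldr_mulJ length_mi_dirs inner_Jrot_pow mult.left_commute)
  also have "\<dots> = (- 1) ^ mi_order \<beta> * (LINT x|lborel. (\<phi> x *\<^sub>R e) \<bullet> ift (foldr mulJ ?vs \<psi>) x)"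
    by (simp only: ft_ift_adjoint[OF i(1) L2_bdd_supp_integrable[OF L2_bdd_supp_foldr_mulJ[OF \<psi>]]] integral_mult_right_zero)
  finally show "(LINT x|lborel. (foldr dir_deriv ?vs \<phi> x *\<^sub>R e) \<bullet> ift \<psi> x)
    = (- 1) ^ mi_order \<beta> * (LINT x|lborel. (\<phi> x *\<^sub>R e) \<bullet> ift (foldr mulJ ?vs \<psi>) x)" .
qed

text \<open>Since \<open>ft\<close> sees only the class modulo null sets, K will give identical
  functions for equivalent data.\<close>

lemma ft_cong_AE:
  fixes f g :: "'a::euclidean_space \<Rightarrow> 'b::euclidean_space"
  assumes "f \<in> borel_measurable borel" "g \<in> borel_measurable borel" "AE x in lborel. f x = g x"
  shows "ft f = ft g"
proof
  fix \<xi> :: 'a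
  have c: "(LINT x|lborel. h (x \<bullet> \<xi>) *\<^sub>R f x) = (LINT x|lborel. h (x \<bullet> \<xi>) *\<^sub>R g x)"
    if "continuous_on UNIV h" for h :: "real \<Rightarrow> real"
  proof (rule integral_cong_AE)
    have "(\<lambda>x. h (x \<bullet> \<xi>)) \<in> borel_measurable borel"
      by (intro borel_measurable_continuous_onI continuous_on_compose2[OF that] continuous_intros) auto
    then show "(\<lambda>x. h (x \<bullet> \<xi>) *\<^sub>R f x) \<in> borel_measurable lborel" "(\<lambda>x. h (x \<bullet> \<xi>) *\<^sub>R g x) \<in> borel_measurable lborel"
      using assms by (auto intro!: borel_measurable_scaleR)
    show "AE x in lborel. h (x \<bullet> \<xi>) *\<^sub>R f x = h (x \<bullet> \<xi>) *\<^sub>R g x"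
      by (rule AE_mp[OF assms(3)]) simp
  qed
  show "ft f \<xi> = ft g \<xi>"
    unfolding ft_def by (intro arg_cong2[where f=Pair] c continuous_intros)
qed

text \<open>The inverse power of 2 pi is needed because neither \<open>ft\<close> nor
  \<open>ift\<close> carries a constant. The flow here is the one of the system itself, acting on
  the data, whereas tests are moved by the adjoint flow.\<close>

definition low_multiplier :: "('m::finite \<Rightarrow> real^('n1::finite+'n2::finite)^('n1+'n2)) \<Rightarrow> real^'n2^'n2 \<Rightarrow> real \<Rightarrow>
    (real^'m \<Rightarrow> real^('n1+'n2)) \<Rightarrow> real^'m \<Rightarrow> (real^('n1+'n2)) \<times> (real^('n1+'n2))" where
  "low_multiplier A D t w0 = (\<lambda>\<xi>. inverse ((2 * pi) ^ DIM(real^'m)) *\<^sub>R cutoff 1 (\<lambda>\<xi>. lflow (gen A D \<xi>) t (ft w0 \<xi>)) \<xi>)"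

context kawashima
begin

lemma L2_bdd_supp_low_multiplier:
  assumes "w0 \<in> Lp 1" "w0 \<in> Lp 2" "0 \<le> t"
  shows "L2_bdd_supp (low_multiplier A D t w0)"
  unfolding low_multiplier_def
  by (intro L2_bdd_supp_scaleR L2_bdd_supp_cutoff flow_Lp2 plancherel assms)

text \<open>The generator commutes with \<open>Jrot\<close>, so the flow is complex linear, and
  \<open>mulJ\<close> multiplies by a complex scalar at each \<xi>.\<close>

lemma flow_foldr_mulJ:
  "lflow (gen A D \<xi>) t (foldr mulJ vs \<psi> \<xi>) = foldr mulJ vs (\<lambda>\<xi>. lflow (gen A D \<xi>) t (\<psi> \<xi>)) \<xi>"
proof -
  have J: "Jrot (lflow (gen A D \<xi>) t p) = lflow (gen A D \<xi>) t (Jrot p)" for p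
    by (rule lflow_commute[where T=Jrot and L="gen A D \<xi>" and M="gen A D \<xi>"])
      (simp_all add: gen_linear bounded_linear_Jrot gen_Jrot)
  have "(Jrot ^^ n) (lflow (gen A D \<xi>) t p) = lflow (gen A D \<xi>) t ((Jrot ^^ n) p)" for n p
    by (induction n) (simp_all add: J)
  then show ?thesis by (simp only: foldr_mulJ lflow_scaleR[OF gen_linear])
qed

text \<open>Expresses the derivative of the low-frequency part by the same pairing with g0 that
  \<open>weak_solution_pairing\<close> uses, with cutoff 1 in place of n. The sign from the weak
  derivative cancels the one from transposing the multipliers.\<close>

lemma low_frequency_pairing:
  assumes w0: "w0 \<in> Lp 1" "w0 \<in> Lp 2" and wd: "has_weak_deriv \<beta> w0 g0" and g0: "g0 \<in> Lp 2"
    and f: "f \<in> Lp 1" "f \<in> Lp 2" and t: "0 \<le> t"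
  shows "(LINT x|lborel. ift (cutoff 1 (\<lambda>\<xi>. Sadj t \<xi> (ft f \<xi>))) x \<bullet> g0 x)
    = (2 * pi) ^ DIM(real^'m) * (LINT x|lborel. f x \<bullet> ift (foldr mulJ (mi_dirs \<beta>) (low_multiplier A D t w0)) x)"
proof -
  let ?vs = "mi_dirs \<beta>" and ?m = "low_multiplier A D t w0"
  define c where "c = (2 * pi) ^ DIM(real^'m)"
  have c: "c \<noteq> 0" by (simp add: c_def)
  define \<Phi> where "\<Phi> = cutoff 1 (\<lambda>\<xi>. Sadj t \<xi> (ft f \<xi>))"
  have b\<Phi>: "L2_bdd_supp \<Phi>" unfolding \<Phi>_def by (rule L2_bdd_supp_Sadj_cutoff[OF f t])
  note bm = L2_bdd_supp_foldr_mulJ[OF L2_bdd_supp_low_multiplier[OF w0 t]]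
  have i: "integrable lborel f" "integrable lborel w0" using f w0 by (simp_all add: Lp1_iff)
  have pt: "ft w0 \<xi> \<bullet> foldr mulJ ?vs \<Phi> \<xi> = (- 1) ^ mi_order \<beta> * (c * (ft f \<xi> \<bullet> foldr mulJ ?vs ?m \<xi>))" for \<xi>
  proof -
    let ?S = "lflow (gen A D \<xi>) t"
    have "ft w0 \<xi> \<bullet> foldr mulJ ?vs \<Phi> \<xi> = foldr mulJ ?vs \<Phi> \<xi> \<bullet> ft w0 \<xi>" by (rule inner_commute)
    also have "\<dots> = (- 1) ^ mi_order \<beta> * (\<Phi> \<xi> \<bullet> foldr mulJ ?vs (ft w0) \<xi>)"
      unfolding inner_foldr_mulJ length_mi_dirs by (simp add: foldr_mulJ)
    also have "\<Phi> \<xi> \<bullet> foldr mulJ ?vs (ft w0) \<xi> = indicator (cball 0 1) \<xi> * (ft f \<xi> \<bullet> ?S (foldr mulJ ?vs (ft w0) \<xi>))"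
      using flow_adjoint[of \<xi> t "foldr mulJ ?vs (ft w0) \<xi>" "ft f \<xi>"] by (simp add: \<Phi>_def cutoff_def inner_commute)
    also have "\<dots> = c * (ft f \<xi> \<bullet> foldr mulJ ?vs ?m \<xi>)"
      unfolding flow_foldr_mulJ unfolding foldr_mulJ low_multiplier_def c_def[symmetric] cutoff_def
      using c by (simp add: Jrot_pow_scaleR field_simps)
    finally show ?thesis .
  qed
  have "(LINT x|lborel. ift (foldr mulJ ?vs \<Phi>) x \<bullet> w0 x) = (LINT \<xi>|lborel. ft w0 \<xi> \<bullet> foldr mulJ ?vs \<Phi> \<xi>)"
    using ft_ift_adjoint[OF i(2) L2_bdd_supp_integrable[OF L2_bdd_supp_foldr_mulJ[OF b\<Phi>]], of ?vs] by (simp add: inner_commute)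
  also have "\<dots> = (- 1) ^ mi_order \<beta> * (c * (LINT \<xi>|lborel. ft f \<xi> \<bullet> foldr mulJ ?vs ?m \<xi>))"
    unfolding pt by simp
  also have "(LINT \<xi>|lborel. ft f \<xi> \<bullet> foldr mulJ ?vs ?m \<xi>) = (LINT x|lborel. f x \<bullet> ift (foldr mulJ ?vs ?m) x)"
    by (rule ft_ift_adjoint[OF i(1) L2_bdd_supp_integrable[OF bm], symmetric])
  finally have "(- 1) ^ mi_order \<beta> * (LINT x|lborel. ift \<Phi> x \<bullet> g0 x) = (- 1) ^ mi_order \<beta> * (c * (LINT x|lborel. f x \<bullet> ift (foldr mulJ ?vs ?m) x))"
    using weak_deriv_ift[OF wd w0(2) g0 b\<Phi>] by simp
  then show ?thesis by (simp add: \<Phi>_def c_def)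
qed

text \<open>Only |\<xi>| > 1 survives in the difference, where the rate of \<open>flow_decay\<close>
  is constant. It is halved because that bound concerns a square, and sqrt 3 is rounded up to
  2.\<close>

lemma high_frequency_decay:
  "\<exists>\<nu>>0. \<forall>f t n. f \<in> Lp 1 \<longrightarrow> f \<in> Lp 2 \<longrightarrow> 0 \<le> t \<longrightarrow> 1 \<le> n \<longrightarrow>
    Lp_norm 2 (\<lambda>\<xi>. cutoff n (\<lambda>\<xi>. Sadj t \<xi> (ft f \<xi>)) \<xi> - cutoff 1 (\<lambda>\<xi>. Sadj t \<xi> (ft f \<xi>)) \<xi>)
      \<le> 2 * exp (- \<nu> * t) * (sqrt ((2 * pi) ^ DIM(real^'m)) * Lp_norm 2 (f :: real^'m \<Rightarrow> real^('n1+'n2)))"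
proof -
  interpret adj: kawashima "\<lambda>\<alpha>. - A \<alpha>" "transpose D" by (rule adjoint_kawashima)
  obtain \<nu> where \<nu>: "0 < \<nu>" "\<And>\<xi> t v. 0 \<le> t \<Longrightarrow> (norm (Sadj t \<xi> v))\<^sup>2 \<le> 3 * exp (- \<nu> * min 1 ((norm \<xi>)\<^sup>2) * t) * (norm v)\<^sup>2"
    using adj.flow_decay by blast
  have "Lp_norm 2 (\<lambda>\<xi>. cutoff n (\<lambda>\<xi>. Sadj t \<xi> (ft f \<xi>)) \<xi> - cutoff 1 (\<lambda>\<xi>. Sadj t \<xi> (ft f \<xi>)) \<xi>)
      \<le> 2 * exp (- (\<nu> / 2) * t) * (sqrt ((2 * pi) ^ DIM(real^'m)) * Lp_norm 2 f)"
    if f: "f \<in> Lp 1" "f \<in> Lp 2" and t: "0 \<le> t" and n: "1 \<le> n" for f :: "real^'m \<Rightarrow> real^('n1+'n2)" and t n :: real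
    unfolding plancherel_norm[OF f, symmetric]
  proof (rule Lp_norm2_mono[OF plancherel(1)[OF f]])
    show "(\<lambda>\<xi>. cutoff n (\<lambda>\<xi>. Sadj t \<xi> (ft f \<xi>)) \<xi> - cutoff 1 (\<lambda>\<xi>. Sadj t \<xi> (ft f \<xi>)) \<xi>) \<in> borel_measurable borel"
      by (intro borel_measurable_diff L2_bdd_supp_measurable L2_bdd_supp_Sadj_cutoff f t)
    fix \<xi> :: "real^'m"
    show "norm (cutoff n (\<lambda>\<xi>. Sadj t \<xi> (ft f \<xi>)) \<xi> - cutoff 1 (\<lambda>\<xi>. Sadj t \<xi> (ft f \<xi>)) \<xi>) \<le> 2 * exp (- (\<nu> / 2) * t) * norm (ft f \<xi>)"
    proof (cases "1 < norm \<xi>")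
      case True
      then have m: "min 1 ((norm \<xi>)\<^sup>2) = 1" by (simp add: one_le_power)
      have "(norm (Sadj t \<xi> (ft f \<xi>)))\<^sup>2 \<le> 3 * exp (- \<nu> * t) * (norm (ft f \<xi>))\<^sup>2"
        using \<nu>(2)[OF t, of \<xi> "ft f \<xi>"] by (simp add: m)
      also have "\<dots> \<le> 4 * exp (- \<nu> * t) * (norm (ft f \<xi>))\<^sup>2" by (intro mult_right_mono) auto
      also have "\<dots> = (2 * exp (- (\<nu> / 2) * t) * norm (ft f \<xi>))\<^sup>2"
        by (simp add: power_mult_distrib exp_double[symmetric])
      finally have le: "norm (Sadj t \<xi> (ft f \<xi>)) \<le> 2 * exp (- (\<nu> / 2) * t) * norm (ft f \<xi>)"
        by (rule power2_le_imp_le) simp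
      have "cutoff 1 (\<lambda>\<xi>. Sadj t \<xi> (ft f \<xi>)) \<xi> = 0" using True by (simp add: cutoff_def)
      then show ?thesis using order_trans[OF norm_cutoff_le[of n "\<lambda>\<xi>. Sadj t \<xi> (ft f \<xi>)" \<xi>] le] by simp
    next
      case False
      then have "cutoff n (\<lambda>\<xi>. Sadj t \<xi> (ft f \<xi>)) \<xi> = cutoff 1 (\<lambda>\<xi>. Sadj t \<xi> (ft f \<xi>)) \<xi>"
        using n by (simp add: cutoff_def)
      then show ?thesis by simp
    qed
  qed simp
  then show ?thesis using \<nu>(1) by (intro exI[of _ "\<nu> / 2"]) simp
qed

text \<open>Here \<open>w\<close> evolves from the derivative g0 of the data. Subtracting the two
  pairing formulas, the error tested against f is a limit of pairings of g0 with test frequencies 1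
  < |\<xi>| <= n, so all decay is on the side of the test.\<close>

lemma high_frequency_bound:
  "\<exists>\<nu>>0. \<forall>w0 g0 w t \<beta>. w0 \<in> Lp 1 \<longrightarrow> w0 \<in> Lp 2 \<longrightarrow> has_weak_deriv \<beta> w0 g0 \<longrightarrow> g0 \<in> Lp 2 \<longrightarrow>
    weak_solution A (block_B D) g0 w \<longrightarrow> 0 \<le> t \<longrightarrow>
    Lp_norm 2 (\<lambda>x. w t x - ift (foldr mulJ (mi_dirs \<beta>) (low_multiplier A D t w0)) x) \<le> 2 * exp (- \<nu> * t) * Lp_norm 2 g0"
proof -
  let ?c = "(2 * pi) ^ DIM(real^'m)"
  obtain \<nu> where \<nu>: "0 < \<nu>" "\<And>(f :: real^'m \<Rightarrow> real^('n1+'n2)) t n. f \<in> Lp 1 \<Longrightarrow> f \<in> Lp 2 \<Longrightarrow> 0 \<le> t \<Longrightarrow> 1 \<le> n \<Longrightarrow>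
    Lp_norm 2 (\<lambda>\<xi>. cutoff n (\<lambda>\<xi>. Sadj t \<xi> (ft f \<xi>)) \<xi> - cutoff 1 (\<lambda>\<xi>. Sadj t \<xi> (ft f \<xi>)) \<xi>)
      \<le> 2 * exp (- \<nu> * t) * (sqrt ?c * Lp_norm 2 f)"
    using high_frequency_decay by blast
  have "Lp_norm 2 (\<lambda>x. w t x - ift (foldr mulJ (mi_dirs \<beta>) (low_multiplier A D t w0)) x) \<le> 2 * exp (- \<nu> * t) * Lp_norm 2 g0"
    if w0: "w0 \<in> Lp 1" "w0 \<in> Lp 2" and wd: "has_weak_deriv \<beta> w0 g0" and g0: "g0 \<in> Lp 2"
      and ws: "weak_solution A (block_B D) g0 w" and t: "0 \<le> t" for w0 g0 w t \<beta>
  proof (rule Lp2_norm_le_by_duality)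
    let ?k = "ift (foldr mulJ (mi_dirs \<beta>) (low_multiplier A D t w0))"
    have L: "w t \<in> Lp 2" using ws t by (simp add: weak_solution_def)
    have kL: "?k \<in> Lp 2" by (rule L2_bdd_supp_ift_Lp2[OF L2_bdd_supp_foldr_mulJ[OF L2_bdd_supp_low_multiplier[OF w0 t]]])
    show "(\<lambda>x. w t x - ?k x) \<in> Lp 2" by (rule Lp2_diff[OF L kL])
    show "0 \<le> 2 * exp (- \<nu> * t) * Lp_norm 2 g0" by (simp add: Lp_norm2_nonneg)
    fix f :: "real^'m \<Rightarrow> real^('n1+'n2)" assume f: "f \<in> Lp 1" "f \<in> Lp 2"
    define \<Phi> where "\<Phi> n = cutoff n (\<lambda>\<xi>. Sadj t \<xi> (ft f \<xi>))" for n
    have b: "L2_bdd_supp (\<Phi> n)" for n unfolding \<Phi>_def by (rule L2_bdd_supp_Sadj_cutoff[OF f t])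
    have "(\<lambda>n. (LINT x|lborel. ift (\<Phi> (real n)) x \<bullet> g0 x) - (LINT x|lborel. ift (\<Phi> 1) x \<bullet> g0 x))
       \<longlonglongrightarrow> ?c * (LINT x|lborel. f x \<bullet> w t x) - ?c * (LINT x|lborel. f x \<bullet> ?k x)"
      unfolding low_frequency_pairing[OF w0 wd g0 f t, symmetric] \<Phi>_def
      by (intro tendsto_diff weak_solution_pairing[OF ws g0 f t] tendsto_const)
    also have "?c * (LINT x|lborel. f x \<bullet> w t x) - ?c * (LINT x|lborel. f x \<bullet> ?k x) = ?c * (LINT x|lborel. f x \<bullet> (w t x - ?k x))"
      using Lp2_inner[OF f(2) L] Lp2_inner[OF f(2) kL] by (simp add: inner_diff_right right_diff_distrib)
    finally have lim: "(\<lambda>n. \<bar>(LINT x|lborel. ift (\<Phi> (real n)) x \<bullet> g0 x) - (LINT x|lborel. ift (\<Phi> 1) x \<bullet> g0 x)\<bar>)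
       \<longlonglongrightarrow> \<bar>?c * (LINT x|lborel. f x \<bullet> (w t x - ?k x))\<bar>" by (rule tendsto_rabs)
    have le: "\<bar>(LINT x|lborel. ift (\<Phi> (real n)) x \<bullet> g0 x) - (LINT x|lborel. ift (\<Phi> 1) x \<bullet> g0 x)\<bar>
       \<le> ?c * (2 * exp (- \<nu> * t) * Lp_norm 2 g0 * Lp_norm 2 f)" if n: "1 \<le> n" for n :: nat
    proof -
      have bd: "L2_bdd_supp (\<lambda>\<xi>. \<Phi> (real n) \<xi> - \<Phi> 1 \<xi>)" by (rule L2_bdd_supp_diff[OF b b])
      have "(LINT x|lborel. ift (\<Phi> (real n)) x \<bullet> g0 x) - (LINT x|lborel. ift (\<Phi> 1) x \<bullet> g0 x)
        = (LINT x|lborel. ift (\<lambda>\<xi>. \<Phi> (real n) \<xi> - \<Phi> 1 \<xi>) x \<bullet> g0 x)"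
        using Lp2_inner[OF L2_bdd_supp_ift_Lp2[OF b] g0] by (simp add: ift_diff[OF b b] inner_diff_left)
      also have "\<bar>\<dots>\<bar> \<le> Lp_norm 2 (ift (\<lambda>\<xi>. \<Phi> (real n) \<xi> - \<Phi> 1 \<xi>)) * Lp_norm 2 g0"
        by (rule Lp2_Cauchy_Schwarz[OF L2_bdd_supp_ift_Lp2[OF bd] g0])
      \<comment> \<open>One root of the constant comes from \<open>ift\<close> and one from
        Plancherel for f; together they cancel the constant of the inversion formula.\<close>
      also have "\<dots> \<le> (sqrt ?c * (2 * exp (- \<nu> * t) * (sqrt ?c * Lp_norm 2 f))) * Lp_norm 2 g0"
        using \<nu>(2)[OF f t, of "real n"] n unfolding \<Phi>_def[symmetric]
        by (intro mult_right_mono Lp_norm2_nonneg order_trans[OF L2_bdd_supp_ift_norm[OF bd]] mult_left_mono) auto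
      also have "\<dots> = (sqrt ?c * sqrt ?c) * (2 * exp (- \<nu> * t) * Lp_norm 2 g0 * Lp_norm 2 f)" by (simp only: mult_ac)
      also have "sqrt ?c * sqrt ?c = ?c" by simp
      finally show ?thesis .
    qed
    have "\<bar>?c * (LINT x|lborel. f x \<bullet> (w t x - ?k x))\<bar> \<le> ?c * (2 * exp (- \<nu> * t) * Lp_norm 2 g0 * Lp_norm 2 f)"
      by (rule tendsto_upperbound[OF lim]) (use le in \<open>auto intro: eventually_sequentiallyI[of 1]\<close>)
    then have "?c * \<bar>LINT x|lborel. f x \<bullet> (w t x - ?k x)\<bar> \<le> ?c * (2 * exp (- \<nu> * t) * Lp_norm 2 g0 * Lp_norm 2 f)"
      by (simp only: abs_mult) simp
    moreover have "0 < ?c" by simp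
    ultimately show "\<bar>LINT x|lborel. f x \<bullet> (w t x - ?k x)\<bar> \<le> 2 * exp (- \<nu> * t) * Lp_norm 2 g0 * Lp_norm 2 f"
      by (meson mult_le_cancel_left_pos)
  qed
  then show ?thesis using \<nu>(1) by (intro exI[of _ \<nu>]) blast
qed

text \<open>A solution operator is specified for each datum separately, so linearity and
  independence of the representative have to be derived: by the pairing formula the defect is
  orthogonal to every test.\<close>

lemma weak_solution_combination:
  assumes ws: "weak_solution A (block_B D) f u" "weak_solution A (block_B D) g v"
      "weak_solution A (block_B D) h w"
    and L: "f \<in> Lp 2" "g \<in> Lp 2" "h \<in> Lp 2" and t: "0 \<le> t"
    and eq: "AE x in lborel. h x = a *\<^sub>R f x + b *\<^sub>R g x"
  shows "AE x in lborel. w t x = a *\<^sub>R u t x + b *\<^sub>R v t x"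
proof -
  have S: "u t \<in> Lp 2" "v t \<in> Lp 2" "w t \<in> Lp 2" using ws t by (auto simp: weak_solution_def)
  define d where "d = (\<lambda>x. w t x - (a *\<^sub>R u t x + b *\<^sub>R v t x))"
  have dL: "d \<in> Lp 2" unfolding d_def by (intro Lp2_diff Lp2_add Lp2_scaleR S)
  have "AE x in lborel. d x = 0"
  proof (rule Lp2_eq_0_by_duality[OF dL])
    fix k :: "real^'m \<Rightarrow> real^('n1+'n2)" assume k: "k \<in> Lp 1" "k \<in> Lp 2"
    let ?I = "\<lambda>n w0. LINT x|lborel. ift (cutoff (real n) (\<lambda>\<xi>. Sadj t \<xi> (ft k \<xi>))) x \<bullet> w0 x"
    have z: "?I n h - (a * ?I n f + b * ?I n g) = 0" for n
    proof -
      note i = L2_bdd_supp_ift_Lp2[OF L2_bdd_supp_Sadj_cutoff[OF k t], of "real n"]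
      have "?I n h = ?I n (\<lambda>x. a *\<^sub>R f x + b *\<^sub>R g x)"
      proof (rule integral_cong_AE)
        show "AE x in lborel. ift (cutoff (real n) (\<lambda>\<xi>. Sadj t \<xi> (ft k \<xi>))) x \<bullet> h x
          = ift (cutoff (real n) (\<lambda>\<xi>. Sadj t \<xi> (ft k \<xi>))) x \<bullet> (a *\<^sub>R f x + b *\<^sub>R g x)"
          by (rule AE_mp[OF eq]) simp
      qed (use Lp2_inner[OF i L(3)] Lp2_inner[OF i Lp2_add[OF Lp2_scaleR[OF L(1)] Lp2_scaleR[OF L(2)]]] in \<open>auto dest: borel_measurable_integrable\<close>)
      then show ?thesis
        using Lp2_inner[OF i L(1)] Lp2_inner[OF i L(2)] by (simp add: inner_add_right)
    qed
    have "(\<lambda>n. ?I n h - (a * ?I n f + b * ?I n g)) \<longlonglongrightarrow>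
      (2 * pi) ^ DIM(real^'m) * (LINT x|lborel. k x \<bullet> w t x) - (a * ((2 * pi) ^ DIM(real^'m) * (LINT x|lborel. k x \<bullet> u t x))
        + b * ((2 * pi) ^ DIM(real^'m) * (LINT x|lborel. k x \<bullet> v t x)))"
      by (intro tendsto_intros weak_solution_pairing ws L k t)
    also have "(2 * pi) ^ DIM(real^'m) * (LINT x|lborel. k x \<bullet> w t x) - (a * ((2 * pi) ^ DIM(real^'m) * (LINT x|lborel. k x \<bullet> u t x))
        + b * ((2 * pi) ^ DIM(real^'m) * (LINT x|lborel. k x \<bullet> v t x))) = (2 * pi) ^ DIM(real^'m) * (LINT x|lborel. k x \<bullet> d x)"
      using Lp2_inner[OF k(2) S(1)] Lp2_inner[OF k(2) S(2)] Lp2_inner[OF k(2) S(3)]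
      by (simp add: d_def inner_diff_right inner_add_right right_diff_distrib distrib_left mult_ac)
    finally have "(\<lambda>n. 0) \<longlonglongrightarrow> (2 * pi) ^ DIM(real^'m) * (LINT x|lborel. k x \<bullet> d x)" unfolding z .
    from LIMSEQ_unique[OF this tendsto_const] show "(LINT x|lborel. k x \<bullet> d x) = 0" by simp
  qed
  then show ?thesis by (rule AE_mp) (simp add: d_def)
qed

text \<open>Differentiation commutes with the evolution because the multipliers \<open>mulJ\<close>
  commute with the adjoint flow; the pairing formula transfers this from the tests to the
  solutions.\<close>

lemma has_weak_deriv_weak_solution:
  assumes w0: "w0 \<in> Lp 2" and wd: "has_weak_deriv \<beta> w0 g0" and g0: "g0 \<in> Lp 2"
    and ws: "weak_solution A (block_B D) w0 w" "weak_solution A (block_B D) g0 v" and t: "0 \<le> t"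
  shows "has_weak_deriv \<beta> (w t) (v t)"
proof (rule has_weak_derivI)
  interpret adj: kawashima "\<lambda>\<alpha>. - A \<alpha>" "transpose D" by (rule adjoint_kawashima)
  show "w t \<in> Lp 2" "v t \<in> Lp 2" using ws t by (auto simp: weak_solution_def)
  fix \<phi> :: "real^'m \<Rightarrow> real" and e :: "real^('n1+'n2)"
  assume \<phi>: "test_function \<phi>"
  let ?c = "(2 * pi) ^ DIM(real^'m)"
  let ?vs = "mi_dirs \<beta>" and ?f = "\<lambda>x. \<phi> x *\<^sub>R e" and ?g = "\<lambda>x. foldr dir_deriv (mi_dirs \<beta>) \<phi> x *\<^sub>R e"
  let ?C = "\<lambda>n f. cutoff (real n) (\<lambda>\<xi>. Sadj t \<xi> (ft f \<xi>))"
  have f: "?f \<in> Lp 1" "?f \<in> Lp 2" by (rule test_function_Lp[OF \<phi>])+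
  have g: "?g \<in> Lp 1" "?g \<in> Lp 2" by (rule test_function_Lp[OF test_function_foldr[OF \<phi>]])+
  have "?C n ?g \<xi> = foldr mulJ ?vs (?C n ?f) \<xi>" for n \<xi>
    unfolding ft_foldr_dir_deriv[OF \<phi>] cutoff_def adj.flow_foldr_mulJ by (simp add: foldr_mulJ Jrot_pow_scaleR)
  then have eq: "?C n ?g = foldr mulJ ?vs (?C n ?f)" for n by (rule ext)
  have "(\<lambda>n. LINT x|lborel. ift (?C n ?g) x \<bullet> w0 x) \<longlonglongrightarrow> ?c * (LINT x|lborel. ?g x \<bullet> w t x)"
    by (rule weak_solution_pairing[OF ws(1) w0 g t])
  then have 1: "(\<lambda>n. (- 1) ^ mi_order \<beta> * (LINT x|lborel. ift (?C n ?f) x \<bullet> g0 x)) \<longlonglongrightarrow> ?c * (LINT x|lborel. ?g x \<bullet> w t x)"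
    unfolding eq weak_deriv_ift[OF wd w0 g0 L2_bdd_supp_Sadj_cutoff[OF f t]] .
  have 2: "(\<lambda>n. (- 1) ^ mi_order \<beta> * (LINT x|lborel. ift (?C n ?f) x \<bullet> g0 x)) \<longlonglongrightarrow> (- 1) ^ mi_order \<beta> * (?c * (LINT x|lborel. ?f x \<bullet> v t x))"
    by (intro tendsto_mult tendsto_const weak_solution_pairing[OF ws(2) g0 f t])
  show "(LINT x|lborel. ?g x \<bullet> w t x) = (- 1) ^ mi_order \<beta> * (LINT x|lborel. ?f x \<bullet> v t x)"
    using LIMSEQ_unique[OF 1 2] by simp
qed

end

lemma has_weak_deriv_diff:
  fixes f g f' g' :: "real^'m::finite \<Rightarrow> 'b::euclidean_space"
  assumes "has_weak_deriv \<beta> f f'" "has_weak_deriv \<beta> g g'"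
    and L: "f \<in> Lp 2" "g \<in> Lp 2" "f' \<in> Lp 2" "g' \<in> Lp 2"
  shows "has_weak_deriv \<beta> (\<lambda>x. f x - g x) (\<lambda>x. f' x - g' x)"
  unfolding has_weak_deriv_def
proof (intro conjI allI impI)
  show "locally_integrable (\<lambda>x. f x - g x)" "locally_integrable (\<lambda>x. f' x - g' x)"
    by (intro Lp2_locally_integrable Lp2_diff L)+
  fix \<phi> :: "real^'m \<Rightarrow> real" assume \<phi>: "test_function \<phi>"
  have e: "(LINT x|lborel. partial_deriv \<beta> \<phi> x *\<^sub>R f x) = (- 1) ^ mi_order \<beta> *\<^sub>R (LINT x|lborel. \<phi> x *\<^sub>R f' x)"
    "(LINT x|lborel. partial_deriv \<beta> \<phi> x *\<^sub>R g x) = (- 1) ^ mi_order \<beta> *\<^sub>R (LINT x|lborel. \<phi> x *\<^sub>R g' x)"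
    using assms(1,2) \<phi> by (auto simp: has_weak_deriv_def)
  have i: "integrable lborel (\<lambda>x. partial_deriv \<beta> \<phi> x *\<^sub>R f x)" "integrable lborel (\<lambda>x. partial_deriv \<beta> \<phi> x *\<^sub>R g x)"
    "integrable lborel (\<lambda>x. \<phi> x *\<^sub>R f' x)" "integrable lborel (\<lambda>x. \<phi> x *\<^sub>R g' x)"
    unfolding partial_deriv_foldr by (intro test_scaleR_integrable test_function_foldr \<phi> L)+
  show "(LINT x|lborel. partial_deriv \<beta> \<phi> x *\<^sub>R (f x - g x)) = (- 1) ^ mi_order \<beta> *\<^sub>R (LINT x|lborel. \<phi> x *\<^sub>R (f' x - g' x))"
    using i by (simp add: scaleR_diff_right e)
qed

section \<open>Bounds for the low-frequency part\<close>

lemma base_rate_nonneg: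
  assumes "2 \<le> p" shows "0 \<le> base_rate TYPE('m::finite) p"
proof -
  have "enn2real (inverse p) \<le> 1"
  proof (cases p)
    case (real q)
    then have "2 \<le> q" using assms by (metis ennreal_le_iff ennreal_numeral)
    then show ?thesis using real by (simp add: inverse_ennreal inverse_eq_divide)
  qed simp
  then show ?thesis by (simp add: base_rate_def)
qed

lemma map_foldr_mulJ:
  fixes T :: "'b::real_vector \<Rightarrow> 'c::real_vector" and \<psi> :: "'a::real_inner \<Rightarrow> 'b \<times> 'b"
  assumes "linear T"
  shows "(T (fst (foldr mulJ vs \<psi> \<xi>)), T (snd (foldr mulJ vs \<psi> \<xi>))) = foldr mulJ vs (\<lambda>\<xi>. (T (fst (\<psi> \<xi>)), T (snd (\<psi> \<xi>)))) \<xi>"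
proof (induction vs)
  case (Cons v vs)
  have m: "mulJ v h \<xi> = ((\<xi> \<bullet> v) *\<^sub>R snd (h \<xi>), - ((\<xi> \<bullet> v) *\<^sub>R fst (h \<xi>)))" for h :: "'a \<Rightarrow> 'c \<times> 'c"
    by (simp add: mulJ_def Jrot_def)
  have m': "mulJ v h \<xi> = ((\<xi> \<bullet> v) *\<^sub>R snd (h \<xi>), - ((\<xi> \<bullet> v) *\<^sub>R fst (h \<xi>)))" for h :: "'a \<Rightarrow> 'b \<times> 'b"
    by (simp add: mulJ_def Jrot_def)
  show ?case
    by (simp add: m m' linear_scale[OF assms] linear_neg[OF assms] Cons[symmetric])
qed simp

lemma norm_foldr_mulJ_le:
  "norm (foldr mulJ (mi_dirs \<beta>) \<psi> \<xi>) \<le> norm \<xi> ^ mi_order \<beta> * norm (\<psi> \<xi> :: 'b::real_inner \<times> 'b)"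
  using mult_right_mono[OF abs_prod_list_inner_le[of \<xi> "mi_dirs \<beta>"] norm_ge_zero[of "\<psi> \<xi>"]]
  by (simp add: foldr_mulJ norm_mi_dirs length_mi_dirs)

lemma exp_decay_le:
  fixes t \<nu> :: real
  assumes "0 \<le> t" "0 < \<nu>"
  shows "exp (- \<nu> * t) \<le> (1 + 1 / \<nu>) / max 1 t"
proof -
  have "1 + \<nu> * t \<le> exp (\<nu> * t)" by (rule exp_ge_add_one_self)
  moreover have "max 1 t \<le> (1 + 1 / \<nu>) * (1 + \<nu> * t)"
    using assms by (simp add: field_simps)
  ultimately have "max 1 t \<le> (1 + 1 / \<nu>) * exp (\<nu> * t)"
    using assms by (meson add_nonneg_nonneg less_eq_real_def mult_left_mono order_trans zero_le_divide_1_iff zero_le_one)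
  then show ?thesis by (simp add: exp_minus field_simps)
qed

context kawashima
begin

lemma low_multiplier_combination:
  assumes "integrable lborel f" "integrable lborel g"
  shows "low_multiplier A D t (\<lambda>y. a *\<^sub>R f y + b *\<^sub>R g y) \<xi> = a *\<^sub>R low_multiplier A D t f \<xi> + b *\<^sub>R low_multiplier A D t g \<xi>"
  using assms
  by (simp add: low_multiplier_def cutoff_def ft_add ft_scaleR lflow_add[OF gen_linear] lflow_scaleR[OF gen_linear]
    scaleR_add_right mult_ac)

lemma norm_ft_components_le:
  fixes w0 :: "'a::euclidean_space \<Rightarrow> real^('n1+'n2)"
  assumes "integrable lborel w0"
  shows "norm (Z0 (ft w0 \<xi>)) \<le> 2 * Lp_norm 1 (\<lambda>x. L0 (w0 x))" "norm (Zm (ft w0 \<xi>)) \<le> 2 * Lp_norm 1 (\<lambda>x. Lminus (w0 x))"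
proof -
  have l: "bounded_linear (L0 :: real^('n1+'n2) \<Rightarrow> _)" "bounded_linear (Lminus :: real^('n1+'n2) \<Rightarrow> _)"
    using L0_linear Lminus_linear by (auto simp: linear_conv_bounded_linear)
  show "norm (Z0 (ft w0 \<xi>)) \<le> 2 * Lp_norm 1 (\<lambda>x. L0 (w0 x))" "norm (Zm (ft w0 \<xi>)) \<le> 2 * Lp_norm 1 (\<lambda>x. Lminus (w0 x))"
    unfolding Z0_def Zm_def ft_map[OF assms l(1), symmetric] ft_map[OF assms l(2), symmetric] Lp_norm1
    by (intro norm_ft_le integrable_bounded_linear[OF _ assms] l)+
qed

text \<open>The exponentially decaying part of the \<open>L\<^sub>-\<close>-to-\<open>L\<^sub>-\<close> block is absorbed by \<open>exp (- \<mu> t) \<le> C / max 1 t\<close>, which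
  has the rate of \<open>|\<xi>|\<^sup>2\<close> against the heat kernel.\<close>

lemma low_multiplier_bound:
  "\<exists>C>0. \<exists>\<mu>>0. \<forall>w0 t \<xi>. w0 \<in> Lp 1 \<longrightarrow> 0 \<le> t \<longrightarrow>
    norm (Z0 (low_multiplier A D t w0 \<xi>)) \<le> indicator (cball 0 1) \<xi> *
      ((C * Lp_norm 1 (\<lambda>x. L0 (w0 x)) + C * Lp_norm 1 (\<lambda>x. Lminus (w0 x)) * norm \<xi>) * exp (- \<mu> * (norm \<xi>)\<^sup>2 * t)) \<and>
    norm (Zm (low_multiplier A D t w0 \<xi>)) \<le> indicator (cball 0 1) \<xi> *
      ((C * Lp_norm 1 (\<lambda>x. L0 (w0 x)) * norm \<xi> + C * Lp_norm 1 (\<lambda>x. Lminus (w0 x)) * (norm \<xi>)\<^sup>2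
        + C * Lp_norm 1 (\<lambda>x. Lminus (w0 x)) / max 1 t) * exp (- \<mu> * (norm \<xi>)\<^sup>2 * t))"
proof -
  let ?c = "inverse ((2 * pi) ^ DIM(real^'m))"
  obtain C \<nu> where C: "0 < C" and \<nu>: "0 < \<nu>"
    and bd: "\<And>\<xi> t v. norm \<xi> \<le> 1 \<Longrightarrow> 0 \<le> t \<Longrightarrow>
     norm (Z0 (lflow (gen A D \<xi>) t v)) \<le> C * exp (- \<nu> * (norm \<xi>)\<^sup>2 * t) * (norm (Z0 v) + norm \<xi> * norm (Zm v)) \<and>
     norm (Zm (lflow (gen A D \<xi>) t v)) \<le> C * exp (- \<nu> * (norm \<xi>)\<^sup>2 * t) * (norm \<xi> * norm (Z0 v) + (norm \<xi>)\<^sup>2 * norm (Zm v))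
       + C * exp (- \<nu> * t) * norm (Zm v)"
    using low_frequency_bound by blast
  \<comment> \<open>The transient exp (- \<nu> t) is split into two equal factors: one yields 1 /
    max 1 t with the constant \<open>E\<close>, the other dominates the heat factor because |\<xi>|
    <= 1.\<close>
  define \<mu> where "\<mu> = \<nu> / 2"
  define E where "E = 1 + 1 / \<mu>"
  have \<mu>: "0 < \<mu>" "\<nu> = \<mu> + \<mu>" and E: "1 \<le> E" using \<nu> by (auto simp: \<mu>_def E_def)
  define C' where "C' = ?c * C * 2 * E"
  have c: "0 < ?c" by simp
  have C': "0 < C'" using c C E by (simp add: C'_def)
  have Z0s: "Z0 (a *\<^sub>R p) = a *\<^sub>R Z0 p" and Zms: "Zm (a *\<^sub>R p) = a *\<^sub>R Zm p" for a and p :: "(real^('n1+'n2)) \<times> (real^('n1+'n2))"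
    by (rule linear_scale[OF Z0_linear], rule linear_scale[OF Zm_linear])
  have "norm (Z0 (low_multiplier A D t w0 \<xi>)) \<le> indicator (cball 0 1) \<xi> *
      ((C' * Lp_norm 1 (\<lambda>x. L0 (w0 x)) + C' * Lp_norm 1 (\<lambda>x. Lminus (w0 x)) * norm \<xi>) * exp (- \<mu> * (norm \<xi>)\<^sup>2 * t)) \<and>
    norm (Zm (low_multiplier A D t w0 \<xi>)) \<le> indicator (cball 0 1) \<xi> *
      ((C' * Lp_norm 1 (\<lambda>x. L0 (w0 x)) * norm \<xi> + C' * Lp_norm 1 (\<lambda>x. Lminus (w0 x)) * (norm \<xi>)\<^sup>2
        + C' * Lp_norm 1 (\<lambda>x. Lminus (w0 x)) / max 1 t) * exp (- \<mu> * (norm \<xi>)\<^sup>2 * t))"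
    if w0: "w0 \<in> Lp 1" and t: "0 \<le> t" for w0 t \<xi>
  proof (cases "norm \<xi> \<le> 1")
    case False
    then show ?thesis by (simp add: low_multiplier_def cutoff_def linear_0[OF Z0_linear] linear_0[OF Zm_linear])
  next
    case True
    define N0 where "N0 = Lp_norm 1 (\<lambda>x. L0 (w0 x))"
    define Nm where "Nm = Lp_norm 1 (\<lambda>x. Lminus (w0 x))"
    define r where "r = norm \<xi>"
    define G where "G = exp (- \<mu> * r\<^sup>2 * t)"
    let ?v = "ft w0 \<xi>" and ?S = "lflow (gen A D \<xi>) t (ft w0 \<xi>)"
    have N: "norm (Z0 ?v) \<le> 2 * N0" "norm (Zm ?v) \<le> 2 * Nm"
      unfolding N0_def Nm_def using norm_ft_components_le[of w0 \<xi>] w0 by (auto simp: Lp1_iff)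
    have N0: "0 \<le> N0" "0 \<le> Nm" by (simp_all add: N0_def Nm_def Lp_norm1)
    have r: "0 \<le> r" "r \<le> 1" using True by (auto simp: r_def)
    have r2: "r\<^sup>2 \<le> 1" using r by (simp add: power_le_one)
    have rt: "r\<^sup>2 * t \<le> t" using mult_right_mono[OF r2 t] by simp
    have G: "0 \<le> G" by (simp add: G_def)
    have e1: "exp (- \<nu> * r\<^sup>2 * t) \<le> G" using t \<mu> by (simp add: G_def mult_right_mono)
    have e2: "exp (- \<nu> * t) \<le> E / max 1 t * G"
    proof -
      have "exp (- \<nu> * t) = exp (- \<mu> * t) * exp (- \<mu> * t)" by (simp add: \<mu>(2) exp_add[symmetric] algebra_simps)
      also have "\<dots> \<le> E / max 1 t * G"
        unfolding E_def G_def
        by (intro mult_mono exp_decay_le t \<mu>) (use rt t \<mu> in \<open>auto simp: mult_left_le intro!: mult_right_mono divide_nonneg_nonneg\<close>)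
      finally show ?thesis .
    qed
    have C2: "C * 2 * x \<le> C * 2 * E * x" if "0 \<le> x" for x
      using mult_right_mono[OF E that] C by simp
    have fin: "?c * (C * 2 * E * x) = C' * x" for x by (simp add: C'_def)
    have 1: "norm (Z0 ?S) \<le> C * 2 * E * (N0 + r * Nm) * G"
    proof -
      have "norm (Z0 ?S) \<le> C * exp (- \<nu> * r\<^sup>2 * t) * (norm (Z0 ?v) + r * norm (Zm ?v))"
        using bd[OF True t, of ?v] by (simp add: r_def)
      also have "\<dots> \<le> C * G * (2 * N0 + r * (2 * Nm))"
        using C N r N0 G by (intro mult_mono add_mono mult_left_mono e1) auto
      also have "\<dots> = C * 2 * ((N0 + r * Nm) * G)" by (simp add: algebra_simps)
      also have "\<dots> \<le> C * 2 * E * ((N0 + r * Nm) * G)" by (rule C2) (use N0 r G in auto)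
      finally show ?thesis by (simp only: mult.assoc)
    qed
    have 2: "norm (Zm ?S) \<le> C * 2 * E * ((r * N0 + r\<^sup>2 * Nm + Nm / max 1 t) * G)"
    proof -
      have "norm (Zm ?S) \<le> C * exp (- \<nu> * r\<^sup>2 * t) * (r * norm (Z0 ?v) + r\<^sup>2 * norm (Zm ?v)) + C * exp (- \<nu> * t) * norm (Zm ?v)"
        using bd[OF True t, of ?v] by (simp add: r_def)
      also have "\<dots> \<le> C * G * (r * (2 * N0) + r\<^sup>2 * (2 * Nm)) + C * (E / max 1 t * G) * (2 * Nm)"
        using C N r N0 G E by (intro add_mono mult_mono mult_left_mono e1 e2) auto
      also have "\<dots> = C * 2 * ((r * N0 + r\<^sup>2 * Nm) * G) + C * 2 * E * (Nm / max 1 t * G)" by (simp add: algebra_simps)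
      also have "\<dots> \<le> C * 2 * E * ((r * N0 + r\<^sup>2 * Nm) * G) + C * 2 * E * (Nm / max 1 t * G)"
        by (intro add_right_mono C2) (use N0 r G in auto)
      finally show ?thesis by (simp only: distrib_left[symmetric] distrib_right[symmetric])
    qed
    have l: "norm (Z0 (low_multiplier A D t w0 \<xi>)) = ?c * norm (Z0 ?S)" "norm (Zm (low_multiplier A D t w0 \<xi>)) = ?c * norm (Zm ?S)"
      using True by (simp_all add: low_multiplier_def cutoff_def Z0s Zms del: DIM_cart)
    have "norm (Z0 (low_multiplier A D t w0 \<xi>)) \<le> ?c * (C * 2 * E * ((N0 + r * Nm) * G))"
      unfolding l by (rule mult_left_mono[OF 1[unfolded mult.assoc[of _ "N0 + r * Nm"]]]) simp
    moreover have "norm (Zm (low_multiplier A D t w0 \<xi>)) \<le> ?c * (C * 2 * E * ((r * N0 + r\<^sup>2 * Nm + Nm / max 1 t) * G))"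
      unfolding l by (rule mult_left_mono[OF 2]) simp
    moreover have "C' * ((N0 + r * Nm) * G) = (C' * N0 + C' * Nm * r) * G"
      "C' * ((r * N0 + r\<^sup>2 * Nm + Nm / max 1 t) * G) = (C' * N0 * r + C' * Nm * r\<^sup>2 + C' * Nm / max 1 t) * G"
      by (simp_all add: algebra_simps)
    moreover have "indicator (cball 0 1) \<xi> = (1::real)" using True by simp
    ultimately show ?thesis unfolding fin N0_def[symmetric] Nm_def[symmetric] r_def[symmetric] G_def[symmetric]
      by (simp only: mult_1_left)
  qed
  then show ?thesis using C' \<mu>(1) by blast
qed

text \<open>The derivatives multiply each block bound by |\<xi>|^k and commute with the projections
  onto the blocks; each power of |\<xi>| is worth t^(- 1/2). The constant depends on \<beta> only
  through its order.\<close>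

lemma low_frequency_estimate:
  "\<exists>C>0. \<forall>w0 t \<beta> p. w0 \<in> Lp 1 \<longrightarrow> w0 \<in> Lp 2 \<longrightarrow> 0 \<le> t \<longrightarrow> mi_order \<beta> = k \<longrightarrow> 2 \<le> p \<longrightarrow>
    (let \<gamma> = base_rate TYPE('m) p; g = ift (foldr mulJ (mi_dirs \<beta>) (low_multiplier A D t w0)) in
      (\<lambda>x. L0 (g x)) \<in> Lp p \<and>
      Lp_norm p (\<lambda>x. L0 (g x))
        \<le> C * decay (\<gamma> + real k / 2) t * Lp_norm 1 (\<lambda>x. L0 (w0 x))
          + C * decay (\<gamma> + 1 / 2 + real k / 2) t * Lp_norm 1 (\<lambda>x. Lminus (w0 x)) \<and>
      (\<lambda>x. Lminus (g x)) \<in> Lp p \<and>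
      Lp_norm p (\<lambda>x. Lminus (g x))
        \<le> C * decay (\<gamma> + 1 / 2 + real k / 2) t * Lp_norm 1 (\<lambda>x. L0 (w0 x))
          + C * decay (\<gamma> + 1 + real k / 2) t * Lp_norm 1 (\<lambda>x. Lminus (w0 x)))"
proof -
  obtain C \<mu> where C: "0 < C" and \<mu>: "0 < \<mu>" and bd: "\<And>w0 t \<xi>. w0 \<in> Lp 1 \<Longrightarrow> 0 \<le> t \<Longrightarrow>
    norm (Z0 (low_multiplier A D t w0 \<xi>)) \<le> indicator (cball 0 1) \<xi> *
      ((C * Lp_norm 1 (\<lambda>x. L0 (w0 x)) + C * Lp_norm 1 (\<lambda>x. Lminus (w0 x)) * norm \<xi>) * exp (- \<mu> * (norm \<xi>)\<^sup>2 * t)) \<and>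
    norm (Zm (low_multiplier A D t w0 \<xi>)) \<le> indicator (cball 0 1) \<xi> *
      ((C * Lp_norm 1 (\<lambda>x. L0 (w0 x)) * norm \<xi> + C * Lp_norm 1 (\<lambda>x. Lminus (w0 x)) * (norm \<xi>)\<^sup>2
        + C * Lp_norm 1 (\<lambda>x. Lminus (w0 x)) / max 1 t) * exp (- \<mu> * (norm \<xi>)\<^sup>2 * t))"
    using low_multiplier_bound by blast
  \<comment> \<open>The \<open>L0\<close> block has only two monomials; the third slot will be
    filled with coefficient 0.\<close>
  obtain C1 where C1: "0 < C1" and est1: "\<And>(\<psi> :: real^'m \<Rightarrow> (real^'n1) \<times> (real^'n1)) t a1 a2 a3 p.
    \<psi> \<in> borel_measurable borel \<Longrightarrow> 0 \<le> t \<Longrightarrow> 0 \<le> a1 \<Longrightarrow> 0 \<le> a2 \<Longrightarrow> 0 \<le> a3 \<Longrightarrow>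
    (\<And>\<xi>. norm (\<psi> \<xi>) \<le> indicator (cball 0 1) \<xi> * ((a1 * norm \<xi> ^ k + a2 * norm \<xi> ^ (k + 1) + a3 * norm \<xi> ^ k) * exp (- \<mu> * (norm \<xi>)\<^sup>2 * t))) \<Longrightarrow>
    2 \<le> p \<Longrightarrow> ift \<psi> \<in> Lp p \<and>
    Lp_norm p (ift \<psi>) \<le> C1 * (a1 * max 1 t powr (- real k / 2) + a2 * max 1 t powr (- real (k + 1) / 2) + a3 * max 1 t powr (- real k / 2))
      * max 1 t powr (- base_rate TYPE('m) p)"
    using low_frequency_Lp[OF \<mu>, of k "k + 1" k] by blast
  obtain C2 where C2: "0 < C2" and est2: "\<And>(\<psi> :: real^'m \<Rightarrow> (real^'n2) \<times> (real^'n2)) t a1 a2 a3 p.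
    \<psi> \<in> borel_measurable borel \<Longrightarrow> 0 \<le> t \<Longrightarrow> 0 \<le> a1 \<Longrightarrow> 0 \<le> a2 \<Longrightarrow> 0 \<le> a3 \<Longrightarrow>
    (\<And>\<xi>. norm (\<psi> \<xi>) \<le> indicator (cball 0 1) \<xi> * ((a1 * norm \<xi> ^ (k + 1) + a2 * norm \<xi> ^ (k + 2) + a3 * norm \<xi> ^ k) * exp (- \<mu> * (norm \<xi>)\<^sup>2 * t))) \<Longrightarrow>
    2 \<le> p \<Longrightarrow> ift \<psi> \<in> Lp p \<and>
    Lp_norm p (ift \<psi>) \<le> C2 * (a1 * max 1 t powr (- real (k + 1) / 2) + a2 * max 1 t powr (- real (k + 2) / 2) + a3 * max 1 t powr (- real k / 2))
      * max 1 t powr (- base_rate TYPE('m) p)"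
    using low_frequency_Lp[OF \<mu>, of "k + 1" "k + 2" k] by blast
  \<comment> \<open>The 2 accounts for two contributions of dissipative data with equal rate,
    |\<xi>|^2 and 1 / max 1 t.\<close>
  define M where "M = C * C1 + 2 * C * C2"
  have M: "0 < M" "C * C1 \<le> M" "C * C2 \<le> M" "2 * C * C2 \<le> M" using mult_pos_pos[OF C C1] mult_pos_pos[OF C C2] unfolding M_def mult.assoc by linarith+
  have Bl: "bounded_linear (L0 :: real^('n1+'n2) \<Rightarrow> _)" "bounded_linear (Lminus :: real^('n1+'n2) \<Rightarrow> _)"
    using L0_linear Lminus_linear by (auto simp: linear_conv_bounded_linear)
  have "let \<gamma> = base_rate TYPE('m) p; g = ift (foldr mulJ (mi_dirs \<beta>) (low_multiplier A D t w0)) in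
      (\<lambda>x. L0 (g x)) \<in> Lp p \<and>
      Lp_norm p (\<lambda>x. L0 (g x))
        \<le> M * decay (\<gamma> + real k / 2) t * Lp_norm 1 (\<lambda>x. L0 (w0 x))
          + M * decay (\<gamma> + 1 / 2 + real k / 2) t * Lp_norm 1 (\<lambda>x. Lminus (w0 x)) \<and>
      (\<lambda>x. Lminus (g x)) \<in> Lp p \<and>
      Lp_norm p (\<lambda>x. Lminus (g x))
        \<le> M * decay (\<gamma> + 1 / 2 + real k / 2) t * Lp_norm 1 (\<lambda>x. L0 (w0 x))
          + M * decay (\<gamma> + 1 + real k / 2) t * Lp_norm 1 (\<lambda>x. Lminus (w0 x))"
    if w0: "w0 \<in> Lp 1" "w0 \<in> Lp 2" and t: "0 \<le> t" and k: "mi_order \<beta> = k" and p: "2 \<le> p" for w0 t \<beta> p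
  proof -
    let ?vs = "mi_dirs \<beta>" and ?m = "low_multiplier A D t w0"
    define N0 where "N0 = Lp_norm 1 (\<lambda>x. L0 (w0 x))"
    define Nm where "Nm = Lp_norm 1 (\<lambda>x. Lminus (w0 x))"
    define \<gamma> where "\<gamma> = base_rate TYPE('m) p"
    define R where "R = max 1 t"
    have N: "0 \<le> N0" "0 \<le> Nm" by (simp_all add: N0_def Nm_def Lp_norm1)
    have R: "1 \<le> R" by (simp add: R_def)
    have \<gamma>: "0 \<le> \<gamma>" unfolding \<gamma>_def by (rule base_rate_nonneg[OF p])
    have bm: "L2_bdd_supp ?m" by (rule L2_bdd_supp_low_multiplier[OF w0 t])
    note bF = L2_bdd_supp_foldr_mulJ[OF bm, of ?vs]
    define \<psi>0 where "\<psi>0 = foldr mulJ ?vs (\<lambda>\<xi>. Z0 (?m \<xi>))"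
    define \<psi>m where "\<psi>m = foldr mulJ ?vs (\<lambda>\<xi>. Zm (?m \<xi>))"
    have bZ: "L2_bdd_supp (\<lambda>\<xi>. Z0 (?m \<xi>))" "L2_bdd_supp (\<lambda>\<xi>. Zm (?m \<xi>))"
      unfolding Z0_def Zm_def by (intro L2_bdd_supp_map bm Bl)+
    have ms: "\<psi>0 \<in> borel_measurable borel" "\<psi>m \<in> borel_measurable borel"
      unfolding \<psi>0_def \<psi>m_def by (intro L2_bdd_supp_measurable L2_bdd_supp_foldr_mulJ bZ)+
    have i0: "(\<lambda>x. L0 (ift (foldr mulJ ?vs ?m) x)) = ift \<psi>0"
      unfolding \<psi>0_def Z0_def map_foldr_mulJ[OF L0_linear, symmetric] using ift_map[OF bF Bl(1)] by (simp add: fun_eq_iff)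
    have im: "(\<lambda>x. Lminus (ift (foldr mulJ ?vs ?m) x)) = ift \<psi>m"
      unfolding \<psi>m_def Zm_def map_foldr_mulJ[OF Lminus_linear, symmetric] using ift_map[OF bF Bl(2)] by (simp add: fun_eq_iff)
    have n0: "norm (\<psi>0 \<xi>) \<le> indicator (cball 0 1) \<xi> * ((C * N0 * norm \<xi> ^ k + C * Nm * norm \<xi> ^ (k + 1) + 0 * norm \<xi> ^ k) * exp (- \<mu> * (norm \<xi>)\<^sup>2 * t))" for \<xi>
    proof -
      have "norm (\<psi>0 \<xi>) \<le> norm \<xi> ^ k * norm (Z0 (?m \<xi>))"
        using norm_foldr_mulJ_le[of \<beta> "\<lambda>\<xi>. Z0 (?m \<xi>)" \<xi>] by (simp add: \<psi>0_def k)
      also have "\<dots> \<le> norm \<xi> ^ k * (indicator (cball 0 1) \<xi> * ((C * N0 + C * Nm * norm \<xi>) * exp (- \<mu> * (norm \<xi>)\<^sup>2 * t)))"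
        using bd[OF w0(1) t, of \<xi>] unfolding N0_def Nm_def by (intro mult_left_mono) auto
      finally show ?thesis by (simp add: algebra_simps)
    qed
    have nm: "norm (\<psi>m \<xi>) \<le> indicator (cball 0 1) \<xi> * ((C * N0 * norm \<xi> ^ (k + 1) + C * Nm * norm \<xi> ^ (k + 2) + C * Nm / R * norm \<xi> ^ k) * exp (- \<mu> * (norm \<xi>)\<^sup>2 * t))" for \<xi>
    proof -
      have "norm (\<psi>m \<xi>) \<le> norm \<xi> ^ k * norm (Zm (?m \<xi>))"
        using norm_foldr_mulJ_le[of \<beta> "\<lambda>\<xi>. Zm (?m \<xi>)" \<xi>] by (simp add: \<psi>m_def k)
      also have "\<dots> \<le> norm \<xi> ^ k * (indicator (cball 0 1) \<xi> * ((C * N0 * norm \<xi> + C * Nm * (norm \<xi>)\<^sup>2 + C * Nm / R) * exp (- \<mu> * (norm \<xi>)\<^sup>2 * t)))"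
        using bd[OF w0(1) t, of \<xi>] unfolding N0_def Nm_def R_def by (intro mult_left_mono) auto
      finally show ?thesis by (simp add: algebra_simps power_add power2_eq_square)
    qed
    have CN: "0 \<le> C * N0" "0 \<le> C * Nm" "0 \<le> C * Nm / R" using C N R by auto
    have e0: "ift \<psi>0 \<in> Lp p \<and> Lp_norm p (ift \<psi>0) \<le>
       C1 * (C * N0 * R powr (- real k / 2) + C * Nm * R powr (- real (k + 1) / 2) + 0 * R powr (- real k / 2)) * R powr (- \<gamma>)"
      unfolding R_def \<gamma>_def by (rule est1[OF ms(1) t CN(1,2) order_refl n0 p])
    have em: "ift \<psi>m \<in> Lp p \<and> Lp_norm p (ift \<psi>m) \<le>
       C2 * (C * N0 * R powr (- real (k + 1) / 2) + C * Nm * R powr (- real (k + 2) / 2) + C * Nm / R * R powr (- real k / 2)) * R powr (- \<gamma>)"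
      using est2[OF ms(2) t CN nm p] unfolding R_def \<gamma>_def .
    have dec: "decay (\<gamma> + real k / 2) t = R powr (- (\<gamma> + real k / 2))"
      "decay (\<gamma> + 1 / 2 + real k / 2) t = R powr (- (\<gamma> + 1 / 2 + real k / 2))"
      "decay (\<gamma> + 1 + real k / 2) t = R powr (- (\<gamma> + 1 + real k / 2))"
      unfolding R_def by (intro decay_eq t; use \<gamma> in simp)+
    have pw: "R powr (- real k / 2) * R powr (- \<gamma>) = R powr (- (\<gamma> + real k / 2))"
      "R powr (- real (k + 1) / 2) * R powr (- \<gamma>) = R powr (- (\<gamma> + 1 / 2 + real k / 2))"
      "R powr (- real (k + 2) / 2) * R powr (- \<gamma>) = R powr (- (\<gamma> + 1 + real k / 2))"
      unfolding powr_add[symmetric] by (rule arg_cong[where f="\<lambda>z. R powr z"], simp add: field_simps)+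
    have pw': "R powr (- real k / 2) / R * R powr (- \<gamma>) = R powr (- (\<gamma> + 1 + real k / 2))"
    proof -
      have "R powr (- real k / 2) / R = R powr (- real k / 2 - 1)" using R by (simp add: powr_diff)
      then have "R powr (- real k / 2) / R * R powr (- \<gamma>) = R powr (- real k / 2 - 1 + - \<gamma>)" by (simp only: powr_add)
      also have "- real k / 2 - 1 + - \<gamma> = - (\<gamma> + 1 + real k / 2)" by simp
      finally show ?thesis .
    qed
    have "C1 * (C * N0 * R powr (- real k / 2) + C * Nm * R powr (- real (k + 1) / 2) + 0 * R powr (- real k / 2)) * R powr (- \<gamma>)
      = (C * C1) * (R powr (- real k / 2) * R powr (- \<gamma>)) * N0 + (C * C1) * (R powr (- real (k + 1) / 2) * R powr (- \<gamma>)) * Nm"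
      by (simp add: algebra_simps)
    also have "\<dots> \<le> M * R powr (- (\<gamma> + real k / 2)) * N0 + M * R powr (- (\<gamma> + 1 / 2 + real k / 2)) * Nm"
      unfolding pw by (intro add_mono mult_right_mono M N) auto
    finally have f0: "Lp_norm p (ift \<psi>0) \<le> M * R powr (- (\<gamma> + real k / 2)) * N0 + M * R powr (- (\<gamma> + 1 / 2 + real k / 2)) * Nm"
      using e0 by linarith
    have "C2 * (C * N0 * R powr (- real (k + 1) / 2) + C * Nm * R powr (- real (k + 2) / 2) + C * Nm / R * R powr (- real k / 2)) * R powr (- \<gamma>)
      = (C * C2) * (R powr (- real (k + 1) / 2) * R powr (- \<gamma>)) * N0
        + (C * C2) * (R powr (- real (k + 2) / 2) * R powr (- \<gamma>)) * Nm + (C * C2) * (R powr (- real k / 2) / R * R powr (- \<gamma>)) * Nm"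
      by (simp add: algebra_simps)
    also have "\<dots> = (C * C2) * R powr (- (\<gamma> + 1 / 2 + real k / 2)) * N0 + (2 * C * C2) * R powr (- (\<gamma> + 1 + real k / 2)) * Nm"
      unfolding pw pw' by (simp add: algebra_simps)
    also have "\<dots> \<le> M * R powr (- (\<gamma> + 1 / 2 + real k / 2)) * N0 + M * R powr (- (\<gamma> + 1 + real k / 2)) * Nm"
      by (intro add_mono mult_right_mono M N) auto
    finally have fm: "Lp_norm p (ift \<psi>m) \<le> M * R powr (- (\<gamma> + 1 / 2 + real k / 2)) * N0 + M * R powr (- (\<gamma> + 1 + real k / 2)) * Nm"
      using em by linarith
    show ?thesis
      unfolding Let_def i0 im \<gamma>_def[symmetric] N0_def[symmetric] Nm_def[symmetric] dec
      using e0 em f0 fm by blast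
  qed
  then show ?thesis using M(1) by blast
qed

end

theorem theorem4p2:
  fixes A :: "'m::finite \<Rightarrow> real ^ ('n1::finite + 'n2::finite) ^ ('n1 + 'n2)"
    and D :: "real ^ 'n2 ^ 'n2"
    and \<Gamma> :: "real \<Rightarrow> (real ^ 'm \<Rightarrow> real ^ ('n1 + 'n2)) \<Rightarrow> real ^ 'm \<Rightarrow> real ^ ('n1 + 'n2)"
  assumes A_sym: "\<forall>\<alpha>. transpose (A \<alpha>) = A \<alpha>"
    and D_neg: "\<forall>x. x \<noteq> 0 \<longrightarrow> x \<bullet> (D *v x) < 0"
    and no_eigvec: "\<forall>\<xi>::real ^ 'm. \<xi> \<noteq> 0 \<longrightarrow>
      (\<forall>v \<mu>. v \<noteq> 0 \<and> symbol A \<xi> *v v = \<mu> *\<^sub>R v \<longrightarrow> block_B D *v v \<noteq> 0)"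
    and \<Gamma>: "solution_operator A (block_B D) \<Gamma>"
  shows "\<exists>(K :: real \<Rightarrow> (real ^ 'm \<Rightarrow> real ^ ('n1 + 'n2)) \<Rightarrow> real ^ 'm \<Rightarrow> real ^ ('n1 + 'n2))
          (\<K> :: real \<Rightarrow> (real ^ 'm \<Rightarrow> real ^ ('n1 + 'n2)) \<Rightarrow> real ^ 'm \<Rightarrow> real ^ ('n1 + 'n2))
          (C' :: nat \<Rightarrow> real) (C :: real) (c :: real).
    (\<forall>k. C' k > 0) \<and> C > 0 \<and> c > 0 \<and>
    (\<forall>t\<ge>0. linear_operator (K t) \<and> linear_operator (\<K> t)) \<and>
    (\<forall>w0 \<in> Lp 1 \<inter> Lp 2. \<forall>t\<ge>0.
      (AE x in lborel. \<Gamma> t w0 x = K t w0 x + \<K> t w0 x) \<and>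
      (\<forall>\<beta> :: nat ^ 'm. \<exists>g. has_weak_deriv \<beta> (K t w0) g \<and>
        (\<forall>p\<ge>2. let \<gamma> = base_rate TYPE('m) p; k = mi_order \<beta> in
          (\<lambda>x. L0 (g x)) \<in> Lp p \<and>
          Lp_norm p (\<lambda>x. L0 (g x))
            \<le> C' k * decay (\<gamma> + real k / 2) t * Lp_norm 1 (\<lambda>x. L0 (w0 x))
              + C' k * decay (\<gamma> + 1 / 2 + real k / 2) t * Lp_norm 1 (\<lambda>x. Lminus (w0 x)) \<and>
          (\<lambda>x. Lminus (g x)) \<in> Lp p \<and>
          Lp_norm p (\<lambda>x. Lminus (g x))
            \<le> C' k * decay (\<gamma> + 1 / 2 + real k / 2) t * Lp_norm 1 (\<lambda>x. L0 (w0 x))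
              + C' k * decay (\<gamma> + 1 + real k / 2) t * Lp_norm 1 (\<lambda>x. Lminus (w0 x)))) \<and>
      (\<forall>(\<beta> :: nat ^ 'm) g0. has_weak_deriv \<beta> w0 g0 \<and> g0 \<in> Lp 2 \<longrightarrow>
        (\<exists>g. has_weak_deriv \<beta> (\<K> t w0) g \<and> g \<in> Lp 2 \<and>
          Lp_norm 2 g \<le> C * exp (- c * t) * Lp_norm 2 g0)))"
proof -
  interpret kawashima A D
  proof
    show "Lminus v \<noteq> 0" if "\<xi> \<noteq> 0" "v \<noteq> 0" "symbol A \<xi> *v v = \<mu> *\<^sub>R v" for \<xi> v \<mu>
    proof
      assume "Lminus v = 0"
      then have "block_B D *v v = 0"
        by (intro split_eqI) (simp_all add: L0_block_B Lminus_block_B linear_0[OF L0_linear] linear_0[OF Lminus_linear])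
      then show False using no_eigvec that by blast
    qed
  qed (use A_sym D_neg in auto)
  have ws: "weak_solution A (block_B D) w0 (\<lambda>t. \<Gamma> t w0)" if "w0 \<in> Lp 2" for w0
    using \<Gamma> that by (simp add: solution_operator_def)
  have \<Gamma>L: "\<Gamma> t w0 \<in> Lp 2" if "w0 \<in> Lp 2" "0 \<le> t" for t w0
    using ws[OF that(1)] that(2) by (simp add: weak_solution_def)
  define K where "K t w0 = ift (low_multiplier A D t w0)" for t w0
  \<comment> \<open>As the remainder by definition, so that the decomposition is exact and linearity
    reduces to that of \<Gamma> and K.\<close>
  define \<K> where "\<K> t w0 = (\<lambda>x. \<Gamma> t w0 x - K t w0 x)" for t w0
  have KL: "K t w0 \<in> Lp 2" if "w0 \<in> Lp 1" "w0 \<in> Lp 2" "0 \<le> t" for t w0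
    unfolding K_def by (rule L2_bdd_supp_ift_Lp2[OF L2_bdd_supp_low_multiplier[OF that]])
  have Kcong: "K t f = K t g" if "f \<in> Lp 2" "g \<in> Lp 2" "AE x in lborel. f x = g x" for t f g
    using ft_cong_AE[OF Lp2_measurable[OF that(1)] Lp2_measurable[OF that(2)] that(3)] by (simp add: K_def low_multiplier_def)
  have Klin: "K t (\<lambda>y. a *\<^sub>R f y + b *\<^sub>R g y) x = a *\<^sub>R K t f x + b *\<^sub>R K t g x"
    if "f \<in> Lp 1 \<inter> Lp 2" "g \<in> Lp 1 \<inter> Lp 2" "0 \<le> t" for t f g a b x
  proof -
    have b: "L2_bdd_supp (low_multiplier A D t f)" "L2_bdd_supp (low_multiplier A D t g)" using L2_bdd_supp_low_multiplier that by auto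
    have "low_multiplier A D t (\<lambda>y. a *\<^sub>R f y + b *\<^sub>R g y) = (\<lambda>\<xi>. a *\<^sub>R low_multiplier A D t f \<xi> + b *\<^sub>R low_multiplier A D t g \<xi>)"
      using low_multiplier_combination[of f g t a b] that by (simp add: Lp1_iff fun_eq_iff)
    then show ?thesis
      by (simp add: K_def ift_add[OF L2_bdd_supp_integrable[OF L2_bdd_supp_scaleR[OF b(1)]] L2_bdd_supp_integrable[OF L2_bdd_supp_scaleR[OF b(2)]]] ift_scaleR)
  qed
  have \<Gamma>comb: "AE x in lborel. \<Gamma> t h x = a *\<^sub>R \<Gamma> t f x + b *\<^sub>R \<Gamma> t g x"
    if "f \<in> Lp 2" "g \<in> Lp 2" "h \<in> Lp 2" "0 \<le> t" "AE x in lborel. h x = a *\<^sub>R f x + b *\<^sub>R g x" for t f g h a b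
    by (rule weak_solution_combination[OF ws[OF that(1)] ws[OF that(2)] ws[OF that(3)] that])
  have lin: "linear_operator (K t)" "linear_operator (\<K> t)" if t: "0 \<le> t" for t
  proof -
    show "linear_operator (K t)"
      unfolding linear_operator_def
    proof (intro conjI ballI impI allI)
      fix f g :: "real^'m \<Rightarrow> real^('n1+'n2)" and a b :: real
      assume f: "f \<in> Lp 1 \<inter> Lp 2"
      then show "K t f \<in> Lp 2" using KL t by auto
      assume g: "g \<in> Lp 1 \<inter> Lp 2"
      show "AE x in lborel. K t (\<lambda>y. a *\<^sub>R f y + b *\<^sub>R g y) x = a *\<^sub>R K t f x + b *\<^sub>R K t g x"
        using Klin[OF f g t] by simp
      assume "AE x in lborel. f x = g x"
      then show "AE x in lborel. K t f x = K t g x" using Kcong[of f g t] f g by simp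
    qed
    show "linear_operator (\<K> t)"
      unfolding linear_operator_def
    proof (intro conjI ballI impI allI)
      fix f g :: "real^'m \<Rightarrow> real^('n1+'n2)" and a b :: real
      assume f: "f \<in> Lp 1 \<inter> Lp 2"
      then show "\<K> t f \<in> Lp 2" using KL \<Gamma>L t unfolding \<K>_def by (intro Lp2_diff) auto
      assume g: "g \<in> Lp 1 \<inter> Lp 2"
      have "AE x in lborel. \<Gamma> t (\<lambda>y. a *\<^sub>R f y + b *\<^sub>R g y) x = a *\<^sub>R \<Gamma> t f x + b *\<^sub>R \<Gamma> t g x"
        by (rule \<Gamma>comb) (use f g t in \<open>auto intro!: Lp2_add Lp2_scaleR\<close>)
      then show "AE x in lborel. \<K> t (\<lambda>y. a *\<^sub>R f y + b *\<^sub>R g y) x = a *\<^sub>R \<K> t f x + b *\<^sub>R \<K> t g x"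
        by (rule AE_mp) (simp add: \<K>_def Klin[OF f g t] algebra_simps)
      assume eq: "AE x in lborel. f x = g x"
      \<comment> \<open>Independence of the representative is linearity applied to the combination 1
        g + 0 g.\<close>
      have "AE x in lborel. \<Gamma> t f x = 1 *\<^sub>R \<Gamma> t g x + 0 *\<^sub>R \<Gamma> t g x"
        by (rule \<Gamma>comb) (use f g t eq in auto)
      then show "AE x in lborel. \<K> t f x = \<K> t g x"
        by (rule AE_mp) (use Kcong[OF _ _ eq, of t] f g in \<open>simp add: \<K>_def\<close>)
    qed
  qed
  \<comment> \<open>Names the estimate so that one constant can be chosen for each order k, before
    the data, t, \<beta> and p.\<close>
  define P where "P k C \<longleftrightarrow> (\<forall>w0 t (\<beta> :: nat^'m) p. w0 \<in> Lp 1 \<longrightarrow> w0 \<in> Lp 2 \<longrightarrow> 0 \<le> t \<longrightarrow> mi_order \<beta> = k \<longrightarrow> 2 \<le> p \<longrightarrow>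
    (let \<gamma> = base_rate TYPE('m) p; g = ift (foldr mulJ (mi_dirs \<beta>) (low_multiplier A D t w0)) in
      (\<lambda>x. L0 (g x)) \<in> Lp p \<and>
      Lp_norm p (\<lambda>x. L0 (g x))
        \<le> C * decay (\<gamma> + real k / 2) t * Lp_norm 1 (\<lambda>x. L0 (w0 x))
          + C * decay (\<gamma> + 1 / 2 + real k / 2) t * Lp_norm 1 (\<lambda>x. Lminus (w0 x)) \<and>
      (\<lambda>x. Lminus (g x)) \<in> Lp p \<and>
      Lp_norm p (\<lambda>x. Lminus (g x))
        \<le> C * decay (\<gamma> + 1 / 2 + real k / 2) t * Lp_norm 1 (\<lambda>x. L0 (w0 x))
          + C * decay (\<gamma> + 1 + real k / 2) t * Lp_norm 1 (\<lambda>x. Lminus (w0 x))))" for k :: nat and C :: real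
  have "\<forall>k. \<exists>C. 0 < C \<and> P k C" unfolding P_def using low_frequency_estimate by blast
  from choice[OF this] obtain C' where C': "\<And>k. 0 < C' k" "\<And>k. P k (C' k)" by blast
  obtain \<nu> where \<nu>: "0 < \<nu>" "\<And>w0 g0 w t \<beta>. w0 \<in> Lp 1 \<Longrightarrow> w0 \<in> Lp 2 \<Longrightarrow> has_weak_deriv \<beta> w0 g0 \<Longrightarrow> g0 \<in> Lp 2 \<Longrightarrow>
    weak_solution A (block_B D) g0 w \<Longrightarrow> 0 \<le> t \<Longrightarrow>
    Lp_norm 2 (\<lambda>x. w t x - ift (foldr mulJ (mi_dirs \<beta>) (low_multiplier A D t w0)) x) \<le> 2 * exp (- \<nu> * t) * Lp_norm 2 g0"
    using high_frequency_bound by blast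
  have Kest: "\<exists>g. has_weak_deriv \<beta> (K t w0) g \<and>
        (\<forall>p\<ge>2. let \<gamma> = base_rate TYPE('m) p; k = mi_order \<beta> in
          (\<lambda>x. L0 (g x)) \<in> Lp p \<and>
          Lp_norm p (\<lambda>x. L0 (g x))
            \<le> C' k * decay (\<gamma> + real k / 2) t * Lp_norm 1 (\<lambda>x. L0 (w0 x))
              + C' k * decay (\<gamma> + 1 / 2 + real k / 2) t * Lp_norm 1 (\<lambda>x. Lminus (w0 x)) \<and>
          (\<lambda>x. Lminus (g x)) \<in> Lp p \<and>
          Lp_norm p (\<lambda>x. Lminus (g x))
            \<le> C' k * decay (\<gamma> + 1 / 2 + real k / 2) t * Lp_norm 1 (\<lambda>x. L0 (w0 x))
              + C' k * decay (\<gamma> + 1 + real k / 2) t * Lp_norm 1 (\<lambda>x. Lminus (w0 x)))"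
    if w0: "w0 \<in> Lp 1" "w0 \<in> Lp 2" and t: "0 \<le> t" for w0 t and \<beta> :: "nat^'m"
    using has_weak_deriv_ift[OF L2_bdd_supp_low_multiplier[OF w0 t], of \<beta>] C'(2)[of "mi_order \<beta>"] w0 t
    unfolding K_def Let_def P_def by blast
  have \<K>est: "\<exists>g. has_weak_deriv \<beta> (\<K> t w0) g \<and> g \<in> Lp 2 \<and> Lp_norm 2 g \<le> 2 * exp (- \<nu> * t) * Lp_norm 2 g0"
    if w0: "w0 \<in> Lp 1" "w0 \<in> Lp 2" and t: "0 \<le> t" and wd: "has_weak_deriv \<beta> w0 g0" and g0: "g0 \<in> Lp 2" for w0 t g0 and \<beta> :: "nat^'m"
  proof -
    let ?k = "ift (foldr mulJ (mi_dirs \<beta>) (low_multiplier A D t w0))"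
    have kL: "?k \<in> Lp 2" by (rule L2_bdd_supp_ift_Lp2[OF L2_bdd_supp_foldr_mulJ[OF L2_bdd_supp_low_multiplier[OF w0 t]]])
    \<comment> \<open>The derivative of the remainder is the evolution of the derivative g0 minus
      the differentiated low-frequency part, the very difference that
      \<open>high_frequency_bound\<close> controls.\<close>
    have "has_weak_deriv \<beta> (\<K> t w0) (\<lambda>x. \<Gamma> t g0 x - ?k x)"
      unfolding \<K>_def
      by (rule has_weak_deriv_diff[OF has_weak_deriv_weak_solution[OF w0(2) wd g0 ws[OF w0(2)] ws[OF g0] t]
          has_weak_deriv_ift[OF L2_bdd_supp_low_multiplier[OF w0 t], folded K_def] \<Gamma>L[OF w0(2) t] KL[OF w0 t] \<Gamma>L[OF g0 t] kL])
    moreover have "(\<lambda>x. \<Gamma> t g0 x - ?k x) \<in> Lp 2" by (rule Lp2_diff[OF \<Gamma>L[OF g0 t] kL])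
    moreover have "Lp_norm 2 (\<lambda>x. \<Gamma> t g0 x - ?k x) \<le> 2 * exp (- \<nu> * t) * Lp_norm 2 g0"
      by (rule \<nu>(2)[OF w0 wd g0 ws[OF g0] t])
    ultimately show ?thesis by blast
  qed
  show ?thesis
    by (rule exI[of _ K], rule exI[of _ \<K>], rule exI[of _ C'], rule exI[of _ 2], rule exI[of _ \<nu>], intro conjI ballI allI impI)
      ((elim IntE, rule Kest; assumption) | (elim IntE conjE, rule \<K>est; assumption) | simp add: C'(1) \<nu>(1) lin \<K>_def)+
qed

end
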